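(* Let $X\in M(\infty)$ be strongly regular and let $i:GL(\infty)\cdot X\hookrightarrow M(\infty)$ be the inclusion morphism. Then: (1) The set $i^{-1}(A(\infty)\cdot X)$ naturally has the structure of an irreducible ind-subvariety of $GL(\infty)\cdot X$. Thus $A(\infty)\cdot X\subset M(\infty)$ is an immersed irreducible ind-subvariety. (2) The ind-subvariety $i^{-1}(A(\infty)\cdot X)\subseteq GL(\infty)\cdot X$ is Lagrangian with respect to the weak symplectic form $\omega_\infty$ on $GL(\infty)\cdot X$. (3) For any $Y\in A(\infty)\cdot X$, we have $T_Y(A(\infty)\cdot Y)=\mathfrak a(\infty)_Y$, so that the strongly regular $A(\infty)$-orbits in $M(\infty)$ are tangent to the Lie algebra $\mathfrak a(\infty)$ of Hamiltonian vector fields.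
   Context: Let $\mathfrak g_n=\mathfrak{gl}(n,\mathbb C)$ and $G_n=GL(n,\mathbb C)$, with $\mathfrak g_n\hookrightarrow\mathfrak g_{n+1}$ as the upper left $n\times n$ block (zeros elsewhere) and $G_n\hookrightarrow G_{n+1}$, $g\mapsto\mathrm{diag}(g,1)$. $GL(\infty)=\varinjlim G_n=\bigcup G_n$, $\mathfrak{gl}(\infty)=\varinjlim\mathfrak g_n$. $M(\infty)=\varprojlim\mathfrak g_n$ is the set of sequences $X=(X(1),X(2),\dots)$, $X(n)\in\mathfrak g_n$, such that the upper left $n\times n$ corner of $X(n+1)$ is $X(n)$ (all infinite complex matrices); write $X_n:=X(n)$ and $p_n(X)=X_n$. $M(\infty)$ is identified with $\mathfrak{gl}(\infty)^*$ by $X\mapsto(A\in\mathfrak g_n\mapsto\mathrm{tr}(X_nA))$; the coadjoint action becomes $\mathrm{Ad}(g)X=gXg^{-1}$. $M(\infty)$ is a provariety: inverse limit of the Zariski topologies, $\mathcal O(p_n^{-1}(U_n))=\varinjlim_{k\ge n}p_k^*\mathcal O_{\mathfrak g_k}(p_{kn}^{-1}(U_n))$ for $U_n\subseteq\mathfrak g_n$ open, where $p_{kn}:\mathfrak g_k\to\mathfrak g_n$ takes the upper left corner; $T_X(M(\infty))=\varprojlim\mathfrak g_n=M(\infty)$, $T_X^*(M(\infty))=\varinjlim T^*_{X_n}(\mathfrak g_n)$. It is Poisson, with bracket $\{p_n^*f,p_n^*g\}=p_n^*\{f,g\}_n$, $\{f,g\}_n(Z)=\mathrm{tr}(Z[\nabla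 f(Z),\nabla g(Z)])$, gradients taken with respect to the trace form; Hamiltonian vector fields are $\xi_f(g)=\{f,g\}$. Let $J_\infty=\{p_n^*f_{nj}:n\in\mathbb N,1\le j\le n\}$, $f_{nj}(Z)=\mathrm{tr}(Z^j)$ on $\mathfrak g_n$. $X\in M(\infty)$ is strongly regular if the differentials $\{(df)_X:f\in J_\infty\}$ are linearly independent. $\mathfrak a(\infty)=\mathrm{span}\{\xi_f:f\in J_\infty\}$ and $\mathfrak a(\infty)_Y=\mathrm{span}\{(\xi_f)_Y:f\in J_\infty\}\subseteq T_Y(M(\infty))$. Let $A(n)=\mathbb C^{\binom n2}=\mathbb C^1\times\dots\times\mathbb C^{n-1}$ with coordinates $(\underline t_1,\dots,\underline t_{n-1})$, $\underline t_i=(t_{i1},\dots,t_{ii})$, embedded in $A(n+1)$ by appending $\underline t_n=0$; $A(\infty)=\varinjlim A(n)$. $a=(\underline t_1,\dots,\underline t_{n-1})\in A(n)$ acts on $M(\infty)$ by $a\cdot X=\mathrm{Ad}(z_1z_2\cdots z_{n-1})X$, $z_i=\exp(t_{i1}\mathrm{Id}_i)\cdots\exp(j\,t_{ij}X_i^{j-1})\cdots\exp(i\,t_{ii}X_i^{i-1})\in G_i$. These define an action of $A(\infty)$ on $M(\infty)$ preserving $GL(\infty)$-orbits. $GL(\infty)\cdot X=\varinjlim G_n\cdot X$ is an ind-variety (direct limit of varieties along locally closed embeddings, final topology, tangent spaces are direct limits), where $G_n\cdot X\cong G_n/G_n^X$, $G_n^X$ the stabilizer of $X$ in $G_n$; for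 $Y$ in the orbit, $T_Y(GL(\infty)\cdot X)=\mathfrak{gl}(\infty)/\mathfrak{gl}(\infty)^Y$, with $\mathfrak{gl}(\infty)^Y$ the Lie algebra of the stabilizer of $Y$. $\omega_\infty$ is the inverse limit of the pullbacks to $G_n\cdot X$ of the Kostant–Kirillov forms on $G_n\cdot X_n\subset\mathfrak g_n$; explicitly $(\omega_\infty)_Y(A+\mathfrak{gl}(\infty)^Y,B+\mathfrak{gl}(\infty)^Y)=\mathrm{tr}(Y_n[A,B])$ for $A,B\in\mathfrak g_n$. An ind-subvariety $\mathcal L\subseteq GL(\infty)\cdot X$ is a subset with each $\mathcal L_n=\mathcal L\cap(G_n\cdot X)$ a locally closed subvariety of $G_n\cdot X$; $T_Y(\mathcal L)=\varinjlim T_Y(\mathcal L_n)$. It is Lagrangian if $T_Y(\mathcal L)=T_Y(\mathcal L)^\perp$ (annihilator with respect to $(\omega_\infty)_Y$ in $T_Y(GL(\infty)\cdot X)$) for all $Y\in\mathcal L$; irreducible if its topological space is. An immersed ind-subvariety of $M(\infty)$ is the image of an ind-variety under an injective morphism of ringed spaces with injective differential at every point. In (3), $T_Y(A(\infty)\cdot Y)$ denotes the image in $T_Y(M(\infty))$ under $di$ of the tangent space of the ind-subvariety $i^{-1}(A(\infty)\cdot Y)=i^{-1}(A(\infty)\cdot X)$ at $Y$. *)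

theory Defs
  imports "HOL-Analysis.Analysis" "HOL-Library.Function_Algebras"
begin

section \<open>Infinite matrices\<close>

text \<open>
  A coherent sequence \<open>(X(1), X(2), \<dots>)\<close> of matrices is the same thing as one infinite matrix, so
  \<open>M(\<infinity>)\<close> is the whole type \<open>imat\<close>.  Indices start at 0.  All groups and Lie
  algebras are subsets of the same type: \<open>A \<in> gl(n)\<close> is padded by zeros, and
  \<open>g \<in> GL(n)\<close> by ones on the diagonal, so that the embeddings
  \<open>gl(n) \<hookrightarrow> gl(n+1)\<close> and \<open>GL(n) \<hookrightarrow> GL(n+1)\<close> become inclusions.
  The additive structure is the pointwise one of \<^theory>\<open>HOL-Library.Function_Algebras\<close>; the
  pointwise product of that theory is never used.
\<close>

type_synonym imat = "nat \<Rightarrow> nat \<Rightarrow> complex"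

definition msmult :: "complex \<Rightarrow> imat \<Rightarrow> imat" where
  "msmult c A = (\<lambda>i j. c * A i j)"

text \<open>
  Only used when one of the factors lies in \<open>gl(\<infinity>)\<close> or \<open>GL(\<infinity>)\<close>; then the index
  set of the sum is finite.
\<close>
definition mmul :: "imat \<Rightarrow> imat \<Rightarrow> imat" (infixl "\<odot>" 70) where
  "A \<odot> B = (\<lambda>i j. \<Sum>k | A i k * B k j \<noteq> 0. A i k * B k j)"

definition mone :: imat where
  "mone = (\<lambda>i j. if i = j then 1 else 0)"

definition comm :: "imat \<Rightarrow> imat \<Rightarrow> imat" where
  "comm A B = A \<odot> B - B \<odot> A"

primrec mpow :: "imat \<Rightarrow> nat \<Rightarrow> imat" where
  "mpow A 0 = mone"
| "mpow A (Suc k) = mpow A k \<odot> A"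

definition mprod :: "imat list \<Rightarrow> imat" where
  "mprod gs = foldr (\<odot>) gs mone"

definition tr :: "nat \<Rightarrow> imat \<Rightarrow> complex" where
  "tr n Z = (\<Sum>i<n. Z i i)"

text \<open>The projection \<open>p\<^sub>n : M(\<infinity>) \<rightarrow> gl(n)\<close>, \<open>X \<mapsto> X\<^sub>n\<close>.\<close>
definition corner :: "nat \<Rightarrow> imat \<Rightarrow> imat" where
  "corner n X = (\<lambda>i j. if i < n \<and> j < n then X i j else 0)"

definition gl :: "nat \<Rightarrow> imat set" where
  "gl n = {A. \<forall>i j. n \<le> i \<or> n \<le> j \<longrightarrow> A i j = 0}"

definition gl_inf :: "imat set" where
  "gl_inf = (\<Union>n. gl n)"

definition GL :: "nat \<Rightarrow> imat set" where
  "GL n = {g. (\<forall>i j. n \<le> i \<or> n \<le> j \<longrightarrow> g i j = mone i j) \<and>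
              (\<exists>h. (\<forall>i j. n \<le> i \<or> n \<le> j \<longrightarrow> h i j = mone i j) \<and> g \<odot> h = mone \<and> h \<odot> g = mone)}"

definition GL_inf :: "imat set" where
  "GL_inf = (\<Union>n. GL n)"

definition minv :: "imat \<Rightarrow> imat" where
  "minv g = (THE h. h \<in> GL_inf \<and> g \<odot> h = mone \<and> h \<odot> g = mone)"

definition Ad :: "imat \<Rightarrow> imat \<Rightarrow> imat" where
  "Ad g X = g \<odot> X \<odot> minv g"

text \<open>For \<open>A \<in> gl(n)\<close> the zeroth term \<open>mone\<close> makes this the element \<open>diag(exp(A), 1, 1, \<dots>)\<close> of \<open>GL(n)\<close>.\<close>
definition mexp :: "imat \<Rightarrow> imat" where
  "mexp A = (\<lambda>i j. \<Sum>k. mpow A k i j / fact k)"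

definition GL_orbit :: "nat \<Rightarrow> imat \<Rightarrow> imat set" where
  "GL_orbit n X = {Ad g X | g. g \<in> GL n}"

definition GL_inf_orbit :: "imat \<Rightarrow> imat set" where
  "GL_inf_orbit X = {Ad g X | g. g \<in> GL_inf}"


section \<open>Spaces with functions, varieties and ind-varieties\<close>

text \<open>
  A topological space with a sheaf of complex-valued functions.  \<open>sp_reg Z U\<close> is the set of sections
  over \<open>U\<close> (meaningful only for open \<open>U\<close>); a section is represented by any total HOL function having
  the right values on \<open>U\<close>.
\<close>
record 'a space_fun =
  sp_top :: "'a topology"
  sp_reg :: "'a set \<Rightarrow> ('a \<Rightarrow> complex) set"

abbreviation sp_carrier :: "'a space_fun \<Rightarrow> 'a set" where
  "sp_carrier Z \<equiv> topspace (sp_top Z)"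

definition sheaf_of_functions :: "'a space_fun \<Rightarrow> bool" where
  "sheaf_of_functions Z \<longleftrightarrow>
     (\<forall>U V f. openin (sp_top Z) U \<and> openin (sp_top Z) V \<and> V \<subseteq> U \<and> f \<in> sp_reg Z U \<longrightarrow> f \<in> sp_reg Z V) \<and>
     (\<forall>U f. openin (sp_top Z) U \<and>
        (\<forall>x\<in>U. \<exists>V. openin (sp_top Z) V \<and> x \<in> V \<and> V \<subseteq> U \<and> (\<exists>h\<in>sp_reg Z V. \<forall>y\<in>V. f y = h y))
        \<longrightarrow> f \<in> sp_reg Z U)"

definition sp_morphism :: "'a space_fun \<Rightarrow> 'b space_fun \<Rightarrow> ('a \<Rightarrow> 'b) \<Rightarrow> bool" where
  "sp_morphism Z W \<phi> \<longleftrightarrow> continuous_map (sp_top Z) (sp_top W) \<phi> \<and>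
     (\<forall>U. openin (sp_top W) U \<longrightarrow>
        (\<forall>f\<in>sp_reg W U. f \<circ> \<phi> \<in> sp_reg Z {x \<in> sp_carrier Z. \<phi> x \<in> U}))"

definition sp_iso :: "'a space_fun \<Rightarrow> 'b space_fun \<Rightarrow> ('a \<Rightarrow> 'b) \<Rightarrow> bool" where
  "sp_iso Z W \<phi> \<longleftrightarrow> homeomorphic_map (sp_top Z) (sp_top W) \<phi> \<and>
     (\<forall>U. openin (sp_top W) U \<longrightarrow>
        (\<forall>f. f \<in> sp_reg W U \<longleftrightarrow> f \<circ> \<phi> \<in> sp_reg Z {x \<in> sp_carrier Z. \<phi> x \<in> U}))"

text \<open>
  The induced (reduced) structure on a subset: a function is regular if it extends locally to a
  regular function on the ambient space.
\<close>
definition sp_sub :: "'a space_fun \<Rightarrow> 'a set \<Rightarrow> 'a space_fun" where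
  "sp_sub Z S = \<lparr> sp_top = subtopology (sp_top Z) S,
     sp_reg = (\<lambda>V. {f. \<forall>x\<in>V. \<exists>U h. openin (sp_top Z) U \<and> x \<in> U \<and> h \<in> sp_reg Z U \<and>
                        (\<forall>y\<in>U \<inter> V. f y = h y)}) \<rparr>"

definition locally_closedin :: "'a topology \<Rightarrow> 'a set \<Rightarrow> bool" where
  "locally_closedin T S \<longleftrightarrow> (\<exists>U C. openin T U \<and> closedin T C \<and> S = U \<inter> C)"

definition irreducible_top :: "'a topology \<Rightarrow> bool" where
  "irreducible_top T \<longleftrightarrow> topspace T \<noteq> {} \<and>
     (\<forall>C D. closedin T C \<and> closedin T D \<and> topspace T = C \<union> D \<longrightarrow> C = topspace T \<or> D = topspace T)"

text \<open>The algebra of functions generated by a set \<open>\<Phi>\<close> of coordinate functions.\<close>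
inductive_set poly_funs :: "('a \<Rightarrow> complex) set \<Rightarrow> ('a \<Rightarrow> complex) set"
  for \<Phi> :: "('a \<Rightarrow> complex) set" where
  const: "(\<lambda>_. c) \<in> poly_funs \<Phi>"
| coord: "x \<in> \<Phi> \<Longrightarrow> x \<in> poly_funs \<Phi>"
| add: "p \<in> poly_funs \<Phi> \<Longrightarrow> q \<in> poly_funs \<Phi> \<Longrightarrow> (\<lambda>z. p z + q z) \<in> poly_funs \<Phi>"
| mult: "p \<in> poly_funs \<Phi> \<Longrightarrow> q \<in> poly_funs \<Phi> \<Longrightarrow> (\<lambda>z. p z * q z) \<in> poly_funs \<Phi>"

text \<open>
  The Zariski structure on a set \<open>S\<close> with coordinates \<open>\<Phi>\<close>: principal open sets are a basis, and the
  regular functions are those which are locally quotients of polynomials.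
\<close>
definition zariski_top :: "'a set \<Rightarrow> ('a \<Rightarrow> complex) set \<Rightarrow> 'a topology" where
  "zariski_top S \<Phi> = topology_generated_by {{z \<in> S. p z \<noteq> 0} | p. p \<in> poly_funs \<Phi>}"

definition zariski_space :: "'a set \<Rightarrow> ('a \<Rightarrow> complex) set \<Rightarrow> 'a space_fun" where
  "zariski_space S \<Phi> = \<lparr> sp_top = zariski_top S \<Phi>,
     sp_reg = (\<lambda>U. {f. \<forall>z\<in>U. \<exists>V p q. openin (zariski_top S \<Phi>) V \<and> z \<in> V \<and> V \<subseteq> U \<and>
                        p \<in> poly_funs \<Phi> \<and> q \<in> poly_funs \<Phi> \<and> (\<forall>y\<in>V. q y \<noteq> 0 \<and> f y = p y / q y)}) \<rparr>"

definition affine_coords :: "nat \<Rightarrow> ((nat \<Rightarrow> complex) \<Rightarrow> complex) set" where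
  "affine_coords N = {(\<lambda>x. x k) | k. k < N}"

text \<open>The closed subset of affine \<open>N\<close>-space cut out by \<open>P\<close>; it need not be irreducible.\<close>
definition affine_variety :: "nat \<Rightarrow> ((nat \<Rightarrow> complex) \<Rightarrow> complex) set \<Rightarrow> (nat \<Rightarrow> complex) space_fun" where
  "affine_variety N P =
     zariski_space {x. (\<forall>k\<ge>N. x k = 0) \<and> (\<forall>p\<in>P. p x = 0)} (affine_coords N)"

definition prevariety :: "'a space_fun \<Rightarrow> bool" where
  "prevariety Z \<longleftrightarrow> sheaf_of_functions Z \<and>
     (\<exists>\<U>. finite \<U> \<and> \<Union>\<U> = sp_carrier Z \<and>
        (\<forall>U\<in>\<U>. openin (sp_top Z) U \<and>
           (\<exists>N P \<phi>. P \<subseteq> poly_funs (affine_coords N) \<and> sp_iso (sp_sub Z U) (affine_variety N P) \<phi>)))"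

text \<open>
  The Hausdorff axiom for prevarieties: any two morphisms into \<open>Z\<close> agree on a closed set.  Since
  closedness is local on the source, affine sources suffice.
\<close>
definition variety :: "'a space_fun \<Rightarrow> bool" where
  "variety Z \<longleftrightarrow> prevariety Z \<and>
     (\<forall>N P \<phi> \<psi>. P \<subseteq> poly_funs (affine_coords N) \<and>
        sp_morphism (affine_variety N P) Z \<phi> \<and> sp_morphism (affine_variety N P) Z \<psi> \<longrightarrow>
        closedin (sp_top (affine_variety N P)) {x \<in> sp_carrier (affine_variety N P). \<phi> x = \<psi> x})"

text \<open>
  An ind-variety, given by its filtration; the locally closed embeddings are normalised to be
  inclusions.
\<close>
definition ind_variety :: "(nat \<Rightarrow> 'a space_fun) \<Rightarrow> bool" where
  "ind_variety Z \<longleftrightarrow> (\<forall>n. variety (Z n) \<and>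
     sp_carrier (Z n) \<subseteq> sp_carrier (Z (Suc n)) \<and>
     locally_closedin (sp_top (Z (Suc n))) (sp_carrier (Z n)) \<and>
     sp_iso (Z n) (sp_sub (Z (Suc n)) (sp_carrier (Z n))) (\<lambda>x. x))"

definition ind_space :: "(nat \<Rightarrow> 'a space_fun) \<Rightarrow> 'a space_fun" where
  "ind_space Z = \<lparr>
     sp_top = topology (\<lambda>U. U \<subseteq> (\<Union>n. sp_carrier (Z n)) \<and>
                            (\<forall>n. openin (sp_top (Z n)) (U \<inter> sp_carrier (Z n)))),
     sp_reg = (\<lambda>U. {f. \<forall>n. f \<in> sp_reg (Z n) (U \<inter> sp_carrier (Z n))}) \<rparr>"

lemma openin_ind_space:
  "openin (sp_top (ind_space Z)) U \<longleftrightarrow>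
     U \<subseteq> (\<Union>n. sp_carrier (Z n)) \<and> (\<forall>n. openin (sp_top (Z n)) (U \<inter> sp_carrier (Z n)))"
proof -
  have "istopology (\<lambda>U. U \<subseteq> (\<Union>n. sp_carrier (Z n)) \<and>
                        (\<forall>n. openin (sp_top (Z n)) (U \<inter> sp_carrier (Z n))))"
    unfolding istopology_def
  proof (intro conjI allI impI)
    fix S T n
    assume S: "S \<subseteq> (\<Union>n. sp_carrier (Z n)) \<and> (\<forall>n. openin (sp_top (Z n)) (S \<inter> sp_carrier (Z n)))"
      and T: "T \<subseteq> (\<Union>n. sp_carrier (Z n)) \<and> (\<forall>n. openin (sp_top (Z n)) (T \<inter> sp_carrier (Z n)))"
    show "S \<inter> T \<subseteq> (\<Union>n. sp_carrier (Z n))" using S by blast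
    have "openin (sp_top (Z n)) ((S \<inter> sp_carrier (Z n)) \<inter> (T \<inter> sp_carrier (Z n)))"
      by (rule openin_Int) (use S T in blast)+
    moreover have "(S \<inter> sp_carrier (Z n)) \<inter> (T \<inter> sp_carrier (Z n)) = S \<inter> T \<inter> sp_carrier (Z n)"
      by blast
    ultimately show "openin (sp_top (Z n)) (S \<inter> T \<inter> sp_carrier (Z n))"
      by simp
  next
    fix K n
    assume K: "\<forall>U\<in>K. U \<subseteq> (\<Union>n. sp_carrier (Z n)) \<and> (\<forall>n. openin (sp_top (Z n)) (U \<inter> sp_carrier (Z n)))"
    show "\<Union>K \<subseteq> (\<Union>n. sp_carrier (Z n))" using K by blast
    have "openin (sp_top (Z n)) (\<Union>((\<lambda>U. U \<inter> sp_carrier (Z n)) ` K))"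
      using K by (intro openin_Union) auto
    moreover have "\<Union>((\<lambda>U. U \<inter> sp_carrier (Z n)) ` K) = \<Union>K \<inter> sp_carrier (Z n)"
      by blast
    ultimately show "openin (sp_top (Z n)) (\<Union>K \<inter> sp_carrier (Z n))"
      by simp
  qed
  then show ?thesis by (simp add: ind_space_def topology_inverse')
qed

text \<open>Germs at \<open>x\<close>, and Zariski tangent vectors at \<open>x\<close> as point derivations of the ring of germs.\<close>
definition regular_at :: "'a space_fun \<Rightarrow> 'a \<Rightarrow> ('a \<Rightarrow> complex) \<Rightarrow> bool" where
  "regular_at Z x f \<longleftrightarrow> (\<exists>U. openin (sp_top Z) U \<and> x \<in> U \<and> f \<in> sp_reg Z U)"

definition point_derivation :: "'a space_fun \<Rightarrow> 'a \<Rightarrow> (('a \<Rightarrow> complex) \<Rightarrow> complex) \<Rightarrow> bool" where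
  "point_derivation Z x D \<longleftrightarrow>
     (\<forall>f g. regular_at Z x f \<and> regular_at Z x g \<longrightarrow>
        ((\<exists>U. openin (sp_top Z) U \<and> x \<in> U \<and> (\<forall>y\<in>U. f y = g y)) \<longrightarrow> D f = D g) \<and>
        D (\<lambda>y. f y + g y) = D f + D g \<and>
        (\<forall>c. D (\<lambda>y. c * f y) = c * D f) \<and>
        D (\<lambda>y. f y * g y) = f x * D g + g x * D f)"

definition inj_differential_at :: "'a space_fun \<Rightarrow> 'b space_fun \<Rightarrow> ('a \<Rightarrow> 'b) \<Rightarrow> 'a \<Rightarrow> bool" where
  "inj_differential_at Z W \<phi> x \<longleftrightarrow>
     (\<forall>D. point_derivation Z x D \<and> (\<forall>h. regular_at W (\<phi> x) h \<longrightarrow> D (h \<circ> \<phi>) = 0) \<longrightarrow>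
          (\<forall>f. regular_at Z x f \<longrightarrow> D f = 0))"


section \<open>The provariety of infinite matrices and its Poisson structure\<close>

definition gl_coords :: "nat \<Rightarrow> (imat \<Rightarrow> complex) set" where
  "gl_coords n = {(\<lambda>Z. Z i j) | i j. i < n \<and> j < n}"

definition gl_space :: "nat \<Rightarrow> imat space_fun" where
  "gl_space n = zariski_space (gl n) (gl_coords n)"

text \<open>\<open>GL(n)\<close> as an open subvariety of \<open>gl(n)\<close>, via the upper left blocks.\<close>
definition GL_space :: "nat \<Rightarrow> imat space_fun" where
  "GL_space n = zariski_space (GL n) (gl_coords n)"

text \<open>
  The inverse limit topology, and the sheaf generated by the functions \<open>h \<circ> p\<^sub>n\<close> on
  \<open>p\<^sub>n\<close>-preimages of open sets; in the direct limit over \<open>k \<ge> n\<close> one may replace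
  \<open>U\<^sub>n\<close> by its preimage in \<open>gl(k)\<close>, so a single index suffices.
\<close>
definition M_inf :: "imat space_fun" where
  "M_inf = \<lparr>
     sp_top = topology_generated_by {corner n -` W | n W. openin (sp_top (gl_space n)) W},
     sp_reg = (\<lambda>U. {f. \<forall>X\<in>U. \<exists>n W h. openin (sp_top (gl_space n)) W \<and> h \<in> sp_reg (gl_space n) W \<and>
                        X \<in> corner n -` W \<and> corner n -` W \<subseteq> U \<and>
                        (\<forall>Y\<in>corner n -` W. f Y = h (corner n Y))}) \<rparr>"

text \<open>The ring of global functions, i.e. the direct limit of the rings of regular functions on \<open>gl(n)\<close>.\<close>
definition O_M_inf :: "(imat \<Rightarrow> complex) set" where
  "O_M_inf = {(\<lambda>X. f (corner n X)) | n f. f \<in> sp_reg (gl_space n) (gl n)}"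

definition diff_at :: "(imat \<Rightarrow> complex) \<Rightarrow> imat \<Rightarrow> imat \<Rightarrow> complex" where
  "diff_at f Z V = deriv (\<lambda>t. f (Z + msmult t V)) 0"

definition grad :: "nat \<Rightarrow> (imat \<Rightarrow> complex) \<Rightarrow> imat \<Rightarrow> imat" where
  "grad n f Z = (THE B. B \<in> gl n \<and> (\<forall>V\<in>gl n. diff_at f Z V = tr n (B \<odot> V)))"

definition poisson_gl :: "nat \<Rightarrow> (imat \<Rightarrow> complex) \<Rightarrow> (imat \<Rightarrow> complex) \<Rightarrow> imat \<Rightarrow> complex" where
  "poisson_gl n f g Z = tr n (Z \<odot> comm (grad n f Z) (grad n g Z))"

definition poisson :: "(imat \<Rightarrow> complex) \<Rightarrow> (imat \<Rightarrow> complex) \<Rightarrow> imat \<Rightarrow> complex" where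
  "poisson F G X = (THE c. \<forall>n f g.
     f \<in> sp_reg (gl_space n) (gl n) \<and> g \<in> sp_reg (gl_space n) (gl n) \<and>
     F = (\<lambda>Y. f (corner n Y)) \<and> G = (\<lambda>Y. g (corner n Y)) \<longrightarrow>
     c = poisson_gl n f g (corner n X))"

text \<open>
  The value at \<open>Y\<close> of the Hamiltonian vector field \<open>\<xi>\<^sub>F\<close>, as an element of
  \<open>T\<^sub>Y(M(\<infinity>)) = M(\<infinity>)\<close>.
\<close>
definition ham :: "(imat \<Rightarrow> complex) \<Rightarrow> imat \<Rightarrow> imat" where
  "ham F Y = (THE V. \<forall>G\<in>O_M_inf. diff_at G Y V = poisson F G Y)"

definition J_inf :: "(imat \<Rightarrow> complex) set" where
  "J_inf = {(\<lambda>X. tr n (mpow (corner n X) j)) | n j. 1 \<le> j \<and> j \<le> n}"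

text \<open>Linear independence of the family of differentials indexed by \<open>J_inf\<close>, hence the injectivity clause.\<close>
definition strongly_regular :: "imat \<Rightarrow> bool" where
  "strongly_regular X \<longleftrightarrow> inj_on (\<lambda>f. diff_at f X) J_inf \<and>
     \<not> module.dependent (\<lambda>c \<eta> V. c * \<eta> V) ((\<lambda>f. diff_at f X) ` J_inf)"

text \<open>\<open>\<aa>(\<infinity>)\<^sub>Y\<close>.\<close>
definition a_inf_at :: "imat \<Rightarrow> imat set" where
  "a_inf_at Y = module.span msmult {ham f Y | f. f \<in> J_inf}"


section \<open>The action of \<open>A(\<infinity>)\<close>\<close>

text \<open>Here \<open>t i j\<close>, with \<open>1 \<le> j \<le> i < n\<close>, is the coordinate \<open>t\<^sub>i\<^sub>j\<close> of a point of \<open>A(n)\<close>.\<close>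
definition A_grp :: "nat \<Rightarrow> (nat \<Rightarrow> nat \<Rightarrow> complex) set" where
  "A_grp n = {t. \<forall>i j. \<not> (1 \<le> j \<and> j \<le> i \<and> i < n) \<longrightarrow> t i j = 0}"

text \<open>The outer \<open>corner i\<close> only matters for \<open>j = 1\<close>, where it turns the infinite identity matrix into \<open>Id\<^sub>i\<close>.\<close>
definition z_elt :: "(nat \<Rightarrow> nat \<Rightarrow> complex) \<Rightarrow> imat \<Rightarrow> nat \<Rightarrow> imat" where
  "z_elt t X i = mprod (map (\<lambda>j. mexp (msmult (of_nat j * t i j)
                                        (corner i (mpow (corner i X) (j - 1))))) [1..<Suc i])"

definition A_act :: "nat \<Rightarrow> (nat \<Rightarrow> nat \<Rightarrow> complex) \<Rightarrow> imat \<Rightarrow> imat" where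
  "A_act n t X = Ad (mprod (map (z_elt t X) [1..<n])) X"

definition A_orbit :: "imat \<Rightarrow> imat set" where
  "A_orbit X = {A_act n t X | n t. t \<in> A_grp n}"


section \<open>The ind-variety \<open>GL(\<infinity>)\<cdot>X\<close> and its weak symplectic form\<close>

text \<open>\<open>GL(n)\<cdot>X\<close> with the structure of the quotient of \<open>GL(n)\<close> by the stabilizer of \<open>X\<close>.\<close>
definition orbit_space :: "nat \<Rightarrow> imat \<Rightarrow> imat space_fun" where
  "orbit_space n X = \<lparr>
     sp_top = topology (\<lambda>U. U \<subseteq> GL_orbit n X \<and> openin (sp_top (GL_space n)) {g \<in> GL n. Ad g X \<in> U}),
     sp_reg = (\<lambda>U. {f. (\<lambda>g. f (Ad g X)) \<in> sp_reg (GL_space n) {g \<in> GL n. Ad g X \<in> U}}) \<rparr>"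

lemma openin_orbit_space:
  "openin (sp_top (orbit_space n X)) U \<longleftrightarrow>
     U \<subseteq> GL_orbit n X \<and> openin (sp_top (GL_space n)) {g \<in> GL n. Ad g X \<in> U}"
proof -
  have "istopology (\<lambda>U. U \<subseteq> GL_orbit n X \<and> openin (sp_top (GL_space n)) {g \<in> GL n. Ad g X \<in> U})"
    unfolding istopology_def
  proof (intro conjI allI impI)
    fix S T
    assume S: "S \<subseteq> GL_orbit n X \<and> openin (sp_top (GL_space n)) {g \<in> GL n. Ad g X \<in> S}"
      and T: "T \<subseteq> GL_orbit n X \<and> openin (sp_top (GL_space n)) {g \<in> GL n. Ad g X \<in> T}"
    show "S \<inter> T \<subseteq> GL_orbit n X" using S by blast
    have "{g \<in> GL n. Ad g X \<in> S \<inter> T} = {g \<in> GL n. Ad g X \<in> S} \<inter> {g \<in> GL n. Ad g X \<in> T}"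
      by blast
    then show "openin (sp_top (GL_space n)) {g \<in> GL n. Ad g X \<in> S \<inter> T}"
      using S T by (simp add: openin_Int)
  next
    fix K
    assume K: "\<forall>U\<in>K. U \<subseteq> GL_orbit n X \<and> openin (sp_top (GL_space n)) {g \<in> GL n. Ad g X \<in> U}"
    show "\<Union>K \<subseteq> GL_orbit n X" using K by blast
    have "{g \<in> GL n. Ad g X \<in> \<Union>K} = \<Union>((\<lambda>U. {g \<in> GL n. Ad g X \<in> U}) ` K)"
      by blast
    moreover have "openin (sp_top (GL_space n)) (\<Union>((\<lambda>U. {g \<in> GL n. Ad g X \<in> U}) ` K))"
      using K by (intro openin_Union) auto
    ultimately show "openin (sp_top (GL_space n)) {g \<in> GL n. Ad g X \<in> \<Union>K}" by simp
  qed
  then show ?thesis by (simp add: orbit_space_def topology_inverse')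
qed

text \<open>The Lie algebra of the stabilizer of \<open>Y\<close> in \<open>GL(n)\<close>, resp. in \<open>GL(\<infinity>)\<close>.\<close>
definition stab_lie :: "nat \<Rightarrow> imat \<Rightarrow> imat set" where
  "stab_lie n Y = {A \<in> gl n. \<forall>t. Ad (mexp (msmult t A)) Y = Y}"

definition stab_lie_inf :: "imat \<Rightarrow> imat set" where
  "stab_lie_inf Y = (\<Union>n. stab_lie n Y)"

text \<open>
  Elements of the quotient spaces \<open>T\<^sub>Y(GL(n)\<cdot>X) = gl(n)/gl(n)\<^sup>Y\<close> and
  \<open>T\<^sub>Y(GL(\<infinity>)\<cdot>X) = gl(\<infinity>)/gl(\<infinity>)\<^sup>Y\<close> are cosets.
\<close>
definition coset_of :: "imat set \<Rightarrow> imat \<Rightarrow> imat set" where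
  "coset_of \<h> A = {A + C | C. C \<in> \<h>}"

definition orbit_tangent :: "imat \<Rightarrow> imat set set" where
  "orbit_tangent Y = coset_of (stab_lie_inf Y) ` gl_inf"

text \<open>The tangent vector represented by \<open>A\<close>, acting on a function defined on the orbit near \<open>Y\<close>.\<close>
definition orbit_deriv :: "imat \<Rightarrow> imat \<Rightarrow> (imat \<Rightarrow> complex) \<Rightarrow> complex" where
  "orbit_deriv Y A f = deriv (\<lambda>t. f (Ad (mexp (msmult t A)) Y)) 0"

definition omega_inf :: "imat \<Rightarrow> imat set \<Rightarrow> imat set \<Rightarrow> complex" where
  "omega_inf Y S T = (THE c. \<forall>n A B. A \<in> S \<inter> gl n \<and> B \<in> T \<inter> gl n \<longrightarrow>
                              c = tr n (corner n Y \<odot> comm A B))"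

text \<open>
  The differential at \<open>Y\<close> of the inclusion \<open>i\<close> of \<open>GL(\<infinity>)\<cdot>X\<close> into \<open>M(\<infinity>)\<close>: the element \<open>V\<close> of
  \<open>T\<^sub>Y(M(\<infinity>)) = M(\<infinity>)\<close> along which the derivative of a function on \<open>M(\<infinity>)\<close> is the
  derivative of its restriction to the orbit.
\<close>
definition di :: "imat \<Rightarrow> imat set \<Rightarrow> imat" where
  "di Y S = (THE V. \<forall>A\<in>S. \<forall>F\<in>O_M_inf. diff_at F Y V = orbit_deriv Y A F)"


section \<open>Ind-subvarieties of \<open>GL(\<infinity>)\<cdot>X\<close> and immersed ind-subvarieties of \<open>M(\<infinity>)\<close>\<close>

definition ind_subvariety :: "imat \<Rightarrow> imat set \<Rightarrow> bool" where
  "ind_subvariety X L \<longleftrightarrow> L \<subseteq> GL_inf_orbit X \<and>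
     (\<forall>n. locally_closedin (sp_top (orbit_space n X)) (L \<inter> GL_orbit n X))"

text \<open>The filtration of an ind-subvariety by the subvarieties \<open>L\<^sub>n\<close>.\<close>
definition strata :: "imat \<Rightarrow> imat set \<Rightarrow> nat \<Rightarrow> imat space_fun" where
  "strata X L n = sp_sub (orbit_space n X) (L \<inter> GL_orbit n X)"

text \<open>
  The tangent space of the subvariety \<open>L\<^sub>n\<close> at \<open>Y\<close>, as a subspace of
  \<open>gl(n)/gl(n)\<^sup>Y\<close>: the tangent vectors annihilating the germs that vanish on \<open>L\<^sub>n\<close>.
\<close>
definition stratum_tangent :: "nat \<Rightarrow> imat \<Rightarrow> imat set \<Rightarrow> imat \<Rightarrow> imat set set" where
  "stratum_tangent n X L Y = {coset_of (stab_lie n Y) A | A. A \<in> gl n \<and>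
     (\<forall>U f. openin (sp_top (orbit_space n X)) U \<and> Y \<in> U \<and> f \<in> sp_reg (orbit_space n X) U \<and>
            (\<forall>Z\<in>U \<inter> L. f Z = 0) \<longrightarrow> orbit_deriv Y A f = 0)}"

definition ind_tangent :: "imat \<Rightarrow> imat set \<Rightarrow> imat \<Rightarrow> imat set set" where
  "ind_tangent X L Y = {coset_of (stab_lie_inf Y) A | n A.
     Y \<in> GL_orbit n X \<and> A \<in> gl n \<and> coset_of (stab_lie n Y) A \<in> stratum_tangent n X L Y}"

definition omega_perp :: "imat \<Rightarrow> imat set set \<Rightarrow> imat set set" where
  "omega_perp Y W = {S \<in> orbit_tangent Y. \<forall>T\<in>W. omega_inf Y S T = 0}"

definition lagrangian :: "imat \<Rightarrow> imat set \<Rightarrow> bool" where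
  "lagrangian X L \<longleftrightarrow> (\<forall>Y\<in>L. ind_tangent X L Y = omega_perp Y (ind_tangent X L Y))"

text \<open>
  \<open>S\<close> is the image of the ind-variety \<open>Z\<close> under the immersion \<open>\<phi>\<close>.  The tangent space of
  \<open>Z\<close> at a point is the increasing union of the tangent spaces of the \<open>Z n\<close>, so the differential is
  injective iff it is so on each of them.
\<close>
definition immersed_by :: "(nat \<Rightarrow> 'a space_fun) \<Rightarrow> ('a \<Rightarrow> imat) \<Rightarrow> imat set \<Rightarrow> bool" where
  "immersed_by Z \<phi> S \<longleftrightarrow> ind_variety Z \<and> sp_morphism (ind_space Z) M_inf \<phi> \<and>
     inj_on \<phi> (sp_carrier (ind_space Z)) \<and> \<phi> ` sp_carrier (ind_space Z) = S \<and>
     (\<forall>n. \<forall>x\<in>sp_carrier (Z n). inj_differential_at (Z n) M_inf \<phi> x)"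

text \<open>\<open>i\<^sup>-\<^sup>1(S)\<close> for the inclusion \<open>i\<close> of \<open>GL(\<infinity>)\<cdot>X\<close> into \<open>M(\<infinity>)\<close>.\<close>
definition i_preimage :: "imat \<Rightarrow> imat set \<Rightarrow> imat set" where
  "i_preimage X S = {Y \<in> GL_inf_orbit X. Y \<in> S}"

end

theory Submission
  imports Defs "HOL-Complex_Analysis.Complex_Analysis"
    "HOL-Computational_Algebra.Fundamental_Theorem_Algebra"
begin

text \<open>
  By an algebraic form of strong regularity, every \<open>X\<^sub>n\<close> is a regular matrix and the centralizers of
  \<open>X\<^sub>n\<close> and \<open>X\<^sub>n\<^sub>+\<^sub>1\<close> in \<open>gl(n)\<close> meet in \<open>0\<close>.  Hence \<open>X\<close> has trivial
  stabilizer in \<open>GL(\<infinity>)\<close>, so that \<open>GL(n)\<cdot>X\<close> is a copy of \<open>GL(n)\<close>, and, the exponential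
  being onto the centralizer groups \<open>Z\<^sub>n\<close> of the \<open>X\<^sub>n\<close>, the \<open>n\<close>-th stratum of
  \<open>A(\<infinity>)\<cdot>X\<close> corresponds to \<open>Z\<^sub>1 Z\<^sub>2 \<cdots> Z\<^sub>n\<close>.  The factors of such a product are unique
  and solve a linear system; so they depend regularly on the product, which makes the strata locally
  closed.  Two points of a stratum lie on an entire curve \<open>t \<mapsto> exp(a\<^sub>1 + t b\<^sub>1) \<cdots> exp(a\<^sub>n + t b\<^sub>n)\<close>, which
  gives irreducibility.

  The tangent space at \<open>Y\<close> is the sum of the centralizers of the \<open>Y\<^sub>i\<close>.  One inclusion is the
  derivative of exponential curves in the orbit, the other one tests tangent vectors against
  \<open>Z \<mapsto> tr(Z\<^sub>i\<^sup>j)\<close>, which is constant on the orbit.  That sum is isotropic, and a dimension count shows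
  that it contains its annihilator.  Since the Hamiltonian vector field of \<open>tr(Z\<^sub>i\<^sup>j)\<close> at \<open>Y\<close> is
  \<open>-j [Y\<^sub>i\<^sup>j\<^sup>-\<^sup>1, Y]\<close>, its image in the matrices is \<open>\<aa>(\<infinity>)\<^sub>Y\<close>.
\<close>

section \<open>Matrix algebra\<close>

text \<open>The obstacle is that \<open>A(\<infinity>)\<close> acts through exponentials, which are
  not algebraic, while the claims are about varieties. Surjectivity of the exponential onto each
  centralizer group removes exponentials from the description of the strata; they return only for
  irreducibility and for tangent vectors, where analysis is the shorter way. A product of subgroups
  is in general only constructible, and splitting g = h z is not a linear problem. Taking w = z^(-1)
  as the unknown makes it one, since w commutes with a corner of X and \<open>g \<odot> w\<close>
  must have a trivial last row and column; that gl(n) meets the centralizer of the (n+1)-corner in 0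
  gives uniqueness of the solution. The same uniqueness identifies a stratum with the tuples of its
  factors, hence with a closed subset of affine space, so nothing has to be glued. Dimension theory
  does not enter: all counts are homogeneous linear systems with more unknowns than
  equations.\<close>

lemma mmul_sum:
  assumes "finite K" and "\<And>k. k \<notin> K \<Longrightarrow> A i k * B k j = 0"
  shows "(A \<odot> B) i j = (\<Sum>k\<in>K. A i k * B k j)"
  unfolding mmul_def by (rule sum.mono_neutral_left) (use assms in auto)

lemma mmul_nonzeroD: "(A \<odot> B) i j \<noteq> 0 \<Longrightarrow> \<exists>k. A i k \<noteq> 0 \<and> B k j \<noteq> 0"
proof (rule ccontr)
  assume "(A \<odot> B) i j \<noteq> 0" "\<nexists>k. A i k \<noteq> 0 \<and> B k j \<noteq> 0"
  then have "{k. A i k * B k j \<noteq> 0} = {}" by auto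
  with \<open>(A \<odot> B) i j \<noteq> 0\<close> show False unfolding mmul_def by (simp only: sum.empty)
qed

lemma mmul_zeroI: "(\<And>k. A i k = 0 \<or> B k j = 0) \<Longrightarrow> (A \<odot> B) i j = 0"
  using mmul_nonzeroD by blast

text \<open>An infinite index set makes the sum in \<open>mmul_def\<close> collapse to 0, so
  associativity and distributivity fail for arbitrary matrices. Finite rows and columns are a
  condition shared by gl, GL and all their products.\<close>

definition row_col_finite :: "imat \<Rightarrow> bool" where
  "row_col_finite A \<longleftrightarrow> (\<forall>i. finite {k. A i k \<noteq> 0}) \<and> (\<forall>k. finite {i. A i k \<noteq> 0})"

lemma row_col_finite_mone [simp]: "row_col_finite mone"
  by (auto simp: row_col_finite_def mone_def)

lemma row_col_finite_zero [simp]: "row_col_finite 0"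
  by (auto simp: row_col_finite_def)

lemma row_col_finite_mmul [simp]:
  assumes "row_col_finite A" "row_col_finite B"
  shows "row_col_finite (A \<odot> B)"
  unfolding row_col_finite_def
proof (intro conjI allI)
  fix i
  have "{k. (A \<odot> B) i k \<noteq> 0} \<subseteq> (\<Union>l\<in>{l. A i l \<noteq> 0}. {k. B l k \<noteq> 0})"
    using mmul_nonzeroD by blast
  then show "finite {k. (A \<odot> B) i k \<noteq> 0}"
    by (rule finite_subset) (use assms in \<open>auto simp: row_col_finite_def\<close>)
  have "{k. (A \<odot> B) k i \<noteq> 0} \<subseteq> (\<Union>l\<in>{l. B l i \<noteq> 0}. {k. A k l \<noteq> 0})"
    using mmul_nonzeroD by blast
  then show "finite {k. (A \<odot> B) k i \<noteq> 0}"
    by (rule finite_subset) (use assms in \<open>auto simp: row_col_finite_def\<close>)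
qed

lemma row_col_finite_add [simp]: "row_col_finite A \<Longrightarrow> row_col_finite B \<Longrightarrow> row_col_finite (A + B)"
  unfolding row_col_finite_def
proof (intro conjI allI)
  fix i
  assume *: "(\<forall>i. finite {k. A i k \<noteq> 0}) \<and> (\<forall>k. finite {i. A i k \<noteq> 0})"
    "(\<forall>i. finite {k. B i k \<noteq> 0}) \<and> (\<forall>k. finite {i. B i k \<noteq> 0})"
  have "{k. (A + B) i k \<noteq> 0} \<subseteq> {k. A i k \<noteq> 0} \<union> {k. B i k \<noteq> 0}" by auto
  then show "finite {k. (A + B) i k \<noteq> 0}"
    by (rule finite_subset) (use * in auto)
  have "{k. (A + B) k i \<noteq> 0} \<subseteq> {k. A k i \<noteq> 0} \<union> {k. B k i \<noteq> 0}" by auto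
  then show "finite {k. (A + B) k i \<noteq> 0}"
    by (rule finite_subset) (use * in auto)
qed

lemma row_col_finite_uminus [simp]: "row_col_finite (- A) \<longleftrightarrow> row_col_finite A"
  by (simp add: row_col_finite_def)

lemma row_col_finite_diff [simp]: "row_col_finite A \<Longrightarrow> row_col_finite B \<Longrightarrow> row_col_finite (A - B)"
  using row_col_finite_add[of A "- B"] by simp

lemma row_col_finite_msmult [simp]: "row_col_finite A \<Longrightarrow> row_col_finite (msmult c A)"
  unfolding row_col_finite_def msmult_def by (cases "c = 0") auto

lemma row_col_finite_gl [simp]: "A \<in> gl n \<Longrightarrow> row_col_finite A"
proof -
  assume "A \<in> gl n"
  then have "{k. A i k \<noteq> 0} \<subseteq> {..<n}" "{k. A k i \<noteq> 0} \<subseteq> {..<n}" for i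
    by (auto simp: gl_def not_le[symmetric] simp del: not_le)
  then show "row_col_finite A" unfolding row_col_finite_def by (meson finite_lessThan finite_subset)
qed

text \<open>Both double sums are cut down to one finite rectangle J x K at a fixed entry. Which
  rectangle works depends on which two factors are finite, hence the abstract support
  conditions.\<close>

lemma mmul_assoc_aux:
  assumes "finite K" "finite J"
    and "\<And>j k. j \<in> J \<Longrightarrow> k \<notin> K \<Longrightarrow> A i k * B k j = 0"
    and "\<And>j. j \<notin> J \<Longrightarrow> (A \<odot> B) i j * C j l = 0"
    and "\<And>j k. k \<in> K \<Longrightarrow> j \<notin> J \<Longrightarrow> B k j * C j l = 0"
    and "\<And>k. k \<notin> K \<Longrightarrow> A i k * (B \<odot> C) k l = 0"
  shows "((A \<odot> B) \<odot> C) i l = (A \<odot> (B \<odot> C)) i l"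
proof -
  have "((A \<odot> B) \<odot> C) i l = (\<Sum>j\<in>J. (A \<odot> B) i j * C j l)"
    by (rule mmul_sum) (use assms in auto)
  also have "\<dots> = (\<Sum>j\<in>J. (\<Sum>k\<in>K. A i k * B k j) * C j l)"
    using assms by (intro sum.cong refl arg_cong2[where f="(*)"] mmul_sum) auto
  also have "\<dots> = (\<Sum>k\<in>K. A i k * (\<Sum>j\<in>J. B k j * C j l))"
    by (subst sum_distrib_left, subst sum_distrib_right, subst sum.swap) (simp add: mult.assoc)
  also have "\<dots> = (\<Sum>k\<in>K. A i k * (B \<odot> C) k l)"
    using assms by (intro sum.cong refl arg_cong2[where f="(*)"] mmul_sum[symmetric]) auto
  also have "\<dots> = (A \<odot> (B \<odot> C)) i l"
    by (rule mmul_sum[symmetric]) (use assms in auto)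
  finally show ?thesis .
qed

text \<open>Two finite factors in any positions are enough: in \<open>Ad g X\<close> the arbitrary
  matrix X sits in the middle.\<close>

lemma mmul_assoc:
  assumes "row_col_finite A \<and> row_col_finite B \<or> row_col_finite A \<and> row_col_finite C \<or> row_col_finite B \<and> row_col_finite C"
  shows "(A \<odot> B) \<odot> C = A \<odot> (B \<odot> C)"
proof (intro ext)
  fix i l
  consider "row_col_finite A" "row_col_finite B" | "row_col_finite A" "row_col_finite C" | "row_col_finite B" "row_col_finite C" using assms by blast
  then show "((A \<odot> B) \<odot> C) i l = (A \<odot> (B \<odot> C)) i l"
  proof cases
    case 1
    show ?thesis
      by (rule mmul_assoc_aux[where K="{k. A i k \<noteq> 0}" and J="\<Union>k\<in>{k. A i k \<noteq> 0}. {j. B k j \<noteq> 0}"])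
        (use 1 in \<open>auto simp: row_col_finite_def intro: mmul_zeroI\<close>)
  next
    case 2
    show ?thesis
      by (rule mmul_assoc_aux[where K="{k. A i k \<noteq> 0}" and J="{j. C j l \<noteq> 0}"])
        (use 2 in \<open>auto simp: row_col_finite_def\<close>)
  next
    case 3
    show ?thesis
      by (rule mmul_assoc_aux[where J="{j. C j l \<noteq> 0}" and K="\<Union>j\<in>{j. C j l \<noteq> 0}. {k. B k j \<noteq> 0}"])
        (use 3 in \<open>auto simp: row_col_finite_def intro: mmul_zeroI\<close>)
  qed
qed

lemma mmul_mone_left [simp]: "mone \<odot> A = A"
  by (intro ext, subst mmul_sum[where K="{_}"]) (auto simp: mone_def)

lemma mmul_mone_right [simp]: "A \<odot> mone = A"
  by (intro ext, subst mmul_sum[where K="{_}"]) (auto simp: mone_def)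

lemma mmul_zero_left [simp]: "0 \<odot> A = 0"
  by (auto simp: mmul_def fun_eq_iff)

lemma mmul_zero_right [simp]: "A \<odot> 0 = 0"
  by (auto simp: mmul_def fun_eq_iff)

lemma mmul_add_left:
  assumes "row_col_finite C \<or> row_col_finite A \<and> row_col_finite B"
  shows "(A + B) \<odot> C = A \<odot> C + B \<odot> C"
proof (intro ext)
  fix i j
  define K where "K = (if row_col_finite C then {k. C k j \<noteq> 0} else {k. A i k \<noteq> 0} \<union> {k. B i k \<noteq> 0})"
  have K: "finite K" using assms by (auto simp: K_def row_col_finite_def)
  have "((A + B) \<odot> C) i j = (\<Sum>k\<in>K. (A + B) i k * C k j)"
    "(A \<odot> C) i j = (\<Sum>k\<in>K. A i k * C k j)" "(B \<odot> C) i j = (\<Sum>k\<in>K. B i k * C k j)"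
    by (rule mmul_sum[OF K]; auto simp: K_def split: if_splits)+
  then show "((A + B) \<odot> C) i j = (A \<odot> C + B \<odot> C) i j"
    by (simp add: algebra_simps sum.distrib)
qed

lemma mmul_add_right:
  assumes "row_col_finite C \<or> row_col_finite A \<and> row_col_finite B"
  shows "C \<odot> (A + B) = C \<odot> A + C \<odot> B"
proof (intro ext)
  fix i j
  define K where "K = (if row_col_finite C then {k. C i k \<noteq> 0} else {k. A k j \<noteq> 0} \<union> {k. B k j \<noteq> 0})"
  have K: "finite K" using assms by (auto simp: K_def row_col_finite_def)
  have "(C \<odot> (A + B)) i j = (\<Sum>k\<in>K. C i k * (A + B) k j)"
    "(C \<odot> A) i j = (\<Sum>k\<in>K. C i k * A k j)" "(C \<odot> B) i j = (\<Sum>k\<in>K. C i k * B k j)"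
    by (rule mmul_sum[OF K]; auto simp: K_def split: if_splits)+
  then show "(C \<odot> (A + B)) i j = (C \<odot> A + C \<odot> B) i j"
    by (simp add: algebra_simps sum.distrib)
qed

lemma mmul_msmult_left: "msmult c A \<odot> B = msmult c (A \<odot> B)"
proof (cases "c = 0")
  case True
  then show ?thesis by (auto simp: msmult_def mmul_def fun_eq_iff)
next
  case False
  then show ?thesis by (auto simp: msmult_def mmul_def fun_eq_iff sum_distrib_left mult.assoc)
qed

lemma mmul_msmult_right: "A \<odot> msmult c B = msmult c (A \<odot> B)"
proof (cases "c = 0")
  case True
  then show ?thesis by (auto simp: msmult_def mmul_def fun_eq_iff)
next
  case False
  then show ?thesis by (auto simp: msmult_def mmul_def fun_eq_iff sum_distrib_left ac_simps)
qed

interpretation mat: vector_space msmult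
  by unfold_locales (auto simp: msmult_def fun_eq_iff algebra_simps)

lemma msmult_apply [simp]: "msmult c A i j = c * A i j"
  by (simp add: msmult_def)

lemma msmult_minus1: "msmult (- 1) A = - A"
  by (simp add: fun_eq_iff)

lemma mmul_uminus_left: "(- A) \<odot> B = - (A \<odot> B)"
  using mmul_msmult_left[of "- 1" A B] by (simp only: msmult_minus1)

lemma mmul_uminus_right: "A \<odot> (- B) = - (A \<odot> B)"
  using mmul_msmult_right[of A "- 1" B] by (simp only: msmult_minus1)

lemma mmul_diff_left: "row_col_finite C \<or> row_col_finite A \<and> row_col_finite B \<Longrightarrow> (A - B) \<odot> C = A \<odot> C - B \<odot> C"
  using mmul_add_left[of C A "- B"] by (simp add: mmul_uminus_left)

lemma mmul_diff_right: "row_col_finite C \<or> row_col_finite A \<and> row_col_finite B \<Longrightarrow> C \<odot> (A - B) = C \<odot> A - C \<odot> B"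
  using mmul_add_right[of C A "- B"] by (simp add: mmul_uminus_right)

lemma imat_sum_apply: "(\<Sum>x\<in>I. F x :: imat) i j = (\<Sum>x\<in>I. F x i j)"
  by (induction I rule: infinite_finite_induct) auto

lemma row_col_finite_sum:
  fixes F :: "'a \<Rightarrow> imat"
  shows "(\<And>x. x \<in> I \<Longrightarrow> row_col_finite (F x)) \<Longrightarrow> row_col_finite (\<Sum>x\<in>I. F x)"
  by (induction I rule: infinite_finite_induct) auto

lemma mmul_sum_left:
  fixes F :: "'a \<Rightarrow> imat"
  shows "row_col_finite C \<Longrightarrow> (\<Sum>x\<in>I. F x) \<odot> C = (\<Sum>x\<in>I. F x \<odot> C)"
  by (induction I rule: infinite_finite_induct) (auto simp: mmul_add_left)

lemma mmul_sum_right: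
  fixes F :: "'a \<Rightarrow> imat"
  shows "row_col_finite C \<Longrightarrow> C \<odot> (\<Sum>x\<in>I. F x) = (\<Sum>x\<in>I. C \<odot> F x)"
  by (induction I rule: infinite_finite_induct) (auto simp: mmul_add_right)

subsection \<open>Corners and finite matrices\<close>

lemma gl_iff_corner: "A \<in> gl n \<longleftrightarrow> corner n A = A"
  by (auto simp: gl_def corner_def fun_eq_iff)

lemma corner_gl [simp]: "corner n A \<in> gl n"
  by (auto simp: gl_def corner_def)

lemma row_col_finite_corner [simp]: "row_col_finite (corner n A)"
  using row_col_finite_gl corner_gl by blast

lemma corner_id: "A \<in> gl n \<Longrightarrow> corner n A = A"
  by (simp add: gl_iff_corner)

lemma corner_corner [simp]: "corner m (corner n A) = corner (min m n) A"
  by (auto simp: corner_def fun_eq_iff)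

lemma corner_diff: "corner n (A - B) = corner n A - corner n B"
  by (auto simp: corner_def fun_eq_iff)

lemma corner_msmult: "corner n (msmult c A) = msmult c (corner n A)"
  by (auto simp: corner_def fun_eq_iff)

lemma gl_zero [simp]: "0 \<in> gl n" by (simp add: gl_def)

lemma gl_add [simp]: "A \<in> gl n \<Longrightarrow> B \<in> gl n \<Longrightarrow> A + B \<in> gl n" by (auto simp: gl_def)

lemma gl_diff [simp]: "A \<in> gl n \<Longrightarrow> B \<in> gl n \<Longrightarrow> A - B \<in> gl n" by (auto simp: gl_def)

lemma gl_uminus [simp]: "- A \<in> gl n \<longleftrightarrow> A \<in> gl n" by (auto simp: gl_def)

lemma gl_msmult [simp]: "A \<in> gl n \<Longrightarrow> msmult c A \<in> gl n" by (auto simp: gl_def)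

lemma gl_sum:
  fixes F :: "'a \<Rightarrow> imat"
  shows "(\<And>x. x \<in> I \<Longrightarrow> F x \<in> gl n) \<Longrightarrow> (\<Sum>x\<in>I. F x) \<in> gl n"
  by (induction I rule: infinite_finite_induct) auto

lemma gl_mono: "n \<le> m \<Longrightarrow> A \<in> gl n \<Longrightarrow> A \<in> gl m" by (auto simp: gl_def)

lemma gl_outside: "A \<in> gl n \<Longrightarrow> n \<le> i \<or> n \<le> j \<Longrightarrow> A i j = 0" by (auto simp: gl_def)

lemma gl_mmul [simp]: "A \<in> gl n \<Longrightarrow> B \<in> gl n \<Longrightarrow> A \<odot> B \<in> gl n"
  unfolding gl_def using mmul_nonzeroD by blast

lemma gl_mmul_apply: "A \<in> gl n \<or> B \<in> gl n \<Longrightarrow> (A \<odot> B) i j = (\<Sum>k<n. A i k * B k j)"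
  by (rule mmul_sum) (auto simp: gl_def)

text \<open>Block diagonal for the splitting of the indices at n. One factor of this shape already
  makes \<open>corner n\<close> multiplicative, which treats gl, GL and matrix exponentials
  uniformly.\<close>

definition blk :: "nat \<Rightarrow> imat \<Rightarrow> bool" where
  "blk n A \<longleftrightarrow> (\<forall>i j. (i < n) \<noteq> (j < n) \<longrightarrow> A i j = 0)"

lemma blk_gl: "A \<in> gl m \<Longrightarrow> m \<le> n \<Longrightarrow> blk n A" by (auto simp: gl_def blk_def)

lemma blk_mone [simp]: "blk n mone" by (auto simp: blk_def mone_def)

lemma corner_mmul:
  assumes "blk n A \<or> blk n B"
  shows "corner n (A \<odot> B) = corner n A \<odot> corner n B"
proof (intro ext)
  fix i j
  show "corner n (A \<odot> B) i j = (corner n A \<odot> corner n B) i j"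
  proof (cases "i < n \<and> j < n")
    case True
    have "(A \<odot> B) i j = (\<Sum>k<n. A i k * B k j)"
      by (rule mmul_sum) (use assms True in \<open>auto simp: blk_def\<close>)
    moreover have "(corner n A \<odot> corner n B) i j = (\<Sum>k<n. corner n A i k * corner n B k j)"
      by (rule gl_mmul_apply) simp
    ultimately show ?thesis using True by (simp add: corner_def)
  next
    case False
    have "corner n A \<odot> corner n B \<in> gl n" by simp
    with False show ?thesis by (auto simp: corner_def gl_def not_less)
  qed
qed

lemma gl_mmul_blk:
  assumes "A \<in> gl n" "blk n B"
  shows "A \<odot> B \<in> gl n" "B \<odot> A \<in> gl n"
proof -
  have "k < n \<and> l < n" if "A k l \<noteq> 0" for k l
    using assms(1) that by (auto simp: gl_def not_le[symmetric] simp del: not_le)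
  moreover have "(k < n) = (l < n)" if "B k l \<noteq> 0" for k l
    using assms(2) that by (auto simp: blk_def)
  ultimately have "(A \<odot> B) i j = 0 \<and> (B \<odot> A) i j = 0" if "n \<le> i \<or> n \<le> j" for i j
    using that mmul_nonzeroD[of A B i j] mmul_nonzeroD[of B A i j] by (metis not_le)
  then show "A \<odot> B \<in> gl n" "B \<odot> A \<in> gl n" by (auto simp: gl_def)
qed

text \<open>The affine space \<open>mone + gl n\<close>, without invertibility. It is the ambient
  space for candidates of group elements that are not yet known to be invertible.\<close>

definition Mn :: "nat \<Rightarrow> imat set" where
  "Mn n = {g. \<forall>i j. n \<le> i \<or> n \<le> j \<longrightarrow> g i j = mone i j}"

lemma Mn_iff: "g \<in> Mn n \<longleftrightarrow> g - mone \<in> gl n"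
  by (auto simp: Mn_def gl_def)

lemma Mn_gl: "A \<in> gl n \<Longrightarrow> mone + A \<in> Mn n"
  by (simp add: Mn_iff)

lemma Mn_E: "g \<in> Mn n \<Longrightarrow> \<exists>A\<in>gl n. g = mone + A"
  by (rule bexI[of _ "g - mone"]) (auto simp: Mn_iff)

lemma row_col_finite_Mn [simp]: "g \<in> Mn n \<Longrightarrow> row_col_finite g"
  using Mn_E[of g n] by auto

lemma mone_Mn [simp]: "mone \<in> Mn n" by (simp add: Mn_def)

lemma Mn_mono: "n \<le> m \<Longrightarrow> g \<in> Mn n \<Longrightarrow> g \<in> Mn m" by (auto simp: Mn_def)

lemma Mn_mmul [simp]:
  assumes "g \<in> Mn n" "h \<in> Mn n"
  shows "g \<odot> h \<in> Mn n"
proof -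
  obtain A B where *: "A \<in> gl n" "g = mone + A" "B \<in> gl n" "h = mone + B" using assms Mn_E by metis
  have "g \<odot> h = mone + (A + B + A \<odot> B)"
    using * by (simp add: mmul_add_left mmul_add_right add_ac)
  with * show ?thesis by (simp add: Mn_gl)
qed

lemma blk_Mn: "g \<in> Mn m \<Longrightarrow> m \<le> n \<Longrightarrow> blk n g"
  by (auto simp: Mn_def blk_def mone_def)

text \<open>Forces the value into \<open>Mn n\<close>, so that a matrix assembled from locally
  meaningful functions is a map into \<open>Mn n\<close> everywhere.\<close>

definition pad :: "nat \<Rightarrow> imat \<Rightarrow> imat" where
  "pad n A = (\<lambda>i j. if i < n \<and> j < n then A i j else mone i j)"

lemma pad_Mn [simp]: "pad n A \<in> Mn n" by (auto simp: pad_def Mn_def)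

lemma pad_id: "g \<in> Mn n \<Longrightarrow> pad n g = g"
  by (auto simp: pad_def Mn_def fun_eq_iff)

lemma corner_eq_Mn: "g \<in> Mn n \<Longrightarrow> h \<in> Mn n \<Longrightarrow> corner n g = corner n h \<Longrightarrow> g = h"
proof (intro ext)
  fix i j
  assume *: "g \<in> Mn n" "h \<in> Mn n" "corner n g = corner n h"
  show "g i j = h i j"
    using fun_cong[OF fun_cong[OF *(3)], of i j] *(1,2)
    by (cases "i < n \<and> j < n") (auto simp: corner_def Mn_def)
qed

subsection \<open>The groups and the adjoint action\<close>

lemma GL_iff: "g \<in> GL n \<longleftrightarrow> g \<in> Mn n \<and> (\<exists>h\<in>Mn n. g \<odot> h = mone \<and> h \<odot> g = mone)"
  by (simp add: GL_def Mn_def Bex_def)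

lemma GL_Mn [simp]: "g \<in> GL n \<Longrightarrow> g \<in> Mn n" by (simp add: GL_iff)

lemma row_col_finite_GL [simp]: "g \<in> GL n \<Longrightarrow> row_col_finite g" using row_col_finite_Mn GL_Mn by blast

lemma GL_mono: "n \<le> m \<Longrightarrow> g \<in> GL n \<Longrightarrow> g \<in> GL m" unfolding GL_iff using Mn_mono by blast

lemma GL_GL_inf: "g \<in> GL n \<Longrightarrow> g \<in> GL_inf" by (auto simp: GL_inf_def)

lemma row_col_finite_GL_inf [simp]: "g \<in> GL_inf \<Longrightarrow> row_col_finite g" by (auto simp: GL_inf_def)

lemma mone_GL [simp]: "mone \<in> GL n" unfolding GL_iff using mmul_mone_left mone_Mn by blast

lemma mone_GL_inf [simp]: "mone \<in> GL_inf" using mone_GL GL_GL_inf by blast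

lemma minv_eqI:
  assumes "h \<in> GL_inf" "row_col_finite g" "g \<odot> h = mone" "h \<odot> g = mone"
  shows "minv g = h"
  unfolding minv_def
proof (rule the_equality)
  show "h \<in> GL_inf \<and> g \<odot> h = mone \<and> h \<odot> g = mone" using assms by simp
  fix h' assume h': "h' \<in> GL_inf \<and> g \<odot> h' = mone \<and> h' \<odot> g = mone"
  have "h' = h' \<odot> (g \<odot> h)" using assms by simp
  also have "\<dots> = (h' \<odot> g) \<odot> h" using assms h' by (subst mmul_assoc) auto
  finally show "h' = h" using h' by simp
qed

lemma minv_GL:
  assumes "g \<in> GL n"
  shows "minv g \<in> GL n" "g \<odot> minv g = mone" "minv g \<odot> g = mone"
proof -
  obtain h where h: "h \<in> Mn n" "g \<odot> h = mone" "h \<odot> g = mone" using assms unfolding GL_iff by blast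
  then have hn: "h \<in> GL n" using assms unfolding GL_iff by blast
  have "minv g = h" by (rule minv_eqI[OF GL_GL_inf[OF hn] row_col_finite_GL[OF assms] h(2,3)])
  then show "minv g \<in> GL n" "g \<odot> minv g = mone" "minv g \<odot> g = mone" using h hn by simp_all
qed

lemma minv_GL_inf [simp]:
  assumes "g \<in> GL_inf"
  shows "minv g \<in> GL_inf" "g \<odot> minv g = mone" "minv g \<odot> g = mone"
  using assms minv_GL unfolding GL_inf_def by blast+

lemma GL_I:
  assumes "g \<in> Mn n" "h \<in> Mn n" "g \<odot> h = mone" "h \<odot> g = mone"
  shows "g \<in> GL n" "minv g = h"
proof -
  show g: "g \<in> GL n" using assms unfolding GL_iff by blast
  have "h \<in> GL n" using assms unfolding GL_iff by blast
  then show "minv g = h" by (rule minv_eqI[OF GL_GL_inf row_col_finite_GL[OF g] assms(3,4)])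
qed

lemma minv_cancel [simp]:
  assumes "g \<in> GL_inf"
  shows "g \<odot> (minv g \<odot> A) = A" "minv g \<odot> (g \<odot> A) = A" "(A \<odot> g) \<odot> minv g = A" "(A \<odot> minv g) \<odot> g = A"
  using assms by (simp_all add: mmul_assoc[symmetric]) (simp_all add: mmul_assoc)

lemma GL_mmul [simp]:
  assumes "g \<in> GL n" "h \<in> GL n"
  shows "g \<odot> h \<in> GL n"
proof (rule GL_I)
  have 1: "g \<in> GL_inf" "h \<in> GL_inf" using assms GL_GL_inf by blast+
  then show "g \<odot> h \<odot> (minv h \<odot> minv g) = mone" "minv h \<odot> minv g \<odot> (g \<odot> h) = mone"
    by (simp_all add: mmul_assoc)
qed (simp_all add: assms minv_GL(1))

lemma GL_inf_common:
  assumes "g \<in> GL_inf" "h \<in> GL_inf"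
  obtains n where "g \<in> GL n" "h \<in> GL n"
proof -
  obtain a b where "g \<in> GL a" "h \<in> GL b" using assms unfolding GL_inf_def by blast
  then show ?thesis using that[of "max a b"] GL_mono by (meson max.cobounded1 max.cobounded2)
qed

lemma GL_inf_mmul [simp]: "g \<in> GL_inf \<Longrightarrow> h \<in> GL_inf \<Longrightarrow> g \<odot> h \<in> GL_inf"
  by (meson GL_inf_common GL_mmul GL_GL_inf)

lemma minv_mmul:
  assumes "g \<in> GL_inf" "h \<in> GL_inf"
  shows "minv (g \<odot> h) = minv h \<odot> minv g"
  by (rule minv_eqI) (use assms in \<open>simp_all add: mmul_assoc\<close>)

lemma minv_minv [simp]: "g \<in> GL_inf \<Longrightarrow> minv (minv g) = g"
  by (rule minv_eqI) auto

lemma minv_mone [simp]: "minv mone = mone"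
  by (rule minv_eqI) auto

lemma Ad_mone [simp]: "Ad mone X = X"
  by (simp add: Ad_def)

lemma Ad_mmul: "g \<in> GL_inf \<Longrightarrow> h \<in> GL_inf \<Longrightarrow> Ad (g \<odot> h) X = Ad g (Ad h X)"
  by (simp add: Ad_def minv_mmul mmul_assoc)

lemma Ad_eq_iff: "g \<in> GL_inf \<Longrightarrow> Ad g X = Y \<longleftrightarrow> g \<odot> X = Y \<odot> g"
  unfolding Ad_def by (metis minv_cancel(3,4))

lemma Ad_minv: "g \<in> GL_inf \<Longrightarrow> Ad (minv g) (Ad g X) = X"
  by (simp flip: Ad_mmul)

lemma Ad_gl: "g \<in> GL n \<Longrightarrow> A \<in> gl n \<Longrightarrow> Ad g A \<in> gl n"
  unfolding Ad_def using minv_GL(1) blk_Mn gl_mmul_blk GL_Mn by (meson order_refl)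

lemma corner_Ad:
  assumes "g \<in> GL m" "m \<le> n"
  shows "corner n (Ad g X) = Ad g (corner n X)"
proof -
  have b: "blk n g" "blk n (minv g)" using assms minv_GL(1) blk_Mn GL_Mn by blast+
  have "corner n (Ad g X) = corner n g \<odot> corner n X \<odot> corner n (minv g)"
    using b by (simp add: Ad_def corner_mmul)
  also have "\<dots> = corner n (g \<odot> corner n X \<odot> minv g)"
    using b by (simp add: corner_mmul)
  also have "\<dots> = Ad g (corner n X)"
    using Ad_gl[of g n "corner n X"] assms GL_mono by (auto simp: Ad_def corner_id)
  finally show ?thesis .
qed

lemma Ad_mmul_dist:
  assumes "g \<in> GL_inf" "row_col_finite A \<or> row_col_finite B"
  shows "Ad g (A \<odot> B) = Ad g A \<odot> Ad g B"
  using assms by (auto simp: Ad_def mmul_assoc)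

lemma Ad_zero [simp]: "Ad g 0 = 0" by (simp add: Ad_def)

lemma Ad_msmult: "Ad g (msmult c A) = msmult c (Ad g A)"
  by (simp add: Ad_def mmul_msmult_left mmul_msmult_right)

lemma Ad_sum:
  fixes F :: "'a \<Rightarrow> imat"
  shows "g \<in> GL_inf \<Longrightarrow> Ad g (\<Sum>x\<in>I. F x) = (\<Sum>x\<in>I. Ad g (F x))"
  by (simp add: Ad_def mmul_sum_left mmul_sum_right)

lemma Ad_one [simp]: "g \<in> GL_inf \<Longrightarrow> Ad g mone = mone"
  by (simp add: Ad_def)

section \<open>Regular matrices and their centralizers\<close>

text \<open>The single source of linear dependence in the proof: annihilating polynomials,
  expansions along a cyclic vector and the dimension count for annihilators all come from it. An
  equation with a nonzero coefficient eliminates one unknown.\<close>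

lemma underdetermined:
  fixes M :: "'j \<Rightarrow> 'i \<Rightarrow> complex"
  assumes "finite J" "finite I" "card J < card I"
  shows "\<exists>x. (\<exists>i\<in>I. x i \<noteq> 0) \<and> (\<forall>j\<in>J. (\<Sum>i\<in>I. M j i * x i) = 0)"
  using assms
proof (induction J arbitrary: I M rule: finite_induct)
  case empty
  then have "I \<noteq> {}" by auto
  then show ?case by (intro exI[of _ "\<lambda>_. 1"]) auto
next
  case (insert j0 J)
  show ?case
  proof (cases "\<forall>i\<in>I. M j0 i = 0")
    case True
    obtain x where "\<exists>i\<in>I. x i \<noteq> 0" "\<forall>j\<in>J. (\<Sum>i\<in>I. M j i * x i) = 0"
      using insert.IH[of I M] insert.prems insert.hyps by auto
    with True show ?thesis by (intro exI[of _ x]) auto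
  next
    case False
    then obtain i0 where i0: "i0 \<in> I" "M j0 i0 \<noteq> 0" by blast
    let ?I = "I - {i0}"
    have "card J < card ?I" using insert.prems insert.hyps i0 by simp
    then obtain x where x: "\<exists>i\<in>?I. x i \<noteq> 0"
      "\<And>j. j \<in> J \<Longrightarrow> (\<Sum>i\<in>?I. (M j i - M j i0 * M j0 i / M j0 i0) * x i) = 0"
      using insert.IH[of ?I "\<lambda>j i. M j i - M j i0 * M j0 i / M j0 i0"] insert.prems by auto
    define y where "y = x(i0 := - (\<Sum>i\<in>?I. M j0 i * x i) / M j0 i0)"
    have split: "(\<Sum>i\<in>I. M j i * y i) = M j i0 * y i0 + (\<Sum>i\<in>?I. M j i * x i)" for j
      using i0 insert.prems by (simp add: sum.remove[of I i0] y_def)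
    have "(\<Sum>i\<in>I. M j0 i * y i) = 0" using i0 by (simp add: split) (simp add: y_def)
    moreover have "(\<Sum>i\<in>I. M j i * y i) = 0" if "j \<in> J" for j
    proof -
      have "(\<Sum>i\<in>?I. (M j i - M j i0 * M j0 i / M j0 i0) * x i) =
          (\<Sum>i\<in>?I. M j i * x i) - (M j i0 / M j0 i0) * (\<Sum>i\<in>?I. M j0 i * x i)"
        by (simp add: sum_distrib_left sum_subtractf algebra_simps)
      then show ?thesis using x(2)[OF that] by (simp add: split) (simp add: y_def)
    qed
    moreover have "\<exists>i\<in>I. y i \<noteq> 0" using x(1) by (auto simp: y_def)
    ultimately show ?thesis by (intro exI[of _ y]) auto
  qed
qed

text \<open>For Z in gl(n) the outer corner only matters at k = 0, where it replaces the infinite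
  identity by Id_n.\<close>

definition pw :: "nat \<Rightarrow> imat \<Rightarrow> nat \<Rightarrow> imat" where
  "pw n Z k = corner n (mpow Z k)"

lemma pw_gl [simp]: "pw n Z k \<in> gl n"
  by (simp add: pw_def)

lemma corner_mone_left: "A \<in> gl n \<Longrightarrow> corner n mone \<odot> A = A"
  using corner_mmul[of n mone A] by (simp add: corner_id)

lemma corner_mone_right: "A \<in> gl n \<Longrightarrow> A \<odot> corner n mone = A"
  using corner_mmul[of n A mone] by (simp add: corner_id)

lemma pw_0: "pw n Z 0 = corner n mone"
  by (simp add: pw_def)

lemma pw_Suc: "Z \<in> gl n \<Longrightarrow> pw n Z (Suc k) = pw n Z k \<odot> Z"
  unfolding pw_def using blk_gl[of Z n n] by (simp add: corner_mmul corner_id)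

lemma mpow_Suc_gl: "Z \<in> gl n \<Longrightarrow> mpow Z (Suc k) \<in> gl n"
  by (induction k) simp_all

lemma pw_mpow_Suc: "Z \<in> gl n \<Longrightarrow> pw n Z (Suc k) = mpow Z (Suc k)"
  unfolding pw_def using mpow_Suc_gl corner_id by blast

lemma pw_comm:
  assumes "Z \<in> gl n" "A \<in> gl n" "A \<odot> Z = Z \<odot> A"
  shows "A \<odot> pw n Z k = pw n Z k \<odot> A"
proof (induction k)
  case 0
  show ?case using assms by (simp add: pw_0 corner_mone_left corner_mone_right)
next
  case (Suc k)
  have "A \<odot> pw n Z (Suc k) = (A \<odot> pw n Z k) \<odot> Z"
    using assms by (simp add: pw_Suc mmul_assoc)
  also have "\<dots> = pw n Z k \<odot> (A \<odot> Z)" using assms by (simp add: Suc mmul_assoc)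
  also have "\<dots> = pw n Z (Suc k) \<odot> A" using assms by (simp add: pw_Suc mmul_assoc)
  finally show ?case .
qed

lemma pw_Suc': "Z \<in> gl n \<Longrightarrow> pw n Z (Suc k) = Z \<odot> pw n Z k"
  by (simp add: pw_Suc pw_comm)

text \<open>Evaluation of polynomials at Z. For Z in gl(n) it is an algebra homomorphism into gl(n)
  with unit \<open>corner n mone\<close>, through which divisibility arguments on the minimal
  polynomial are run.\<close>

definition pv :: "nat \<Rightarrow> imat \<Rightarrow> complex poly \<Rightarrow> imat" where
  "pv n Z p = (\<Sum>k\<le>degree p. msmult (coeff p k) (pw n Z k))"

lemma pv_gl [simp]: "pv n Z p \<in> gl n"
  unfolding pv_def by (rule gl_sum) simp

lemma row_col_finite_pv [simp]: "row_col_finite (pv n Z p)"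
  using row_col_finite_gl pv_gl by blast

lemma row_col_finite_pw [simp]: "row_col_finite (pw n Z p)"
  using row_col_finite_gl pw_gl by blast

lemma pv_eq:
  assumes "degree p \<le> N"
  shows "pv n Z p = (\<Sum>k\<le>N. msmult (coeff p k) (pw n Z k))"
  unfolding pv_def using assms
  by (intro sum.mono_neutral_left) (auto simp: coeff_eq_0)

lemma pv_0 [simp]: "pv n Z 0 = 0"
  by (simp add: pv_def)

lemma pv_add: "pv n Z (p + q) = pv n Z p + pv n Z q"
proof -
  let ?N = "max (degree p) (degree q)"
  have "pv n Z (p + q) = (\<Sum>k\<le>?N. msmult (coeff (p + q) k) (pw n Z k))"
    by (rule pv_eq) (rule degree_add_le_max)
  also have "\<dots> = (\<Sum>k\<le>?N. msmult (coeff p k) (pw n Z k)) + (\<Sum>k\<le>?N. msmult (coeff q k) (pw n Z k))"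
    by (simp add: mat.scale_left_distrib sum.distrib)
  also have "\<dots> = pv n Z p + pv n Z q" by (simp add: pv_eq[of p ?N] pv_eq[of q ?N])
  finally show ?thesis .
qed

lemma pv_smult: "pv n Z (smult c p) = msmult c (pv n Z p)"
  by (simp add: pv_eq[of "smult c p" "degree p"] pv_eq[of p "degree p"] mat.scale_sum_right degree_smult_le)

lemma pv_pCons:
  assumes "Z \<in> gl n"
  shows "pv n Z (pCons a p) = msmult a (corner n mone) + Z \<odot> pv n Z p"
proof -
  have "pv n Z (pCons a p) = (\<Sum>k\<le>Suc (degree p). msmult (coeff (pCons a p) k) (pw n Z k))"
    by (rule pv_eq) (simp add: degree_pCons_le)
  also have "\<dots> = msmult a (corner n mone) + (\<Sum>k\<le>degree p. msmult (coeff p k) (Z \<odot> pw n Z k))"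
    using assms by (subst sum.atMost_Suc_shift) (simp add: pw_0 pw_Suc')
  also have "(\<Sum>k\<le>degree p. msmult (coeff p k) (Z \<odot> pw n Z k)) = Z \<odot> pv n Z p"
    using assms by (simp add: pv_def mmul_sum_right mmul_msmult_right)
  finally show ?thesis .
qed

lemma pv_mult:
  assumes "Z \<in> gl n"
  shows "pv n Z (p * q) = pv n Z p \<odot> pv n Z q"
proof (induction p rule: pCons_induct)
  case 0
  have "pv n Z (0 * q) = pv n Z 0 \<odot> pv n Z q" by simp
  then show ?case .
next
  case (pCons a p)
  have "row_col_finite Z" "row_col_finite (pv n Z p)" "row_col_finite (pv n Z q)" "row_col_finite (corner n mone)" using assms by simp_all
  then have "pv n Z (pCons a p * q) = pv n Z (pCons a p) \<odot> pv n Z q"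
    using assms pCons.IH
    by (simp add: mult_pCons_left pv_add pv_smult pv_pCons mmul_add_left mmul_msmult_left
        corner_mone_left mmul_assoc)
  then show ?case .
qed

lemma pv_comm:
  assumes "Z \<in> gl n" "A \<in> gl n" "A \<odot> Z = Z \<odot> A"
  shows "A \<odot> pv n Z p = pv n Z p \<odot> A"
  using assms by (simp add: pv_def mmul_sum_right mmul_sum_left mmul_msmult_left mmul_msmult_right pw_comm)

lemma pv_of_coeffs:
  obtains p where "\<And>k. coeff p k = (if k < N then x k else 0)"
    and "\<And>n Z. pv n Z p = (\<Sum>k<N. msmult (x k) (pw n Z k))"
proof -
  define p where "p = (\<Sum>k<N. monom (x k) k)"
  have c: "coeff p k = (if k < N then x k else 0)" for k
    by (simp add: p_def coeff_sum)
  have d: "degree p \<le> N" by (rule degree_le) (simp add: c)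
  have "pv n Z p = (\<Sum>k<N. msmult (x k) (pw n Z k))" for n Z
    unfolding pv_eq[OF d] by (rule sum.mono_neutral_cong_right) (auto simp: c)
  then show ?thesis using that c by blast
qed

text \<open>Non-derogatory matrices: no nonzero polynomial of degree below n kills Z. The form with
  coefficients is the one that independence of the differentials of trace powers produces.\<close>

definition reg :: "nat \<Rightarrow> imat \<Rightarrow> bool" where
  "reg n Z \<longleftrightarrow> (\<forall>x. (\<Sum>k<n. msmult (x k) (pw n Z k)) = 0 \<longrightarrow> (\<forall>k<n. x k = 0))"

lemma minimal_poly:
  assumes "Z \<in> gl n"
  obtains m where "m \<noteq> 0" "pv n Z m = 0" "\<And>q. q \<noteq> 0 \<Longrightarrow> pv n Z q = 0 \<Longrightarrow> degree m \<le> degree q"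
proof -
  \<comment> \<open>\<open>n * n\<close> entries against \<open>n * n + 1\<close> powers. The degree
    obtained here is immaterial, since an annihilating polynomial of least degree is picked at the
    end.\<close>
  let ?J = "{..<n} \<times> {..<n}" and ?I = "{..<Suc (n * n)}"
  have "finite ?J" "finite ?I" "card ?J < card ?I" by simp_all
  then obtain x where x: "\<exists>i\<in>?I. x i \<noteq> 0"
    "\<forall>j\<in>?J. (\<Sum>k\<in>?I. (\<lambda>(r, c) k. pw n Z k r c) j k * x k) = 0"
    using underdetermined[of ?J ?I "\<lambda>(r, c) k. pw n Z k r c"] by blast
  obtain p where p: "\<And>k. coeff p k = (if k < Suc (n * n) then x k else 0)"
    "\<And>n' Z. pv n' Z p = (\<Sum>k<Suc (n * n). msmult (x k) (pw n' Z k))"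
    using pv_of_coeffs by blast
  have "p \<noteq> 0" using x(1) p(1) by (metis coeff_0 lessThan_iff)
  moreover have "pv n Z p = 0"
  proof (intro ext)
    fix r c
    show "pv n Z p r c = 0 r c"
    proof (cases "r < n \<and> c < n")
      case True
      then show ?thesis using bspec[OF x(2), of "(r, c)"]
        by (simp add: p(2) imat_sum_apply mult.commute del: sum.lessThan_Suc)
    next
      case False
      then show ?thesis using gl_outside[OF pv_gl, of n r c] by auto
    qed
  qed
  ultimately have "p \<noteq> 0 \<and> pv n Z p = 0" by blast
  from ex_has_least_nat[where P="\<lambda>m. m \<noteq> 0 \<and> pv n Z m = 0" and m=degree, OF this]
  show ?thesis using that by blast
qed

text \<open>
  A vector \<open>v\<close> avoiding the kernels of \<open>(m / (x - c))(Z)\<close>, for \<open>c\<close> a root of the minimal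
  polynomial \<open>m\<close>, is cyclic; such a \<open>v\<close> is found on the moment curve \<open>(1, s, s\<^sup>2, \<dots>)\<close>.
\<close>
lemma cyclic_vector:
  assumes Z: "Z \<in> gl n" and reg: "reg n Z" and "n > 0"
  obtains v where "v \<in> gl n" "\<And>i j. j \<noteq> 0 \<Longrightarrow> v i j = 0"
    "\<And>p. p \<noteq> 0 \<Longrightarrow> degree p < n \<Longrightarrow> pv n Z p \<odot> v \<noteq> 0"
proof -
  obtain m where m: "m \<noteq> 0" "pv n Z m = 0"
    and min: "\<And>q. q \<noteq> 0 \<Longrightarrow> pv n Z q = 0 \<Longrightarrow> degree m \<le> degree q"
    using minimal_poly[OF Z] by blast
  have deg: "n \<le> degree m"
  proof (rule ccontr)
    assume "\<not> n \<le> degree m"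
    then have "pv n Z m = (\<Sum>k<n. msmult (coeff m k) (pw n Z k))"
      unfolding pv_def by (intro sum.mono_neutral_left) (auto simp: coeff_eq_0)
    then have "\<forall>k<n. coeff m k = 0" using reg m(2) by (simp add: reg_def)
    then have "coeff m (degree m) = 0" using \<open>\<not> n \<le> degree m\<close> by simp
    then show False using m(1) by simp
  qed
  define R where "R = {c. poly m c = 0}"
  have "finite R" using poly_roots_finite[OF m(1)] by (simp add: R_def)
  have "\<exists>q r. m = [:- c, 1:] * q \<and> (\<exists>l. pv n Z q r l \<noteq> 0)" if "c \<in> R" for c
  proof -
    have "[:- c, 1:] dvd m" using that by (simp add: R_def poly_eq_0_iff_dvd)
    then obtain q where q: "m = [:- c, 1:] * q" by (rule dvdE)
    with m(1) have "q \<noteq> 0" by auto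
    then have "degree m = Suc (degree q)"
      unfolding q by (subst degree_mult_eq) simp_all
    then have "pv n Z q \<noteq> 0" using min[OF \<open>q \<noteq> 0\<close>] by fastforce
    then have "\<exists>r l. pv n Z q r l \<noteq> 0" by (simp add: fun_eq_iff)
    then show ?thesis using q by blast
  qed
  then obtain mq rr where mq: "\<And>c. c \<in> R \<Longrightarrow> m = [:- c, 1:] * mq c"
    "\<And>c. c \<in> R \<Longrightarrow> \<exists>l. pv n Z (mq c) (rr c) l \<noteq> 0" by metis
  \<comment> \<open>\<open>D c\<close> at s is the entry in row \<open>rr c\<close> of m / (x - c),
    evaluated at Z and applied to the moment vector of s. Being nonzero polynomials, the
    \<open>D c\<close> exclude only finitely many s.\<close>
  define D where "D c = (\<Sum>l<n. monom (pv n Z (mq c) (rr c) l) l)" for c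
  have "D c \<noteq> 0" if cR: "c \<in> R" for c
  proof -
    obtain l where l: "pv n Z (mq c) (rr c) l \<noteq> 0" using mq(2)[OF cR] by blast
    then have "l < n" using gl_outside[OF pv_gl, of n "rr c" l] by (metis not_le)
    then have "coeff (D c) l \<noteq> 0" using l by (simp add: D_def coeff_sum)
    then show ?thesis by auto
  qed
  then have "finite (\<Union>c\<in>R. {s. poly (D c) s = 0})"
    using \<open>finite R\<close> poly_roots_finite by blast
  then obtain s where s: "\<And>c. c \<in> R \<Longrightarrow> poly (D c) s \<noteq> 0"
    using ex_new_if_finite[OF infinite_UNIV_char_0] by blast
  define v :: imat where "v = (\<lambda>i j. if i < n \<and> j = 0 then s ^ i else 0)"
  have v: "v \<in> gl n" using \<open>n > 0\<close> by (auto simp: v_def gl_def)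
  have nz: "pv n Z (mq c) \<odot> v \<noteq> 0" if "c \<in> R" for c
  proof -
    have "(pv n Z (mq c) \<odot> v) (rr c) 0 = (\<Sum>k<n. pv n Z (mq c) (rr c) k * v k 0)"
      by (rule gl_mmul_apply) simp
    also have "\<dots> = poly (D c) s"
      by (simp add: D_def poly_sum poly_monom v_def)
    finally show ?thesis using s[OF that] by auto
  qed
  have "pv n Z p \<odot> v \<noteq> 0" if "p \<noteq> 0" "degree p < n" for p
    using that
  proof (induction "degree p" arbitrary: p rule: less_induct)
    case less
    show ?case
    proof
      assume 0: "pv n Z p \<odot> v = 0"
      \<comment> \<open>The remainder kills v and has smaller degree, so by induction it is 0 and p
        divides m. As \<open>degree p < n \<le> degree m\<close>, the cofactor has a root c; then p
        divides m / (x - c), which does not kill v.\<close>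
      let ?d = "m div p" and ?r = "m mod p"
      have "pv n Z m = pv n Z ?d \<odot> pv n Z p + pv n Z ?r"
        by (metis Z pv_add pv_mult div_mult_mod_eq)
      then have "(pv n Z ?d \<odot> pv n Z p) \<odot> v + pv n Z ?r \<odot> v = 0"
        using v m(2) mmul_add_left[of v "pv n Z ?d \<odot> pv n Z p" "pv n Z ?r"] by simp
      then have r0: "pv n Z ?r \<odot> v = 0" using v 0 by (simp add: mmul_assoc)
      have "?r = 0"
      proof (rule ccontr)
        assume "?r \<noteq> 0"
        then have "degree ?r < degree p" using less.prems degree_mod_less'[of p m] by auto
        then show False using less r0 \<open>?r \<noteq> 0\<close> by auto
      qed
      then have md: "m = p * ?d" by (metis mod_0_imp_dvd dvd_mult_div_cancel)
      then have "?d \<noteq> 0" using m(1) by auto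
      then have "degree m = degree p + degree ?d" using md less.prems by (metis degree_mult_eq)
      then have "degree ?d > 0" using deg less.prems by linarith
      then obtain c where c: "poly ?d c = 0"
        using fundamental_theorem_of_algebra[of ?d] Fundamental_Theorem_Algebra.constant_degree[of ?d] by auto
      then have "[:- c, 1:] dvd ?d" by (simp add: poly_eq_0_iff_dvd)
      then obtain d' where d': "?d = [:- c, 1:] * d'" by (rule dvdE)
      have "poly m c = 0" using md c by (metis mult_zero_right poly_mult)
      then have "c \<in> R" by (simp add: R_def)
      have "[:- c, 1:] * mq c = [:- c, 1:] * (p * d')"
        using mq(1)[OF \<open>c \<in> R\<close>] md d' by (metis mult.left_commute)
      then have "mq c = d' * p" by (simp only: mult_cancel_left) (simp add: mult.commute)
      then have "pv n Z (mq c) \<odot> v = pv n Z d' \<odot> (pv n Z p \<odot> v)"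
        using Z v by (simp add: pv_mult mmul_assoc)
      then show False using nz[OF \<open>c \<in> R\<close>] 0 by simp
    qed
  qed
  with v show ?thesis using that[of v] by (simp add: v_def)
qed

text \<open>A matrix commuting with Z is determined by its value on a cyclic vector v: A v equals
  p(Z) v for some p of degree below n, and A - p(Z) kills every Z^k v, hence all vectors. Vectors
  are matrices concentrated in column 0.\<close>

lemma centralizer_regular:
  assumes Z: "Z \<in> gl n" and reg: "reg n Z" and A: "A \<in> gl n" and comm: "A \<odot> Z = Z \<odot> A"
  shows "\<exists>x. A = (\<Sum>k<n. msmult (x k) (pw n Z k))"
proof (cases "n = 0")
  case True
  then have "A = 0" using A by (auto simp: gl_def fun_eq_iff)
  with True show ?thesis by auto
next
  case False
  then obtain v where v: "v \<in> gl n" "\<And>i j. j \<noteq> 0 \<Longrightarrow> v i j = 0"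
    and cyc: "\<And>p. p \<noteq> 0 \<Longrightarrow> degree p < n \<Longrightarrow> pv n Z p \<odot> v \<noteq> 0"
    using cyclic_vector[OF Z reg] by blast
  have span: "\<exists>x. u = (\<Sum>k<n. msmult (x k) (pw n Z k)) \<odot> v"
    if u: "u \<in> gl n" "\<And>i j. j \<noteq> 0 \<Longrightarrow> u i j = 0" for u
  proof -
    \<comment> \<open>The Z^k v with k < n, together with u at index n, are n + 1 vectors of length
      n. Cyclicity forbids a relation among the Z^k v alone, so the coefficient of u is not
      0.\<close>
    obtain x where x: "\<exists>i\<in>{..<Suc n}. x i \<noteq> 0"
      "\<And>r. r < n \<Longrightarrow> (\<Sum>k<Suc n. (if k < n then (pw n Z k \<odot> v) r 0 else u r 0) * x k) = 0"
      using underdetermined[of "{..<n}" "{..<Suc n}"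
          "\<lambda>r k. if k < n then (pw n Z k \<odot> v) r 0 else u r 0"] by auto
    obtain p where p: "\<And>k. coeff p k = (if k < n then x k else 0)"
      "\<And>n' Z. pv n' Z p = (\<Sum>k<n. msmult (x k) (pw n' Z k))"
      using pv_of_coeffs by blast
    have col: "(B \<odot> w) i j = 0" if "\<And>i j. j \<noteq> 0 \<Longrightarrow> w i j = 0" "j \<noteq> 0" for B w i j
      using that by (auto intro: mmul_zeroI)
    have eq: "pv n Z p \<odot> v + msmult (x n) u = 0"
    proof (intro ext)
      fix r c
      show "(pv n Z p \<odot> v + msmult (x n) u) r c = 0 r c"
      proof (cases "c = 0 \<and> r < n")
        case True
        have "(pv n Z p \<odot> v) r 0 = (\<Sum>k<n. x k * (pw n Z k \<odot> v) r 0)"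
          using v by (simp add: p(2) mmul_sum_left mmul_msmult_left imat_sum_apply)
        then show ?thesis using x(2)[of r] True by (simp add: mult.commute)
      next
        case False
        have "(pv n Z p \<odot> v) \<in> gl n" using v by simp
        then show ?thesis using False u v(2) col[of v c "pv n Z p" r]
          by (cases "c = 0") (auto simp: gl_def)
      qed
    qed
    have "x n \<noteq> 0"
    proof
      assume "x n = 0"
      then have "\<exists>k<n. x k \<noteq> 0" using x(1) less_Suc_eq by auto
      then have "p \<noteq> 0" using p(1) by (metis coeff_0)
      have "degree p \<le> n - 1" by (rule degree_le) (auto simp: p(1))
      then have "degree p < n" using False by simp
      then show False using cyc[OF \<open>p \<noteq> 0\<close>] eq \<open>x n = 0\<close> by simp
    qed
    have "u = msmult (- 1 / x n) (pv n Z p \<odot> v)"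
    proof (intro ext)
      fix r c
      have "(pv n Z p \<odot> v) r c + x n * u r c = 0" using fun_cong[OF fun_cong[OF eq, of r], of c] by simp
      then show "u r c = msmult (- 1 / x n) (pv n Z p \<odot> v) r c"
        using \<open>x n \<noteq> 0\<close> by (simp add: field_simps eq_neg_iff_add_eq_0 add.commute)
    qed
    also have "\<dots> = (\<Sum>k<n. msmult (- 1 / x n * x k) (pw n Z k)) \<odot> v"
      using v(1) by (simp add: p(2) mmul_sum_left mmul_msmult_left mat.scale_sum_right mmul_uminus_left)
    finally show ?thesis by (intro exI[of _ "\<lambda>k. - 1 / x n * x k"])
  qed
  have "A \<odot> v \<in> gl n" using A v by simp
  moreover have "(A \<odot> v) i j = 0" if "j \<noteq> 0" for i j
    using v(2)[OF that] by (auto intro: mmul_zeroI)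
  ultimately obtain x where x: "A \<odot> v = (\<Sum>k<n. msmult (x k) (pw n Z k)) \<odot> v" using span by blast
  define P where "P = (\<Sum>k<n. msmult (x k) (pw n Z k))"
  have P: "P \<in> gl n" unfolding P_def by (rule gl_sum) simp
  have PZ: "P \<odot> Z = Z \<odot> P"
    unfolding P_def using Z pw_comm[OF Z Z]
    by (simp add: mmul_sum_left mmul_sum_right mmul_msmult_left mmul_msmult_right)
  define D where "D = A - P"
  have D: "D \<in> gl n" "D \<odot> Z = Z \<odot> D" "D \<odot> v = 0"
    using A P Z comm PZ v x by (simp_all add: D_def mmul_diff_left mmul_diff_right P_def[symmetric])
  have Dpw: "D \<odot> (pw n Z k \<odot> v) = 0" for k
  proof -
    have "D \<odot> (pw n Z k \<odot> v) = (D \<odot> pw n Z k) \<odot> v" using D v by (simp add: mmul_assoc)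
    also have "\<dots> = pw n Z k \<odot> (D \<odot> v)" using D v pw_comm[OF Z D(1,2), of k] by (simp add: mmul_assoc)
    finally have "D \<odot> (pw n Z k \<odot> v) = pw n Z k \<odot> (D \<odot> v)" .
    then show ?thesis using D by simp
  qed
  have "D r c = 0" for r c
  proof (cases "r < n \<and> c < n")
    case True
    define e :: imat where "e = (\<lambda>i j. if i = c \<and> j = 0 then 1 else 0)"
    have "e \<in> gl n" "\<And>i j. j \<noteq> 0 \<Longrightarrow> e i j = 0" using True by (auto simp: e_def gl_def)
    then obtain y where "e = (\<Sum>k<n. msmult (y k) (pw n Z k)) \<odot> v" using span by blast
    then have "D \<odot> e = 0"
      using v D by (simp add: mmul_sum_left mmul_sum_right mmul_msmult_left mmul_msmult_right Dpw)
    moreover have "(D \<odot> e) r 0 = (\<Sum>k\<in>{c}. D r k * e k 0)" by (rule mmul_sum) (auto simp: e_def)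
    ultimately show ?thesis by (simp add: e_def)
  next
    case False
    then show ?thesis using gl_outside[OF D(1), of r c] by auto
  qed
  then have "A = P" by (simp add: D_def fun_eq_iff)
  then show ?thesis unfolding P_def by blast
qed

section \<open>Power series of matrices and the exponential\<close>

lemma mpow_Suc': "row_col_finite A \<Longrightarrow> mpow A (Suc k) = A \<odot> mpow A k"
proof -
  assume A: "row_col_finite A"
  have f: "row_col_finite (mpow A k)" for k by (induction k) (simp_all add: A)
  show ?thesis
  proof (induction k)
    case (Suc k)
    have "mpow A (Suc (Suc k)) = (A \<odot> mpow A k) \<odot> A" using Suc by simp
    then show ?case using A f by (simp add: mmul_assoc)
  qed simp
qed

lemma row_col_finite_mpow [simp]: "row_col_finite A \<Longrightarrow> row_col_finite (mpow A k)"
  by (induction k) simp_all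

lemma mpow_msmult: "mpow (msmult t A) k = msmult (t ^ k) (mpow A k)"
proof (induction k)
  case 0
  have "mpow (msmult t A) 0 = msmult (t ^ 0) (mpow A 0)" by simp
  then show ?case .
next
  case (Suc k)
  have "mpow (msmult t A) (Suc k) = msmult (t ^ Suc k) (mpow A (Suc k))"
    unfolding mpow.simps Suc by (simp add: mmul_msmult_left mmul_msmult_right mult.commute)
  then show ?case .
qed

lemma mpow_commute: "row_col_finite A \<Longrightarrow> row_col_finite B \<Longrightarrow> B \<odot> A = A \<odot> B \<Longrightarrow> B \<odot> mpow A k = mpow A k \<odot> B"
proof (induction k)
  case (Suc k)
  have "B \<odot> mpow A (Suc k) = (B \<odot> mpow A k) \<odot> A" using Suc.prems by (simp add: mmul_assoc)
  also have "\<dots> = mpow A k \<odot> (B \<odot> A)" using Suc by (simp add: mmul_assoc)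
  also have "\<dots> = mpow A (Suc k) \<odot> B" using Suc.prems by (simp add: mmul_assoc)
  finally show ?case .
qed simp

section \<open>Entire power series of a finite matrix\<close>

lemma mpow_bound:
  assumes "A \<in> gl n"
  shows "\<exists>C::real. \<forall>k i j. norm (mpow A k i j) \<le> C ^ k"
proof -
  define C where "C = 1 + (\<Sum>j<n. \<Sum>l<n. norm (A l j))"
  have C: "C \<ge> 1" unfolding C_def by (simp add: sum_nonneg)
  have col: "(\<Sum>l<n. norm (A l j)) \<le> C" for j
  proof (cases "j < n")
    case True
    have "(\<Sum>l<n. norm (A l j)) \<le> (\<Sum>j<n. \<Sum>l<n. norm (A l j))"
      using True by (intro member_le_sum) (auto simp: sum_nonneg)
    then show ?thesis by (simp add: C_def)
  next
    case False
    then have "(\<Sum>l<n. norm (A l j)) = 0" using assms by (auto simp: gl_def)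
    then show ?thesis using C by simp
  qed
  have "norm (mpow A k i j) \<le> C ^ k" for k i j
  proof (induction k arbitrary: i j)
    case 0
    show ?case by (simp add: mone_def)
  next
    case (Suc k)
    have "mpow A (Suc k) i j = (\<Sum>l<n. mpow A k i l * A l j)"
      using assms by (simp add: gl_mmul_apply)
    then have "norm (mpow A (Suc k) i j) \<le> (\<Sum>l<n. norm (mpow A k i l) * norm (A l j))"
      by (simp add: sum_norm_le norm_mult)
    also have "\<dots> \<le> (\<Sum>l<n. C ^ k * norm (A l j))"
      by (intro sum_mono mult_right_mono Suc) simp
    also have "\<dots> = C ^ k * (\<Sum>l<n. norm (A l j))" by (simp add: sum_distrib_left)
    also have "\<dots> \<le> C ^ k * C" using C by (intro mult_left_mono col) simp
    finally show ?case by (simp add: mult.commute)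
  qed
  then show ?thesis by blast
qed

text \<open>General coefficients, because the series of (exp x - 1) / x is needed besides exp. The
  bound \<open>1 / fact k\<close> survives the shift \<open>c (Suc k)\<close> that leads from one to
  the other.\<close>

definition ser :: "(nat \<Rightarrow> complex) \<Rightarrow> imat \<Rightarrow> imat" where
  "ser c A = (\<lambda>i j. \<Sum>k. c k * mpow A k i j)"

definition exp_bounded :: "(nat \<Rightarrow> complex) \<Rightarrow> bool" where
  "exp_bounded c \<longleftrightarrow> (\<forall>k. norm (c k) \<le> 1 / fact k)"

lemma exp_bounded_exp [simp]: "exp_bounded (\<lambda>k. 1 / fact k)"
  by (simp add: exp_bounded_def norm_divide)

lemma exp_bounded_Suc [simp]: "exp_bounded c \<Longrightarrow> exp_bounded (\<lambda>k. c (Suc k))"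
  unfolding exp_bounded_def
proof
  fix k
  assume "\<forall>k. norm (c k) \<le> 1 / fact k"
  then have "norm (c (Suc k)) \<le> 1 / fact (Suc k)" by blast
  also have "\<dots> \<le> 1 / fact k" by (intro divide_left_mono fact_mono) simp_all
  finally show "norm (c (Suc k)) \<le> 1 / fact k" .
qed

lemma mexp_ser: "mexp A = ser (\<lambda>k. 1 / fact k) A"
  by (simp add: mexp_def ser_def)

lemma exp_bounded_summable:
  assumes "exp_bounded c" "\<And>k. norm (x k) \<le> C ^ k"
  shows "summable (\<lambda>k. norm (c k * x k))"
proof (rule summable_comparison_test')
  show "summable (\<lambda>k. inverse (fact k) * C ^ k)" by (rule summable_exp)
  fix k :: nat
  have "norm (c k) * norm (x k) \<le> (1 / fact k) * C ^ k"
    using assms by (intro mult_mono) (auto simp: exp_bounded_def)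
  then show "norm (norm (c k * x k)) \<le> inverse (fact k) * C ^ k"
    by (simp add: norm_mult divide_inverse)
qed

lemma ser_summable_norm:
  assumes "A \<in> gl n" "exp_bounded c"
  shows "summable (\<lambda>k. norm (c k * mpow A k i j))"
proof -
  obtain C :: real where C: "\<And>k i j. norm (mpow A k i j) \<le> C ^ k"
    using mpow_bound[OF assms(1)] by blast
  from C show ?thesis by (rule exp_bounded_summable[OF assms(2)])
qed

lemma ser_summable: "A \<in> gl n \<Longrightarrow> exp_bounded c \<Longrightarrow> summable (\<lambda>k. c k * mpow A k i j)"
  by (rule summable_norm_cancel[OF ser_summable_norm])

lemma ser_mmul_left:
  assumes "A \<in> gl n" "exp_bounded c" "B \<in> gl m"
  shows "(B \<odot> ser c A) i j = (\<Sum>k. c k * (B \<odot> mpow A k) i j)"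
proof -
  have "(B \<odot> ser c A) i j = (\<Sum>l<m. \<Sum>k. B i l * (c k * mpow A k l j))"
    using assms by (subst gl_mmul_apply[of B m]) (simp_all add: ser_def suminf_mult ser_summable)
  also have "\<dots> = (\<Sum>k. \<Sum>l<m. B i l * (c k * mpow A k l j))"
    using assms by (intro suminf_sum[symmetric] summable_mult ser_summable)
  also have "\<dots> = (\<Sum>k. c k * (B \<odot> mpow A k) i j)"
    using assms by (subst gl_mmul_apply[of B m]) (simp_all add: sum_distrib_left mult.left_commute)
  finally show ?thesis .
qed

lemma ser_mmul_right:
  assumes "A \<in> gl n" "exp_bounded c" "B \<in> gl m"
  shows "(ser c A \<odot> B) i j = (\<Sum>k. c k * (mpow A k \<odot> B) i j)"
proof -
  have "(ser c A \<odot> B) i j = (\<Sum>l<m. \<Sum>k. c k * mpow A k i l * B l j)"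
    using assms by (subst gl_mmul_apply[of _ m B]) (simp_all add: ser_def suminf_mult2 ser_summable)
  also have "\<dots> = (\<Sum>k. \<Sum>l<m. c k * mpow A k i l * B l j)"
    using assms by (intro suminf_sum[symmetric] summable_mult2 ser_summable)
  also have "\<dots> = (\<Sum>k. c k * (mpow A k \<odot> B) i j)"
    using assms by (subst gl_mmul_apply[of _ m B]) (simp_all add: sum_distrib_left mult.assoc)
  finally show ?thesis .
qed

lemma ser_commute:
  assumes "A \<in> gl n" "exp_bounded c" "B \<in> gl m" "B \<odot> A = A \<odot> B"
  shows "B \<odot> ser c A = ser c A \<odot> B"
proof -
  have "B \<odot> mpow A k = mpow A k \<odot> B" for k using assms mpow_commute[of A B k] by simp
  then show ?thesis using assms by (auto simp: fun_eq_iff ser_mmul_left ser_mmul_right)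
qed

lemma ser_shift:
  assumes "A \<in> gl n" "exp_bounded c"
  shows "ser c A = msmult (c 0) mone + A \<odot> ser (\<lambda>k. c (Suc k)) A"
proof (intro ext)
  fix i j
  have "ser c A i j = (\<Sum>k. c (Suc k) * mpow A (Suc k) i j) + c 0 * mpow A 0 i j"
    using suminf_split_head[OF ser_summable[OF assms, of i j]] by (simp add: ser_def)
  also have "(\<Sum>k. c (Suc k) * mpow A (Suc k) i j) = (A \<odot> ser (\<lambda>k. c (Suc k)) A) i j"
    using assms mpow_Suc'[of A] by (subst ser_mmul_left[of A n _ A n]) (simp_all del: mpow.simps(2))
  finally show "ser c A i j = (msmult (c 0) mone + A \<odot> ser (\<lambda>k. c (Suc k)) A) i j" by simp
qed

lemma blk_mpow: "A \<in> gl n \<Longrightarrow> blk n (mpow A k)"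
  using blk_gl[OF mpow_Suc_gl order_refl, of A n] by (cases k) (simp_all del: mpow.simps(2))

lemma blk_ser: "A \<in> gl n \<Longrightarrow> blk n (ser c A)"
  using blk_mpow[of A n] by (simp add: blk_def ser_def)

lemma row_col_finite_ser:
  assumes "A \<in> gl n" "exp_bounded c"
  shows "row_col_finite (ser c A)"
proof -
  have "A \<odot> ser (\<lambda>k. c (Suc k)) A \<in> gl n" by (rule gl_mmul_blk(1)[OF assms(1) blk_ser[OF assms(1)]])
  then show ?thesis using ser_shift[OF assms] by simp
qed

lemma mexp_split:
  assumes "A \<in> gl n"
  shows "mexp A = mone + A \<odot> ser (\<lambda>k. 1 / fact (Suc k)) A"
  using ser_shift[OF assms exp_bounded_exp] unfolding mexp_ser by simp

lemma mexp_Mn: "A \<in> gl n \<Longrightarrow> mexp A \<in> Mn n"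
  by (simp add: mexp_split Mn_gl gl_mmul_blk(1) blk_ser)

lemma mexp_commute:
  "A \<in> gl n \<Longrightarrow> B \<in> gl m \<Longrightarrow> B \<odot> A = A \<odot> B \<Longrightarrow> B \<odot> mexp A = mexp A \<odot> B"
  unfolding mexp_ser by (rule ser_commute) simp_all

lemma row_mpow:
  assumes "row_col_finite A" "L \<in> gl m" "L \<odot> A = msmult \<alpha> L"
  shows "L \<odot> mpow A k = msmult (\<alpha> ^ k) L"
proof (induction k)
  case (Suc k)
  have IH: "L \<odot> mpow A k = msmult (\<alpha> ^ k) L" using Suc .
  have "L \<odot> mpow A (Suc k) = (L \<odot> mpow A k) \<odot> A" using assms by (simp add: mmul_assoc)
  then have "L \<odot> mpow A (Suc k) = msmult (\<alpha> ^ Suc k) L"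
    unfolding IH mmul_msmult_left assms(3) by (simp add: mult.commute)
  then show ?case .
qed simp

text \<open>A left eigenvector of A is one of every such series, with the scalar series as
  eigenvalue. This reduces matrix equations to scalar ones in \<open>mexp_surj\<close>.\<close>

lemma row_ser:
  assumes "A \<in> gl n" "exp_bounded c" "L \<in> gl m" "L \<odot> A = msmult \<alpha> L"
  shows "L \<odot> ser c A = msmult (\<Sum>k. c k * \<alpha> ^ k) L"
proof (intro ext)
  fix i j
  have "summable (\<lambda>k. norm (c k * \<alpha> ^ k))"
    by (rule exp_bounded_summable[OF assms(2), of _ "norm \<alpha>"]) (simp add: norm_power)
  then have s: "summable (\<lambda>k. c k * \<alpha> ^ k)" by (rule summable_norm_cancel)
  have "(L \<odot> ser c A) i j = (\<Sum>k. c k * \<alpha> ^ k * L i j)"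
    using assms row_mpow[of A L m \<alpha>] by (simp add: ser_mmul_left mult.assoc)
  then show "(L \<odot> ser c A) i j = msmult (\<Sum>k. c k * \<alpha> ^ k) L i j"
    using s by (simp add: suminf_mult2)
qed

lemma suminf_exp: "(\<Sum>k. 1 / fact k * \<alpha> ^ k) = exp (\<alpha> :: complex)"
  by (simp add: exp_def scaleR_conv_of_real divide_inverse)

lemma suminf_phi:
  fixes x :: complex
  shows "x * (\<Sum>k. 1 / fact (Suc k) * x ^ k) = exp x - 1"
proof -
  have "summable (\<lambda>k. 1 / fact (Suc k) * x ^ k)"
    by (rule summable_norm_cancel, rule exp_bounded_summable[OF exp_bounded_Suc[OF exp_bounded_exp],
        of "\<lambda>k. x ^ k" "norm x"]) (simp add: norm_power)
  then have "x * (\<Sum>k. 1 / fact (Suc k) * x ^ k) = (\<Sum>k. 1 / fact (Suc k) * x ^ Suc k)"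
    by (simp add: suminf_mult[symmetric] mult.left_commute del: fact_Suc)
  also have "\<dots> = (\<Sum>k. 1 / fact k * x ^ k) - 1 / fact 0 * x ^ 0"
    by (rule suminf_split_head, rule summable_norm_cancel,
        rule exp_bounded_summable[OF exp_bounded_exp, of "\<lambda>k. x ^ k" "norm x"]) (simp add: norm_power)
  finally show ?thesis unfolding suminf_exp by simp
qed

text \<open>The binomial theorem for the divided powers \<open>S A k\<close>. The recursion (k + 1)
  S_(k+1) = A S_k and the splitting k + 1 = i + (k + 1 - i) avoid binomial coefficients.\<close>

lemma mpow_add_fact:
  assumes "A \<in> gl n" "B \<in> gl n" "A \<odot> B = B \<odot> A"
  defines "S \<equiv> \<lambda>A k. msmult (1 / fact k) (mpow A k)"
  shows "S (A + B) k = (\<Sum>i\<le>k. S A i \<odot> S B (k - i))"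
proof (induction k)
  case 0
  have "S (A + B) 0 = (\<Sum>i\<le>0. S A i \<odot> S B (0 - i))" by (simp add: S_def)
  then show ?case .
next
  case (Suc k)
  have f: "row_col_finite A" "row_col_finite B" using assms by simp_all
  have fS: "row_col_finite (S C i)" if "row_col_finite C" for C i using that by (simp add: S_def)
  have S_Suc: "msmult (of_nat (Suc i)) (S C (Suc i)) = C \<odot> S C i" if "row_col_finite C" for C i
    using that mpow_Suc'[OF that, of i] 
    by (simp add: S_def mmul_msmult_right del: mpow.simps(2) of_nat_Suc)
  have comm: "B \<odot> S A i = S A i \<odot> B" for i
    using assms f by (simp add: S_def mmul_msmult_right mmul_msmult_left mpow_commute)
  let ?T = "\<lambda>i. S A i \<odot> S B (Suc k - i)"
  have 1: "(\<Sum>i\<le>k. A \<odot> (S A i \<odot> S B (k - i))) = (\<Sum>i\<le>Suc k. msmult (of_nat i) (?T i))"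
    by (subst sum.atMost_Suc_shift)
      (simp add: mmul_assoc[symmetric] f fS S_Suc[symmetric] mmul_msmult_left del: of_nat_Suc)
  have 2: "(\<Sum>i\<le>k. B \<odot> (S A i \<odot> S B (k - i))) = (\<Sum>i\<le>Suc k. msmult (of_nat (Suc k - i)) (?T i))"
  proof -
    have "B \<odot> (S A i \<odot> S B (k - i)) = msmult (of_nat (Suc k - i)) (?T i)" if "i \<le> k" for i
    proof -
      have "B \<odot> (S A i \<odot> S B (k - i)) = S A i \<odot> (B \<odot> S B (k - i))"
        using f fS by (simp add: mmul_assoc[symmetric] comm)
      also have "\<dots> = msmult (of_nat (Suc (k - i))) (S A i \<odot> S B (Suc (k - i)))"
        using f by (simp add: S_Suc[symmetric] mmul_msmult_right del: of_nat_Suc)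
      finally show ?thesis using that by (simp add: Suc_diff_le del: of_nat_Suc)
    qed
    then show ?thesis by simp
  qed
  have "msmult (of_nat (Suc k)) (S (A + B) (Suc k)) = (A + B) \<odot> S (A + B) k"
    using f by (simp add: S_Suc del: of_nat_Suc)
  also have "\<dots> = (\<Sum>i\<le>k. A \<odot> (S A i \<odot> S B (k - i))) + (\<Sum>i\<le>k. B \<odot> (S A i \<odot> S B (k - i)))"
    using f fS unfolding Suc by (simp add: mmul_add_left mmul_sum_right sum.distrib)
  also have "\<dots> = (\<Sum>i\<le>Suc k. msmult (of_nat i) (?T i) + msmult (of_nat (Suc k - i)) (?T i))"
    unfolding 1 2 by (rule sum.distrib[symmetric])
  also have "\<dots> = (\<Sum>i\<le>Suc k. msmult (of_nat (Suc k)) (?T i))"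
    by (intro sum.cong refl) (simp add: mat.scale_left_distrib[symmetric] of_nat_add[symmetric] del: of_nat_add of_nat_Suc)
  also have "\<dots> = msmult (of_nat (Suc k)) (\<Sum>i\<le>Suc k. ?T i)"
    by (simp only: mat.scale_sum_right)
  finally have "S (A + B) (Suc k) = (\<Sum>i\<le>Suc k. ?T i)"
    unfolding mat.scale_cancel_left by (simp del: of_nat_Suc)
  then show ?case .
qed

lemma mexp_add:
  assumes "A \<in> gl n" "B \<in> gl n" "A \<odot> B = B \<odot> A"
  shows "mexp (A + B) = mexp A \<odot> mexp B"
proof (intro ext)
  fix i j
  define S where "S = (\<lambda>A k. msmult (1 / fact k) (mpow A k))"
  \<comment> \<open>Row i of a power of A lives in the first n columns, apart from the diagonal
    entry of the identity when i \<ge> n.\<close>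
  define K where "K = {..<max n (Suc i)}"
  have mS: "mexp C i j = (\<Sum>k. S C k i j)" for C i j by (simp add: mexp_def S_def)
  have sn: "summable (\<lambda>k. norm (S C k i j))" if "C \<in> gl n" for C i j
    using ser_summable_norm[OF that exp_bounded_exp, of i j] by (simp add: S_def norm_mult)
  have rowA: "S A k i l = 0" if "l \<notin> K" for k l
    using that blk_mpow[OF assms(1), of k] mpow_Suc_gl[OF assms(1)]
    by (cases k) (auto simp: S_def K_def gl_def mone_def)
  have row: "mexp A i l = 0" if "l \<notin> K" for l using rowA[OF that] by (simp add: mS)
  have "(mexp A \<odot> mexp B) i j = (\<Sum>l\<in>K. mexp A i l * mexp B l j)"
    by (rule mmul_sum) (use row in \<open>auto simp: K_def\<close>)
  also have "\<dots> = (\<Sum>l\<in>K. \<Sum>k. \<Sum>m\<le>k. S A m i l * S B (k - m) l j)"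
    using assms by (simp add: mS Cauchy_product sn)
  also have "\<dots> = (\<Sum>k. \<Sum>l\<in>K. \<Sum>m\<le>k. S A m i l * S B (k - m) l j)"
    by (rule suminf_sum[symmetric], rule summable_Cauchy_product) (use assms sn in auto)
  also have "\<dots> = (\<Sum>k. S (A + B) k i j)"
  proof (intro arg_cong[where f=suminf] ext)
    fix k
    have "(S A m \<odot> S B (k - m)) i j = (\<Sum>l\<in>K. S A m i l * S B (k - m) l j)" for m
      by (rule mmul_sum) (use rowA in \<open>auto simp: K_def\<close>)
    then show "(\<Sum>l\<in>K. \<Sum>m\<le>k. S A m i l * S B (k - m) l j) = S (A + B) k i j"
      using mpow_add_fact[OF assms, of k] by (subst sum.swap) (simp add: S_def imat_sum_apply)
  qed
  finally show "mexp (A + B) i j = (mexp A \<odot> mexp B) i j" by (simp add: mS)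
qed

lemma mexp_0 [simp]: "mexp 0 = mone"
  using mexp_split[OF gl_zero] by simp

lemma mexp_minus:
  assumes "A \<in> gl n"
  shows "mexp A \<odot> mexp (- A) = mone"
proof -
  have "A \<odot> (- A) = (- A) \<odot> A" by (simp add: mmul_uminus_left mmul_uminus_right)
  then show ?thesis using mexp_add[of A n "- A"] assms by simp
qed

lemma mexp_GL:
  assumes "A \<in> gl n"
  shows "mexp A \<in> GL n" "minv (mexp A) = mexp (- A)"
  using GL_I[of "mexp A" n "mexp (- A)"] mexp_minus[of A n] mexp_minus[of "- A" n] assms mexp_Mn
  by simp_all

lemma mexp_line_has_derivative:
  assumes "A \<in> gl n"
  shows "\<exists>D. ((\<lambda>t. mexp (msmult t A) i j) has_field_derivative D) (at x)"
    and "((\<lambda>t. mexp (msmult t A) i j) has_field_derivative A i j) (at 0)"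
proof -
  define c where "c = (\<lambda>k. mpow A k i j / fact k)"
  have eq: "(\<lambda>t. mexp (msmult t A) i j) = (\<lambda>t. \<Sum>k. c k * t ^ k)"
    by (simp add: mexp_def mpow_msmult c_def mult.commute)
  have s: "summable (\<lambda>k. c k * t ^ k)" for t
    using ser_summable[of "msmult t A" n "\<lambda>k. 1 / fact k" i j] assms
    by (simp add: mpow_msmult c_def mult.commute)
  have d: "((\<lambda>t. \<Sum>k. c k * t ^ k) has_field_derivative (\<Sum>k. diffs c k * x ^ k)) (at x)" for x
    by (rule termdiffs_strong_converges_everywhere[OF s])
  show "\<exists>D. ((\<lambda>t. mexp (msmult t A) i j) has_field_derivative D) (at x)"
    unfolding eq using d by blast
  have "(\<Sum>k. diffs c k * 0 ^ k) = A i j"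
    by (subst powser_zero) (simp add: diffs_def c_def)
  then show "((\<lambda>t. mexp (msmult t A) i j) has_field_derivative A i j) (at 0)"
    unfolding eq using d[of 0] by simp
qed


section \<open>Logarithms in the centralizer of a regular matrix\<close>

lemma pv_1: "pv n Z 1 = corner n mone"
  using pv_eq[of 1 0 n Z] by (simp add: pw_0)

lemma pv_const: "pv n Z [:u:] = msmult u (corner n mone)"
  using pv_eq[of "[:u:]" 0 n Z] by (simp add: pw_0)

lemma pv_commutes_Z: "Z \<in> gl n \<Longrightarrow> pv n Z p \<odot> Z = Z \<odot> pv n Z p"
  by (rule pv_comm[symmetric]) simp_all

text \<open>
  The exponential is onto the units of \<open>\<complex>[Z]\<close>: modulo larger and larger
  factors \<open>f(Z)\<close> of the minimal polynomial, \<open>g\<close> is an exponential; passing from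
  \<open>f\<close> to \<open>f \<cdot> (x - c)\<close> amounts to solving a scalar equation at the eigenvalue \<open>c\<close>.
\<close>
lemma mexp_surj:
  assumes Z: "Z \<in> gl n" and reg: "reg n Z" and g: "g \<in> GL n" and comm: "g \<odot> Z = Z \<odot> g"
  shows "\<exists>a\<in>gl n. a \<odot> Z = Z \<odot> a \<and> mexp a = g"
proof -
  have poly: "\<exists>p. r = pv n Z p" if rZ: "r \<in> gl n" "r \<odot> Z = Z \<odot> r" for r
  proof -
    obtain x where x: "r = (\<Sum>k<n. msmult (x k) (pw n Z k))"
      using centralizer_regular[OF Z reg rZ] by (elim exE)
    obtain p where "\<And>k. coeff p k = (if k < n then x k else 0)"
      "\<And>n' Z. pv n' Z p = (\<Sum>k<n. msmult (x k) (pw n' Z k))"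
      using pv_of_coeffs by blast
    then have "r = pv n Z p" by (simp add: x)
    then show ?thesis by blast
  qed
  have g1: "g - mone \<in> gl n" using g GL_Mn Mn_iff by simp
  obtain pg where pg: "g - mone = pv n Z pg"
    using poly[OF g1] comm Z g by (auto simp: mmul_diff_left mmul_diff_right)
  obtain m where m: "m \<noteq> 0" "pv n Z m = 0"
    and min: "\<And>q. q \<noteq> 0 \<Longrightarrow> pv n Z q = 0 \<Longrightarrow> degree m \<le> degree q"
    using minimal_poly[OF Z] by metis
  have step: "\<exists>f d pa ph. m = f * d \<and> degree f = k \<and> g - mexp (pv n Z pa) = pv n Z f \<odot> pv n Z ph"
    if "k \<le> degree m" for k
    using that
  proof (induction k)
    case 0
    have "m = 1 * m \<and> degree (1 :: complex poly) = 0 \<and> g - mexp (pv n Z 0) = pv n Z 1 \<odot> pv n Z pg"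
      using pg[symmetric] g1 by (simp add: pv_1 corner_mone_left)
    then show ?case by blast
  next
    case (Suc k)
    from Suc.IH[OF Suc_leD[OF Suc.prems]] obtain f d pa ph where IH: "m = f * d" "degree f = k"
      "g - mexp (pv n Z pa) = pv n Z f \<odot> pv n Z ph" by blast
    have nz: "f \<noteq> 0" "d \<noteq> 0" using IH(1) m(1) by auto
    then have "degree m = degree f + degree d" unfolding IH(1) by (rule degree_mult_eq)
    then have "degree d > 0" using IH(2) Suc.prems by linarith
    then obtain c where "poly d c = 0"
      using fundamental_theorem_of_algebra[of d] Fundamental_Theorem_Algebra.constant_degree[of d] by auto
    then have "[:- c, 1:] dvd d" by (simp add: poly_eq_0_iff_dvd)
    then obtain d' where d': "d = [:- c, 1:] * d'" by (rule dvdE)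
    define mq where "mq = f * d'"
    have mq: "m = [:- c, 1:] * mq" unfolding IH(1) d' mq_def by (rule mult.left_commute)
    have mq0: "mq \<noteq> 0" using mq m(1) by auto
    then have "degree m = Suc (degree mq)" unfolding mq by (subst degree_mult_eq) simp_all
    then have "pv n Z mq \<noteq> 0" using min[OF mq0] by fastforce
    then obtain r l where rl: "pv n Z mq r l \<noteq> 0" by (auto simp: fun_eq_iff)
    then have rn: "r < n" using gl_outside[OF pv_gl, of n r l] by (metis not_le)
    \<comment> \<open>A nonzero row of (m / (x - c))(Z), moved to row 0. Since that matrix times Z -
      c is m(Z) = 0, the row is a left eigenvector of Z for c, and polynomials in Z act on it by
      their values at c.\<close>
    define L :: imat where "L = (\<lambda>i j. if i = 0 then pv n Z mq r j else 0)"
    have L: "L \<in> gl n"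
      using rn gl_outside[OF pv_gl[of n Z mq]] by (auto simp: L_def gl_def)
    have "L 0 l \<noteq> 0" using rl by (simp add: L_def)
    then have L0: "L \<noteq> 0" by auto
    have LB: "(L \<odot> B) i j = (if i = 0 then (pv n Z mq \<odot> B) r j else 0)" for B i j
    proof (cases "i = 0")
      case True
      then show ?thesis
        using gl_mmul_apply[of L n B 0 j] gl_mmul_apply[of "pv n Z mq" n B r j] L by (simp add: L_def)
    qed (auto simp: L_def intro: mmul_zeroI)
    have "pv n Z mq \<odot> pv n Z [:- c, 1:] = 0"
      using m(2) Z unfolding mq by (simp add: pv_mult[symmetric] mult.commute)
    then have Lc: "L \<odot> pv n Z [:- c, 1:] = 0" by (intro ext) (simp add: LB)
    have Lpv: "L \<odot> pv n Z p = msmult (poly p c) L" for p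
    proof -
      have "p = [:- c, 1:] * synthetic_div p c + [:poly p c:]"
        using synthetic_div_correct'[of c p] by (simp add: algebra_simps)
      then have "pv n Z p = pv n Z [:- c, 1:] \<odot> pv n Z (synthetic_div p c) + msmult (poly p c) (corner n mone)"
        using Z by (metis pv_add pv_mult pv_const)
      then have "L \<odot> pv n Z p = (L \<odot> pv n Z [:- c, 1:]) \<odot> pv n Z (synthetic_div p c) + msmult (poly p c) L"
        using L by (simp add: mmul_add_right mmul_assoc mmul_msmult_right corner_mone_right)
      then show ?thesis by (simp add: Lc)
    qed
    let ?a = "pv n Z pa" and ?F = "pv n Z f" and ?h = "pv n Z ph"
    define \<alpha> \<mu> \<eta> \<gamma> where "\<alpha> = poly pa c" and "\<mu> = poly f c" and "\<eta> = poly ph c" and "\<gamma> = 1 + poly pg c"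
    have Lexp: "L \<odot> mexp ?a = msmult (exp \<alpha>) L"
      unfolding mexp_ser suminf_exp[symmetric] \<alpha>_def
      by (rule row_ser[OF pv_gl exp_bounded_exp L Lpv])
    have "g = mone + pv n Z pg" using pg by (simp add: algebra_simps)
    then have Lg: "L \<odot> g = msmult \<gamma> L"
      using L by (simp add: mmul_add_right Lpv \<gamma>_def mat.scale_left_distrib)
    have "\<gamma> \<noteq> 0"
    proof
      assume "\<gamma> = 0"
      then have "(L \<odot> g) \<odot> minv g = 0" by (simp add: Lg)
      then show False using L0 g GL_GL_inf by simp
    qed
    have scale: "u = v" if "msmult u L = msmult v L" for u v
      using that L0 by (simp add: mat.scale_right_imp_eq[OF L0])
    have rel: "\<gamma> - exp \<alpha> = \<mu> * \<eta>"
    proof (rule scale)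
      have "L \<odot> (g - mexp ?a) = msmult (\<gamma> - exp \<alpha>) L"
        using L by (simp add: mmul_diff_right Lg Lexp mat.scale_left_diff_distrib)
      moreover have "L \<odot> (?F \<odot> ?h) = msmult (\<mu> * \<eta>) L"
        using L by (simp add: mmul_assoc[symmetric] Lpv mmul_msmult_left \<mu>_def \<eta>_def)
      ultimately show "msmult (\<gamma> - exp \<alpha>) L = msmult (\<mu> * \<eta>) L" using IH(3) by metis
    qed
    define \<phi> where "\<phi> = (\<lambda>x::complex. \<Sum>k. 1 / fact (Suc k) * x ^ k)"
    have \<phi>: "x * \<phi> x = exp x - 1" for x unfolding \<phi>_def by (rule suminf_phi)
    have \<phi>0: "\<phi> 0 = 1"
      unfolding \<phi>_def using powser_zero[of "\<lambda>k. 1 / fact (Suc k) :: complex"] by simp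
    \<comment> \<open>The exponent is going to change by e f(Z), and the equation says that the new
      cofactor vanishes at c. It is linear in e when f(c) = 0; otherwise a logarithm solves it,
      which exists because the eigenvalue \<gamma> of the invertible g is not 0.\<close>
    obtain e where e: "\<eta> = e * exp \<alpha> * \<phi> (e * \<mu>)"
    proof (cases "\<mu> = 0")
      case True
      then show ?thesis using that[of "\<eta> / exp \<alpha>"] \<phi>0 by simp
    next
      case False
      define e where "e = Ln (\<gamma> / exp \<alpha>) / \<mu>"
      have "exp (e * \<mu>) = \<gamma> / exp \<alpha>" using False \<open>\<gamma> \<noteq> 0\<close> by (simp add: e_def)
      then have "\<mu> * \<eta> = exp \<alpha> * (exp (e * \<mu>) - 1)" using rel by (simp add: right_diff_distrib)
      also have "\<dots> = \<mu> * (e * exp \<alpha> * \<phi> (e * \<mu>))" by (simp add: \<phi>[symmetric])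
      finally have "\<eta> = e * exp \<alpha> * \<phi> (e * \<mu>)" using False by simp
      then show ?thesis by (rule that)
    qed
    define G where "G = msmult e ?F"
    have G: "G \<in> gl n" "G = pv n Z (smult e f)" by (simp_all add: G_def pv_smult)
    define \<Phi> where "\<Phi> = ser (\<lambda>k. 1 / fact (Suc k)) G"
    have eb: "exp_bounded (\<lambda>k. 1 / fact (Suc k))" by (rule exp_bounded_Suc[OF exp_bounded_exp])
    have \<Phi>: "blk n \<Phi>" "row_col_finite \<Phi>" "\<Phi> \<odot> Z = Z \<odot> \<Phi>"
      unfolding \<Phi>_def
      using blk_ser[OF G(1)] row_col_finite_ser[OF G(1) eb] ser_commute[OF G(1) eb Z] pv_commutes_Z[OF Z, of "smult e f"] G(2)
      by simp_all
    define E where "E = mexp ?a"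
    have E: "E \<in> Mn n" "row_col_finite E" "blk n E" "E \<odot> Z = Z \<odot> E" "E \<odot> ?F = ?F \<odot> E"
      unfolding E_def
      using mexp_Mn[OF pv_gl, of n Z pa] blk_Mn[OF mexp_Mn[OF pv_gl], of n n Z pa]
        mexp_commute[OF pv_gl Z pv_commutes_Z[OF Z, symmetric]]
        mexp_commute[OF pv_gl pv_gl pv_comm[OF Z pv_gl pv_commutes_Z[OF Z]]]
      by simp_all
    have LPhi: "L \<odot> \<Phi> = msmult (\<phi> (e * \<mu>)) L"
      unfolding \<Phi>_def \<phi>_def
      by (rule row_ser[OF G(1) eb L]) (simp add: G_def mmul_msmult_right Lpv \<mu>_def)
    \<comment> \<open>The new cofactor: g - exp(a + e f(Z)) = f(Z) r'. The corner removes the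
      identity of \<open>E \<odot> \<Phi>\<close> outside the n-block, which multiplication by f(Z)
      does not see. From L r' = 0 the factor x - c splits off r'.\<close>
    define r' where "r' = ?h - msmult e (corner n (E \<odot> \<Phi>))"
    have bEP: "blk n (E \<odot> \<Phi>)"
      unfolding blk_def
    proof (intro allI impI)
      fix i j assume "(i < n) \<noteq> (j < n)"
      then show "(E \<odot> \<Phi>) i j = 0"
        using E(3) \<Phi>(1) by (intro mmul_zeroI) (auto simp: blk_def)
    qed
    have EPZ: "(E \<odot> \<Phi>) \<odot> Z = Z \<odot> (E \<odot> \<Phi>)"
    proof -
      have "(E \<odot> \<Phi>) \<odot> Z = E \<odot> (Z \<odot> \<Phi>)" using E \<Phi> Z by (simp add: mmul_assoc)
      also have "\<dots> = (Z \<odot> E) \<odot> \<Phi>" using E \<Phi> Z by (simp add: mmul_assoc[symmetric])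
      finally show ?thesis using E \<Phi> Z by (simp add: mmul_assoc)
    qed
    have bZ: "blk n Z" using blk_gl[OF Z] by simp
    have "corner n ((E \<odot> \<Phi>) \<odot> Z) = corner n (Z \<odot> (E \<odot> \<Phi>))" using EPZ by simp
    then have "corner n (E \<odot> \<Phi>) \<odot> Z = Z \<odot> corner n (E \<odot> \<Phi>)"
      using Z bZ by (simp only: corner_mmul[OF disjI1[OF bZ]] corner_mmul[OF disjI2[OF bZ]] corner_id[OF Z])
    then have "r' \<in> gl n" "r' \<odot> Z = Z \<odot> r'"
      using Z pv_commutes_Z[OF Z]
      by (simp_all add: r'_def mmul_diff_left mmul_diff_right mmul_msmult_left mmul_msmult_right)
    then obtain pr where pr: "r' = pv n Z pr" using poly by blast
    have corner_left: "B \<odot> corner n W = B \<odot> W" if "B \<in> gl n" "blk n W" for B W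
    proof -
      have "B \<odot> W = corner n (B \<odot> W)" using gl_mmul_blk(1)[OF that] by (simp add: corner_id)
      also have "\<dots> = B \<odot> corner n W" using that by (simp add: corner_mmul corner_id)
      finally show ?thesis ..
    qed
    have "L \<odot> corner n (E \<odot> \<Phi>) = (L \<odot> E) \<odot> \<Phi>"
      using corner_left[OF L bEP] L E \<Phi> by (simp add: mmul_assoc)
    also have "\<dots> = msmult (exp \<alpha> * \<phi> (e * \<mu>)) L"
      using Lexp by (simp add: E_def mmul_msmult_left LPhi)
    finally have "L \<odot> r' = msmult (\<eta> - e * (exp \<alpha> * \<phi> (e * \<mu>))) L"
      using L by (simp add: r'_def mmul_diff_right mmul_msmult_right Lpv \<eta>_def mat.scale_left_diff_distrib)
    then have "msmult (poly pr c) L = msmult 0 L"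
      using e by (simp add: pr Lpv mult.assoc)
    then have "poly pr c = 0" by (rule scale)
    then have "[:- c, 1:] dvd pr" by (simp add: poly_eq_0_iff_dvd)
    then obtain q where q: "pr = [:- c, 1:] * q" by (rule dvdE)
    let ?a' = "pv n Z (pa + smult e f)"
    have "?a \<odot> G = G \<odot> ?a"
      unfolding G(2) by (rule pv_comm[OF Z pv_gl pv_commutes_Z[OF Z]])
    then have "mexp ?a' = E \<odot> mexp G"
      unfolding E_def using mexp_add[OF pv_gl G(1), of Z pa] by (simp add: pv_add G(2))
    also have "\<dots> = E + E \<odot> (G \<odot> \<Phi>)"
      unfolding mexp_split[OF G(1)] \<Phi>_def[symmetric] using E(2) by (simp add: mmul_add_right)
    also have "E \<odot> (G \<odot> \<Phi>) = (E \<odot> ?F) \<odot> msmult e \<Phi>"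
      using E(2) \<Phi>(2) by (simp add: G_def mmul_assoc mmul_msmult_left mmul_msmult_right)
    also have "\<dots> = ?F \<odot> msmult e (E \<odot> \<Phi>)"
      using E \<Phi> by (simp add: mmul_assoc mmul_msmult_right)
    also have "\<dots> = ?F \<odot> msmult e (corner n (E \<odot> \<Phi>))"
      using corner_left[OF pv_gl bEP] by (simp add: mmul_msmult_right)
    finally have ma: "mexp ?a' = E + ?F \<odot> msmult e (corner n (E \<odot> \<Phi>))" .
    have "g - mexp ?a' = (g - E) - ?F \<odot> msmult e (corner n (E \<odot> \<Phi>))"
      unfolding ma by (simp add: algebra_simps)
    also have "\<dots> = ?F \<odot> r'"
      using IH(3) by (simp add: E_def r'_def mmul_diff_right)
    also have "\<dots> = pv n Z (f * [:- c, 1:]) \<odot> pv n Z q"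
      unfolding pr q using Z by (simp add: pv_mult mmul_assoc del: mult_pCons_left mult_pCons_right)
    finally have "g - mexp ?a' = pv n Z (f * [:- c, 1:]) \<odot> pv n Z q" .
    moreover have "m = (f * [:- c, 1:]) * d'" unfolding IH(1) d' by (rule mult.assoc[symmetric])
    moreover have "degree (f * [:- c, 1:]) = Suc k"
      using nz IH(2) by (subst degree_mult_eq) simp_all
    ultimately show ?case by blast
  qed
  from step[OF order_refl] obtain f d pa ph where fd: "m = f * d" "degree f = degree m"
      "g - mexp (pv n Z pa) = pv n Z f \<odot> pv n Z ph" by blast
  have nz: "f \<noteq> 0" "d \<noteq> 0" using fd(1) m(1) by auto
  then have "degree m = degree f + degree d" unfolding fd(1) by (rule degree_mult_eq)
  \<comment> \<open>At full degree the complementary factor d is a nonzero constant, so f(Z) = 0 and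
    the error term disappears.\<close>
  then obtain u where u: "d = [:u:]" using fd(2) degree_eq_zeroE[of d] by auto
  then have "msmult u (pv n Z f) = 0" using m(2) fd(1) by (simp add: pv_smult)
  then have "pv n Z f = 0" using u nz by simp
  then have "mexp (pv n Z pa) = g" using fd(3) by simp
  then show ?thesis using pv_commutes_Z[OF Z] pv_gl by blast
qed

section \<open>Centralizers of the corners and products of centralizer groups\<close>

definition Cent :: "nat \<Rightarrow> imat \<Rightarrow> imat set" where
  "Cent n Y = {A \<in> gl n. A \<odot> corner n Y = corner n Y \<odot> A}"

definition cent_grp :: "nat \<Rightarrow> imat \<Rightarrow> imat set" where
  "cent_grp n Y = {g \<in> GL n. g \<odot> corner n Y = corner n Y \<odot> g}"

text \<open>Equivalent to \<open>strongly_regular\<close>, but without differentials.\<close>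
definition strong_reg :: "imat \<Rightarrow> bool" where
  "strong_reg Y \<longleftrightarrow> (\<forall>n. reg n (corner n Y)) \<and> (\<forall>n. \<forall>A\<in>Cent n Y. A \<in> Cent (Suc n) Y \<longrightarrow> A = 0)"

lemma CentD: "A \<in> Cent n Y \<Longrightarrow> A \<in> gl n" "A \<in> Cent n Y \<Longrightarrow> A \<odot> corner n Y = corner n Y \<odot> A"
  by (simp_all add: Cent_def)

lemma cent_grpD: "g \<in> cent_grp n Y \<Longrightarrow> g \<in> GL n" "g \<in> cent_grp n Y \<Longrightarrow> g \<odot> corner n Y = corner n Y \<odot> g"
  by (simp_all add: cent_grp_def)

lemma strong_reg_reg: "strong_reg Y \<Longrightarrow> reg n (corner n Y)" by (simp add: strong_reg_def)

lemma Cent_zero [simp]: "0 \<in> Cent n Y" by (simp add: Cent_def)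

lemma Cent_add: "A \<in> Cent n Y \<Longrightarrow> B \<in> Cent n Y \<Longrightarrow> A + B \<in> Cent n Y"
  by (simp add: Cent_def mmul_add_left mmul_add_right)

lemma Cent_diff: "A \<in> Cent n Y \<Longrightarrow> B \<in> Cent n Y \<Longrightarrow> A - B \<in> Cent n Y"
  by (simp add: Cent_def mmul_diff_left mmul_diff_right)

lemma Cent_msmult: "A \<in> Cent n Y \<Longrightarrow> msmult c A \<in> Cent n Y"
  by (simp add: Cent_def mmul_msmult_left mmul_msmult_right)

lemma Cent_sum:
  fixes F :: "'a \<Rightarrow> imat"
  assumes "\<And>x. x \<in> I \<Longrightarrow> F x \<in> Cent n Y"
  shows "(\<Sum>x\<in>I. F x) \<in> Cent n Y"
  using assms by (induction I rule: infinite_finite_induct) (simp_all add: Cent_add)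

lemma pw_Cent: "pw n (corner n Y) k \<in> Cent n Y"
  unfolding Cent_def using pw_comm[of "corner n Y" n "corner n Y" k] by simp

lemma Cent_expand:
  assumes "strong_reg Y" "A \<in> Cent n Y"
  shows "\<exists>x. A = (\<Sum>k<n. msmult (x k) (pw n (corner n Y) k))"
  by (rule centralizer_regular[OF corner_gl strong_reg_reg[OF assms(1)] CentD[OF assms(2)]])

lemma Cent_commute:
  assumes "strong_reg Y" "A \<in> Cent n Y" "B \<in> Cent n Y"
  shows "A \<odot> B = B \<odot> A"
proof -
  obtain x where "A = (\<Sum>k<n. msmult (x k) (pw n (corner n Y) k))"
    using Cent_expand[OF assms(1,2)] by (elim exE)
  moreover have "B \<odot> pw n (corner n Y) k = pw n (corner n Y) k \<odot> B" for k
    using pw_comm CentD assms(3) by simp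
  ultimately show ?thesis using CentD(1)[OF assms(3)]
    by (simp add: mmul_sum_left mmul_sum_right mmul_msmult_left mmul_msmult_right)
qed

lemma Cent_down:
  assumes "A \<in> Cent m Y" "A \<in> gl n" "n \<le> m"
  shows "A \<in> Cent n Y"
proof -
  have b: "blk n A" using blk_gl assms(2) by blast
  have "corner n (A \<odot> corner m Y) = corner n (corner m Y \<odot> A)" using CentD(2)[OF assms(1)] by simp
  then have "A \<odot> corner n Y = corner n Y \<odot> A"
    using b assms by (simp add: corner_mmul corner_id min_def)
  with assms(2) show ?thesis by (simp add: Cent_def)
qed

text \<open>Commuting with the larger corner restricts to commuting with the smaller one once A lies
  in gl(n), so A lies in two neighbouring centralizers. Strong regularity is mostly applied in this
  form.\<close>

lemma strong_reg_zero:
  assumes "strong_reg Y" "A \<in> Cent (Suc n) Y" "A \<in> gl n"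
  shows "A = 0"
  using assms Cent_down[OF assms(2,3)] by (auto simp: strong_reg_def)

lemma strong_reg_commutant_zero:
  assumes "strong_reg Y" "A \<in> gl n" "A \<odot> Y = Y \<odot> A"
  shows "A = 0"
proof (rule strong_reg_zero[OF assms(1) _ assms(2)])
  have A: "A \<in> gl (Suc n)" using gl_mono[OF _ assms(2), of "Suc n"] by simp
  have b: "blk (Suc n) A" using blk_gl[OF A] by simp
  have "corner (Suc n) (A \<odot> Y) = corner (Suc n) (Y \<odot> A)" using assms(3) by simp
  then show "A \<in> Cent (Suc n) Y" using A b by (simp add: Cent_def corner_mmul corner_id)
qed

lemma cent_grp_Cent: "g \<in> GL n \<Longrightarrow> g \<in> cent_grp n Y \<longleftrightarrow> g - mone \<in> Cent n Y"
  using Mn_iff[of g n] by (simp add: cent_grp_def Cent_def mmul_diff_left mmul_diff_right)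

lemma cent_grp_mone [simp]: "mone \<in> cent_grp n Y" by (simp add: cent_grp_def)

lemma cent_grp_mmul:
  assumes "g \<in> cent_grp n Y" "h \<in> cent_grp n Y"
  shows "g \<odot> h \<in> cent_grp n Y"
proof -
  note gh = cent_grpD(1)[OF assms(1)] cent_grpD(1)[OF assms(2)]
  note f = row_col_finite_GL[OF gh(1)] row_col_finite_GL[OF gh(2)]
  have "(g \<odot> h) \<odot> corner n Y = g \<odot> (corner n Y \<odot> h)" using f cent_grpD(2)[OF assms(2)] by (simp add: mmul_assoc)
  also have "\<dots> = (corner n Y \<odot> g) \<odot> h" using f cent_grpD(2)[OF assms(1)] by (simp add: mmul_assoc[symmetric])
  finally show ?thesis using f gh by (simp add: cent_grp_def mmul_assoc)
qed

lemma cent_grp_minv: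
  assumes "g \<in> cent_grp n Y"
  shows "minv g \<in> cent_grp n Y"
proof -
  note g = cent_grpD(1)[OF assms] GL_GL_inf[OF cent_grpD(1)[OF assms]]
  have f: "row_col_finite (minv g)" using g by simp
  have "minv g \<odot> corner n Y = minv g \<odot> ((corner n Y \<odot> g) \<odot> minv g)"
    using g by simp
  also have "\<dots> = minv g \<odot> ((g \<odot> corner n Y) \<odot> minv g)" using cent_grpD(2)[OF assms] by simp
  also have "\<dots> = corner n Y \<odot> minv g" using g f by (simp add: mmul_assoc)
  finally show ?thesis using minv_GL(1)[OF g(1)] by (simp add: cent_grp_def)
qed

lemma mexp_cent_grp:
  assumes "a \<in> Cent n Y"
  shows "mexp a \<in> cent_grp n Y"
  using mexp_GL(1)[OF CentD(1)[OF assms]]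
    mexp_commute[OF CentD(1)[OF assms] corner_gl CentD(2)[OF assms, symmetric]]
  by (simp add: cent_grp_def)

lemma cent_grp_mexp:
  assumes "strong_reg Y" "g \<in> cent_grp n Y"
  shows "\<exists>a\<in>Cent n Y. mexp a = g"
proof -
  obtain a where "a \<in> gl n" "a \<odot> corner n Y = corner n Y \<odot> a" "mexp a = g"
    using mexp_surj[OF corner_gl strong_reg_reg[OF assms(1)] cent_grpD[OF assms(2)]] by blast
  then show ?thesis by (auto simp: Cent_def)
qed

lemma cent_grp_GL_mone:
  assumes "strong_reg Y" "g \<in> cent_grp (Suc n) Y" "g \<in> GL n"
  shows "g = mone"
proof -
  have "g - mone \<in> gl n" using assms(3) GL_Mn Mn_iff by blast
  moreover have "g - mone \<in> Cent (Suc n) Y" using assms(2) cent_grpD(1) cent_grp_Cent by blast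
  ultimately have "g - mone = 0" using strong_reg_zero[OF assms(1)] by blast
  then show ?thesis by simp
qed

lemma strong_reg_stabilizer:
  assumes "strong_reg Y" "g \<in> GL_inf" "Ad g Y = Y"
  shows "g = mone"
proof -
  obtain n where "g \<in> GL n" using assms(2) by (auto simp: GL_inf_def)
  then have "g - mone \<in> gl n" using GL_Mn Mn_iff by blast
  moreover have "(g - mone) \<odot> Y = Y \<odot> (g - mone)"
    using assms(2,3) by (simp add: Ad_eq_iff mmul_diff_left mmul_diff_right)
  ultimately have "g - mone = 0" using strong_reg_commutant_zero[OF assms(1)] by blast
  then show ?thesis by simp
qed

lemma strong_reg_Ad_inj:
  assumes "strong_reg Y" "g \<in> GL_inf" "h \<in> GL_inf" "Ad g Y = Ad h Y"
  shows "g = h"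
proof -
  have "Ad (minv h \<odot> g) Y = Y" using assms by (simp add: Ad_mmul Ad_minv)
  then have "minv h \<odot> g = mone" using strong_reg_stabilizer assms by simp
  then have "h \<odot> (minv h \<odot> g) = h" by simp
  then show ?thesis using assms(3) by simp
qed

section \<open>Ordered products of the centralizer groups\<close>

primrec cent_prod :: "imat \<Rightarrow> nat \<Rightarrow> imat set" where
  "cent_prod X 0 = {mone}"
| "cent_prod X (Suc n) = {h \<odot> z | h z. h \<in> cent_prod X n \<and> z \<in> cent_grp (Suc n) X}"

lemma cent_prod_GL: "g \<in> cent_prod X n \<Longrightarrow> g \<in> GL n"
proof (induction n arbitrary: g)
  case (Suc n)
  then obtain h z where *: "g = h \<odot> z" "h \<in> cent_prod X n" "z \<in> cent_grp (Suc n) X" by auto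
  have "h \<in> GL (Suc n)" using GL_mono[OF _ Suc.IH[OF *(2)], of "Suc n"] by simp
  then show ?case using *(1) cent_grpD(1)[OF *(3)] by simp
qed simp

lemma cent_prod_GL_inf: "g \<in> cent_prod X n \<Longrightarrow> g \<in> GL_inf"
  using cent_prod_GL GL_GL_inf by blast

lemma cent_prod_Suc: "g \<in> cent_prod X n \<Longrightarrow> g \<in> cent_prod X (Suc n)"
  by (simp, rule exI[of _ g], rule exI[of _ mone]) simp

lemma cent_prod_mono: "n \<le> m \<Longrightarrow> g \<in> cent_prod X n \<Longrightarrow> g \<in> cent_prod X m"
  by (induction m rule: dec_induct) (auto intro: cent_prod_Suc simp del: cent_prod.simps)

lemma cent_prod_mone: "mone \<in> cent_prod X n"
  using cent_prod_mono[of 0 n mone X] by simp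

text \<open>The element h'^(-1) h = z' z^(-1) lies in GL(n) and centralizes the (n+1)-corner, hence
  is the identity.\<close>

lemma cent_prod_unique:
  assumes "strong_reg X" "h \<in> GL n" "h' \<in> GL n" "z \<in> cent_grp (Suc n) X" "z' \<in> cent_grp (Suc n) X" "h \<odot> z = h' \<odot> z'"
  shows "h = h'" "z = z'"
proof -
  have i: "h \<in> GL_inf" "h' \<in> GL_inf" "z \<in> GL_inf" "z' \<in> GL_inf" using assms cent_grpD(1) GL_GL_inf by blast+
  have "minv h' \<odot> (h \<odot> z) \<odot> minv z = minv h' \<odot> (h' \<odot> z') \<odot> minv z" using assms by simp
  then have eq: "minv h' \<odot> h = z' \<odot> minv z" using i by (simp add: mmul_assoc)
  have "minv h' \<odot> h \<in> GL n" using assms minv_GL(1) by simp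
  then have "z' \<odot> minv z = mone"
    using eq cent_grp_GL_mone[OF assms(1), of "z' \<odot> minv z" n] cent_grp_mmul[OF assms(5) cent_grp_minv[OF assms(4)]] by simp
  then have "(z' \<odot> minv z) \<odot> z = z" by simp
  then show "z = z'" using i by simp
  have "h' \<odot> (minv h' \<odot> h) = h'" using eq \<open>z' \<odot> minv z = mone\<close> by simp
  then show "h = h'" using i by simp
qed

text \<open>Compare g = h z with g = g 1: as soon as g lies in the smaller group, the last factor is
  trivial and the product shortens.\<close>

lemma cent_prod_GL_down:
  assumes "strong_reg X" "n \<le> m" "g \<in> cent_prod X m" "g \<in> GL n"
  shows "g \<in> cent_prod X n"
  using assms(2,3)
proof (induction m rule: dec_induct)
  case (step m)
  then obtain h z where *: "g = h \<odot> z" "h \<in> cent_prod X m" "z \<in> cent_grp (Suc m) X" by auto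
  have "g \<in> GL m" using GL_mono step(1) assms(4) by blast
  moreover have "h \<odot> z = g \<odot> mone" using *(1) by simp
  ultimately have "h = g" by (rule cent_prod_unique(1)[OF assms(1) cent_prod_GL[OF *(2)] _ *(3) cent_grp_mone])
  then have "g \<in> cent_prod X m" using *(2) by simp
  then show ?case by (rule step.IH)
qed simp

lemma corner_eq_down: "corner m X = corner m Y \<Longrightarrow> i \<le> m \<Longrightarrow> corner i X = corner i Y"
  using corner_corner[of i m X] corner_corner[of i m Y] by (simp add: min_def)

lemma corner_Ad_cent_grp:
  assumes "z \<in> cent_grp m X" "i \<le> m"
  shows "corner i (Ad z X) = corner i X"
proof (rule corner_eq_down[OF _ assms(2)])
  have "corner m (Ad z X) = Ad z (corner m X)" using corner_Ad cent_grpD(1)[OF assms(1)] by simp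
  also have "\<dots> = corner m X"
    using Ad_eq_iff[OF GL_GL_inf[OF cent_grpD(1)[OF assms(1)]]] cent_grpD(2)[OF assms(1)] by simp
  finally show "corner m (Ad z X) = corner m X" .
qed

lemma corner_Ad_cong:
  assumes "corner m X = corner m X'" "h \<in> GL n" "n \<le> m" "i \<le> m"
  shows "corner i (Ad h X) = corner i (Ad h X')"
  by (rule corner_eq_down[OF _ assms(4)]) (simp add: corner_Ad[OF assms(2,3)] assms(1))

text \<open>The last factor acts first and fixes the (n+1)-corner of X, so the small corners only
  see the earlier factors. This is the effect of putting the new factor on the right.\<close>

lemma corner_Ad_cent_prod_Suc:
  assumes "h \<in> cent_prod X n" "z \<in> cent_grp (Suc n) X" "i \<le> Suc n"
  shows "corner i (Ad (h \<odot> z) X) = corner i (Ad h X)"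
proof -
  have "Ad (h \<odot> z) X = Ad h (Ad z X)"
    using cent_prod_GL_inf[OF assms(1)] GL_GL_inf[OF cent_grpD(1)[OF assms(2)]] by (rule Ad_mmul)
  then show ?thesis
    using corner_Ad_cong[OF corner_Ad_cent_grp[OF assms(2) order_refl] cent_prod_GL[OF assms(1)] _ assms(3)] by simp
qed

text \<open>The product of the first k factors serves as u, since the later ones fix the
  (k+1)-corner. A common u for two neighbouring corners is needed to transport the condition on two
  neighbouring centralizers.\<close>

lemma corner_Ad_cent_prod:
  assumes "g \<in> cent_prod X n"
  shows "\<exists>u\<in>GL k. corner k (Ad g X) = Ad u (corner k X) \<and> corner (Suc k) (Ad g X) = Ad u (corner (Suc k) X)"
  using assms
proof (induction n arbitrary: g)
  case 0
  then show ?case by (intro bexI[of _ mone]) simp_all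
next
  case (Suc n)
  show ?case
  proof (cases "Suc n \<le> k")
    case True
    then have "g \<in> GL k" using GL_mono[OF True cent_prod_GL[OF Suc.prems]] by simp
    then show ?thesis using corner_Ad[of g k] by (intro bexI[of _ g]) simp_all
  next
    case False
    obtain h z where *: "g = h \<odot> z" "h \<in> cent_prod X n" "z \<in> cent_grp (Suc n) X" using Suc.prems by auto
    have "corner k (Ad g X) = corner k (Ad h X)" "corner (Suc k) (Ad g X) = corner (Suc k) (Ad h X)"
      unfolding *(1) using False by (auto intro!: corner_Ad_cent_prod_Suc[OF *(2,3)])
    then show ?thesis using Suc.IH[OF *(2)] by simp
  qed
qed

section \<open>Change of base point within an orbit\<close>

lemma Ad_mpow: "u \<in> GL_inf \<Longrightarrow> row_col_finite Z \<Longrightarrow> Ad u (mpow Z k) = mpow (Ad u Z) k"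
proof (induction k)
  case (Suc k)
  have "Ad u (mpow Z (Suc k)) = mpow (Ad u Z) (Suc k)" using Suc by (simp add: Ad_mmul_dist)
  then show ?case .
qed simp

lemma Ad_pw:
  assumes "u \<in> GL n" "Z \<in> gl n"
  shows "pw n (Ad u Z) k = Ad u (pw n Z k)"
proof -
  have "corner n (Ad u (mpow Z k)) = Ad u (corner n (mpow Z k))"
    by (rule corner_Ad[OF assms(1) order_refl])
  then show ?thesis
    unfolding pw_def Ad_mpow[OF GL_GL_inf[OF assms(1)] row_col_finite_gl[OF assms(2)]] .
qed

lemma Ad_inj:
  assumes "u \<in> GL_inf" "Ad u A = Ad u B"
  shows "A = B"
proof -
  have "Ad (minv u) (Ad u A) = Ad (minv u) (Ad u B)" by (simp only: assms(2))
  then show ?thesis by (simp only: Ad_minv[OF assms(1)])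
qed

lemma reg_Ad:
  assumes "u \<in> GL n" "Z \<in> gl n" "reg n Z"
  shows "reg n (Ad u Z)"
  unfolding reg_def
proof (intro allI impI)
  fix x k
  assume "(\<Sum>k<n. msmult (x k) (pw n (Ad u Z) k)) = 0" and k: "k < n"
  then have "Ad u (\<Sum>k<n. msmult (x k) (pw n Z k)) = Ad u 0"
    using assms GL_GL_inf[OF assms(1)] by (simp add: Ad_sum Ad_msmult Ad_pw)
  then have "(\<Sum>k<n. msmult (x k) (pw n Z k)) = 0" by (rule Ad_inj[OF GL_GL_inf[OF assms(1)]])
  then show "x k = 0" using assms(3) k by (simp add: reg_def)
qed

lemma Cent_Ad_iff:
  assumes "u \<in> GL n" "corner n Y = Ad u (corner n X)" "A \<in> gl n"
  shows "Ad u A \<in> Cent n Y \<longleftrightarrow> A \<in> Cent n X"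
proof -
  note u = GL_GL_inf[OF assms(1)]
  have "Ad u A \<odot> corner n Y = corner n Y \<odot> Ad u A \<longleftrightarrow> Ad u (A \<odot> corner n X) = Ad u (corner n X \<odot> A)"
    unfolding assms(2) using u by (simp add: Ad_mmul_dist)
  also have "\<dots> \<longleftrightarrow> A \<odot> corner n X = corner n X \<odot> A" by (rule iffI, erule Ad_inj[OF u], simp)
  finally show ?thesis using Ad_gl[OF assms(1,3)] assms(3) by (simp add: Cent_def)
qed

lemma strong_reg_Ad_cent_prod:
  assumes "strong_reg X" "g \<in> cent_prod X n"
  shows "strong_reg (Ad g X)"
  unfolding strong_reg_def
proof (intro conjI allI ballI impI)
  fix k
  obtain u where u: "u \<in> GL k" "corner k (Ad g X) = Ad u (corner k X)"
    "corner (Suc k) (Ad g X) = Ad u (corner (Suc k) X)" using corner_Ad_cent_prod[OF assms(2)] by blast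
  have ui: "u \<in> GL_inf" "u \<in> GL (Suc k)" using u(1) GL_GL_inf GL_mono[of k "Suc k"] by auto
  show "reg k (corner k (Ad g X))"
    unfolding u(2) by (rule reg_Ad[OF u(1) corner_gl strong_reg_reg[OF assms(1)]])
  fix A assume A: "A \<in> Cent k (Ad g X)" "A \<in> Cent (Suc k) (Ad g X)"
  define B where "B = Ad (minv u) A"
  have B: "B \<in> gl k" unfolding B_def by (rule Ad_gl[OF minv_GL(1)[OF u(1)] CentD(1)[OF A(1)]])
  then have B': "B \<in> gl (Suc k)" using gl_mono[of k "Suc k"] by simp
  have AB: "A = Ad u B" unfolding B_def using Ad_minv[of "minv u" A] ui by simp
  have "B \<in> Cent k X" "B \<in> Cent (Suc k) X"
    using A Cent_Ad_iff[OF u(1,2) B] Cent_Ad_iff[OF ui(2) u(3) B'] unfolding AB by simp_all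
  then have "B = 0" using assms(1) by (auto simp: strong_reg_def)
  then show "A = 0" by (simp add: AB)
qed

lemma cent_prod_cong: "(\<And>i. i \<le> n \<Longrightarrow> corner i X = corner i X') \<Longrightarrow> cent_prod X n = cent_prod X' n"
  by (induction n) (simp_all add: cent_grp_def)

lemma cent_grp_Ad_iff:
  assumes "u \<in> GL n" "corner n Y = Ad u (corner n X)" "z \<in> GL n"
  shows "Ad u z \<in> cent_grp n Y \<longleftrightarrow> z \<in> cent_grp n X"
proof -
  note u = GL_GL_inf[OF assms(1)]
  have g: "Ad u z \<in> GL n" unfolding Ad_def using assms minv_GL(1) by simp
  have "Ad u z \<odot> corner n Y = corner n Y \<odot> Ad u z \<longleftrightarrow> Ad u (z \<odot> corner n X) = Ad u (corner n X \<odot> z)"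
    unfolding assms(2) using u by (simp add: Ad_mmul_dist)
  also have "\<dots> \<longleftrightarrow> z \<odot> corner n X = corner n X \<odot> z" by (rule iffI, erule Ad_inj[OF u], simp)
  finally show ?thesis using g assms(3) by (simp add: cent_grp_def)
qed

text \<open>Induction on the number of factors: with g = h z, the first m factors depend only on
  corners that \<open>Ad g X\<close> and \<open>Ad h X\<close> share, and the last centralizer of
  \<open>Ad g X\<close> is the conjugate by h of that of X. It makes the orbit independent of the
  chosen base point.\<close>

lemma cent_prod_translate:
  assumes "g \<in> cent_prod X m"
  shows "g' \<in> cent_prod X m \<longleftrightarrow> (\<exists>w\<in>cent_prod (Ad g X) m. g' = w \<odot> g)"
  using assms
proof (induction m arbitrary: g g')
  case 0
  then show ?case by simp
next
  case (Suc m)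
  then obtain h z where *: "g = h \<odot> z" "h \<in> cent_prod X m" "z \<in> cent_grp (Suc m) X" by auto
  have hi: "h \<in> GL_inf" "z \<in> GL_inf" using cent_prod_GL_inf[OF *(2)] cent_grpD(1)[OF *(3)] GL_GL_inf by blast+
  have h: "h \<in> GL (Suc m)" using GL_mono[OF _ cent_prod_GL[OF *(2)], of "Suc m"] by simp
  have PPe: "cent_prod (Ad g X) m = cent_prod (Ad h X) m"
    by (rule cent_prod_cong) (simp add: *(1) corner_Ad_cent_prod_Suc[OF *(2,3)])
  have c: "corner (Suc m) (Ad g X) = Ad h (corner (Suc m) X)"
    using corner_Ad_cent_prod_Suc[OF *(2,3)] corner_Ad[OF h order_refl, of X] by (simp add: *(1))
  show ?case
  proof
    assume "g' \<in> cent_prod X (Suc m)"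
    then obtain h' z' where g': "g' = h' \<odot> z'" "h' \<in> cent_prod X m" "z' \<in> cent_grp (Suc m) X" by auto
    obtain w where w: "w \<in> cent_prod (Ad h X) m" "h' = w \<odot> h" using Suc.IH[OF *(2)] g'(2) by blast
    have wi: "w \<in> GL_inf" "z' \<in> GL_inf" using cent_prod_GL_inf[OF w(1)] cent_grpD(1)[OF g'(3)] GL_GL_inf by blast+
    \<comment> \<open>Solves w \<zeta> h z = w h z' for \<zeta>.\<close>
    define \<zeta> where "\<zeta> = Ad h (z' \<odot> minv z)"
    have zz: "z' \<odot> minv z \<in> cent_grp (Suc m) X" using cent_grp_mmul cent_grp_minv * g' by blast
    then have "\<zeta> \<in> cent_grp (Suc m) (Ad g X)" unfolding \<zeta>_def using cent_grp_Ad_iff[OF h c] cent_grpD(1) by blast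
    moreover have "g' = (w \<odot> \<zeta>) \<odot> g"
      using hi wi by (simp add: g' w \<zeta>_def Ad_def *(1) mmul_assoc)
    ultimately show "\<exists>w\<in>cent_prod (Ad g X) (Suc m). g' = w \<odot> g" using w(1) PPe by auto
  next
    assume "\<exists>w\<in>cent_prod (Ad g X) (Suc m). g' = w \<odot> g"
    then obtain w \<zeta> where w: "w \<in> cent_prod (Ad h X) m" "\<zeta> \<in> cent_grp (Suc m) (Ad g X)" "g' = (w \<odot> \<zeta>) \<odot> g"
      using PPe by auto
    have wi: "w \<in> GL_inf" "\<zeta> \<in> GL_inf" using cent_prod_GL_inf[OF w(1)] cent_grpD(1)[OF w(2)] GL_GL_inf by blast+
    define z' where "z' = Ad (minv h) \<zeta>"
    have z'g: "z' \<in> GL (Suc m)" unfolding z'_def Ad_def using h minv_GL(1) cent_grpD(1)[OF w(2)] by simp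
    have "\<zeta> = Ad h z'" unfolding z'_def using Ad_minv[of "minv h" \<zeta>] hi by simp
    then have "z' \<in> cent_grp (Suc m) X" using cent_grp_Ad_iff[OF h c z'g] w(2) by simp
    then have zz: "z' \<odot> z \<in> cent_grp (Suc m) X" using cent_grp_mmul *(3) by blast
    have "w \<odot> h \<in> cent_prod X m" using Suc.IH[OF *(2)] w(1) by blast
    moreover have "g' = (w \<odot> h) \<odot> (z' \<odot> z)"
      using hi wi by (simp add: w(3) z'_def Ad_def *(1) mmul_assoc)
    ultimately show "g' \<in> cent_prod X (Suc m)" using zz by auto
  qed
qed

subsection \<open>The orbits of the abelian group\<close>

lemma foldr_mmul: "(\<And>x. x \<in> set xs \<Longrightarrow> row_col_finite x) \<Longrightarrow> row_col_finite (mprod xs) \<and> foldr (\<odot>) xs y = mprod xs \<odot> y"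
proof (induction xs)
  case (Cons x xs)
  then show ?case by (simp add: mprod_def mmul_assoc)
qed (simp add: mprod_def)

lemma mprod_snoc: "(\<And>x. x \<in> set xs \<Longrightarrow> row_col_finite x) \<Longrightarrow> mprod (xs @ [x]) = mprod xs \<odot> x"
  using foldr_mmul[of xs x] by (simp add: mprod_def)

lemma mprod_mexp:
  assumes "\<And>j. B j \<in> gl n" "\<And>i j. B i \<odot> B j = B j \<odot> B i"
  shows "mprod (map (\<lambda>j. mexp (B j)) [1..<Suc m]) = mexp (\<Sum>j=1..m. B j)"
proof (induction m)
  case 0
  have "mprod (map (\<lambda>j. mexp (B j)) [1..<Suc 0]) = mexp (\<Sum>j=1..0. B j)" by (simp add: mprod_def)
  then show ?case .
next
  case (Suc m)
  have IH: "mprod (map (\<lambda>j. mexp (B j)) [1..<Suc m]) = mexp (\<Sum>j=1..m. B j)" using Suc .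
  have "(\<Sum>j=1..m. B j) \<in> gl n" using assms by (intro gl_sum) simp
  moreover have "row_col_finite (B j)" for j using assms(1) row_col_finite_gl by blast
  then have "(\<Sum>j=1..m. B j) \<odot> B (Suc m) = B (Suc m) \<odot> (\<Sum>j=1..m. B j)"
    using assms by (simp add: mmul_sum_left mmul_sum_right)
  ultimately have "mexp ((\<Sum>j=1..m. B j) + B (Suc m)) = mexp (\<Sum>j=1..m. B j) \<odot> mexp (B (Suc m))"
    using mexp_add assms(1) by blast
  moreover have "row_col_finite (mexp (B j))" for j using mexp_Mn[OF assms(1)] row_col_finite_Mn by blast
  then have "mprod (map (\<lambda>j. mexp (B j)) ([1..<Suc m] @ [Suc m])) =
      mprod (map (\<lambda>j. mexp (B j)) [1..<Suc m]) \<odot> mexp (B (Suc m))"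
    unfolding map_append list.map by (intro mprod_snoc) auto
  ultimately have "mprod (map (\<lambda>j. mexp (B j)) [1..<Suc (Suc m)]) = mexp (\<Sum>j=1..Suc m. B j)"
    unfolding IH by simp
  then show ?case .
qed

lemma z_elt_mexp:
  "z_elt t X i = mexp (\<Sum>j=1..i. msmult (of_nat j * t i j) (pw i (corner i X) (j - 1)))"
proof -
  let ?B = "\<lambda>j. msmult (of_nat j * t i j) (pw i (corner i X) (j - 1))"
  have "?B j \<odot> ?B l = ?B l \<odot> ?B j" for j l
    using pw_comm[OF corner_gl pw_gl CentD(2)[OF pw_Cent]]
    by (simp add: mmul_msmult_left mmul_msmult_right mult.commute)
  then show ?thesis
    unfolding z_elt_def pw_def[symmetric] by (intro mprod_mexp[of ?B i]) simp_all
qed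

lemma z_elt_cent_grp: "z_elt t X i \<in> cent_grp i X"
  unfolding z_elt_mexp by (intro mexp_cent_grp Cent_sum Cent_msmult pw_Cent)

lemma mprod_upt_Suc:
  assumes "\<And>i. row_col_finite (z i)"
  shows "mprod (map z [1..<Suc (Suc n)]) = mprod (map z [1..<Suc n]) \<odot> z (Suc n)"
proof -
  have "[1..<Suc (Suc n)] = [1..<Suc n] @ [Suc n]" by simp
  then have "map z [1..<Suc (Suc n)] = map z [1..<Suc n] @ [z (Suc n)]" by (simp only: map_append list.map)
  then show ?thesis using mprod_snoc[of "map z [1..<Suc n]" "z (Suc n)"] assms by (auto simp del: upt_Suc)
qed

lemma mprod_cent_prod:
  assumes "\<And>i. z i \<in> cent_grp i X"
  shows "mprod (map z [1..<Suc n]) \<in> cent_prod X n"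
proof (induction n)
  case (Suc n)
  have f: "row_col_finite (z i)" for i by (rule row_col_finite_GL[OF cent_grpD(1)[OF assms]])
  show ?case
    unfolding mprod_upt_Suc[of z n, OF f] cent_prod.simps using Suc assms by blast
qed (simp add: mprod_def)

lemma cent_prod_mprod:
  assumes "g \<in> cent_prod X n"
  shows "\<exists>z. (\<forall>i. z i \<in> cent_grp i X) \<and> g = mprod (map z [1..<Suc n])"
  using assms
proof (induction n arbitrary: g)
  case 0
  then show ?case by (intro exI[of _ "\<lambda>_. mone"]) (simp add: mprod_def)
next
  case (Suc n)
  then obtain h \<zeta> where *: "g = h \<odot> \<zeta>" "h \<in> cent_prod X n" "\<zeta> \<in> cent_grp (Suc n) X" by auto
  obtain z where z: "\<And>i. z i \<in> cent_grp i X" "h = mprod (map z [1..<Suc n])" using Suc.IH[OF *(2)] by blast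
  let ?z = "z(Suc n := \<zeta>)"
  have zz: "?z i \<in> cent_grp i X" for i using z(1) *(3) by simp
  have f: "row_col_finite (?z i)" for i by (rule row_col_finite_GL[OF cent_grpD(1)[OF zz]])
  have "map ?z [1..<Suc n] = map z [1..<Suc n]" by (intro map_cong) auto
  then have "g = mprod (map ?z [1..<Suc (Suc n)])"
    unfolding mprod_upt_Suc[of ?z n, OF f] *(1) z(2) by (simp only: fun_upd_same)
  then show ?case using zz by blast
qed

text \<open>Every factor has a logarithm in its centralizer, and that logarithm expands in powers of
  the corner; so the parameters t reach every product. Products with n factors correspond to
  \<open>A_grp (Suc n)\<close>.\<close>

lemma A_orbit_cent_prod:
  assumes "strong_reg X"
  shows "A_orbit X = {Ad g X | g n. g \<in> cent_prod X n}"
proof (intro equalityI subsetI)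
  fix Y assume "Y \<in> A_orbit X"
  then obtain n t where Y: "Y = Ad (mprod (map (z_elt t X) [1..<n])) X"
    by (auto simp: A_orbit_def A_act_def)
  have "mprod (map (z_elt t X) [1..<n]) \<in> cent_prod X (n - 1)"
    using mprod_cent_prod[of "z_elt t X" X "n - 1"] z_elt_cent_grp cent_prod_mone by (cases n) (auto simp: mprod_def)
  then show "Y \<in> {Ad g X | g n. g \<in> cent_prod X n}" using Y by blast
next
  fix Y assume "Y \<in> {Ad g X | g n. g \<in> cent_prod X n}"
  then obtain g n where Y: "Y = Ad g X" "g \<in> cent_prod X n" by blast
  obtain z where z: "\<And>i. z i \<in> cent_grp i X" "g = mprod (map z [1..<Suc n])" using cent_prod_mprod[OF Y(2)] by blast
  have "\<exists>x. z i = mexp (\<Sum>k<i. msmult (x k) (pw i (corner i X) k))" for i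
  proof -
    obtain a where a: "a \<in> Cent i X" "mexp a = z i" using cent_grp_mexp[OF assms z(1)] by blast
    obtain x where "a = (\<Sum>k<i. msmult (x k) (pw i (corner i X) k))"
      using Cent_expand[OF assms a(1)] by (elim exE)
    then show ?thesis using a(2) by (intro exI[of _ x]) simp
  qed
  then have "\<exists>x. \<forall>i. z i = mexp (\<Sum>k<i. msmult (x i k) (pw i (corner i X) k))"
    by (intro choice allI)
  then obtain x where x: "\<And>i. z i = mexp (\<Sum>k<i. msmult (x i k) (pw i (corner i X) k))"
    by (elim exE) blast
  \<comment> \<open>Division by j cancels the factor j in the exponents of \<open>z_elt\<close>,
    whose power is j - 1; the default 0 puts t into \<open>A_grp\<close>.\<close>
  define t where "t i j = (if 1 \<le> j \<and> j \<le> i \<and> i < Suc n then x i (j - 1) / of_nat j else 0)" for i j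
  have "t \<in> A_grp (Suc n)" by (simp add: t_def A_grp_def)
  moreover have "z_elt t X i = z i" if "i \<in> set [1..<Suc n]" for i
  proof -
    have "(\<Sum>j=1..i. msmult (of_nat j * t i j) (pw i (corner i X) (j - 1))) =
        (\<Sum>k<i. msmult (x i k) (pw i (corner i X) k))"
      by (rule sum.reindex_bij_witness[of _ Suc "\<lambda>j. j - 1"]) (use that in \<open>auto simp: t_def\<close>)
    then show ?thesis unfolding z_elt_mexp x[of i] by simp
  qed
  then have "map (z_elt t X) [1..<Suc n] = map z [1..<Suc n]" by (intro map_cong) auto
  ultimately show "Y \<in> A_orbit X"
    unfolding A_orbit_def A_act_def Y(1) z(2)
    by (intro CollectI exI[of _ "Suc n"] exI[of _ t]) (simp only:)
qed

lemma A_orbit_subset: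
  assumes "strong_reg X"
  shows "A_orbit X \<subseteq> GL_inf_orbit X"
  unfolding A_orbit_cent_prod[OF assms] GL_inf_orbit_def using cent_prod_GL_inf by blast

text \<open>A point of the intersection is reached from X by an element of some product and by an
  element of GL(n). They coincide because the stabilizer is trivial.\<close>

lemma A_orbit_stratum:
  assumes "strong_reg X"
  shows "A_orbit X \<inter> GL_orbit n X = {Ad g X | g. g \<in> cent_prod X n}"
proof (intro equalityI subsetI)
  fix Y assume "Y \<in> A_orbit X \<inter> GL_orbit n X"
  then obtain g m h where Y: "Y = Ad g X" "g \<in> cent_prod X m" "Y = Ad h X" "h \<in> GL n"
    unfolding A_orbit_cent_prod[OF assms] GL_orbit_def by blast
  have "g = h" using strong_reg_Ad_inj[OF assms cent_prod_GL_inf[OF Y(2)] GL_GL_inf[OF Y(4)]] Y by simp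
  then have "g \<in> cent_prod X n"
    using cent_prod_GL_down[OF assms _ Y(2)] cent_prod_mono[OF _ Y(2)] Y(4) by (cases "n \<le> m") auto
  then show "Y \<in> {Ad g X | g. g \<in> cent_prod X n}" using Y by blast
next
  fix Y assume "Y \<in> {Ad g X | g. g \<in> cent_prod X n}"
  then show "Y \<in> A_orbit X \<inter> GL_orbit n X"
    unfolding A_orbit_cent_prod[OF assms] GL_orbit_def using cent_prod_GL by blast
qed

lemma A_orbit_strong_reg: "strong_reg X \<Longrightarrow> Y \<in> A_orbit X \<Longrightarrow> strong_reg Y"
  unfolding A_orbit_cent_prod using strong_reg_Ad_cent_prod by blast

lemma A_orbit_eq:
  assumes "strong_reg X" "Y \<in> A_orbit X"
  shows "A_orbit Y = A_orbit X"
proof -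
  obtain g n where g: "Y = Ad g X" "g \<in> cent_prod X n" using assms A_orbit_cent_prod by blast
  have gi: "g \<in> GL_inf" by (rule cent_prod_GL_inf[OF g(2)])
  have "Z \<in> A_orbit Y \<longleftrightarrow> Z \<in> A_orbit X" for Z
  proof
    assume "Z \<in> A_orbit Y"
    then obtain w m where w: "Z = Ad w Y" "w \<in> cent_prod Y m" using A_orbit_cent_prod[OF A_orbit_strong_reg[OF assms]] by blast
    have "w \<in> cent_prod Y (max n m)" using cent_prod_mono[OF _ w(2)] by simp
    moreover have "g \<in> cent_prod X (max n m)" using cent_prod_mono[OF _ g(2)] by simp
    ultimately have "w \<odot> g \<in> cent_prod X (max n m)" using cent_prod_translate g(1) by blast
    moreover have "Z = Ad (w \<odot> g) X" using w g gi cent_prod_GL_inf[OF w(2)] by (simp add: Ad_mmul)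
    ultimately show "Z \<in> A_orbit X" using A_orbit_cent_prod[OF assms(1)] by blast
  next
    assume "Z \<in> A_orbit X"
    then obtain w m where w: "Z = Ad w X" "w \<in> cent_prod X m" using A_orbit_cent_prod[OF assms(1)] by blast
    have "w \<in> cent_prod X (max n m)" using cent_prod_mono[OF _ w(2)] by simp
    moreover have "g \<in> cent_prod X (max n m)" using cent_prod_mono[OF _ g(2)] by simp
    ultimately obtain v where v: "v \<in> cent_prod Y (max n m)" "w = v \<odot> g" using cent_prod_translate g(1) by blast
    then have "Z = Ad v Y" using w g gi cent_prod_GL_inf[OF v(1)] by (simp add: Ad_mmul)
    then show "Z \<in> A_orbit Y" using v(1) A_orbit_cent_prod[OF A_orbit_strong_reg[OF assms]] by blast
  qed
  then show ?thesis by blast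
qed

section \<open>Zariski spaces\<close>

text \<open>
  Regularity at \<open>z\<close>, witnessed on the largest possible set, the principal open set of the denominator.
\<close>
definition reg_at :: "'a set \<Rightarrow> ('a \<Rightarrow> complex) set \<Rightarrow> 'a \<Rightarrow> ('a \<Rightarrow> complex) \<Rightarrow> bool" where
  "reg_at S \<Phi> z f \<longleftrightarrow> (\<exists>p\<in>poly_funs \<Phi>. \<exists>q\<in>poly_funs \<Phi>. q z \<noteq> 0 \<and> (\<forall>y\<in>S. q y \<noteq> 0 \<longrightarrow> f y = p y / q y))"

definition zopen :: "'a set \<Rightarrow> ('a \<Rightarrow> complex) set \<Rightarrow> 'a set \<Rightarrow> bool" where
  "zopen S \<Phi> U \<longleftrightarrow> U \<subseteq> S \<and> (\<forall>z\<in>U. \<exists>q\<in>poly_funs \<Phi>. q z \<noteq> 0 \<and> {y\<in>S. q y \<noteq> 0} \<subseteq> U)"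

lemma zopen_subset: "zopen S \<Phi> U \<Longrightarrow> U \<subseteq> S" by (simp add: zopen_def)

lemma zopenD: "zopen S \<Phi> U \<Longrightarrow> z \<in> U \<Longrightarrow> \<exists>q\<in>poly_funs \<Phi>. q z \<noteq> 0 \<and> (\<forall>y\<in>S. q y \<noteq> 0 \<longrightarrow> y \<in> U)"
  unfolding zopen_def by blast

lemma zopenI:
  "U \<subseteq> S \<Longrightarrow> (\<And>z. z \<in> U \<Longrightarrow> \<exists>q\<in>poly_funs \<Phi>. q z \<noteq> 0 \<and> (\<forall>y\<in>S. q y \<noteq> 0 \<longrightarrow> y \<in> U)) \<Longrightarrow> zopen S \<Phi> U"
  unfolding zopen_def by blast

lemma zopen_whole: "zopen S \<Phi> S"
  by (rule zopenI) (auto intro!: bexI[of _ "\<lambda>_. 1"] poly_funs.const)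

lemma zopen_Int:
  assumes "zopen S \<Phi> U" "zopen S \<Phi> V"
  shows "zopen S \<Phi> (U \<inter> V)"
proof (rule zopenI)
  show "U \<inter> V \<subseteq> S" using zopen_subset[OF assms(1)] by blast
  fix z assume z: "z \<in> U \<inter> V"
  obtain p where p: "p \<in> poly_funs \<Phi>" "p z \<noteq> 0" "\<forall>y\<in>S. p y \<noteq> 0 \<longrightarrow> y \<in> U" using zopenD[OF assms(1)] z by blast
  obtain q where q: "q \<in> poly_funs \<Phi>" "q z \<noteq> 0" "\<forall>y\<in>S. q y \<noteq> 0 \<longrightarrow> y \<in> V" using zopenD[OF assms(2)] z by blast
  show "\<exists>q\<in>poly_funs \<Phi>. q z \<noteq> 0 \<and> (\<forall>y\<in>S. q y \<noteq> 0 \<longrightarrow> y \<in> U \<inter> V)"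
    by (rule bexI[OF _ poly_funs.mult[OF p(1) q(1)]]) (use p q in auto)
qed

lemma zopen_Union: "(\<And>U. U \<in> K \<Longrightarrow> zopen S \<Phi> U) \<Longrightarrow> zopen S \<Phi> (\<Union>K)"
  by (rule zopenI) (use zopen_subset in blast, use zopenD in fast)

lemma zopen_basic: "q \<in> poly_funs \<Phi> \<Longrightarrow> zopen S \<Phi> {y\<in>S. q y \<noteq> 0}"
  by (rule zopenI) auto

lemma zopen_finite_Inter:
  assumes "finite K" "\<And>U. U \<in> K \<Longrightarrow> zopen S \<Phi> U"
  shows "zopen S \<Phi> (S \<inter> \<Inter>K)"
  using assms
proof (induction K rule: finite_induct)
  case empty
  then show ?case using zopen_whole by simp
next
  case (insert U K)
  have "zopen S \<Phi> U" "zopen S \<Phi> (S \<inter> \<Inter>K)" using insert by blast+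
  then have "zopen S \<Phi> (U \<inter> (S \<inter> \<Inter>K))" by (rule zopen_Int)
  moreover have "U \<inter> (S \<inter> \<Inter>K) = S \<inter> \<Inter>(insert U K)" by auto
  ultimately show ?case by simp
qed

lemma openin_zariski_top: "openin (zariski_top S \<Phi>) U \<longleftrightarrow> zopen S \<Phi> U"
proof
  assume "openin (zariski_top S \<Phi>) U"
  then have "generate_topology_on {{z \<in> S. p z \<noteq> 0} | p. p \<in> poly_funs \<Phi>} U"
    by (simp add: zariski_top_def openin_topology_generated_by_iff)
  then show "zopen S \<Phi> U"
  proof induction
    case Empty
    show ?case by (simp add: zopen_def)
  next
    case (Int a b)
    then show ?case by (simp add: zopen_Int)
  next
    case (UN K)
    then show ?case by (simp add: zopen_Union)
  next
    case (Basis s)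
    then show ?case using zopen_basic by blast
  qed
next
  assume U: "zopen S \<Phi> U"
  let ?K = "{{y \<in> S. q y \<noteq> 0} | q. q \<in> poly_funs \<Phi> \<and> {y \<in> S. q y \<noteq> 0} \<subseteq> U}"
  have "openin (zariski_top S \<Phi>) (\<Union>?K)"
    unfolding zariski_top_def by (intro openin_Union) (auto intro!: topology_generated_by_Basis)
  moreover have "\<Union>?K = U"
  proof (intro equalityI subsetI)
    fix z assume "z \<in> U"
    then obtain q where "q \<in> poly_funs \<Phi>" "q z \<noteq> 0" "{y\<in>S. q y \<noteq> 0} \<subseteq> U" "z \<in> S"
      using U unfolding zopen_def by blast
    then show "z \<in> \<Union>?K" by blast
  qed blast
  ultimately show "openin (zariski_top S \<Phi>) U" by simp
qed

subsection \<open>Regular functions\<close>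

lemma reg_atE:
  assumes "reg_at S \<Phi> z f"
  obtains p q where "p \<in> poly_funs \<Phi>" "q \<in> poly_funs \<Phi>" "q z \<noteq> 0" "\<And>y. y \<in> S \<Longrightarrow> q y \<noteq> 0 \<Longrightarrow> f y = p y / q y"
  using assms unfolding reg_at_def by blast

lemma reg_atI: "p \<in> poly_funs \<Phi> \<Longrightarrow> q \<in> poly_funs \<Phi> \<Longrightarrow> q z \<noteq> 0 \<Longrightarrow> (\<And>y. y \<in> S \<Longrightarrow> q y \<noteq> 0 \<Longrightarrow> f y = p y / q y) \<Longrightarrow> reg_at S \<Phi> z f"
  unfolding reg_at_def by blast

lemma reg_at_poly: "p \<in> poly_funs \<Phi> \<Longrightarrow> reg_at S \<Phi> z p"
  by (rule reg_atI[of p _ "\<lambda>_. 1"]) (auto intro: poly_funs.const)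

lemma reg_at_const [simp]: "reg_at S \<Phi> z (\<lambda>_. c)"
  by (rule reg_at_poly[OF poly_funs.const])

lemma reg_at_coord: "c \<in> \<Phi> \<Longrightarrow> reg_at S \<Phi> z c"
  by (rule reg_at_poly[OF poly_funs.coord])

lemma reg_at_add:
  assumes "reg_at S \<Phi> z f" "reg_at S \<Phi> z g"
  shows "reg_at S \<Phi> z (\<lambda>y. f y + g y)"
proof -
  obtain p q where 1: "p \<in> poly_funs \<Phi>" "q \<in> poly_funs \<Phi>" "q z \<noteq> 0" "\<And>y. y \<in> S \<Longrightarrow> q y \<noteq> 0 \<Longrightarrow> f y = p y / q y"
    using reg_atE[OF assms(1)] by metis
  obtain a b where 2: "a \<in> poly_funs \<Phi>" "b \<in> poly_funs \<Phi>" "b z \<noteq> 0" "\<And>y. y \<in> S \<Longrightarrow> b y \<noteq> 0 \<Longrightarrow> g y = a y / b y"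
    using reg_atE[OF assms(2)] by metis
  show ?thesis
    by (rule reg_atI[OF poly_funs.add[OF poly_funs.mult[OF 1(1) 2(2)] poly_funs.mult[OF 2(1) 1(2)]] poly_funs.mult[OF 1(2) 2(2)]])
      (use 1 2 in \<open>auto simp: field_simps\<close>)
qed

lemma reg_at_mult:
  assumes "reg_at S \<Phi> z f" "reg_at S \<Phi> z g"
  shows "reg_at S \<Phi> z (\<lambda>y. f y * g y)"
proof -
  obtain p q where 1: "p \<in> poly_funs \<Phi>" "q \<in> poly_funs \<Phi>" "q z \<noteq> 0" "\<And>y. y \<in> S \<Longrightarrow> q y \<noteq> 0 \<Longrightarrow> f y = p y / q y"
    using reg_atE[OF assms(1)] by metis
  obtain a b where 2: "a \<in> poly_funs \<Phi>" "b \<in> poly_funs \<Phi>" "b z \<noteq> 0" "\<And>y. y \<in> S \<Longrightarrow> b y \<noteq> 0 \<Longrightarrow> g y = a y / b y"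
    using reg_atE[OF assms(2)] by metis
  show ?thesis
    by (rule reg_atI[OF poly_funs.mult[OF 1(1) 2(1)] poly_funs.mult[OF 1(2) 2(2)]]) (use 1 2 in auto)
qed

lemma reg_at_uminus: "reg_at S \<Phi> z f \<Longrightarrow> reg_at S \<Phi> z (\<lambda>y. - f y)"
  using reg_at_mult[OF reg_at_const[of S \<Phi> z "- 1"]] by simp

lemma reg_at_diff: "reg_at S \<Phi> z f \<Longrightarrow> reg_at S \<Phi> z g \<Longrightarrow> reg_at S \<Phi> z (\<lambda>y. f y - g y)"
  using reg_at_add[OF _ reg_at_uminus] by fastforce

lemma reg_at_sum: "(\<And>i. i \<in> I \<Longrightarrow> reg_at S \<Phi> z (f i)) \<Longrightarrow> reg_at S \<Phi> z (\<lambda>y. \<Sum>i\<in>I. f i y)"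
  by (induction I rule: infinite_finite_induct) (simp_all add: reg_at_add)

text \<open>The fraction representing g is expanded by numerator and denominator of r. Where the new
  denominator does not vanish, r does not vanish either, so f and g agree there.\<close>

lemma reg_at_local:
  assumes "reg_at S \<Phi> z r" "z \<in> S" "r z \<noteq> 0" "\<And>y. y \<in> S \<Longrightarrow> r y \<noteq> 0 \<Longrightarrow> f y = g y" "reg_at S \<Phi> z g"
  shows "reg_at S \<Phi> z f"
proof -
  obtain p q where 1: "p \<in> poly_funs \<Phi>" "q \<in> poly_funs \<Phi>" "q z \<noteq> 0" "\<And>y. y \<in> S \<Longrightarrow> q y \<noteq> 0 \<Longrightarrow> g y = p y / q y"
    using reg_atE[OF assms(5)] by metis
  obtain a b where 2: "a \<in> poly_funs \<Phi>" "b \<in> poly_funs \<Phi>" "b z \<noteq> 0" "\<And>y. y \<in> S \<Longrightarrow> b y \<noteq> 0 \<Longrightarrow> r y = a y / b y"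
    using reg_atE[OF assms(1)] by metis
  have ab: "(\<lambda>y. a y * b y) \<in> poly_funs \<Phi>" using 2 by (intro poly_funs.mult)
  have az: "a z \<noteq> 0" using 2(3,4) assms(2,3) by fastforce
  show ?thesis
  proof (rule reg_atI[OF poly_funs.mult[OF 1(1) ab] poly_funs.mult[OF 1(2) ab]])
    fix y assume y: "y \<in> S" "q y * (a y * b y) \<noteq> 0"
    then have "r y \<noteq> 0" using 2(4) by simp
    then show "f y = p y * (a y * b y) / (q y * (a y * b y))" using y 1(4) assms(4) by simp
  qed (use az 1 2 in auto)
qed

lemma reg_at_open_cong:
  assumes "zopen S \<Phi> V" "z \<in> V" "\<And>y. y \<in> V \<Longrightarrow> f y = g y" "reg_at S \<Phi> z g"
  shows "reg_at S \<Phi> z f"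
proof -
  obtain q where q: "q \<in> poly_funs \<Phi>" "q z \<noteq> 0" "\<forall>y\<in>S. q y \<noteq> 0 \<longrightarrow> y \<in> V" using zopenD[OF assms(1,2)] by blast
  show ?thesis
    by (rule reg_at_local[OF reg_at_poly[OF q(1)] _ q(2) _ assms(4)]) (use q zopen_subset[OF assms(1)] assms in auto)
qed

lemma reg_at_cong: "(\<And>y. y \<in> S \<Longrightarrow> f y = g y) \<Longrightarrow> reg_at S \<Phi> z g \<Longrightarrow> reg_at S \<Phi> z f"
  unfolding reg_at_def by simp

lemma reg_at_divide:
  assumes "reg_at S \<Phi> z f" "reg_at S \<Phi> z g" "z \<in> S" "g z \<noteq> 0"
  shows "reg_at S \<Phi> z (\<lambda>y. f y / g y)"
proof -
  obtain a b where 2: "a \<in> poly_funs \<Phi>" "b \<in> poly_funs \<Phi>" "b z \<noteq> 0" "\<And>y. y \<in> S \<Longrightarrow> b y \<noteq> 0 \<Longrightarrow> g y = a y / b y"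
    using reg_atE[OF assms(2)] by metis
  have az: "a z \<noteq> 0" using 2(3,4) assms(3,4) by fastforce
  have 3: "reg_at S \<Phi> z (\<lambda>y. b y * b y / (a y * b y))"
    by (rule reg_atI[OF poly_funs.mult[OF 2(2,2)] poly_funs.mult[OF 2(1,2)]]) (use az 2 in auto)
  have 4: "1 / g y = b y * b y / (a y * b y)" if "y \<in> S" "a y * b y \<noteq> 0" for y
    using that by (simp add: 2(4))
  have "a z * b z \<noteq> 0" using az 2(3) by simp
  from reg_at_local[OF reg_at_poly[OF poly_funs.mult[OF 2(1,2)]] assms(3) this 4 3]
  have "reg_at S \<Phi> z (\<lambda>y. 1 / g y)" by simp
  from reg_at_mult[OF assms(1) this] show ?thesis by simp
qed

lemma reg_at_nbhd:
  assumes "reg_at S \<Phi> z f" "z \<in> S"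
  shows "\<exists>U. zopen S \<Phi> U \<and> z \<in> U \<and> (\<forall>y\<in>U. reg_at S \<Phi> y f)"
proof -
  obtain p q where 1: "p \<in> poly_funs \<Phi>" "q \<in> poly_funs \<Phi>" "q z \<noteq> 0" "\<And>y. y \<in> S \<Longrightarrow> q y \<noteq> 0 \<Longrightarrow> f y = p y / q y"
    using reg_atE[OF assms(1)] by metis
  show ?thesis
    by (intro exI[of _ "{y\<in>S. q y \<noteq> 0}"] conjI zopen_basic ballI) (use 1 assms(2) in \<open>auto intro: reg_atI[OF 1(1,2)]\<close>)
qed

lemma zopen_nonzero:
  assumes "zopen S \<Phi> U" "\<And>y. y \<in> U \<Longrightarrow> reg_at S \<Phi> y f"
  shows "zopen S \<Phi> {y\<in>U. f y \<noteq> 0}"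
proof (rule zopenI)
  fix z assume z: "z \<in> {y\<in>U. f y \<noteq> 0}"
  then have zS: "z \<in> S" using zopen_subset[OF assms(1)] by blast
  have "reg_at S \<Phi> z f" using assms(2) z by blast
  then obtain p q where 1: "p \<in> poly_funs \<Phi>" "q \<in> poly_funs \<Phi>" "q z \<noteq> 0" "\<And>y. y \<in> S \<Longrightarrow> q y \<noteq> 0 \<Longrightarrow> f y = p y / q y"
    using reg_atE by metis
  obtain r where r: "r \<in> poly_funs \<Phi>" "r z \<noteq> 0" "\<forall>y\<in>S. r y \<noteq> 0 \<longrightarrow> y \<in> U" using zopenD[OF assms(1)] z by blast
  have "p z \<noteq> 0" using 1(3,4) z zS by fastforce
  show "\<exists>q\<in>poly_funs \<Phi>. q z \<noteq> 0 \<and> (\<forall>y\<in>S. q y \<noteq> 0 \<longrightarrow> y \<in> {y \<in> U. f y \<noteq> 0})"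
    by (rule bexI[OF _ poly_funs.mult[OF poly_funs.mult[OF 1(1,2)] r(1)]]) (use 1 r \<open>p z \<noteq> 0\<close> in auto)
qed (use zopen_subset[OF assms(1)] in blast)

lemma reg_at_poly_comp:
  assumes "p \<in> poly_funs \<Psi>" "\<And>c. c \<in> \<Psi> \<Longrightarrow> reg_at S \<Phi> z (\<lambda>y. c (\<phi> y))"
  shows "reg_at S \<Phi> z (\<lambda>y. p (\<phi> y))"
  using assms(1) by induction (use assms(2) in \<open>auto intro: reg_at_add reg_at_mult\<close>)

lemma reg_at_comp:
  assumes "reg_at T \<Psi> (\<phi> z) f" "\<And>c. c \<in> \<Psi> \<Longrightarrow> reg_at S \<Phi> z (\<lambda>y. c (\<phi> y))" "z \<in> S" "\<And>y. y \<in> S \<Longrightarrow> \<phi> y \<in> T"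
  shows "reg_at S \<Phi> z (\<lambda>y. f (\<phi> y))"
proof -
  obtain p q where 1: "p \<in> poly_funs \<Psi>" "q \<in> poly_funs \<Psi>" "q (\<phi> z) \<noteq> 0" "\<And>y. y \<in> T \<Longrightarrow> q y \<noteq> 0 \<Longrightarrow> f y = p y / q y"
    using reg_atE[OF assms(1)] by metis
  have pq: "reg_at S \<Phi> z (\<lambda>y. p (\<phi> y))" "reg_at S \<Phi> z (\<lambda>y. q (\<phi> y))"
    by (rule reg_at_poly_comp[where \<phi>=\<phi>, OF 1(1)], erule assms(2),
        rule reg_at_poly_comp[where \<phi>=\<phi>, OF 1(2)], erule assms(2))
  show ?thesis
    by (rule reg_at_local[OF pq(2) assms(3) 1(3) _ reg_at_divide[OF pq assms(3) 1(3)]]) (use 1(4) assms(4) in auto)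
qed

text \<open>The coordinates of \<phi> have to be regular only on the open set U, which admits maps
  given by local formulas.\<close>

lemma zopen_preimage:
  assumes "zopen S \<Phi> U" "\<And>y c. y \<in> U \<Longrightarrow> c \<in> \<Psi> \<Longrightarrow> reg_at S \<Phi> y (\<lambda>y. c (\<phi> y))"
    and "\<And>y. y \<in> U \<Longrightarrow> \<phi> y \<in> T" "zopen T \<Psi> V"
  shows "zopen S \<Phi> {y\<in>U. \<phi> y \<in> V}"
proof (rule zopenI)
  fix z assume z: "z \<in> {y\<in>U. \<phi> y \<in> V}"
  obtain q where q: "q \<in> poly_funs \<Psi>" "q (\<phi> z) \<noteq> 0" "\<forall>y\<in>T. q y \<noteq> 0 \<longrightarrow> y \<in> V" using zopenD[OF assms(4)] z by blast
  have "zopen S \<Phi> {y\<in>U. q (\<phi> y) \<noteq> 0}"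
    by (rule zopen_nonzero[OF assms(1)], rule reg_at_poly_comp[where \<phi>=\<phi>, OF q(1)], rule assms(2))
  moreover have "z \<in> {y\<in>U. q (\<phi> y) \<noteq> 0}" using z q by blast
  ultimately obtain r where r: "r \<in> poly_funs \<Phi>" "r z \<noteq> 0" "\<forall>y\<in>S. r y \<noteq> 0 \<longrightarrow> y \<in> {y\<in>U. q (\<phi> y) \<noteq> 0}"
    using zopenD by meson
  then show "\<exists>q\<in>poly_funs \<Phi>. q z \<noteq> 0 \<and> (\<forall>y\<in>S. q y \<noteq> 0 \<longrightarrow> y \<in> {y \<in> U. \<phi> y \<in> V})"
    using q(3) assms(3) by (intro bexI[OF _ r(1)]) auto
qed (use zopen_subset[OF assms(1)] in blast)

lemma reg_at_subset: "reg_at S \<Phi> z f \<Longrightarrow> T \<subseteq> S \<Longrightarrow> reg_at T \<Phi> z f"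
  unfolding reg_at_def by blast

lemma zopen_restrict:
  assumes "T \<subseteq> S"
  shows "zopen T \<Phi> V \<longleftrightarrow> (\<exists>U. zopen S \<Phi> U \<and> V = U \<inter> T)"
proof
  assume V: "zopen T \<Phi> V"
  let ?U = "\<Union>{{y\<in>S. q y \<noteq> 0} | q. q \<in> poly_funs \<Phi> \<and> {y\<in>T. q y \<noteq> 0} \<subseteq> V}"
  have "zopen S \<Phi> ?U" by (rule zopen_Union) (use zopen_basic in blast)
  moreover have "V = ?U \<inter> T"
  proof (intro equalityI subsetI)
    fix z assume z: "z \<in> V"
    then obtain q where "q \<in> poly_funs \<Phi>" "q z \<noteq> 0" "{y\<in>T. q y \<noteq> 0} \<subseteq> V" using V unfolding zopen_def by blast
    moreover have "z \<in> T" using z zopen_subset[OF V] by blast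
    ultimately show "z \<in> ?U \<inter> T" using assms by blast
  qed blast
  ultimately show "\<exists>U. zopen S \<Phi> U \<and> V = U \<inter> T" by blast
next
  assume "\<exists>U. zopen S \<Phi> U \<and> V = U \<inter> T"
  then obtain U where U: "zopen S \<Phi> U" "V = U \<inter> T" by blast
  show "zopen T \<Phi> V"
  proof (rule zopenI)
    fix z assume "z \<in> V"
    then obtain q where "q \<in> poly_funs \<Phi>" "q z \<noteq> 0" "\<forall>y\<in>S. q y \<noteq> 0 \<longrightarrow> y \<in> U"
      using zopenD[OF U(1)] U(2) by blast
    then show "\<exists>q\<in>poly_funs \<Phi>. q z \<noteq> 0 \<and> (\<forall>y\<in>T. q y \<noteq> 0 \<longrightarrow> y \<in> V)"
      using U(2) assms by (intro bexI[of _ q]) auto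
  qed (use U(2) in blast)
qed

subsection \<open>Spaces with a Zariski structure\<close>

text \<open>Equality with \<open>zariski_space S \<Phi>\<close> would be too strong, because
  \<open>sp_reg\<close> is meaningless on sets that are not open. Subspaces and quotients satisfy
  this weaker form, and the coordinates can then be changed freely.\<close>

definition is_zar :: "'a space_fun \<Rightarrow> 'a set \<Rightarrow> ('a \<Rightarrow> complex) set \<Rightarrow> bool" where
  "is_zar Z S \<Phi> \<longleftrightarrow> (\<forall>U. openin (sp_top Z) U \<longleftrightarrow> zopen S \<Phi> U) \<and>
     (\<forall>U f. zopen S \<Phi> U \<longrightarrow> (f \<in> sp_reg Z U \<longleftrightarrow> (\<forall>z\<in>U. reg_at S \<Phi> z f)))"

lemma is_zar_open: "is_zar Z S \<Phi> \<Longrightarrow> openin (sp_top Z) U \<longleftrightarrow> zopen S \<Phi> U"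
  by (simp add: is_zar_def)

lemma is_zar_reg: "is_zar Z S \<Phi> \<Longrightarrow> zopen S \<Phi> U \<Longrightarrow> f \<in> sp_reg Z U \<longleftrightarrow> (\<forall>z\<in>U. reg_at S \<Phi> z f)"
  by (simp add: is_zar_def)

lemma is_zar_carrier:
  assumes "is_zar Z S \<Phi>"
  shows "sp_carrier Z = S"
proof
  show "sp_carrier Z \<subseteq> S"
    using is_zar_open[OF assms, of "sp_carrier Z"] zopen_subset openin_topspace by blast
  show "S \<subseteq> sp_carrier Z"
    using is_zar_open[OF assms, of S] zopen_whole[of S \<Phi>] openin_subset by blast
qed

lemma is_zar_zariski: "is_zar (zariski_space S \<Phi>) S \<Phi>"
  unfolding is_zar_def
proof (intro conjI allI impI)
  show "openin (sp_top (zariski_space S \<Phi>)) U = zopen S \<Phi> U" for U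
    by (simp add: zariski_space_def openin_zariski_top)
  fix U f assume U: "zopen S \<Phi> U"
  have "(\<exists>V p q. zopen S \<Phi> V \<and> z \<in> V \<and> V \<subseteq> U \<and> p \<in> poly_funs \<Phi> \<and> q \<in> poly_funs \<Phi> \<and>
      (\<forall>y\<in>V. q y \<noteq> 0 \<and> f y = p y / q y)) \<longleftrightarrow> reg_at S \<Phi> z f" if z: "z \<in> U" for z
  proof
    assume "\<exists>V p q. zopen S \<Phi> V \<and> z \<in> V \<and> V \<subseteq> U \<and> p \<in> poly_funs \<Phi> \<and> q \<in> poly_funs \<Phi> \<and>
      (\<forall>y\<in>V. q y \<noteq> 0 \<and> f y = p y / q y)"
    then obtain V p q where *: "zopen S \<Phi> V" "z \<in> V" "p \<in> poly_funs \<Phi>" "q \<in> poly_funs \<Phi>"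
      "\<forall>y\<in>V. q y \<noteq> 0 \<and> f y = p y / q y" by blast
    show "reg_at S \<Phi> z f"
      by (rule reg_at_open_cong[OF *(1,2), of _ "\<lambda>y. p y / q y"]) (use * in \<open>auto intro: reg_atI[OF *(3,4)]\<close>)
  next
    assume "reg_at S \<Phi> z f"
    then obtain p q where 1: "p \<in> poly_funs \<Phi>" "q \<in> poly_funs \<Phi>" "q z \<noteq> 0" "\<And>y. y \<in> S \<Longrightarrow> q y \<noteq> 0 \<Longrightarrow> f y = p y / q y"
      using reg_atE by metis
    have "zopen S \<Phi> (U \<inter> {y\<in>S. q y \<noteq> 0})" by (rule zopen_Int[OF U zopen_basic[OF 1(2)]])
    then show "\<exists>V p q. zopen S \<Phi> V \<and> z \<in> V \<and> V \<subseteq> U \<and> p \<in> poly_funs \<Phi> \<and> q \<in> poly_funs \<Phi> \<and>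
      (\<forall>y\<in>V. q y \<noteq> 0 \<and> f y = p y / q y)"
      using 1 z zopen_subset[OF U]
      by (intro exI[of _ "U \<inter> {y\<in>S. q y \<noteq> 0}"] exI[of _ p] exI[of _ q]) auto
  qed
  then show "(f \<in> sp_reg (zariski_space S \<Phi>) U) = (\<forall>z\<in>U. reg_at S \<Phi> z f)"
    by (simp add: zariski_space_def openin_zariski_top)
qed

lemma is_zar_sub:
  assumes "is_zar Z S \<Phi>" "T \<subseteq> S"
  shows "is_zar (sp_sub Z T) T \<Phi>"
  unfolding is_zar_def
proof (intro conjI allI impI)
  show "openin (sp_top (sp_sub Z T)) U = zopen T \<Phi> U" for U
    by (simp add: sp_sub_def openin_subtopology zopen_restrict[OF assms(2)] is_zar_open[OF assms(1)])
  fix V f assume V: "zopen T \<Phi> V"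
  have "(\<exists>U h. zopen S \<Phi> U \<and> x \<in> U \<and> h \<in> sp_reg Z U \<and> (\<forall>y\<in>U \<inter> V. f y = h y)) \<longleftrightarrow> reg_at T \<Phi> x f"
    if x: "x \<in> V" for x
  proof
    assume "\<exists>U h. zopen S \<Phi> U \<and> x \<in> U \<and> h \<in> sp_reg Z U \<and> (\<forall>y\<in>U \<inter> V. f y = h y)"
    then obtain U h where *: "zopen S \<Phi> U" "x \<in> U" "h \<in> sp_reg Z U" "\<forall>y\<in>U \<inter> V. f y = h y" by blast
    have h: "reg_at T \<Phi> x h" using is_zar_reg[OF assms(1) *(1)] *(2,3) reg_at_subset[OF _ assms(2)] by blast
    have "zopen T \<Phi> (U \<inter> T)" using *(1) zopen_restrict[OF assms(2)] by blast
    then have "zopen T \<Phi> ((U \<inter> T) \<inter> V)" using V zopen_Int by blast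
    then show "reg_at T \<Phi> x f"
      by (rule reg_at_open_cong[OF _ _ _ h]) (use * x zopen_subset[OF V] in auto)
  next
    assume "reg_at T \<Phi> x f"
    then obtain p q where 1: "p \<in> poly_funs \<Phi>" "q \<in> poly_funs \<Phi>" "q x \<noteq> 0" "\<And>y. y \<in> T \<Longrightarrow> q y \<noteq> 0 \<Longrightarrow> f y = p y / q y"
      using reg_atE by metis
    let ?U = "{y\<in>S. q y \<noteq> 0}"
    have U: "zopen S \<Phi> ?U" by (rule zopen_basic[OF 1(2)])
    have "(\<lambda>y. p y / q y) \<in> sp_reg Z ?U"
      unfolding is_zar_reg[OF assms(1) U] by (auto intro: reg_atI[OF 1(1,2)])
    moreover have "x \<in> ?U" using x 1(3) zopen_subset[OF V] assms(2) by blast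
    moreover have "\<forall>y\<in>?U \<inter> V. f y = p y / q y" using 1(4) zopen_subset[OF V] by blast
    ultimately show "\<exists>U h. zopen S \<Phi> U \<and> x \<in> U \<and> h \<in> sp_reg Z U \<and> (\<forall>y\<in>U \<inter> V. f y = h y)"
      using U by blast
  qed
  then show "(f \<in> sp_reg (sp_sub Z T) V) = (\<forall>z\<in>V. reg_at T \<Phi> z f)"
    by (simp add: sp_sub_def is_zar_open[OF assms(1)])
qed

section \<open>Changes of coordinates, morphisms and isomorphisms\<close>

lemma is_zar_coords:
  assumes "is_zar Z S \<Phi>" "\<And>c z. c \<in> \<Phi> \<Longrightarrow> z \<in> S \<Longrightarrow> reg_at S \<Psi> z c" "\<And>c z. c \<in> \<Psi> \<Longrightarrow> z \<in> S \<Longrightarrow> reg_at S \<Phi> z c"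
  shows "is_zar Z S \<Psi>"
proof -
  have 1: "zopen S \<Psi> U" if "zopen S \<Phi> U" for U
    using zopen_preimage[OF zopen_whole[of S \<Psi>], of \<Phi> "\<lambda>y. y" S U] assms(2) that zopen_subset[OF that]
    by (simp add: Collect_conj_eq Int_absorb1)
  have 2: "zopen S \<Phi> U" if "zopen S \<Psi> U" for U
    using zopen_preimage[OF zopen_whole[of S \<Phi>], of \<Psi> "\<lambda>y. y" S U] assms(3) that zopen_subset[OF that]
    by (simp add: Collect_conj_eq Int_absorb1)
  have "reg_at S \<Psi> z f \<longleftrightarrow> reg_at S \<Phi> z f" if "z \<in> S" for z f
    using reg_at_comp[of S \<Phi> "\<lambda>y. y" z f S \<Psi>] reg_at_comp[of S \<Psi> "\<lambda>y. y" z f S \<Phi>] assms(2,3) that by blast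
  then show ?thesis
    using assms(1) 1 2 zopen_subset unfolding is_zar_def by (metis subsetD)
qed

text \<open>The target may have fewer open sets and fewer sections than the Zariski structure on T;
  this covers \<open>M_inf\<close>, where only that comparison is established.\<close>

lemma sp_morphismI:
  assumes "is_zar Z S \<Phi>" "topspace (sp_top W) = T"
    and "\<And>U. openin (sp_top W) U \<Longrightarrow> zopen T \<Psi> U"
    and "\<And>U f z. openin (sp_top W) U \<Longrightarrow> f \<in> sp_reg W U \<Longrightarrow> z \<in> U \<Longrightarrow> reg_at T \<Psi> z f"
    and "\<And>y. y \<in> S \<Longrightarrow> \<phi> y \<in> T" "\<And>c z. c \<in> \<Psi> \<Longrightarrow> z \<in> S \<Longrightarrow> reg_at S \<Phi> z (\<lambda>y. c (\<phi> y))"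
  shows "sp_morphism Z W \<phi>"
proof -
  have pre: "zopen S \<Phi> {y\<in>S. \<phi> y \<in> U}" if "openin (sp_top W) U" for U
    by (rule zopen_preimage[OF zopen_whole _ _ assms(3)[OF that]]) (use assms(5,6) in auto)
  show ?thesis
    unfolding sp_morphism_def continuous_map_def is_zar_carrier[OF assms(1)] assms(2)
  proof (intro conjI allI impI ballI)
    show "\<phi> \<in> S \<rightarrow> T" using assms(5) by blast
    show "openin (sp_top Z) {x \<in> S. \<phi> x \<in> U}" if "openin (sp_top W) U" for U
      using pre[OF that] is_zar_open[OF assms(1)] by blast
    fix U f assume U: "openin (sp_top W) U" "f \<in> sp_reg W U"
    show "f \<circ> \<phi> \<in> sp_reg Z {x \<in> S. \<phi> x \<in> U}"
      unfolding is_zar_reg[OF assms(1) pre[OF U(1)]] comp_def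
    proof
      fix z assume "z \<in> {x \<in> S. \<phi> x \<in> U}"
      then have z: "z \<in> S" "\<phi> z \<in> U" by auto
      show "reg_at S \<Phi> z (\<lambda>x. f (\<phi> x))"
        by (rule reg_at_comp[where \<phi>=\<phi>, OF assms(4)[OF U z(2)] _ z(1) assms(5)]) (rule assms(6)[OF _ z(1)])
    qed
  qed
qed

lemma sp_morphism_zar:
  assumes "is_zar Z S \<Phi>" "is_zar W T \<Psi>"
    and "\<And>y. y \<in> S \<Longrightarrow> \<phi> y \<in> T" "\<And>c z. c \<in> \<Psi> \<Longrightarrow> z \<in> S \<Longrightarrow> reg_at S \<Phi> z (\<lambda>y. c (\<phi> y))"
  shows "sp_morphism Z W \<phi>"
  by (rule sp_morphismI[OF assms(1) is_zar_carrier[OF assms(2)]])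
    (use is_zar_open[OF assms(2)] is_zar_reg[OF assms(2)] assms in auto)

lemma sp_iso_zar:
  assumes "is_zar Z S \<Phi>" "is_zar W T \<Psi>"
    and "\<And>y. y \<in> S \<Longrightarrow> \<phi> y \<in> T" "\<And>c z. c \<in> \<Psi> \<Longrightarrow> z \<in> S \<Longrightarrow> reg_at S \<Phi> z (\<lambda>y. c (\<phi> y))"
    and "\<And>y. y \<in> T \<Longrightarrow> \<psi> y \<in> S" "\<And>c z. c \<in> \<Phi> \<Longrightarrow> z \<in> T \<Longrightarrow> reg_at T \<Psi> z (\<lambda>y. c (\<psi> y))"
    and "\<And>y. y \<in> S \<Longrightarrow> \<psi> (\<phi> y) = y" "\<And>y. y \<in> T \<Longrightarrow> \<phi> (\<psi> y) = y"
  shows "sp_iso Z W \<phi>"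
proof -
  have m: "sp_morphism Z W \<phi>" "sp_morphism W Z \<psi>"
    by (rule sp_morphism_zar[OF assms(1,2)], erule assms(3), erule (1) assms(4),
        rule sp_morphism_zar[OF assms(2,1)], erule assms(5), erule (1) assms(6))
  then have "homeomorphic_maps (sp_top Z) (sp_top W) \<phi> \<psi>"
    unfolding homeomorphic_maps_def sp_morphism_def is_zar_carrier[OF assms(1)] is_zar_carrier[OF assms(2)]
    using assms(7,8) by blast
  then have "homeomorphic_map (sp_top Z) (sp_top W) \<phi>" using homeomorphic_map_maps by blast
  moreover have "f \<in> sp_reg W U" if U: "openin (sp_top W) U" and f: "f \<circ> \<phi> \<in> sp_reg Z {x \<in> S. \<phi> x \<in> U}" for U f
  proof -
    have zU: "zopen T \<Psi> U" using U is_zar_open[OF assms(2)] by blast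
    have "zopen S \<Phi> {x \<in> S. \<phi> x \<in> U}"
      by (rule zopen_preimage[OF zopen_whole _ _ zU]) (use assms in auto)
    then have f': "\<forall>z\<in>{x \<in> S. \<phi> x \<in> U}. reg_at S \<Phi> z (f \<circ> \<phi>)" using f is_zar_reg[OF assms(1)] by blast
    have "reg_at T \<Psi> z f" if z: "z \<in> U" for z
    proof -
      have zT: "z \<in> T" using z zopen_subset[OF zU] by blast
      then have "reg_at S \<Phi> (\<psi> z) (f \<circ> \<phi>)" using f' z assms(5,8) by force
      then have "reg_at T \<Psi> z (\<lambda>y. (f \<circ> \<phi>) (\<psi> y))" by (rule reg_at_comp[where \<phi>=\<psi>, OF _ _ zT]) (use assms(5,6) zT in auto)
      then show ?thesis by (rule reg_at_cong[rotated]) (simp add: assms(8))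
    qed
    then show ?thesis using is_zar_reg[OF assms(2) zU] by blast
  qed
  ultimately show ?thesis
    using m(1) unfolding sp_iso_def sp_morphism_def is_zar_carrier[OF assms(1)] by blast
qed

lemma is_zar_sheaf:
  assumes "is_zar Z S \<Phi>"
  shows "sheaf_of_functions Z"
  unfolding sheaf_of_functions_def is_zar_open[OF assms]
proof (intro conjI allI impI)
  fix U V f assume *: "zopen S \<Phi> U \<and> zopen S \<Phi> V \<and> V \<subseteq> U \<and> f \<in> sp_reg Z U"
  then have U: "zopen S \<Phi> U" and V: "zopen S \<Phi> V" by auto
  show "f \<in> sp_reg Z V" unfolding is_zar_reg[OF assms V] using * is_zar_reg[OF assms U, of f] by blast
next
  fix U f
  assume *: "zopen S \<Phi> U \<and> (\<forall>x\<in>U. \<exists>V. zopen S \<Phi> V \<and> x \<in> V \<and> V \<subseteq> U \<and> (\<exists>h\<in>sp_reg Z V. \<forall>y\<in>V. f y = h y))"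
  then have U: "zopen S \<Phi> U" by blast
  have "reg_at S \<Phi> z f" if "z \<in> U" for z
  proof -
    obtain V h where V: "zopen S \<Phi> V" "z \<in> V" "h \<in> sp_reg Z V" "\<forall>y\<in>V. f y = h y" using * \<open>z \<in> U\<close> by blast
    have "reg_at S \<Phi> z h" using V is_zar_reg[OF assms V(1)] by blast
    then show ?thesis using reg_at_open_cong[OF V(1,2)] V(4) by blast
  qed
  then show "f \<in> sp_reg Z U" unfolding is_zar_reg[OF assms U] by blast
qed

section \<open>Spaces with a single affine chart\<close>

abbreviation affine_carrier :: "nat \<Rightarrow> ((nat \<Rightarrow> complex) \<Rightarrow> complex) set \<Rightarrow> (nat \<Rightarrow> complex) set" where
  "affine_carrier N P \<equiv> {x. (\<forall>k\<ge>N. x k = 0) \<and> (\<forall>p\<in>P. p x = 0)}"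

lemma is_zar_affine: "is_zar (affine_variety N P) (affine_carrier N P) (affine_coords N)"
  unfolding affine_variety_def by (rule is_zar_zariski)

text \<open>One chart covers the whole space. For separatedness, coordinates separate points, so two
  morphisms agree exactly where the differences of their coordinates, which are regular functions,
  all vanish.\<close>

lemma affine_chart_variety:
  assumes Z: "is_zar Z S \<Phi>" and sep: "\<And>x y. x \<in> S \<Longrightarrow> y \<in> S \<Longrightarrow> (\<And>c. c \<in> \<Phi> \<Longrightarrow> c x = c y) \<Longrightarrow> x = y"
    and P: "P \<subseteq> poly_funs (affine_coords N)"
    and "\<And>y. y \<in> S \<Longrightarrow> \<phi> y \<in> affine_carrier N P" "\<And>k z. k < N \<Longrightarrow> z \<in> S \<Longrightarrow> reg_at S \<Phi> z (\<lambda>y. \<phi> y k)"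
    and "\<And>y. y \<in> affine_carrier N P \<Longrightarrow> \<psi> y \<in> S"
    and "\<And>c z. c \<in> \<Phi> \<Longrightarrow> z \<in> affine_carrier N P \<Longrightarrow> reg_at (affine_carrier N P) (affine_coords N) z (\<lambda>y. c (\<psi> y))"
    and "\<And>y. y \<in> S \<Longrightarrow> \<psi> (\<phi> y) = y" "\<And>y. y \<in> affine_carrier N P \<Longrightarrow> \<phi> (\<psi> y) = y"
  shows "variety Z"
proof -
  have "is_zar (sp_sub Z S) S \<Phi>" by (rule is_zar_sub[OF Z order_refl])
  then have iso: "sp_iso (sp_sub Z S) (affine_variety N P) \<phi>"
    by (rule sp_iso_zar[OF _ is_zar_affine, of _ _ _ _ _ _ \<psi>]) (use assms in \<open>auto simp: affine_coords_def\<close>)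
  have "prevariety Z"
    unfolding prevariety_def
    by (intro conjI is_zar_sheaf[OF Z] exI[of _ "{S}"] ballI)
      (use iso P zopen_whole is_zar_carrier[OF Z] is_zar_open[OF Z] in auto)
  moreover have "closedin (sp_top (affine_variety M Q)) {x \<in> sp_carrier (affine_variety M Q). \<alpha> x = \<beta> x}"
    if m: "sp_morphism (affine_variety M Q) Z \<alpha>" "sp_morphism (affine_variety M Q) Z \<beta>" for M Q \<alpha> \<beta>
  proof -
    let ?K = "affine_carrier M Q" and ?C = "affine_coords M"
    note A = is_zar_affine[of M Q]
    have mS: "\<alpha> x \<in> S" "\<beta> x \<in> S" if "x \<in> ?K" for x
      using m that unfolding sp_morphism_def continuous_map_def is_zar_carrier[OF Z] is_zar_carrier[OF A] by blast+
    have reg: "\<forall>z\<in>?K. reg_at ?K ?C z (\<lambda>x. c (\<gamma> x))"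
      if c: "c \<in> \<Phi>" and g: "sp_morphism (affine_variety M Q) Z \<gamma>" for c \<gamma>
    proof -
      have gS: "\<gamma> x \<in> S" if "x \<in> ?K" for x
        using g that unfolding sp_morphism_def continuous_map_def is_zar_carrier[OF Z] is_zar_carrier[OF A] by blast
      have "c \<in> sp_reg Z S" unfolding is_zar_reg[OF Z zopen_whole] using reg_at_coord[OF c] by blast
      moreover have "openin (sp_top Z) S" using is_zar_open[OF Z] zopen_whole by blast
      ultimately have "c \<circ> \<gamma> \<in> sp_reg (affine_variety M Q) {x \<in> ?K. \<gamma> x \<in> S}"
        using g unfolding sp_morphism_def is_zar_carrier[OF A] by blast
      moreover have "{x \<in> ?K. \<gamma> x \<in> S} = ?K" using gS by blast
      ultimately show ?thesis using is_zar_reg[OF A zopen_whole] by (simp add: comp_def)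
    qed
    have "zopen ?K ?C (\<Union>{{x\<in>?K. c (\<alpha> x) - c (\<beta> x) \<noteq> 0} | c. c \<in> \<Phi>})"
    proof (rule zopen_Union)
      fix U assume "U \<in> {{x\<in>?K. c (\<alpha> x) - c (\<beta> x) \<noteq> 0} | c. c \<in> \<Phi>}"
      then obtain c where c: "c \<in> \<Phi>" "U = {x\<in>?K. c (\<alpha> x) - c (\<beta> x) \<noteq> 0}" by blast
      show "zopen ?K ?C U"
        unfolding c(2)
      proof (rule zopen_nonzero[OF zopen_whole])
        fix z assume "z \<in> ?K"
        then show "reg_at ?K ?C z (\<lambda>x. c (\<alpha> x) - c (\<beta> x))"
          using reg_at_diff[OF bspec[OF reg[OF c(1) m(1)]] bspec[OF reg[OF c(1) m(2)]]] by blast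
      qed
    qed
    moreover have "(\<Union>{{x\<in>?K. c (\<alpha> x) - c (\<beta> x) \<noteq> 0} | c. c \<in> \<Phi>}) = ?K - {x \<in> ?K. \<alpha> x = \<beta> x}"
    proof (intro equalityI subsetI)
      fix x assume x: "x \<in> ?K - {x \<in> ?K. \<alpha> x = \<beta> x}"
      then have xK: "x \<in> ?K" "\<alpha> x \<noteq> \<beta> x" by auto
      have "\<exists>c\<in>\<Phi>. c (\<alpha> x) \<noteq> c (\<beta> x)"
      proof (rule ccontr)
        assume "\<not> ?thesis"
        then have "c (\<alpha> x) = c (\<beta> x)" if "c \<in> \<Phi>" for c using that by blast
        then show False using sep[OF mS(1)[OF xK(1)] mS(2)[OF xK(1)]] xK(2) by blast
      qed
      then show "x \<in> \<Union>{{x\<in>?K. c (\<alpha> x) - c (\<beta> x) \<noteq> 0} | c. c \<in> \<Phi>}" using x by auto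
    qed auto
    ultimately show ?thesis
      unfolding closedin_def is_zar_carrier[OF A] is_zar_open[OF A] by auto
  qed
  ultimately show ?thesis unfolding variety_def by blast
qed

text \<open>T is the union of the good neighbourhoods U intersected with the complement of the union
  of the sets U - T.\<close>

lemma locally_closedin_local:
  assumes "\<And>z. z \<in> T \<Longrightarrow> \<exists>U. openin X U \<and> z \<in> U \<and> openin X (U - T)"
  shows "locally_closedin X T"
proof -
  let ?K = "{U. openin X U \<and> openin X (U - T)}"
  have "openin X (\<Union>?K)" by (rule openin_Union) blast
  moreover have "openin X (\<Union>((\<lambda>U. U - T) ` ?K))" by (rule openin_Union) blast
  then have "closedin X (topspace X - \<Union>((\<lambda>U. U - T) ` ?K))" by (rule closedin_diff[OF closedin_topspace])
  moreover have "T = \<Union>?K \<inter> (topspace X - \<Union>((\<lambda>U. U - T) ` ?K))"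
    using assms openin_subset by fast
  ultimately show ?thesis unfolding locally_closedin_def by blast
qed

subsection \<open>Linear systems with regular coefficients\<close>

text \<open>
  Gaussian elimination with pivots that do not vanish at \<open>z\<close>: no determinants are needed to see
  that the unique solution depends regularly on the coefficients.
\<close>
lemma linear_system_regular:
  fixes M :: "'j \<Rightarrow> 'i \<Rightarrow> 'a \<Rightarrow> complex"
  assumes "finite I" "z \<in> S"
    and "\<And>i j. j \<in> J \<Longrightarrow> i \<in> I \<Longrightarrow> reg_at S \<Phi> z (M j i)" "\<And>j. j \<in> J \<Longrightarrow> reg_at S \<Phi> z (b j)"
    and "\<And>x. (\<And>j. j \<in> J \<Longrightarrow> (\<Sum>i\<in>I. M j i z * x i) = 0) \<Longrightarrow> (\<forall>i\<in>I. x i = 0)"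
  shows "\<exists>X r. (\<forall>i\<in>I. reg_at S \<Phi> z (X i)) \<and> reg_at S \<Phi> z r \<and> r z \<noteq> 0 \<and>
    (\<forall>y\<in>S. r y \<noteq> 0 \<longrightarrow> (\<forall>x. (\<forall>j\<in>J. (\<Sum>i\<in>I. M j i y * x i) = b j y) \<longrightarrow> (\<forall>i\<in>I. x i = X i y)))"
  using assms
proof (induction I arbitrary: M b rule: finite_induct)
  case empty
  show ?case by (intro exI[of _ "\<lambda>_ _. 0"] exI[of _ "\<lambda>_. 1"]) simp
next
  case (insert a F)
  \<comment> \<open>Otherwise the unit vector at a would be a nonzero solution at z. The system may
    be overdetermined and unsolvable near z: the claim only concerns solutions that exist.\<close>
  have "\<exists>j0\<in>J. M j0 a z \<noteq> 0"
  proof (rule ccontr)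
    assume "\<not> ?thesis"
    moreover have "(\<Sum>i\<in>F. M j i z * (if i = a then 1 else 0)) = 0" for j
      by (rule sum.neutral) (use insert.hyps in auto)
    ultimately have "(\<Sum>i\<in>insert a F. M j i z * (if i = a then 1 else 0)) = 0" if "j \<in> J" for j
      using insert.hyps that by simp
    from insert.prems(4)[OF this] show False by simp
  qed
  then obtain j0 where j0: "j0 \<in> J" "M j0 a z \<noteq> 0" by blast
  define M' where "M' j i y = M j i y - M j a y * M j0 i y / M j0 a y" for j i y
  define b' where "b' j y = b j y - M j a y * b j0 y / M j0 a y" for j y
  have red: "(\<Sum>i\<in>F. M' j i y * x i) = (\<Sum>i\<in>F. M j i y * x i) - M j a y / M j0 a y * (\<Sum>i\<in>F. M j0 i y * x i)" for j y x
    unfolding M'_def by (simp add: sum_distrib_left sum_subtractf algebra_simps)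
  have "\<exists>X r. (\<forall>i\<in>F. reg_at S \<Phi> z (X i)) \<and> reg_at S \<Phi> z r \<and> r z \<noteq> 0 \<and>
    (\<forall>y\<in>S. r y \<noteq> 0 \<longrightarrow> (\<forall>x. (\<forall>j\<in>J. (\<Sum>i\<in>F. M' j i y * x i) = b' j y) \<longrightarrow> (\<forall>i\<in>F. x i = X i y)))"
  proof (rule insert.IH[OF insert.prems(1)])
    show "reg_at S \<Phi> z (M' j i)" if "j \<in> J" "i \<in> F" for i j
      unfolding M'_def using insert.prems j0 that
      by (intro reg_at_diff reg_at_divide reg_at_mult) auto
    show "reg_at S \<Phi> z (b' j)" if "j \<in> J" for j
      unfolding b'_def using insert.prems j0 that
      by (intro reg_at_diff reg_at_divide reg_at_mult) auto
    fix x assume x: "\<And>j. j \<in> J \<Longrightarrow> (\<Sum>i\<in>F. M' j i z * x i) = 0"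
    define x' where "x' = x(a := - (\<Sum>i\<in>F. M j0 i z * x i) / M j0 a z)"
    have s: "(\<Sum>i\<in>F. M j i z * x' i) = (\<Sum>i\<in>F. M j i z * x i)" for j
      using insert.hyps by (intro sum.cong) (auto simp: x'_def)
    have "(\<Sum>i\<in>insert a F. M j i z * x' i) = 0" if "j \<in> J" for j
      using x[OF that] insert.hyps j0(2) by (simp add: red s) (simp add: x'_def)
    from insert.prems(4)[OF this] have x'0: "\<forall>i\<in>insert a F. x' i = 0" .
    show "\<forall>i\<in>F. x i = 0"
    proof
      fix i assume i: "i \<in> F"
      then have "x' i = x i" using insert.hyps unfolding x'_def by (metis fun_upd_other)
      then show "x i = 0" using x'0 i by simp
    qed
  qed
  then obtain X r where X: "\<And>i. i \<in> F \<Longrightarrow> reg_at S \<Phi> z (X i)" and r: "reg_at S \<Phi> z r" "r z \<noteq> 0"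
    and sol: "\<And>y x. y \<in> S \<Longrightarrow> r y \<noteq> 0 \<Longrightarrow> (\<forall>j\<in>J. (\<Sum>i\<in>F. M' j i y * x i) = b' j y) \<Longrightarrow> (\<forall>i\<in>F. x i = X i y)"
    by blast
  define X' where "X' = X(a := (\<lambda>y. (b j0 y - (\<Sum>i\<in>F. M j0 i y * X i y)) / M j0 a y))"
  show ?case
  proof (intro exI[of _ X'] exI[of _ "\<lambda>y. r y * M j0 a y"] conjI ballI impI allI)
    show "reg_at S \<Phi> z (X' i)" if "i \<in> insert a F" for i
    proof (cases "i = a")
      case True
      have "reg_at S \<Phi> z (\<lambda>y. (b j0 y - (\<Sum>i\<in>F. M j0 i y * X i y)) / M j0 a y)"
        using insert.prems j0 X by (intro reg_at_divide reg_at_diff reg_at_sum reg_at_mult) auto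
      then show ?thesis by (simp add: X'_def True)
    next
      case False
      then show ?thesis using X that by (simp add: X'_def)
    qed
    show "reg_at S \<Phi> z (\<lambda>y. r y * M j0 a y)" using r insert.prems j0 by (intro reg_at_mult) auto
    show "r z * M j0 a z \<noteq> 0" using r j0 by simp
    fix y x i assume y: "y \<in> S" "r y * M j0 a y \<noteq> 0"
      and x: "\<forall>j\<in>J. (\<Sum>i\<in>insert a F. M j i y * x i) = b j y" and i: "i \<in> insert a F"
    have eq: "M j a y * x a + (\<Sum>i\<in>F. M j i y * x i) = b j y" if "j \<in> J" for j
      using x that insert.hyps by simp
    have xa: "x a = (b j0 y - (\<Sum>i\<in>F. M j0 i y * x i)) / M j0 a y"
      using eq[OF j0(1)] y(2) by (simp add: field_simps)
    have "(\<Sum>i\<in>F. M' j i y * x i) = b' j y" if "j \<in> J" for j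
    proof -
      have "(\<Sum>i\<in>F. M j i y * x i) = b j y - M j a y * x a" using eq[OF that] by (simp add: algebra_simps)
      then show ?thesis unfolding red b'_def using y(2) by (simp add: xa field_simps)
    qed
    then have xF: "\<forall>i\<in>F. x i = X i y" using sol y by auto
    then have "(\<Sum>i\<in>F. M j0 i y * x i) = (\<Sum>i\<in>F. M j0 i y * X i y)" by (intro sum.cong) auto
    then show "x i = X' i y" using i xF xa by (auto simp: X'_def)
  qed
qed

text \<open>Column j of the inverse is the unique solution of g x = e_j, so elimination takes the
  place of Cramer's rule.\<close>

lemma minv_regular:
  assumes "z \<in> S" "\<And>y. y \<in> S \<Longrightarrow> g y \<in> GL n" "\<And>i j. reg_at S \<Phi> z (\<lambda>y. g y i j)"
  shows "reg_at S \<Phi> z (\<lambda>y. minv (g y) i j)"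
proof (cases "i < n \<and> j < n")
  case True
  have gl: "g y i k = mone i k" "minv (g y) i k = mone i k" if "y \<in> S" "n \<le> i \<or> n \<le> k" for y i k
    using GL_Mn[OF assms(2)[OF that(1)]] GL_Mn[OF minv_GL(1)[OF assms(2)[OF that(1)]]] that(2) by (auto simp: Mn_def)
  have row: "(g y \<odot> B) i k = (\<Sum>l<n. g y i l * B l k)" "(minv (g y) \<odot> B) i k = (\<Sum>l<n. minv (g y) i l * B l k)"
    if "y \<in> S" "i < n" for y i k B
    by (rule mmul_sum; use that in \<open>simp add: gl mone_def\<close>)+
  have "\<exists>X r. (\<forall>i\<in>{..<n}. reg_at S \<Phi> z (X i)) \<and> reg_at S \<Phi> z r \<and> r z \<noteq> 0 \<and>
    (\<forall>y\<in>S. r y \<noteq> 0 \<longrightarrow> (\<forall>x. (\<forall>k\<in>{..<n}. (\<Sum>l\<in>{..<n}. g y k l * x l) = mone k j) \<longrightarrow> (\<forall>i\<in>{..<n}. x i = X i y)))"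
  proof (rule linear_system_regular[of "{..<n}" z S "{..<n}" \<Phi> "\<lambda>k l y. g y k l" "\<lambda>k y. mone k j"])
    fix x assume x: "\<And>k. k \<in> {..<n} \<Longrightarrow> (\<Sum>l\<in>{..<n}. g z k l * x l) = 0"
    define B :: imat where "B = (\<lambda>k c. if k < n \<and> c = 0 then x k else 0)"
    show "\<forall>i\<in>{..<n}. x i = 0"
    proof
      fix i assume i: "i \<in> {..<n}"
      have "B \<in> gl n" using i by (auto simp: B_def gl_def)
      then have "g z \<odot> B \<in> gl n" by (rule gl_mmul_blk(2)) (use blk_Mn[OF GL_Mn[OF assms(2)[OF assms(1)]]] in simp)
      moreover have "(g z \<odot> B) k c = 0" if "k < n" for k c
        using row(1)[OF assms(1) that] x[of k] that by (cases "c = 0") (auto simp: B_def)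
      ultimately have gB: "g z \<odot> B = 0" by (intro ext) (metis gl_outside not_le zero_fun_apply)
      have "B = minv (g z) \<odot> (g z \<odot> B)" using GL_GL_inf[OF assms(2)[OF assms(1)]] by simp
      then have "B i 0 = 0" unfolding gB by simp
      then show "x i = 0" using i by (simp add: B_def)
    qed
  qed (use assms in auto)
  then obtain X r where X: "\<forall>i\<in>{..<n}. reg_at S \<Phi> z (X i)" "reg_at S \<Phi> z r" "r z \<noteq> 0"
    and sol: "\<And>y x. y \<in> S \<Longrightarrow> r y \<noteq> 0 \<Longrightarrow> (\<forall>k\<in>{..<n}. (\<Sum>l\<in>{..<n}. g y k l * x l) = mone k j) \<Longrightarrow> (\<forall>i\<in>{..<n}. x i = X i y)"
    by blast
  have "minv (g y) i j = X i y" if y: "y \<in> S" "r y \<noteq> 0" for y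
  proof -
    have "(\<Sum>l\<in>{..<n}. g y k l * minv (g y) l j) = mone k j" if "k \<in> {..<n}" for k
      using row(1)[OF y(1), of k "minv (g y)" j] minv_GL(2)[OF assms(2)[OF y(1)]] that by simp
    then show ?thesis using sol[OF y, of "\<lambda>l. minv (g y) l j"] True by blast
  qed
  then show ?thesis by (rule reg_at_local[OF X(2) assms(1) X(3)]) (use X(1) True in auto)
next
  case False
  then have "minv (g y) i j = mone i j" if "y \<in> S" for y
    using GL_Mn[OF minv_GL(1)[OF assms(2)[OF that]]] by (auto simp: Mn_def)
  then show ?thesis by (rule reg_at_cong) simp_all
qed

section \<open>The group and orbit spaces as Zariski spaces\<close>

text \<open>All entries instead of those of a block: outside the block they are constant on gl(n),
  GL(n) and \<open>Mn n\<close>, so one coordinate system serves every n.\<close>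

definition ecoords :: "(imat \<Rightarrow> complex) set" where
  "ecoords = {(\<lambda>Z. Z i j) | i j. True}"

lemma reg_at_entry [simp]: "reg_at S ecoords z (\<lambda>Z. Z i j)"
  by (rule reg_at_coord) (auto simp: ecoords_def)

lemma ecoordsE: "c \<in> ecoords \<Longrightarrow> (\<And>i j. c = (\<lambda>Z. Z i j) \<Longrightarrow> thesis) \<Longrightarrow> thesis"
  by (auto simp: ecoords_def)

lemma is_zar_block:
  assumes "\<And>Z i j. Z \<in> S \<Longrightarrow> n \<le> i \<or> n \<le> j \<Longrightarrow> Z i j = c i j"
  shows "is_zar (zariski_space S (gl_coords n)) S ecoords"
proof (rule is_zar_coords[OF is_zar_zariski])
  fix f z assume "f \<in> gl_coords n" "z \<in> S"
  then show "reg_at S ecoords z f" by (auto simp: gl_coords_def)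
next
  fix f z assume f: "f \<in> ecoords" and "z \<in> S"
  obtain i j where f: "f = (\<lambda>Z. Z i j)" by (rule ecoordsE[OF f])
  show "reg_at S (gl_coords n) z f"
  proof (cases "i < n \<and> j < n")
    case True
    then show ?thesis unfolding f by (intro reg_at_coord) (auto simp: gl_coords_def)
  next
    case False
    then have "f y = c i j" if "y \<in> S" for y using assms[OF that, of i j] by (auto simp: f)
    then show ?thesis by (rule reg_at_cong) simp_all
  qed
qed

lemma is_zar_GL: "is_zar (GL_space n) (GL n) ecoords"
  unfolding GL_space_def by (rule is_zar_block[of _ _ mone]) (auto simp: GL_def)

lemma is_zar_gl: "is_zar (gl_space n) (gl n) ecoords"
  unfolding gl_space_def by (rule is_zar_block[of _ _ "\<lambda>_ _. 0"]) (auto simp: gl_def)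

lemma reg_at_mmul:
  assumes "\<And>y. y \<in> S \<Longrightarrow> A y \<in> Mn n" "\<And>i j. reg_at S \<Phi> z (\<lambda>y. A y i j)" "\<And>i j. reg_at S \<Phi> z (\<lambda>y. B y i j)"
  shows "reg_at S \<Phi> z (\<lambda>y. (A y \<odot> B y) i j)"
proof -
  have "(A y \<odot> B y) i j = (\<Sum>l<max n (Suc i). A y i l * B y l j)" if "y \<in> S" for y
    using assms(1)[OF that] by (intro mmul_sum) (auto simp: Mn_def mone_def)
  then show ?thesis by (rule reg_at_cong) (assumption, intro reg_at_sum reg_at_mult assms(2,3))
qed

lemma reg_at_mmul_right:
  assumes "\<And>y. y \<in> S \<Longrightarrow> B y \<in> Mn n" "\<And>i j. reg_at S \<Phi> z (\<lambda>y. A y i j)" "\<And>i j. reg_at S \<Phi> z (\<lambda>y. B y i j)"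
  shows "reg_at S \<Phi> z (\<lambda>y. (A y \<odot> B y) i j)"
proof -
  have "(A y \<odot> B y) i j = (\<Sum>l<max n (Suc j). A y i l * B y l j)" if "y \<in> S" for y
    using assms(1)[OF that] by (intro mmul_sum) (auto simp: Mn_def mone_def)
  then show ?thesis by (rule reg_at_cong) (assumption, intro reg_at_sum reg_at_mult assms(2,3))
qed

lemma reg_at_Ad:
  assumes "z \<in> GL n"
  shows "reg_at (GL n) ecoords z (\<lambda>g. Ad g X i j)"
  unfolding Ad_def
proof (rule reg_at_mmul_right[of _ _ n])
  show "minv y \<in> Mn n" if "y \<in> GL n" for y using minv_GL(1)[OF that] by simp
  show "reg_at (GL n) ecoords z (\<lambda>y. (y \<odot> X) i j)" for i j
    by (rule reg_at_mmul[of _ _ n]) simp_all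
  show "reg_at (GL n) ecoords z (\<lambda>y. minv y i j)" for i j
    by (rule minv_regular[OF assms]) simp_all
qed

section \<open>The orbit as a copy of the group\<close>

definition orbit_elt :: "imat \<Rightarrow> imat \<Rightarrow> imat" where
  "orbit_elt X Y = (THE g. g \<in> GL_inf \<and> Ad g X = Y)"

text \<open>With a trivial stabilizer the quotient structure of the orbit is that of GL(n), so the
  coordinates are the entries of the group element and not those of Y.\<close>

definition orbit_coords :: "imat \<Rightarrow> (imat \<Rightarrow> complex) set" where
  "orbit_coords X = {(\<lambda>Y. orbit_elt X Y i j) | i j. True}"

lemma orbit_coordsE: "c \<in> orbit_coords X \<Longrightarrow> (\<And>i j. c = (\<lambda>Y. orbit_elt X Y i j) \<Longrightarrow> thesis) \<Longrightarrow> thesis"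
  by (auto simp: orbit_coords_def)

lemma reg_at_orbit_elt [simp]: "reg_at S (orbit_coords X) z (\<lambda>Y. orbit_elt X Y i j)"
  by (rule reg_at_coord) (auto simp: orbit_coords_def)

lemma orbit_elt_Ad:
  assumes "strong_reg X" "g \<in> GL_inf"
  shows "orbit_elt X (Ad g X) = g"
  unfolding orbit_elt_def by (rule the_equality) (use assms strong_reg_Ad_inj in auto)

lemma orbit_elt_orbit:
  assumes "strong_reg X" "Y \<in> GL_orbit n X"
  shows "orbit_elt X Y \<in> GL n" "Ad (orbit_elt X Y) X = Y"
proof -
  obtain g where "g \<in> GL n" "Y = Ad g X" using assms(2) by (auto simp: GL_orbit_def)
  then show "orbit_elt X Y \<in> GL n" "Ad (orbit_elt X Y) X = Y" using orbit_elt_Ad[OF assms(1) GL_GL_inf] by simp_all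
qed

lemma reg_at_orbit_GL:
  assumes X: "strong_reg X" and g: "g \<in> GL n" and f: "reg_at (GL_orbit n X) (orbit_coords X) (Ad g X) f"
  shows "reg_at (GL n) ecoords g (\<lambda>g. f (Ad g X))"
proof (rule reg_at_comp[where \<phi>="\<lambda>g. Ad g X", OF f _ g])
  show "Ad h X \<in> GL_orbit n X" if "h \<in> GL n" for h using that by (auto simp: GL_orbit_def)
  fix c assume "c \<in> orbit_coords X"
  then obtain i j where c: "c = (\<lambda>Y. orbit_elt X Y i j)" by (rule orbit_coordsE)
  have "c (Ad h X) = h i j" if "h \<in> GL n" for h unfolding c by (simp add: orbit_elt_Ad[OF X GL_GL_inf[OF that]])
  then show "reg_at (GL n) ecoords g (\<lambda>h. c (Ad h X))" by (rule reg_at_cong) simp_all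
qed

lemma reg_at_GL_orbit:
  assumes X: "strong_reg X" and Y: "Y \<in> GL_orbit n X" and f: "reg_at (GL n) ecoords (orbit_elt X Y) f"
  shows "reg_at (GL_orbit n X) (orbit_coords X) Y (\<lambda>Y. f (orbit_elt X Y))"
  by (rule reg_at_comp[where \<phi>="orbit_elt X", OF f _ Y orbit_elt_orbit(1)[OF X]]) (auto elim: ecoordsE)

lemma is_zar_orbit:
  assumes X: "strong_reg X"
  shows "is_zar (orbit_space n X) (GL_orbit n X) (orbit_coords X)"
proof -
  let ?O = "GL_orbit n X" and ?G = "\<lambda>U. {g \<in> GL n. Ad g X \<in> U}"
  have 1: "zopen (GL n) ecoords (?G U)" if U: "zopen ?O (orbit_coords X) U" for U
  proof (rule zopen_preimage[OF zopen_whole _ _ U])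
    show "reg_at (GL n) ecoords y (\<lambda>y. c (Ad y X))" if "y \<in> GL n" "c \<in> orbit_coords X" for y c
      by (rule reg_at_orbit_GL[OF X that(1) reg_at_coord[OF that(2)]])
  qed (auto simp: GL_orbit_def)
  have 2: "zopen ?O (orbit_coords X) U" if U: "zopen (GL n) ecoords (?G U)" "U \<subseteq> ?O" for U
  proof -
    have "zopen ?O (orbit_coords X) {Y \<in> ?O. orbit_elt X Y \<in> ?G U}"
      by (rule zopen_preimage[OF zopen_whole _ orbit_elt_orbit(1)[OF X] U(1)]) (auto elim: ecoordsE)
    moreover have "{Y \<in> ?O. orbit_elt X Y \<in> ?G U} = U" using U(2) orbit_elt_orbit[OF X] by auto
    ultimately show ?thesis by simp
  qed
  have o: "openin (sp_top (orbit_space n X)) U \<longleftrightarrow> zopen ?O (orbit_coords X) U" for U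
    unfolding openin_orbit_space is_zar_open[OF is_zar_GL] using 1 2 zopen_subset[of ?O "orbit_coords X" U] by blast
  have "f \<in> sp_reg (orbit_space n X) U \<longleftrightarrow> (\<forall>Y\<in>U. reg_at ?O (orbit_coords X) Y f)" if U: "zopen ?O (orbit_coords X) U" for U f
  proof -
    have "f \<in> sp_reg (orbit_space n X) U \<longleftrightarrow> (\<forall>g\<in>?G U. reg_at (GL n) ecoords g (\<lambda>g. f (Ad g X)))"
      unfolding is_zar_reg[OF is_zar_GL 1[OF U], symmetric] by (simp add: orbit_space_def)
    also have "\<dots> \<longleftrightarrow> (\<forall>Y\<in>U. reg_at ?O (orbit_coords X) Y f)"
    proof (intro iffI ballI)
      fix Y assume *: "\<forall>g\<in>?G U. reg_at (GL n) ecoords g (\<lambda>g. f (Ad g X))" and Y: "Y \<in> U"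
      then have YO: "Y \<in> ?O" using zopen_subset[OF U] by blast
      have "reg_at (GL n) ecoords (orbit_elt X Y) (\<lambda>g. f (Ad g X))" using * orbit_elt_orbit[OF X YO] Y by simp
      then have "reg_at ?O (orbit_coords X) Y (\<lambda>Y. f (Ad (orbit_elt X Y) X))" by (rule reg_at_GL_orbit[OF X YO])
      then show "reg_at ?O (orbit_coords X) Y f" by (rule reg_at_cong[rotated]) (simp add: orbit_elt_orbit(2)[OF X])
    next
      fix g assume "\<forall>Y\<in>U. reg_at ?O (orbit_coords X) Y f" "g \<in> ?G U"
      then show "reg_at (GL n) ecoords g (\<lambda>g. f (Ad g X))" using reg_at_orbit_GL[OF X, of g n f] by simp
    qed
    finally show ?thesis .
  qed
  with o show ?thesis unfolding is_zar_def by blast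
qed

lemma reg_at_orbit_entry:
  assumes "strong_reg X" "Y \<in> GL_orbit n X"
  shows "reg_at (GL_orbit n X) (orbit_coords X) Y (\<lambda>Y. Y i j)"
proof -
  have "reg_at (GL_orbit n X) (orbit_coords X) Y (\<lambda>Y. Ad (orbit_elt X Y) X i j)"
    by (rule reg_at_GL_orbit[OF assms reg_at_Ad[OF orbit_elt_orbit(1)[OF assms]]])
  then show ?thesis by (rule reg_at_cong[rotated]) (simp add: orbit_elt_orbit(2)[OF assms(1)])
qed

section \<open>Regularity of the factors and local closedness\<close>

text \<open>Let m = c + x q be the minimal polynomial of the corner Z of w. Multiplying m(Z) = 0 by
  the left inverse a gives q(Z) = - c a. If c were 0, q would be an annihilator of smaller degree;
  so a is a polynomial in Z and also a right inverse.\<close>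

lemma left_inverse_Mn:
  assumes "a \<in> Mn n" "w \<in> Mn n" "a \<odot> w = mone"
  shows "w \<in> GL n" "minv w = a"
proof -
  define Z where "Z = corner n w"
  have Z: "Z \<in> gl n" by (simp add: Z_def)
  have b: "blk n a" "blk n w" using blk_Mn assms by blast+
  have aZ: "corner n a \<odot> Z = corner n mone" using b assms(3) by (simp add: Z_def corner_mmul[symmetric])
  obtain m where m: "m \<noteq> 0" "pv n Z m = 0"
    and min: "\<And>q. q \<noteq> 0 \<Longrightarrow> pv n Z q = 0 \<Longrightarrow> degree m \<le> degree q"
    using minimal_poly[OF Z] by metis
  obtain c q where cq: "m = pCons c q" by (rule pCons_cases)
  have e: "msmult c (corner n mone) + Z \<odot> pv n Z q = 0" using m(2) Z by (simp add: cq pv_pCons)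
  have "corner n a \<odot> (Z \<odot> pv n Z q) = pv n Z q"
    using aZ Z by (simp add: mmul_assoc[symmetric] corner_mone_left)
  moreover have "Z \<odot> pv n Z q = msmult (- c) (corner n mone)"
    using e by (simp add: eq_neg_iff_add_eq_0 add.commute)
  ultimately have q: "pv n Z q = msmult (- c) (corner n a)"
    by (simp add: mmul_msmult_right corner_mone_right mmul_uminus_right)
  have "c \<noteq> 0"
  proof
    assume c0: "c = 0"
    then have "q \<noteq> 0" using m(1) cq by auto
    moreover have "pv n Z q = 0" using q c0 by simp
    ultimately have "degree m \<le> degree q" by (rule min)
    then show False using cq c0 \<open>q \<noteq> 0\<close> by simp
  qed
  have "msmult c (corner n mone) + Z \<odot> msmult (- c) (corner n a) = 0" using e q by simp
  then have "msmult c (Z \<odot> corner n a) = msmult c (corner n mone)"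
    by (simp add: mmul_msmult_right mmul_uminus_right eq_commute[of "corner n mone"])
  then have "Z \<odot> corner n a = corner n mone" using \<open>c \<noteq> 0\<close> by simp
  then have "corner n (w \<odot> a) = corner n mone" using b by (simp add: Z_def corner_mmul)
  then have "w \<odot> a = mone" by (rule corner_eq_Mn[rotated 2]) (use assms in simp_all)
  then show "w \<in> GL n" "minv w = a" using GL_I[OF assms(2,1)] assms(3) by simp_all
qed

text \<open>
  \<open>g = h z\<close> with \<open>h \<in> GL(n)\<close> and \<open>z\<close> centralizing \<open>X\<^sub>n\<^sub>+\<^sub>1\<close> holds iff \<open>w = z\<^sup>-\<^sup>1\<close> satisfies the
  following system, which is linear in \<open>w\<close>.
\<close>
definition fsol :: "nat \<Rightarrow> imat \<Rightarrow> imat \<Rightarrow> imat \<Rightarrow> bool" where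
  "fsol n X g w \<longleftrightarrow> w \<in> Mn (Suc n) \<and> w \<odot> corner (Suc n) X = corner (Suc n) X \<odot> w \<and> g \<odot> w \<in> Mn n"

text \<open>The flag \<open>True\<close> marks the entries of the commutation equation.
  \<open>False\<close> marks the condition on \<open>g \<odot> w\<close>, of which only the last row
  and column of the block remain to be imposed, as the product lies in \<open>Mn (Suc n)\<close>
  anyway.\<close>

definition feqs :: "nat \<Rightarrow> (bool \<times> nat \<times> nat) set" where
  "feqs n = {(b, i, j). i < Suc n \<and> j < Suc n \<and> (b \<or> i = n \<or> j = n)}"

definition fmat :: "nat \<Rightarrow> imat \<Rightarrow> bool \<times> nat \<times> nat \<Rightarrow> nat \<times> nat \<Rightarrow> imat \<Rightarrow> complex" where
  "fmat n X q p g = (case q of (b, i, j) \<Rightarrow> case p of (l, m) \<Rightarrow>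
     if b then (if l = i then corner (Suc n) X m j else 0) - (if m = j then corner (Suc n) X i l else 0)
     else (if m = j then g i l else 0))"

definition frhs :: "bool \<times> nat \<times> nat \<Rightarrow> complex" where
  "frhs q = (case q of (b, i, j) \<Rightarrow> if b then 0 else mone i j)"

abbreviation fidx :: "nat \<Rightarrow> (nat \<times> nat) set" where
  "fidx n \<equiv> {..<Suc n} \<times> {..<Suc n}"

lemma fmat_sum_True:
  assumes "i < Suc n" "j < Suc n"
  shows "(\<Sum>p\<in>fidx n. fmat n X (True, i, j) p g * w (fst p) (snd p)) =
    (w \<odot> corner (Suc n) X - corner (Suc n) X \<odot> w) i j"
proof -
  have "(\<Sum>p\<in>fidx n. fmat n X (True, i, j) p g * w (fst p) (snd p)) =
      (\<Sum>l<Suc n. \<Sum>m<Suc n. fmat n X (True, i, j) (l, m) g * w l m)"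
    by (simp add: sum.cartesian_product case_prod_unfold del: sum.lessThan_Suc)
  also have "\<dots> = (\<Sum>l<Suc n. \<Sum>m<Suc n. (if l = i then corner (Suc n) X m j * w l m else 0))
      - (\<Sum>l<Suc n. \<Sum>m<Suc n. (if m = j then corner (Suc n) X i l * w l m else 0))"
    unfolding sum_subtractf[symmetric] by (intro sum.cong refl) (simp add: fmat_def left_diff_distrib)
  also have "(\<Sum>l<Suc n. \<Sum>m<Suc n. (if l = i then corner (Suc n) X m j * w l m else 0)) =
      (\<Sum>m<Suc n. corner (Suc n) X m j * w i m)"
    using assms by (subst sum.swap) (simp add: sum.delta del: sum.lessThan_Suc)
  also have "(\<Sum>l<Suc n. \<Sum>m<Suc n. (if m = j then corner (Suc n) X i l * w l m else 0)) =
      (\<Sum>l<Suc n. corner (Suc n) X i l * w l j)"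
    using assms by (simp add: sum.delta del: sum.lessThan_Suc)
  finally show ?thesis
    by (simp add: gl_mmul_apply[of _ "Suc n"] mult.commute del: sum.lessThan_Suc)
qed

lemma fmat_sum_False:
  assumes "i < Suc n" "j < Suc n" "g \<in> Mn (Suc n)"
  shows "(\<Sum>p\<in>fidx n. fmat n X (False, i, j) p g * w (fst p) (snd p)) = (g \<odot> w) i j"
proof -
  have "(\<Sum>p\<in>fidx n. fmat n X (False, i, j) p g * w (fst p) (snd p)) =
      (\<Sum>l<Suc n. \<Sum>m<Suc n. fmat n X (False, i, j) (l, m) g * w l m)"
    by (simp add: sum.cartesian_product case_prod_unfold del: sum.lessThan_Suc)
  also have "\<dots> = (\<Sum>l<Suc n. \<Sum>m<Suc n. (if m = j then g i l * w l m else 0))"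
    by (intro sum.cong refl) (simp add: fmat_def)
  also have "\<dots> = (\<Sum>l<Suc n. g i l * w l j)"
    using assms by (simp add: sum.delta del: sum.lessThan_Suc)
  also have "\<dots> = (g \<odot> w) i j"
    using assms by (intro mmul_sum[symmetric]) (auto simp: Mn_def mone_def)
  finally show ?thesis .
qed

lemma gl_eq_0_iff:
  assumes "D \<in> gl n"
  shows "D = 0 \<longleftrightarrow> (\<forall>i<n. \<forall>j<n. D i j = 0)"
proof
  assume *: "\<forall>i<n. \<forall>j<n. D i j = 0"
  show "D = 0"
  proof (intro ext)
    fix i j
    show "D i j = 0 i j" using * gl_outside[OF assms, of i j] by (cases "i < n \<and> j < n") auto
  qed
qed simp

lemma fsol_iff:
  assumes "g \<in> Mn (Suc n)" "w \<in> Mn (Suc n)"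
  shows "fsol n X g w \<longleftrightarrow> (\<forall>q\<in>feqs n. (\<Sum>p\<in>fidx n. fmat n X q p g * w (fst p) (snd p)) = frhs q)"
proof -
  let ?D = "w \<odot> corner (Suc n) X - corner (Suc n) X \<odot> w"
  have "blk (Suc n) w" by (rule blk_Mn[OF assms(2)]) simp
  then have "?D \<in> gl (Suc n)" using gl_mmul_blk[of "corner (Suc n) X" "Suc n" w] by simp
  then have D: "?D = 0 \<longleftrightarrow> (\<forall>i<Suc n. \<forall>j<Suc n. ?D i j = 0)" by (rule gl_eq_0_iff)
  have gw: "g \<odot> w \<in> Mn (Suc n)" using assms by simp
  have M: "g \<odot> w \<in> Mn n \<longleftrightarrow> (\<forall>i<Suc n. \<forall>j<Suc n. i = n \<or> j = n \<longrightarrow> (g \<odot> w) i j = mone i j)"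
  proof
    assume *: "\<forall>i<Suc n. \<forall>j<Suc n. i = n \<or> j = n \<longrightarrow> (g \<odot> w) i j = mone i j"
    have "(g \<odot> w) i j = mone i j" if "n \<le> i \<or> n \<le> j" for i j
    proof (cases "i < Suc n \<and> j < Suc n")
      case True
      then have "i = n \<or> j = n" using that by auto
      then show ?thesis using * True by blast
    next
      case False
      then show ?thesis using gw by (auto simp: Mn_def)
    qed
    then show "g \<odot> w \<in> Mn n" by (simp add: Mn_def)
  qed (auto simp: Mn_def)
  have "fsol n X g w \<longleftrightarrow> ?D = 0 \<and> g \<odot> w \<in> Mn n" using assms(2) by (simp add: fsol_def)
  also have "\<dots> \<longleftrightarrow> (\<forall>q\<in>feqs n. (\<Sum>p\<in>fidx n. fmat n X q p g * w (fst p) (snd p)) = frhs q)"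
  proof (intro iffI ballI conjI)
    fix q assume *: "?D = 0 \<and> g \<odot> w \<in> Mn n" and q: "q \<in> feqs n"
    obtain b i j where qq: "q = (b, i, j)" by (cases q)
    then have ij: "i < Suc n" "j < Suc n" "b \<or> i = n \<or> j = n" using q by (auto simp: feqs_def)
    show "(\<Sum>p\<in>fidx n. fmat n X q p g * w (fst p) (snd p)) = frhs q"
    proof (cases b)
      case True
      then show ?thesis using fmat_sum_True[OF ij(1,2), of X g w] * by (simp only: qq frhs_def) simp
    next
      case False
      have "i = n \<or> j = n" using ij(3) False by blast
      then have "(g \<odot> w) i j = mone i j" using * ij(1,2) M by blast
      then show ?thesis using fmat_sum_False[OF ij(1,2) assms(1), of X w] False by (simp add: qq frhs_def)
    qed
  next
    assume *: "\<forall>q\<in>feqs n. (\<Sum>p\<in>fidx n. fmat n X q p g * w (fst p) (snd p)) = frhs q"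
    have "?D i j = 0" if "i < Suc n" "j < Suc n" for i j
      using bspec[OF *, of "(True, i, j)"] that fmat_sum_True[OF that, of X g w] by (simp only: feqs_def frhs_def) simp
    then show "?D = 0" using D by blast
    have "(g \<odot> w) i j = mone i j" if "i < Suc n" "j < Suc n" "i = n \<or> j = n" for i j
      using bspec[OF *, of "(False, i, j)"] that fmat_sum_False[OF that(1,2) assms(1), of X w]
      by (simp only: feqs_def frhs_def) simp
    then show "g \<odot> w \<in> Mn n" using M by blast
  qed
  finally show ?thesis .
qed

text \<open>At g0 = h0 z0 the homogeneous system has only the solution 0: if w centralizes the
  (n+1)-corner and g0 w lies in gl(n), then z0 w = h0^(-1) g0 w lies in gl(n) and in that
  centralizer. S stays general, because the statement is used on \<open>Mn (Suc n)\<close> and on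
  the product itself.\<close>

lemma fsol_regular:
  assumes X: "strong_reg X" and g0: "g0 \<in> cent_prod X (Suc n)" "g0 \<in> S" and S: "S \<subseteq> Mn (Suc n)"
  shows "\<exists>W r. (\<forall>p\<in>fidx n. reg_at S ecoords g0 (W p)) \<and> reg_at S ecoords g0 r \<and> r g0 \<noteq> 0 \<and>
    (\<forall>g\<in>S. r g \<noteq> 0 \<longrightarrow> (\<forall>w. fsol n X g w \<longrightarrow> (\<forall>p\<in>fidx n. w (fst p) (snd p) = W p g)))"
proof -
  obtain h0 z0 where hz: "g0 = h0 \<odot> z0" "h0 \<in> cent_prod X n" "z0 \<in> cent_grp (Suc n) X" using g0(1) by auto
  have i: "h0 \<in> GL_inf" "z0 \<in> GL_inf" using cent_prod_GL_inf[OF hz(2)] GL_GL_inf[OF cent_grpD(1)[OF hz(3)]] by auto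
  have gM: "g0 \<in> Mn (Suc n)" using g0(2) S by blast
  have "\<exists>W r. (\<forall>p\<in>fidx n. reg_at S ecoords g0 (W p)) \<and> reg_at S ecoords g0 r \<and> r g0 \<noteq> 0 \<and>
    (\<forall>g\<in>S. r g \<noteq> 0 \<longrightarrow> (\<forall>x. (\<forall>q\<in>feqs n. (\<Sum>p\<in>fidx n. fmat n X q p g * x p) = frhs q) \<longrightarrow> (\<forall>p\<in>fidx n. x p = W p g)))"
  proof (rule linear_system_regular[of "fidx n" g0 S "feqs n" ecoords "fmat n X" "\<lambda>q g. frhs q"])
    fix p :: "nat \<times> nat" and q :: "bool \<times> nat \<times> nat"
    obtain b i j where q: "q = (b, i, j)" by (cases q)
    obtain l m where p: "p = (l, m)" by (cases p)
    show "reg_at S ecoords g0 (fmat n X q p)"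
      by (cases b; cases "m = j") (simp_all add: fmat_def[abs_def] p q)
  next
    fix x assume x: "\<And>q. q \<in> feqs n \<Longrightarrow> (\<Sum>p\<in>fidx n. fmat n X q p g0 * x p) = 0"
    define w :: imat where "w = (\<lambda>l m. if l < Suc n \<and> m < Suc n then x (l, m) else 0)"
    have w: "w \<in> gl (Suc n)" by (auto simp: w_def gl_def)
    have xw: "(\<Sum>p\<in>fidx n. fmat n X q p g0 * w (fst p) (snd p)) = 0" if "q \<in> feqs n" for q
    proof -
      have "(\<Sum>p\<in>fidx n. fmat n X q p g0 * w (fst p) (snd p)) = (\<Sum>p\<in>fidx n. fmat n X q p g0 * x p)"
        by (intro sum.cong refl) (auto simp: w_def)
      then show ?thesis using x[OF that] by simp
    qed
    let ?D = "w \<odot> corner (Suc n) X - corner (Suc n) X \<odot> w"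
    have "?D i j = 0" for i j
    proof (cases "i < Suc n \<and> j < Suc n")
      case True
      then show ?thesis using xw[of "(True, i, j)"] fmat_sum_True[of i n j X g0 w] by (simp only: feqs_def) simp
    next
      case False
      have "?D \<in> gl (Suc n)" using w by simp
      then show ?thesis using False by (auto simp: gl_def)
    qed
    then have "w \<odot> corner (Suc n) X = corner (Suc n) X \<odot> w" by (simp add: fun_eq_iff)
    then have wC: "w \<in> Cent (Suc n) X" using w by (simp add: Cent_def)
    have "blk (Suc n) g0" by (rule blk_Mn[OF gM]) simp
    then have gw: "g0 \<odot> w \<in> gl (Suc n)" by (rule gl_mmul_blk(2)[OF w])
    have "(g0 \<odot> w) i j = 0" if "n \<le> i \<or> n \<le> j" for i j
    proof (cases "i < Suc n \<and> j < Suc n")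
      case True
      then have "(False, i, j) \<in> feqs n" using that by (auto simp: feqs_def)
      then show ?thesis using xw[of "(False, i, j)"] fmat_sum_False[of i n j g0 X w] gM True by simp
    next
      case False
      then show ?thesis using gw by (auto simp: gl_def)
    qed
    then have gwn: "g0 \<odot> w \<in> gl n" by (simp add: gl_def)
    have "blk n (minv h0)" using blk_Mn[OF GL_Mn[OF minv_GL(1)[OF cent_prod_GL[OF hz(2)]]]] by simp
    then have "minv h0 \<odot> (g0 \<odot> w) \<in> gl n" by (rule gl_mmul_blk(2)[OF gwn])
    moreover have "minv h0 \<odot> (g0 \<odot> w) = z0 \<odot> w"
      using i w by (simp add: hz(1) mmul_assoc)
    ultimately have zwn: "z0 \<odot> w \<in> gl n" by simp
    have "z0 \<odot> w \<in> gl (Suc n)" using gl_mono[OF _ zwn] by simp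
    moreover have "(z0 \<odot> w) \<odot> corner (Suc n) X = corner (Suc n) X \<odot> (z0 \<odot> w)"
    proof -
      have f: "row_col_finite z0" "row_col_finite w" using i w by auto
      have "(z0 \<odot> w) \<odot> corner (Suc n) X = z0 \<odot> (corner (Suc n) X \<odot> w)"
        using f CentD(2)[OF wC] by (simp add: mmul_assoc)
      also have "\<dots> = (corner (Suc n) X \<odot> z0) \<odot> w"
        using f cent_grpD(2)[OF hz(3)] by (simp add: mmul_assoc[symmetric])
      finally show ?thesis using f by (simp add: mmul_assoc)
    qed
    ultimately have "z0 \<odot> w \<in> Cent (Suc n) X" by (simp add: Cent_def)
    then have "z0 \<odot> w = 0" by (rule strong_reg_zero[OF X _ zwn])
    then have "minv z0 \<odot> (z0 \<odot> w) = 0" by simp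
    then have "w = 0" using i by simp
    then have w0: "w l m = 0" for l m by simp
    show "\<forall>p\<in>fidx n. x p = 0"
    proof
      fix p assume "p \<in> fidx n"
      then show "x p = 0" using w0[of "fst p" "snd p"] by (auto simp: w_def)
    qed
  qed (use g0 in auto)
  then obtain W r where Wr: "\<forall>p\<in>fidx n. reg_at S ecoords g0 (W p)" "reg_at S ecoords g0 r" "r g0 \<noteq> 0"
    and sol: "\<forall>g\<in>S. r g \<noteq> 0 \<longrightarrow> (\<forall>x. (\<forall>q\<in>feqs n. (\<Sum>p\<in>fidx n. fmat n X q p g * x p) = frhs q) \<longrightarrow> (\<forall>p\<in>fidx n. x p = W p g))"
    by blast
  have "\<forall>p\<in>fidx n. w (fst p) (snd p) = W p g" if g: "g \<in> S" "r g \<noteq> 0" "fsol n X g w" for g w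
  proof -
    have "w \<in> Mn (Suc n)" "g \<in> Mn (Suc n)" using g S by (auto simp: fsol_def)
    then have "\<forall>q\<in>feqs n. (\<Sum>p\<in>fidx n. fmat n X q p g * w (fst p) (snd p)) = frhs q"
      using fsol_iff[of g n w X] g(3) by simp
    with sol[THEN bspec, OF g(1), THEN mp, OF g(2), THEN spec, of "\<lambda>p. w (fst p) (snd p)"]
    show ?thesis by (rule mp)
  qed
  then show ?thesis using Wr by blast
qed

lemma fsol_factor:
  assumes "h \<in> GL n" "z \<in> cent_grp (Suc n) X"
  shows "fsol n X (h \<odot> z) (minv z)"
  using cent_grpD[OF cent_grp_minv[OF assms(2)]] GL_GL_inf[OF cent_grpD(1)[OF assms(2)]] assms(1)
  by (simp add: fsol_def mmul_assoc)

lemma cent_prod_SucE: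
  assumes "g \<in> cent_prod X (Suc n)"
  obtains h z where "g = h \<odot> z" "h \<in> cent_prod X n" "z \<in> cent_grp (Suc n) X"
  using assms by auto

text \<open>Invertibility of w is not among the equations. It follows from the left inverse (g
  w)^(-1) g, and then g = (g w) w^(-1) is the required factorization.\<close>

lemma fsol_cent_prod:
  assumes X: "strong_reg X" and g: "g \<in> Mn (Suc n)" and w: "fsol n X g w" and gw: "g \<odot> w \<in> cent_prod X n"
  shows "g \<in> cent_prod X (Suc n)"
proof -
  note w' = w[unfolded fsol_def]
  have wM: "w \<in> Mn (Suc n)" using w' by blast
  have h: "g \<odot> w \<in> GL (Suc n)" using GL_mono[OF _ cent_prod_GL[OF gw], of "Suc n"] by simp
  have hi: "g \<odot> w \<in> GL_inf" by (rule GL_GL_inf[OF h])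
  have mi: "minv (g \<odot> w) \<in> Mn (Suc n)" using minv_GL(1)[OF h] by simp
  have "(minv (g \<odot> w) \<odot> g) \<odot> w = minv (g \<odot> w) \<odot> (g \<odot> w)"
    using row_col_finite_Mn[OF mi] row_col_finite_Mn[OF g] by (simp add: mmul_assoc)
  then have 1: "(minv (g \<odot> w) \<odot> g) \<odot> w = mone" using minv_GL_inf(3)[OF hi] by simp
  have wG: "w \<in> GL (Suc n)" by (rule left_inverse_Mn(1)[OF Mn_mmul[OF mi g] wM 1])
  then have "w \<in> cent_grp (Suc n) X" using w' by (simp add: cent_grp_def)
  then have "minv w \<in> cent_grp (Suc n) X" by (rule cent_grp_minv)
  moreover have "g = (g \<odot> w) \<odot> minv w" using GL_GL_inf[OF wG] by simp
  ultimately show ?thesis unfolding cent_prod.simps using gw by blast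
qed

text \<open>Near g0 the only possible solution w is a regular function of g. So g belongs to the
  longer product iff this candidate satisfies the equations, a closed condition, and g w belongs to
  the shorter product, which is locally closed by induction. The ambient space is
  \<open>Mn n\<close> because g w need not be invertible for g near g0.\<close>

lemma cent_prod_locally_closed:
  assumes X: "strong_reg X"
  shows "g0 \<in> cent_prod X n \<Longrightarrow> \<exists>U. zopen (Mn n) ecoords U \<and> g0 \<in> U \<and> zopen (Mn n) ecoords (U - cent_prod X n)"
proof (induction n arbitrary: g0)
  case 0
  have "Mn 0 = {mone}" by (auto simp: Mn_def)
  then have "Mn 0 - cent_prod X 0 = {}" by simp
  moreover have "zopen (Mn 0) ecoords {}" by (simp add: zopen_def)
  ultimately have "zopen (Mn 0) ecoords (Mn 0 - cent_prod X 0)" by (simp only:)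
  moreover have "g0 \<in> Mn 0" using 0 by simp
  ultimately show ?case using zopen_whole[of "Mn 0" ecoords] by blast
next
  case (Suc n)
  let ?S = "Mn (Suc n)"
  obtain h0 z0 where hz: "g0 = h0 \<odot> z0" "h0 \<in> cent_prod X n" "z0 \<in> cent_grp (Suc n) X" by (rule cent_prod_SucE[OF Suc.prems])
  have g0: "g0 \<in> ?S" using cent_prod_GL[OF Suc.prems] by simp
  obtain W r where W: "\<forall>p\<in>fidx n. reg_at ?S ecoords g0 (W p)" and r: "reg_at ?S ecoords g0 r" "r g0 \<noteq> 0"
    and sol: "\<forall>g\<in>?S. r g \<noteq> 0 \<longrightarrow> (\<forall>w. fsol n X g w \<longrightarrow> (\<forall>p\<in>fidx n. w (fst p) (snd p) = W p g))"
    using fsol_regular[OF X Suc.prems g0 order_refl] by blast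
  have "\<forall>p\<in>fidx n. \<exists>U. zopen ?S ecoords U \<and> g0 \<in> U \<and> (\<forall>y\<in>U. reg_at ?S ecoords y (W p))"
    using W reg_at_nbhd[OF _ g0] by blast
  then obtain UW where UW: "\<And>p. p \<in> fidx n \<Longrightarrow> zopen ?S ecoords (UW p) \<and> g0 \<in> UW p \<and> (\<forall>y\<in>UW p. reg_at ?S ecoords y (W p))"
    by metis
  obtain Ur where Ur: "zopen ?S ecoords Ur" "g0 \<in> Ur" "\<forall>y\<in>Ur. reg_at ?S ecoords y r"
    using reg_at_nbhd[OF r(1) g0] by blast
  define U0 where "U0 = {y\<in>Ur. r y \<noteq> 0} \<inter> (?S \<inter> \<Inter>(UW ` fidx n))"
  have U0: "zopen ?S ecoords U0"
    unfolding U0_def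
    by (intro zopen_Int zopen_nonzero[OF Ur(1)] zopen_finite_Inter) (use Ur(3) UW in auto)
  have g0U: "g0 \<in> U0" using Ur r g0 UW by (auto simp: U0_def)
  have U0S: "y \<in> ?S" "r y \<noteq> 0" "p \<in> fidx n \<Longrightarrow> reg_at ?S ecoords y (W p)" if "y \<in> U0" for y p
    using that UW by (auto simp: U0_def)
  \<comment> \<open>Candidates for w and for h = g w. They are the true ones wherever a
    factorization exists, and padding keeps them in the right affine spaces elsewhere.\<close>
  define Wm where "Wm g = pad (Suc n) (\<lambda>l m. W (l, m) g)" for g
  define H where "H g = pad n (g \<odot> Wm g)" for g
  have WmM: "Wm g \<in> ?S" for g by (simp add: Wm_def)
  have HM: "H g \<in> Mn n" for g by (simp add: H_def)
  have Wm: "reg_at ?S ecoords y (\<lambda>g. Wm g l m)" if "y \<in> U0" for y l m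
    using U0S(3)[OF that, of "(l, m)"] by (cases "l < Suc n \<and> m < Suc n") (auto simp: Wm_def pad_def)
  have gW: "reg_at ?S ecoords y (\<lambda>g. (g \<odot> Wm g) l m)" if "y \<in> U0" for y l m
    by (rule reg_at_mmul[of _ _ "Suc n"]) (use Wm[OF that] in simp_all)
  have Hrg: "reg_at ?S ecoords y (\<lambda>g. c (H g))" if y: "y \<in> U0" and c: "c \<in> ecoords" for y c
  proof -
    obtain i j where c: "c = (\<lambda>Z. Z i j)" by (rule ecoordsE[OF c])
    have "(\<lambda>g. H g i j) = (\<lambda>g. if i < n \<and> j < n then (g \<odot> Wm g) i j else mone i j)"
      by (simp add: H_def pad_def)
    then show ?thesis unfolding c using gW[OF y, of i j] by (cases "i < n \<and> j < n") auto
  qed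
  have fact: "Wm g = minv z \<and> H g = h" if g: "g \<in> U0" and hz: "g = h \<odot> z" "h \<in> cent_prod X n" "z \<in> cent_grp (Suc n) X" for g h z
  proof -
    have f: "fsol n X g (minv z)" unfolding hz(1) by (rule fsol_factor[OF cent_prod_GL[OF hz(2)] hz(3)])
    then have e: "\<forall>p\<in>fidx n. minv z (fst p) (snd p) = W p g"
      using sol U0S(1,2)[OF g] by blast
    have mz: "minv z \<in> ?S" using f by (simp add: fsol_def)
    have "pad (Suc n) (minv z) = Wm g"
      unfolding Wm_def pad_def using e by (intro ext) auto
    then have 1: "Wm g = minv z" using pad_id[OF mz] by simp
    have "g \<odot> minv z = h" using GL_GL_inf[OF cent_grpD(1)[OF hz(3)]] by (simp add: hz(1))
    then have "H g = pad n h" unfolding H_def 1 by simp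
    then show ?thesis using 1 pad_id[OF GL_Mn[OF cent_prod_GL[OF hz(2)]]] by simp
  qed
  obtain U1 where U1: "zopen (Mn n) ecoords U1" "h0 \<in> U1" "zopen (Mn n) ecoords (U1 - cent_prod X n)"
    using Suc.IH[OF hz(2)] by blast
  define U where "U = {y\<in>U0. H y \<in> U1}"
  have U: "zopen ?S ecoords U"
    unfolding U_def by (rule zopen_preimage[where \<phi>=H, OF U0 Hrg HM U1(1)])
  have "g0 \<in> U" using g0U fact[OF g0U hz] U1(2) by (simp add: U_def)
  define sys where "sys q g = (\<Sum>p\<in>fidx n. fmat n X q p g * Wm g (fst p) (snd p)) - frhs q" for q g
  have sys_reg_at: "reg_at ?S ecoords y (sys q)" if "y \<in> U" for y q
    unfolding sys_def
  proof (intro reg_at_diff reg_at_sum reg_at_mult reg_at_const)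
    have yU: "y \<in> U0" using that by (simp add: U_def)
    fix p :: "nat \<times> nat"
    obtain b i j where q: "q = (b, i, j)" by (cases q)
    obtain l m where p: "p = (l, m)" by (cases p)
    show "reg_at ?S ecoords y (fmat n X q p)"
      by (cases b; cases "m = j") (simp_all add: fmat_def[abs_def] p q)
    show "reg_at ?S ecoords y (\<lambda>g. Wm g (fst p) (snd p))" by (rule Wm[OF yU])
  qed
  have iff: "g \<in> cent_prod X (Suc n) \<longleftrightarrow> (\<forall>q\<in>feqs n. sys q g = 0) \<and> H g \<in> cent_prod X n" if g: "g \<in> U" for g
  proof -
    have gU: "g \<in> U0" using g by (simp add: U_def)
    have s: "(\<forall>q\<in>feqs n. sys q g = 0) \<longleftrightarrow> fsol n X g (Wm g)"
      using fsol_iff[OF U0S(1)[OF gU] WmM] by (simp add: sys_def)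
    show ?thesis
    proof
      assume "g \<in> cent_prod X (Suc n)"
      then obtain h z where *: "g = h \<odot> z" "h \<in> cent_prod X n" "z \<in> cent_grp (Suc n) X" by (rule cent_prod_SucE)
      have f: "fsol n X g (minv z)" unfolding *(1) by (rule fsol_factor[OF cent_prod_GL[OF *(2)] *(3)])
      have "Wm g = minv z" "H g = h" using fact[OF gU *] by auto
      then show "(\<forall>q\<in>feqs n. sys q g = 0) \<and> H g \<in> cent_prod X n" using s f *(2) by simp
    next
      assume *: "(\<forall>q\<in>feqs n. sys q g = 0) \<and> H g \<in> cent_prod X n"
      then have f: "fsol n X g (Wm g)" using s by blast
      then have "g \<odot> Wm g \<in> Mn n" by (simp add: fsol_def)
      then have "g \<odot> Wm g \<in> cent_prod X n" using * pad_id by (simp add: H_def)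
      then show "g \<in> cent_prod X (Suc n)" by (rule fsol_cent_prod[OF X U0S(1)[OF gU] f])
    qed
  qed
  have "zopen ?S ecoords (\<Union>((\<lambda>q. {y\<in>U. sys q y \<noteq> 0}) ` feqs n) \<union> {y\<in>U. H y \<in> U1 - cent_prod X n})"
  proof -
    have "zopen ?S ecoords {y\<in>U. H y \<in> U1 - cent_prod X n}"
      by (rule zopen_preimage[where \<phi>=H, OF U _ HM U1(3)], rule Hrg) (auto simp: U_def)
    moreover have "zopen ?S ecoords {y\<in>U. sys q y \<noteq> 0}" for q
      by (rule zopen_nonzero[OF U sys_reg_at])
    ultimately have "zopen ?S ecoords (\<Union>(insert {y\<in>U. H y \<in> U1 - cent_prod X n} ((\<lambda>q. {y\<in>U. sys q y \<noteq> 0}) ` feqs n)))"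
      by (intro zopen_Union) auto
    then show ?thesis by (simp add: Un_commute)
  qed
  moreover have "(\<Union>((\<lambda>q. {y\<in>U. sys q y \<noteq> 0}) ` feqs n) \<union> {y\<in>U. H y \<in> U1 - cent_prod X n}) = U - cent_prod X (Suc n)"
    using iff by (auto simp: U_def simp del: cent_prod.simps)
  ultimately show ?case using U \<open>g0 \<in> U\<close> by (metis (no_types, lifting))
qed

text \<open>Since factors are unique, an arbitrary choice agrees near each point with the regular
  solution of the linear system. The system yields the inverse of the last factor z; then z itself
  and h = g z^(-1) are regular, and the earlier factors are regular functions of h.\<close>

lemma cent_prod_factors:
  assumes X: "strong_reg X"
  shows "\<exists>\<zeta>. (\<forall>g\<in>cent_prod X n. (\<forall>i. \<zeta> i g \<in> cent_grp i X) \<and> mprod (map (\<lambda>i. \<zeta> i g) [1..<Suc n]) = g) \<and>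
    (\<forall>g0\<in>cent_prod X n. \<forall>i r c. reg_at (cent_prod X n) ecoords g0 (\<lambda>g. \<zeta> i g r c))"
proof (induction n)
  case 0
  show ?case by (intro exI[of _ "\<lambda>i g. mone"]) (simp add: mprod_def)
next
  case (Suc n)
  let ?S = "cent_prod X (Suc n)"
  obtain \<zeta> where \<zeta>: "\<And>g i. g \<in> cent_prod X n \<Longrightarrow> \<zeta> i g \<in> cent_grp i X"
    "\<And>g. g \<in> cent_prod X n \<Longrightarrow> mprod (map (\<lambda>i. \<zeta> i g) [1..<Suc n]) = g"
    "\<And>g0 i r c. g0 \<in> cent_prod X n \<Longrightarrow> reg_at (cent_prod X n) ecoords g0 (\<lambda>g. \<zeta> i g r c)"
    using Suc by blast
  have "\<forall>g\<in>?S. \<exists>h z. g = h \<odot> z \<and> h \<in> cent_prod X n \<and> z \<in> cent_grp (Suc n) X" by auto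
  then obtain h z where hz: "\<And>g. g \<in> ?S \<Longrightarrow> g = h g \<odot> z g" "\<And>g. g \<in> ?S \<Longrightarrow> h g \<in> cent_prod X n"
    "\<And>g. g \<in> ?S \<Longrightarrow> z g \<in> cent_grp (Suc n) X"
    by metis
  have zG: "z g \<in> GL (Suc n)" "z g \<in> GL_inf" "minv (z g) \<in> GL (Suc n)" if "g \<in> ?S" for g
    using cent_grpD(1)[OF hz(3)[OF that]] GL_GL_inf minv_GL(1) by blast+
  have SM: "?S \<subseteq> Mn (Suc n)" using cent_prod_GL GL_Mn by blast
  have wrg: "reg_at ?S ecoords g0 (\<lambda>g. minv (z g) i j)" if g0: "g0 \<in> ?S" for g0 i j
  proof (cases "i < Suc n \<and> j < Suc n")
    case True
    obtain W r where W: "\<forall>p\<in>fidx n. reg_at ?S ecoords g0 (W p)" and r: "reg_at ?S ecoords g0 r" "r g0 \<noteq> 0"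
      and sol: "\<forall>g\<in>?S. r g \<noteq> 0 \<longrightarrow> (\<forall>w. fsol n X g w \<longrightarrow> (\<forall>p\<in>fidx n. w (fst p) (snd p) = W p g))"
      using fsol_regular[OF X g0 g0 SM] by blast
    have ij: "(i, j) \<in> fidx n" using True by auto
    have "minv (z g) i j = W (i, j) g" if g: "g \<in> ?S" "r g \<noteq> 0" for g
    proof -
      have "fsol n X (h g \<odot> z g) (minv (z g))"
        by (rule fsol_factor[OF cent_prod_GL[OF hz(2)[OF g(1)]] hz(3)[OF g(1)]])
      then have "fsol n X g (minv (z g))" using hz(1)[OF g(1)] by simp
      then show ?thesis using sol g ij by fastforce
    qed
    moreover have "reg_at ?S ecoords g0 (W (i, j))" using W ij by blast
    ultimately show ?thesis
      using reg_at_local[where S="?S" and z=g0 and r=r and f="\<lambda>g. minv (z g) i j" and g="W (i, j)"] r g0 by blast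
  next
    case False
    have "minv (z g) i j = mone i j" if "g \<in> ?S" for g
      using GL_Mn[OF zG(3)[OF that]] False by (auto simp: Mn_def)
    then show ?thesis by (rule reg_at_cong) simp_all
  qed
  have zrg: "reg_at ?S ecoords g0 (\<lambda>g. z g i j)" if g0: "g0 \<in> ?S" for g0 i j
  proof -
    have "reg_at ?S ecoords g0 (\<lambda>g. minv (minv (z g)) i j)"
      by (rule minv_regular[OF g0 zG(3)]) (assumption, rule wrg[OF g0])
    then show ?thesis by (rule reg_at_cong[rotated]) (simp add: zG(2))
  qed
  have hrg: "reg_at ?S ecoords g0 (\<lambda>g. h g i j)" if g0: "g0 \<in> ?S" for g0 i j
  proof -
    have "reg_at ?S ecoords g0 (\<lambda>g. (g \<odot> minv (z g)) i j)"
    proof (rule reg_at_mmul[of _ _ "Suc n"])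
      show "reg_at ?S ecoords g0 (\<lambda>g. minv (z g) i j)" for i j by (rule wrg[OF g0])
    qed (use SM in blast, rule reg_at_entry)
    moreover have "h g i j = (g \<odot> minv (z g)) i j" if "g \<in> ?S" for g
    proof -
      have "(h g \<odot> z g) \<odot> minv (z g) = h g" using zG(2)[OF that] by simp
      then show ?thesis using hz(1)[OF that] by simp
    qed
    ultimately show ?thesis by (rule reg_at_cong[rotated])
  qed
  define \<zeta>' where "\<zeta>' i g = (if i = Suc n then z g else \<zeta> i (h g))" for i g
  have Z: "\<zeta>' i g \<in> cent_grp i X" if "g \<in> ?S" for i g
    using hz(3)[OF that] \<zeta>(1)[OF hz(2)[OF that]] by (simp add: \<zeta>'_def)
  have "mprod (map (\<lambda>i. \<zeta>' i g) [1..<Suc (Suc n)]) = g" if g: "g \<in> ?S" for g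
  proof -
    have f: "row_col_finite (\<zeta>' i g)" for i by (rule row_col_finite_GL[OF cent_grpD(1)[OF Z[OF g]]])
    have "map (\<lambda>i. \<zeta>' i g) [1..<Suc n] = map (\<lambda>i. \<zeta> i (h g)) [1..<Suc n]"
      by (intro map_cong) (auto simp: \<zeta>'_def)
    then have e: "mprod (map (\<lambda>i. \<zeta>' i g) [1..<Suc n]) = h g"
      using \<zeta>(2)[OF hz(2)[OF g]] by (simp only:)
    have "\<zeta>' (Suc n) g = z g" by (simp add: \<zeta>'_def)
    then show ?thesis
      unfolding mprod_upt_Suc[of "\<lambda>i. \<zeta>' i g" n, OF f] e using hz(1)[OF g] by (simp only:)
  qed
  moreover have "reg_at ?S ecoords g0 (\<lambda>g. \<zeta>' i g r c)" if g0: "g0 \<in> ?S" for g0 i r c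
  proof (cases "i = Suc n")
    case True
    then show ?thesis using zrg[OF g0] by (simp add: \<zeta>'_def)
  next
    case False
    have "reg_at ?S ecoords g0 (\<lambda>g. \<zeta> i (h g) r c)"
      by (rule reg_at_comp[where \<phi>=h, OF \<zeta>(3)[OF hz(2)[OF g0]] _ g0 hz(2)])
        (erule ecoordsE, hypsubst, rule hrg[OF g0], assumption)
    then show ?thesis using False by (simp add: \<zeta>'_def)
  qed
  ultimately show ?case using Z by blast
qed

lemma mprod_unique:
  assumes X: "strong_reg X"
    and "\<And>i. z i \<in> cent_grp i X" "\<And>i. z' i \<in> cent_grp i X"
    and "mprod (map z [1..<Suc n]) = mprod (map z' [1..<Suc n])" "1 \<le> i" "i \<le> n"
  shows "z i = z' i"
  using assms(4-6)
proof (induction n)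
  case (Suc n)
  have f: "row_col_finite (z i)" "row_col_finite (z' i)" for i using row_col_finite_GL[OF cent_grpD(1)[OF assms(2)]] row_col_finite_GL[OF cent_grpD(1)[OF assms(3)]] by auto
  have G: "mprod (map z [1..<Suc n]) \<in> GL n" "mprod (map z' [1..<Suc n]) \<in> GL n"
    using cent_prod_GL[OF mprod_cent_prod[OF assms(2)]] cent_prod_GL[OF mprod_cent_prod[OF assms(3)]] by auto
  have e: "mprod (map z [1..<Suc n]) \<odot> z (Suc n) = mprod (map z' [1..<Suc n]) \<odot> z' (Suc n)"
    using Suc.prems(1) unfolding mprod_upt_Suc[of z n, OF f(1)] mprod_upt_Suc[of z' n, OF f(2)] .
  note u = cent_prod_unique[OF X G assms(2,3) e]
  show ?case
  proof (cases "i = Suc n")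
    case False
    then show ?thesis using Suc.IH[OF u(1)] Suc.prems by simp
  qed (use u(2) in simp)
qed simp

section \<open>The strata of the orbit\<close>

definition A_stratum :: "imat \<Rightarrow> nat \<Rightarrow> imat set" where
  "A_stratum X n = {Ad g X | g. g \<in> cent_prod X n}"

lemma A_stratum_orbit: "A_stratum X n \<subseteq> GL_orbit n X"
  unfolding A_stratum_def GL_orbit_def using cent_prod_GL by blast

lemma A_stratum_orbit_elt:
  assumes "strong_reg X" "Y \<in> A_stratum X n"
  shows "orbit_elt X Y \<in> cent_prod X n" "Ad (orbit_elt X Y) X = Y"
proof -
  obtain g where g: "g \<in> cent_prod X n" "Y = Ad g X" using assms(2) by (auto simp: A_stratum_def)
  then show "orbit_elt X Y \<in> cent_prod X n" "Ad (orbit_elt X Y) X = Y" using orbit_elt_Ad[OF assms(1) cent_prod_GL_inf[OF g(1)]] by simp_all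
qed

lemma i_preimage_A_orbit:
  assumes "strong_reg X"
  shows "i_preimage X (A_orbit X) = A_orbit X"
  unfolding i_preimage_def using A_orbit_subset[OF assms] by blast

lemma A_orbit_A_stratum: "strong_reg X \<Longrightarrow> A_orbit X = (\<Union>n. A_stratum X n)"
  unfolding A_orbit_cent_prod A_stratum_def by blast

lemma A_stratum_mono: "n \<le> m \<Longrightarrow> A_stratum X n \<subseteq> A_stratum X m"
  unfolding A_stratum_def using cent_prod_mono by blast

lemma is_zar_strata:
  assumes X: "strong_reg X"
  shows "is_zar (strata X (A_orbit X) n) (A_stratum X n) (orbit_coords X)"
  unfolding strata_def A_orbit_stratum[OF X] A_stratum_def[symmetric]
  by (rule is_zar_sub[OF is_zar_orbit[OF X] A_stratum_orbit])

lemma reg_at_cent_prod_A_stratum: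
  assumes X: "strong_reg X" and Y: "Y \<in> A_stratum X n" and f: "reg_at (cent_prod X n) ecoords (orbit_elt X Y) f"
  shows "reg_at (A_stratum X n) (orbit_coords X) Y (\<lambda>Y. f (orbit_elt X Y))"
  by (rule reg_at_comp[where \<phi>="orbit_elt X", OF f _ Y A_stratum_orbit_elt(1)[OF X]]) (erule ecoordsE, simp, assumption)

lemma A_orbit_ind_subvariety:
  assumes X: "strong_reg X"
  shows "ind_subvariety X (A_orbit X)"
  unfolding ind_subvariety_def
proof (intro conjI allI)
  show "A_orbit X \<subseteq> GL_inf_orbit X" by (rule A_orbit_subset[OF X])
  fix n
  show "locally_closedin (sp_top (orbit_space n X)) (A_orbit X \<inter> GL_orbit n X)"
    unfolding A_orbit_stratum[OF X] A_stratum_def[symmetric]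
  proof (rule locally_closedin_local)
    fix Y assume Y: "Y \<in> A_stratum X n"
    note g = A_stratum_orbit_elt[OF X Y]
    obtain U where U: "zopen (Mn n) ecoords U" "orbit_elt X Y \<in> U" "zopen (Mn n) ecoords (U - cent_prod X n)"
      using cent_prod_locally_closed[OF X g(1)] by blast
    have pre: "zopen (GL_orbit n X) (orbit_coords X) {Y \<in> GL_orbit n X. orbit_elt X Y \<in> V}" if V: "zopen (Mn n) ecoords V" for V
    proof (rule zopen_preimage[where \<phi>="orbit_elt X", OF zopen_whole _ _ V])
      show "reg_at (GL_orbit n X) (orbit_coords X) y (\<lambda>y. c (orbit_elt X y))" if "c \<in> ecoords" for y c
        by (rule ecoordsE[OF that]) simp
      show "orbit_elt X y \<in> Mn n" if "y \<in> GL_orbit n X" for y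
        using orbit_elt_orbit(1)[OF X that] by simp
    qed
    have e: "{Y \<in> GL_orbit n X. orbit_elt X Y \<in> U} - A_stratum X n = {Y \<in> GL_orbit n X. orbit_elt X Y \<in> U - cent_prod X n}"
    proof (intro equalityI subsetI)
      fix Z assume Z: "Z \<in> {Y \<in> GL_orbit n X. orbit_elt X Y \<in> U} - A_stratum X n"
      then have "orbit_elt X Z \<notin> cent_prod X n" using orbit_elt_orbit(2)[OF X, of Z n] unfolding A_stratum_def by force
      then show "Z \<in> {Y \<in> GL_orbit n X. orbit_elt X Y \<in> U - cent_prod X n}" using Z by blast
    next
      fix Z assume Z: "Z \<in> {Y \<in> GL_orbit n X. orbit_elt X Y \<in> U - cent_prod X n}"
      then show "Z \<in> {Y \<in> GL_orbit n X. orbit_elt X Y \<in> U} - A_stratum X n" using A_stratum_orbit_elt(1)[OF X, of Z n] by blast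
    qed
    have "Y \<in> {Y \<in> GL_orbit n X. orbit_elt X Y \<in> U}" using Y A_stratum_orbit U(2) by blast
    then show "\<exists>U. openin (sp_top (orbit_space n X)) U \<and> Y \<in> U \<and> openin (sp_top (orbit_space n X)) (U - A_stratum X n)"
      unfolding is_zar_open[OF is_zar_orbit[OF X]]
      using pre[OF U(1)] pre[OF U(3)] e by (intro exI[of _ "{Y \<in> GL_orbit n X. orbit_elt X Y \<in> U}"]) simp
  qed
qed

section \<open>Affineness of the strata\<close>

lemma poly_funs_sum:
  "(\<And>i. i \<in> I \<Longrightarrow> f i \<in> poly_funs \<Phi>) \<Longrightarrow> (\<lambda>y. \<Sum>i\<in>I. f i y) \<in> poly_funs \<Phi>"
  by (induction I rule: infinite_finite_induct) (simp_all add: poly_funs.add poly_funs.const)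

lemma poly_funs_diff:
  assumes "f \<in> poly_funs \<Phi>" "g \<in> poly_funs \<Phi>"
  shows "(\<lambda>y. f y - g y) \<in> poly_funs \<Phi>"
  using poly_funs.add[OF assms(1) poly_funs.mult[OF poly_funs.const[of "- 1"] assms(2)]] by simp

lemma reg_at_mprod:
  assumes "\<And>i y. y \<in> S \<Longrightarrow> z i y \<in> Mn n" "\<And>i r c. i \<in> set [1..<Suc m] \<Longrightarrow> reg_at S \<Phi> y0 (\<lambda>y. z i y r c)"
  shows "reg_at S \<Phi> y0 (\<lambda>y. mprod (map (\<lambda>i. z i y) [1..<Suc m]) r c)"
  using assms(2)
proof (induction m arbitrary: r c)
  case 0
  show ?case by (simp add: mprod_def)
next
  case (Suc m)
  have IH: "reg_at S \<Phi> y0 (\<lambda>y. mprod (map (\<lambda>i. z i y) [1..<Suc m]) r c)" for r c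
    by (rule Suc.IH, rule Suc.prems) auto
  have "reg_at S \<Phi> y0 (\<lambda>y. (mprod (map (\<lambda>i. z i y) [1..<Suc m]) \<odot> z (Suc m) y) r c)"
    by (rule reg_at_mmul_right[OF assms(1)], assumption, rule IH, rule Suc.prems) auto
  moreover have "mprod (map (\<lambda>i. z i y) [1..<Suc (Suc m)]) r c =
      (mprod (map (\<lambda>i. z i y) [1..<Suc m]) \<odot> z (Suc m) y) r c" if "y \<in> S" for y
    by (subst mprod_upt_Suc[of "\<lambda>i. z i y" m]) (simp_all add: row_col_finite_Mn[OF assms(1)[OF that]])
  ultimately show ?case by (rule reg_at_cong[rotated])
qed

text \<open>A point of the stratum is recorded by the entries of its n factors and of their
  inverses. Including the inverses turns invertibility into polynomial equations, so the image is
  closed in affine space; multiplying the factors is the inverse map.\<close>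

lemma strata_variety:
  assumes X: "strong_reg X"
  shows "variety (strata X (A_orbit X) n)"
proof -
  obtain \<zeta> where \<zeta>: "\<And>g i. g \<in> cent_prod X n \<Longrightarrow> \<zeta> i g \<in> cent_grp i X"
    "\<And>g. g \<in> cent_prod X n \<Longrightarrow> mprod (map (\<lambda>i. \<zeta> i g) [1..<Suc n]) = g"
    "\<And>g0 i r c. g0 \<in> cent_prod X n \<Longrightarrow> reg_at (cent_prod X n) ecoords g0 (\<lambda>g. \<zeta> i g r c)"
    using cent_prod_factors[OF X, of n] by blast
  \<comment> \<open>One affine coordinate for each entry (r, c) of the i-th factor or, when the flag
    is \<open>True\<close>, of its inverse. Larger entries are those of the identity.\<close>
  define K where "K = (UNIV :: bool set) \<times> {1..n} \<times> {..<n} \<times> {..<n}"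
  define N where "N = card K"
  have "finite K" by (simp add: K_def)
  then obtain e where e: "bij_betw e {..<N} K"
    using ex_bij_betw_nat_finite[of K] by (auto simp: N_def atLeast0LessThan)
  define d where "d = inv_into {..<N} e"
  have d: "d q < N" "e (d q) = q" if "q \<in> K" for q
    using that e inv_into_into[of q e "{..<N}"] f_inv_into_f[of q e "{..<N}"]
    unfolding d_def bij_betw_def by auto
  have de: "d (e k) = k" "e k \<in> K" if "k < N" for k
    using that e inv_into_f_f[of e "{..<N}" k] unfolding d_def bij_betw_def by auto
  define F where "F b i g = (if b then minv (\<zeta> i g) else \<zeta> i g)" for b i g
  define \<phi> where "\<phi> Y k = (if k < N then (case e k of (b, i, r, c) \<Rightarrow> F b i (orbit_elt X Y) r c) else 0)" for Y k
  define zm :: "bool \<Rightarrow> nat \<Rightarrow> (nat \<Rightarrow> complex) \<Rightarrow> imat" where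
    "zm b i x = (\<lambda>r c. if r < n \<and> c < n then x (d (b, i, r, c)) else mone r c)" for b i x
  define \<psi> where "\<psi> x = Ad (mprod (map (\<lambda>i. zm False i x) [1..<Suc n])) X" for x
  \<comment> \<open>The full ideal of the image instead of explicit equations: every polynomial
    identity valid on the stratum then holds on the closed set. Block shape, inverses and
    commutation suffice to show that no further points arise.\<close>
  define P where "P = {p \<in> poly_funs (affine_coords N). \<forall>Y\<in>A_stratum X n. p (\<phi> Y) = 0}"
  let ?A = "affine_carrier N P"
  have zmM: "zm b i x \<in> Mn n" for b i x by (auto simp: zm_def Mn_def)
  have \<zeta>G: "\<zeta> i g \<in> GL i" "minv (\<zeta> i g) \<in> GL i" "\<zeta> i g \<in> GL_inf" if "g \<in> cent_prod X n" for i g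
    using cent_grpD(1)[OF \<zeta>(1)[OF that]] minv_GL(1) GL_GL_inf by blast+
  have FG: "F b i g \<in> GL i" if "g \<in> cent_prod X n" for b i g using \<zeta>G[OF that] by (simp add: F_def)
  have zm\<phi>: "zm b i (\<phi> Y) = F b i (orbit_elt X Y)" if Y: "Y \<in> A_stratum X n" and i: "1 \<le> i" "i \<le> n" for b i Y
  proof (intro ext)
    fix r c
    have FM: "F b i (orbit_elt X Y) \<in> Mn n" using Mn_mono[OF i(2) GL_Mn[OF FG[OF A_stratum_orbit_elt(1)[OF X Y]]]] .
    show "zm b i (\<phi> Y) r c = F b i (orbit_elt X Y) r c"
    proof (cases "r < n \<and> c < n")
      case True
      then have "(b, i, r, c) \<in> K" using i by (simp add: K_def)
      then show ?thesis using True d by (simp add: zm_def \<phi>_def)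
    next
      case False
      then show ?thesis using FM by (auto simp: zm_def Mn_def)
    qed
  qed
  have pz: "(\<lambda>x. zm b i x r c) \<in> poly_funs (affine_coords N)" if "1 \<le> i" "i \<le> n" for b i r c
  proof (cases "r < n \<and> c < n")
    case True
    then have "d (b, i, r, c) < N" using that d(1) by (simp add: K_def)
    then have "(\<lambda>x. x (d (b, i, r, c))) \<in> poly_funs (affine_coords N)"
      by (intro poly_funs.coord) (auto simp: affine_coords_def)
    then show ?thesis using True by (simp add: zm_def)
  next
    case False
    then have "(\<lambda>x. zm b i x r c) = (\<lambda>_. mone r c)" by (auto simp: zm_def)
    then show ?thesis by (simp add: poly_funs.const)
  qed
  have van: "p x = 0" if "x \<in> ?A" "p \<in> poly_funs (affine_coords N)" "\<And>Y. Y \<in> A_stratum X n \<Longrightarrow> p (\<phi> Y) = 0" for p x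
    using that by (simp add: P_def)
  have row: "(zm b i x \<odot> B) r c = (\<Sum>l<n. zm b i x r l * B l c)" if "r < n" for b i x B r c
    using that zmM[of b i x] by (intro mmul_sum) (auto simp: Mn_def mone_def)
  have zmid: "zm b i x r c = mone r c" if x: "x \<in> ?A" and i: "1 \<le> i" "i \<le> n" and rc: "i \<le> r \<or> i \<le> c" for b i x r c
  proof -
    have "zm b i x r c - mone r c = 0"
    proof (rule van[OF x])
      show "(\<lambda>x. zm b i x r c - mone r c) \<in> poly_funs (affine_coords N)"
        by (intro poly_funs_diff pz[OF i] poly_funs.const)
      fix Y assume Y: "Y \<in> A_stratum X n"
      have "F b i (orbit_elt X Y) \<in> Mn i" using FG[OF A_stratum_orbit_elt(1)[OF X Y]] by simp
      then have "F b i (orbit_elt X Y) r c = mone r c" using rc unfolding Mn_def by blast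
      then show "zm b i (\<phi> Y) r c - mone r c = 0" by (simp add: zm\<phi>[OF Y i])
    qed
    then show ?thesis by simp
  qed
  have zmprod: "zm b i x \<odot> zm (\<not> b) i x = mone" if x: "x \<in> ?A" and i: "1 \<le> i" "i \<le> n" for b i x
  proof (rule corner_eq_Mn[of _ n])
    show "corner n (zm b i x \<odot> zm (\<not> b) i x) = corner n mone"
    proof (intro ext)
      fix r c
      show "corner n (zm b i x \<odot> zm (\<not> b) i x) r c = corner n mone r c"
      proof (cases "r < n \<and> c < n")
        case True
        have "(\<Sum>l<n. zm b i x r l * zm (\<not> b) i x l c) - mone r c = 0"
        proof (rule van[OF x])
          show "(\<lambda>x. (\<Sum>l<n. zm b i x r l * zm (\<not> b) i x l c) - mone r c) \<in> poly_funs (affine_coords N)"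
            by (intro poly_funs_diff poly_funs_sum poly_funs.mult pz[OF i] poly_funs.const)
          fix Y assume Y: "Y \<in> A_stratum X n"
          have "F b i (orbit_elt X Y) \<odot> F (\<not> b) i (orbit_elt X Y) = mone"
            using \<zeta>G(3)[OF A_stratum_orbit_elt(1)[OF X Y]] by (simp add: F_def)
          then have "(zm b i (\<phi> Y) \<odot> zm (\<not> b) i (\<phi> Y)) r c = mone r c" by (simp add: zm\<phi>[OF Y i])
          then show "(\<Sum>l<n. zm b i (\<phi> Y) r l * zm (\<not> b) i (\<phi> Y) l c) - mone r c = 0"
            using row[of r b i "\<phi> Y" "zm (\<not> b) i (\<phi> Y)" c] True by simp
        qed
        then show ?thesis using row[of r b i x "zm (\<not> b) i x" c] True by (simp add: corner_def)
      qed (auto simp: corner_def)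
    qed
  qed (use zmM in simp_all)
  have zmcomm: "zm False i x \<odot> corner i X = corner i X \<odot> zm False i x"
    if x: "x \<in> ?A" and i: "1 \<le> i" "i \<le> n" for i x
  proof -
    let ?D = "\<lambda>Z. Z \<odot> corner i X - corner i X \<odot> Z"
    have cM: "corner i X \<in> gl n" using gl_mono[OF i(2) corner_gl] .
    have col: "(corner i X \<odot> Z) r c = (\<Sum>l<n. corner i X r l * Z l c)" for Z r c
      by (rule gl_mmul_apply) (use cM in blast)
    have "?D (zm False i x) \<in> gl n"
      using gl_mmul_blk[OF cM blk_Mn[OF zmM order_refl]] by simp
    moreover have "?D (zm False i x) r c = 0" if r: "r < n" and c: "c < n" for r c
    proof -
      have "(\<Sum>l<n. zm False i x r l * corner i X l c) - (\<Sum>l<n. corner i X r l * zm False i x l c) = 0"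
      proof (rule van[OF x])
        show "(\<lambda>x. (\<Sum>l<n. zm False i x r l * corner i X l c) - (\<Sum>l<n. corner i X r l * zm False i x l c))
            \<in> poly_funs (affine_coords N)"
          by (intro poly_funs_diff poly_funs_sum poly_funs.mult pz[OF i] poly_funs.const)
        fix Y assume Y: "Y \<in> A_stratum X n"
        have "?D (F False i (orbit_elt X Y)) = 0"
          using cent_grpD(2)[OF \<zeta>(1)[OF A_stratum_orbit_elt(1)[OF X Y]]] by (simp add: F_def)
        then have "?D (zm False i (\<phi> Y)) r c = 0" by (simp add: zm\<phi>[OF Y i])
        then show "(\<Sum>l<n. zm False i (\<phi> Y) r l * corner i X l c) - (\<Sum>l<n. corner i X r l * zm False i (\<phi> Y) l c) = 0"
          using row[OF r, of False i "\<phi> Y" "corner i X" c] col by simp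
      qed
      then show ?thesis using row[OF r, of False i x "corner i X" c] col by simp
    qed
    ultimately have "?D (zm False i x) = 0" using gl_eq_0_iff by blast
    then show ?thesis by simp
  qed
  \<comment> \<open>The value \<open>mone\<close> outside 1..n makes \<open>zx x i\<close> a
    centralizer element for every i, as the lemmas on products require.\<close>
  define zx where "zx x i = (if 1 \<le> i \<and> i \<le> n then zm False i x else mone)" for x i
  have zxZ: "zx x i \<in> cent_grp i X" and zxI: "1 \<le> i \<Longrightarrow> i \<le> n \<Longrightarrow> minv (zx x i) = zm True i x" if x: "x \<in> ?A" for x i
  proof -
    have *: "zm False i x \<in> cent_grp i X \<and> minv (zm False i x) = zm True i x" if i: "1 \<le> i" "i \<le> n"
    proof -
      have M: "zm b i x \<in> Mn i" for b using zmid[OF x i] by (simp add: Mn_def)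
      note G = GL_I[OF M[of False] M[of True]] 
      have "zm False i x \<odot> zm True i x = mone" "zm True i x \<odot> zm False i x = mone"
        using zmprod[OF x i, of False] zmprod[OF x i, of True] by simp_all
      then show ?thesis using G zmcomm[OF x i] by (simp add: cent_grp_def)
    qed
    then show "zx x i \<in> cent_grp i X" by (simp add: zx_def)
    show "1 \<le> i \<Longrightarrow> i \<le> n \<Longrightarrow> minv (zx x i) = zm True i x" using * by (simp add: zx_def)
  qed
  have zxmap: "map (\<lambda>i. zm False i x) [1..<Suc n] = map (zx x) [1..<Suc n]" for x
    by (intro map_cong) (auto simp: zx_def)
  have \<psi>P: "mprod (map (zx x) [1..<Suc n]) \<in> cent_prod X n" if "x \<in> ?A" for x
    by (rule mprod_cent_prod) (rule zxZ[OF that])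
  have \<psi>zx: "\<psi> x = Ad (mprod (map (zx x) [1..<Suc n])) X" for x unfolding \<psi>_def zxmap ..
  have orbit_elt\<psi>: "orbit_elt X (\<psi> x) = mprod (map (zx x) [1..<Suc n])" if "x \<in> ?A" for x
    unfolding \<psi>zx by (rule orbit_elt_Ad[OF X cent_prod_GL_inf[OF \<psi>P[OF that]]])
  show ?thesis
  proof (rule affine_chart_variety[where \<phi>=\<phi> and \<psi>=\<psi> and N=N and P=P, OF is_zar_strata[OF X]])
    fix x y assume xy: "x \<in> A_stratum X n" "y \<in> A_stratum X n" and eq: "\<And>c. c \<in> orbit_coords X \<Longrightarrow> c x = c y"
    have "orbit_elt X x i j = orbit_elt X y i j" for i j
      using eq[of "\<lambda>Y. orbit_elt X Y i j"] by (auto simp: orbit_coords_def)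
    then have "orbit_elt X x = orbit_elt X y" by (simp add: fun_eq_iff)
    then have "Ad (orbit_elt X x) X = Ad (orbit_elt X y) X" by (simp only:)
    then show "x = y" by (simp only: A_stratum_orbit_elt(2)[OF X xy(1)] A_stratum_orbit_elt(2)[OF X xy(2)])
  next
    show "P \<subseteq> poly_funs (affine_coords N)" by (auto simp: P_def)
    show "\<phi> y \<in> ?A" if "y \<in> A_stratum X n" for y using that by (auto simp: \<phi>_def P_def)
    show "reg_at (A_stratum X n) (orbit_coords X) z (\<lambda>y. \<phi> y k)" if k: "k < N" and z: "z \<in> A_stratum X n" for k z
    proof -
      obtain b i r c where ek: "e k = (b, i, r, c)" by (cases "e k")
      have "reg_at (cent_prod X n) ecoords (orbit_elt X z) (\<lambda>g. F b i g r c)"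
      proof (cases b)
        case True
        have "reg_at (cent_prod X n) ecoords (orbit_elt X z) (\<lambda>g. minv (\<zeta> i g) r c)"
          by (rule minv_regular[OF A_stratum_orbit_elt(1)[OF X z] \<zeta>G(1)], assumption, rule \<zeta>(3)[OF A_stratum_orbit_elt(1)[OF X z]])
        then show ?thesis using True by (simp add: F_def)
      next
        case False
        then show ?thesis using \<zeta>(3)[OF A_stratum_orbit_elt(1)[OF X z]] by (simp add: F_def)
      qed
      from reg_at_cent_prod_A_stratum[OF X z this] show ?thesis using k ek by (simp add: \<phi>_def)
    qed
    show "\<psi> x \<in> A_stratum X n" if "x \<in> ?A" for x unfolding \<psi>zx A_stratum_def using \<psi>P[OF that] by blast
    show "reg_at ?A (affine_coords N) z (\<lambda>y. c (\<psi> y))" if c: "c \<in> orbit_coords X" and z: "z \<in> ?A" for c z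
    proof -
      obtain r s where cc: "c = (\<lambda>Y. orbit_elt X Y r s)" by (rule orbit_coordsE[OF c])
      have "reg_at ?A (affine_coords N) z (\<lambda>x. mprod (map (\<lambda>i. zm False i x) [1..<Suc n]) r s)"
        by (rule reg_at_mprod[OF zmM], rule reg_at_poly, rule pz) auto
      then show ?thesis unfolding cc by (rule reg_at_cong[rotated]) (simp only: orbit_elt\<psi> zxmap)
    qed
    show "\<psi> (\<phi> y) = y" if y: "y \<in> A_stratum X n" for y
    proof -
      have "map (\<lambda>i. zm False i (\<phi> y)) [1..<Suc n] = map (\<lambda>i. \<zeta> i (orbit_elt X y)) [1..<Suc n]"
        by (intro map_cong refl) (simp add: zm\<phi>[OF y] F_def del: upt_Suc)
      then have "\<psi> (\<phi> y) = Ad (orbit_elt X y) X" unfolding \<psi>_def using \<zeta>(2)[OF A_stratum_orbit_elt(1)[OF X y]] by (simp only:)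
      then show ?thesis using A_stratum_orbit_elt(2)[OF X y] by simp
    qed
    show "\<phi> (\<psi> x) = x" if x: "x \<in> ?A" for x
    proof
      fix k
      show "\<phi> (\<psi> x) k = x k"
      proof (cases "k < N")
        case False
        then show ?thesis using x by (simp add: \<phi>_def)
      next
        case True
        obtain b i r c where ek: "e k = (b, i, r, c)" by (cases "e k")
        then have irc: "1 \<le> i" "i \<le> n" "r < n" "c < n" using de(2)[OF True] by (auto simp: K_def)
        have g: "orbit_elt X (\<psi> x) \<in> cent_prod X n" using orbit_elt\<psi>[OF x] \<psi>P[OF x] by (simp only:)
        have "mprod (map (\<lambda>i. \<zeta> i (orbit_elt X (\<psi> x))) [1..<Suc n]) = mprod (map (zx x) [1..<Suc n])"
          using \<zeta>(2)[OF g] orbit_elt\<psi>[OF x] by (simp only:)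
        then have z: "\<zeta> i (orbit_elt X (\<psi> x)) = zx x i"
          by (rule mprod_unique[OF X \<zeta>(1)[OF g] zxZ[OF x] _ irc(1,2)])
        have "F b i (orbit_elt X (\<psi> x)) = zm b i x"
          using z zxI[OF x irc(1,2)] irc by (cases b) (simp_all add: F_def, simp add: zx_def)
        then show ?thesis
          using True ek irc de(1)[OF True] by (simp add: \<phi>_def zm_def)
      qed
    qed
  qed
qed

section \<open>The strata as an ind-variety\<close>

lemma GL_Mn_down:
  assumes "g \<in> GL m" "g \<in> Mn n"
  shows "g \<in> GL n"
proof -
  define h where "h = minv g"
  have h: "h \<in> GL m" "g \<odot> h = mone" "h \<odot> g = mone" unfolding h_def using minv_GL[OF assms(1)] by auto
  obtain A where A: "A \<in> gl n" "g = mone + A" using Mn_E[OF assms(2)] by blast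
  have f: "row_col_finite h" "row_col_finite A" using h(1) A(1) by simp_all
  have 1: "h + A \<odot> h = mone" "h + h \<odot> A = mone"
    using h(2,3) f unfolding A(2) by (simp_all add: mmul_add_left mmul_add_right)
  have "h i j = mone i j" if ij: "n \<le> i \<or> n \<le> j" for i j
  proof (cases "n \<le> i")
    case True
    then have "(A \<odot> h) i j = 0" using A(1) by (intro mmul_zeroI) (auto simp: gl_def)
    then show ?thesis using fun_cong[OF fun_cong[OF 1(1), of i], of j] by simp
  next
    case False
    then have "(h \<odot> A) i j = 0" using A(1) ij by (intro mmul_zeroI) (auto simp: gl_def)
    then show ?thesis using fun_cong[OF fun_cong[OF 1(2), of i], of j] by simp
  qed
  then have "h \<in> Mn n" by (simp add: Mn_def)
  then show ?thesis using GL_I(1)[OF assms(2)] h by blast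
qed

lemma strata_carrier: "strong_reg X \<Longrightarrow> sp_carrier (strata X (A_orbit X) n) = A_stratum X n"
  by (rule is_zar_carrier[OF is_zar_strata])

text \<open>The smaller stratum is even closed in the next one: it is where the entries of the group
  element outside the n-block are those of the identity.\<close>

lemma A_stratum_locally_closed:
  assumes X: "strong_reg X"
  shows "locally_closedin (sp_top (strata X (A_orbit X) (Suc n))) (A_stratum X n)"
proof (rule locally_closedin_local)
  fix Y assume Y: "Y \<in> A_stratum X n"
  let ?S = "A_stratum X (Suc n)"
  let ?K = "{{Y \<in> ?S. orbit_elt X Y i j - mone i j \<noteq> 0} | i j. n \<le> i \<or> n \<le> j}"
  have "zopen ?S (orbit_coords X) (\<Union>?K)"
  proof (rule zopen_Union)
    fix U assume "U \<in> ?K"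
    then obtain i j where U: "U = {Y \<in> ?S. orbit_elt X Y i j - mone i j \<noteq> 0}" by blast
    show "zopen ?S (orbit_coords X) U" unfolding U
      by (rule zopen_nonzero[OF zopen_whole], rule reg_at_diff) simp_all
  qed
  moreover have "\<Union>?K = ?S - A_stratum X n"
  proof (intro equalityI subsetI)
    fix Z assume "Z \<in> \<Union>?K"
    then obtain i j where *: "Z \<in> ?S" "orbit_elt X Z i j \<noteq> mone i j" "n \<le> i \<or> n \<le> j" by auto
    have "Z \<notin> A_stratum X n"
    proof
      assume "Z \<in> A_stratum X n"
      then have "orbit_elt X Z \<in> Mn n" using GL_Mn[OF cent_prod_GL[OF A_stratum_orbit_elt(1)[OF X]]] by blast
      then show False using * by (auto simp: Mn_def)
    qed
    then show "Z \<in> ?S - A_stratum X n" using * by blast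
  next
    fix Z assume Z: "Z \<in> ?S - A_stratum X n"
    then have ZS: "Z \<in> ?S" by blast
    note g = A_stratum_orbit_elt[OF X ZS]
    have "orbit_elt X Z \<notin> Mn n"
    proof
      assume "orbit_elt X Z \<in> Mn n"
      then have "orbit_elt X Z \<in> GL n" by (rule GL_Mn_down[OF cent_prod_GL[OF g(1)]])
      then have "orbit_elt X Z \<in> cent_prod X n" using cent_prod_GL_down[OF X _ g(1)] by simp
      then have "Ad (orbit_elt X Z) X \<in> A_stratum X n" unfolding A_stratum_def by blast
      then show False using Z g(2) by simp
    qed
    then obtain i j where "n \<le> i \<or> n \<le> j" "orbit_elt X Z i j \<noteq> mone i j" unfolding Mn_def by blast
    then show "Z \<in> \<Union>?K" using ZS by auto
  qed
  ultimately have "zopen ?S (orbit_coords X) (?S - A_stratum X n)" by (simp only:)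
  moreover have "Y \<in> ?S" using Y A_stratum_mono[of n "Suc n" X] by auto
  ultimately show "\<exists>U. openin (sp_top (strata X (A_orbit X) (Suc n))) U \<and> Y \<in> U \<and>
      openin (sp_top (strata X (A_orbit X) (Suc n))) (U - A_stratum X n)"
    unfolding is_zar_open[OF is_zar_strata[OF X]] using zopen_whole by blast
qed

lemma ind_variety_strata:
  assumes X: "strong_reg X"
  shows "ind_variety (strata X (A_orbit X))"
  unfolding ind_variety_def strata_carrier[OF X]
proof (intro allI conjI strata_variety[OF X] A_stratum_locally_closed[OF X])
  fix n
  show sub: "A_stratum X n \<subseteq> A_stratum X (Suc n)" by (rule A_stratum_mono) simp
  show "sp_iso (strata X (A_orbit X) n) (sp_sub (strata X (A_orbit X) (Suc n)) (A_stratum X n)) (\<lambda>x. x)"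
    by (rule sp_iso_zar[OF is_zar_strata[OF X] is_zar_sub[OF is_zar_strata[OF X] sub], where \<psi>="\<lambda>x. x"])
      (simp_all add: reg_at_coord)
qed

lemma ind_space_carrier:
  "sp_carrier (ind_space Z) = (\<Union>n. sp_carrier (Z n))"
proof
  show "sp_carrier (ind_space Z) \<subseteq> (\<Union>n. sp_carrier (Z n))"
    using openin_ind_space[of Z "sp_carrier (ind_space Z)"] by simp
  have "(\<Union>n. sp_carrier (Z n)) \<inter> sp_carrier (Z m) = sp_carrier (Z m)" for m by blast
  then have "openin (sp_top (ind_space Z)) (\<Union>n. sp_carrier (Z n))"
    unfolding openin_ind_space by simp
  then show "(\<Union>n. sp_carrier (Z n)) \<subseteq> sp_carrier (ind_space Z)" by (rule openin_subset)
qed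

subsection \<open>Irreducibility\<close>

lemma hol_mmul:
  assumes "\<And>s. A s \<in> Mn n" "\<And>i j. (\<lambda>s. A s i j) holomorphic_on UNIV" "\<And>i j. (\<lambda>s. B s i j) holomorphic_on UNIV"
  shows "(\<lambda>s. (A s \<odot> B s) i j) holomorphic_on UNIV"
proof -
  have "(\<lambda>s. (A s \<odot> B s) i j) = (\<lambda>s. \<Sum>l<max n (Suc i). A s i l * B s l j)"
    using assms(1) by (intro ext mmul_sum) (auto simp: Mn_def mone_def)
  then show ?thesis using assms(2,3) by (simp add: holomorphic_on_sum holomorphic_on_mult)
qed

lemma hol_mexp_line:
  assumes "a \<in> Cent i X" "b \<in> Cent i X" "strong_reg X"
  shows "(\<lambda>s. mexp (a + msmult s b) r c) holomorphic_on UNIV"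
proof -
  have g: "a \<in> gl i" "b \<in> gl i" using CentD(1) assms by blast+
  have "a \<odot> msmult s b = msmult s b \<odot> a" for s
    using Cent_commute[OF assms(3,1,2)] by (simp add: mmul_msmult_left mmul_msmult_right)
  then have e: "mexp (a + msmult s b) = mexp a \<odot> mexp (msmult s b)" for s
    using mexp_add[OF g(1) gl_msmult[OF g(2)]] by blast
  have "(\<lambda>s. mexp (msmult s b) i' j') holomorphic_on UNIV" for i' j'
    using mexp_line_has_derivative(1)[OF g(2), of i' j']
    by (simp add: holomorphic_on_def field_differentiable_def)
  then show ?thesis unfolding e
    by (intro hol_mmul[where n=i]) (simp_all add: mexp_Mn[OF g(1)])
qed

lemma hol_mprod:
  assumes "\<And>i s. z i s \<in> Mn (N i)" "\<And>i r c. (\<lambda>s. z i s r c) holomorphic_on UNIV"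
  shows "(\<lambda>s. mprod (map (\<lambda>i. z i s) is) r c) holomorphic_on UNIV"
proof (induction "is" arbitrary: r c)
  case Nil
  show ?case by (simp add: mprod_def)
next
  case (Cons i "is")
  have "(\<lambda>s. (z i s \<odot> mprod (map (\<lambda>i. z i s) is)) r c) holomorphic_on UNIV"
    by (rule hol_mmul[OF assms(1,2) Cons])
  then show ?case by (simp add: mprod_def)
qed

lemma entire_product_zero:
  assumes "f holomorphic_on UNIV" "g holomorphic_on UNIV" "\<And>s::complex. f s * g s = 0" "f a \<noteq> 0"
  shows "g b = 0"
proof -
  let ?S = "{s. f s \<noteq> 0}"
  have "open ?S"
    using open_Collect_neq[OF holomorphic_on_imp_continuous_on[OF assms(1)] continuous_on_const[of UNIV 0]] .
  then show ?thesis
    using analytic_continuation_open[of ?S UNIV g "\<lambda>_. 0" b] assms by auto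
qed

text \<open>If two proper closed sets covered the space, points x and y outside them would lie in a
  common stratum, with functions p and q nonzero at x and y whose product vanishes on it. Along an
  entire curve through x and y this contradicts the absence of zero divisors among entire
  functions.\<close>

lemma A_orbit_irreducible:
  assumes X: "strong_reg X"
  shows "irreducible_top (sp_top (ind_space (strata X (A_orbit X))))"
proof -
  let ?Z = "strata X (A_orbit X)"
  define T where "T = (\<Union>n. A_stratum X n)"
  have LT: "A_stratum X n \<subseteq> T" for n by (auto simp: T_def)
  have top: "sp_carrier (ind_space ?Z) = T" by (simp add: ind_space_carrier strata_carrier[OF X] T_def)
  have "X \<in> A_stratum X 0" by (auto simp: A_stratum_def)
  then have "T \<noteq> {}" using LT by blast
  moreover have "C = T \<or> D = T"
    if C: "closedin (sp_top (ind_space ?Z)) C" and D: "closedin (sp_top (ind_space ?Z)) D"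
      and CD: "T = C \<union> D" for C D
  proof (rule ccontr)
    assume "\<not> ?thesis"
    then have "C \<noteq> T" "D \<noteq> T" by simp_all
    moreover have "C \<subseteq> T" "D \<subseteq> T" using CD by simp_all
    ultimately obtain x y where xy: "x \<in> T" "x \<notin> C" "y \<in> T" "y \<notin> D" by blast
    obtain n1 where n1: "x \<in> A_stratum X n1" using xy(1) by (auto simp: T_def)
    obtain n2 where n2: "y \<in> A_stratum X n2" using xy(3) by (auto simp: T_def)
    define n where "n = max n1 n2"
    have n: "x \<in> A_stratum X n" "y \<in> A_stratum X n"
      using n1 n2 A_stratum_mono[of n1 n X] A_stratum_mono[of n2 n X] by (auto simp: n_def)
    have sep: "\<exists>q\<in>poly_funs (orbit_coords X). q v \<noteq> 0 \<and> (\<forall>w\<in>A_stratum X n. w \<in> B \<longrightarrow> q w = 0)"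
      if B: "closedin (sp_top (ind_space ?Z)) B" and v: "v \<in> A_stratum X n" "v \<notin> B" for B v
    proof -
      have "openin (sp_top (ind_space ?Z)) (T - B)" using B top by (simp add: closedin_def)
      then have "openin (sp_top (?Z n)) ((T - B) \<inter> A_stratum X n)"
        unfolding openin_ind_space strata_carrier[OF X] by blast
      then have "zopen (A_stratum X n) (orbit_coords X) ((T - B) \<inter> A_stratum X n)"
        unfolding is_zar_open[OF is_zar_strata[OF X]] .
      then obtain q where "q \<in> poly_funs (orbit_coords X)" "q v \<noteq> 0"
        "\<forall>w\<in>A_stratum X n. q w \<noteq> 0 \<longrightarrow> w \<in> (T - B) \<inter> A_stratum X n"
        using zopenD[of "A_stratum X n" "orbit_coords X" "(T - B) \<inter> A_stratum X n" v] v LT by blast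
      then show ?thesis by blast
    qed
    obtain p where p: "p \<in> poly_funs (orbit_coords X)" "p x \<noteq> 0" "\<forall>w\<in>A_stratum X n. w \<in> C \<longrightarrow> p w = 0"
      using sep[OF C n(1) xy(2)] by blast
    obtain q where q: "q \<in> poly_funs (orbit_coords X)" "q y \<noteq> 0" "\<forall>w\<in>A_stratum X n. w \<in> D \<longrightarrow> q w = 0"
      using sep[OF D n(2) xy(4)] by blast
    have logs: "\<exists>a. (\<forall>i. a i \<in> Cent i X) \<and> orbit_elt X v = mprod (map (\<lambda>i. mexp (a i)) [1..<Suc n])" if v: "v \<in> A_stratum X n" for v
    proof -
      obtain z where z: "\<And>i. z i \<in> cent_grp i X" "orbit_elt X v = mprod (map z [1..<Suc n])"
        using cent_prod_mprod[OF A_stratum_orbit_elt(1)[OF X v]] by blast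
      have "\<forall>i. \<exists>a. a \<in> Cent i X \<and> mexp a = z i"
        unfolding Bex_def[symmetric] by (intro allI cent_grp_mexp[OF X z(1)])
      then obtain a where "\<forall>i. a i \<in> Cent i X \<and> mexp (a i) = z i" by (rule choice[THEN exE])
      then have a: "a i \<in> Cent i X" "z i = mexp (a i)" for i by simp_all
      have "z = (\<lambda>i. mexp (a i))" by (rule ext) (rule a(2))
      then have "orbit_elt X v = mprod (map (\<lambda>i. mexp (a i)) [1..<Suc n])" using z(2) by (simp only:)
      then show ?thesis using a(1) by (intro exI[of _ a] conjI allI)
    qed
    obtain a where a: "\<And>i. a i \<in> Cent i X" "orbit_elt X x = mprod (map (\<lambda>i. mexp (a i)) [1..<Suc n])"
      using logs[OF n(1)] by blast
    obtain b where b: "\<And>i. b i \<in> Cent i X" "orbit_elt X y = mprod (map (\<lambda>i. mexp (b i)) [1..<Suc n])"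
      using logs[OF n(2)] by blast
    \<comment> \<open>Straight lines in the centralizer algebras: G 0 and G 1 are the group elements
      of x and y, and G s never leaves the product. Commutativity of each algebra makes the
      exponentials entire in s.\<close>
    define G where "G s = mprod (map (\<lambda>i. mexp (a i + msmult s (b i - a i))) [1..<Suc n])" for s
    have cC: "a i + msmult s (b i - a i) \<in> Cent i X" for i s
      by (intro Cent_add Cent_msmult Cent_diff a b)
    have GP: "G s \<in> cent_prod X n" for s unfolding G_def by (rule mprod_cent_prod) (rule mexp_cent_grp[OF cC])
    have Ghol: "(\<lambda>s. G s r c) holomorphic_on UNIV" for r c
      unfolding G_def
      by (rule hol_mprod[where N="\<lambda>i. i"]) (use mexp_Mn[OF CentD(1)[OF cC]] hol_mexp_line[OF a(1) Cent_diff[OF b(1) a(1)] X] in auto)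
    have Gx: "Ad (G 0) X = x" "Ad (G 1) X = y"
      unfolding G_def using A_stratum_orbit_elt(2)[OF X n(1)] A_stratum_orbit_elt(2)[OF X n(2)] a(2) b(2) by simp_all
    have GL: "Ad (G s) X \<in> A_stratum X n" for s unfolding A_stratum_def using GP by blast
    have hol: "(\<lambda>s. f (Ad (G s) X)) holomorphic_on UNIV" if "f \<in> poly_funs (orbit_coords X)" for f
      using that
    proof induction
      case (coord c)
      obtain i j where c: "c = (\<lambda>Y. orbit_elt X Y i j)" by (rule orbit_coordsE[OF coord])
      show ?case unfolding c by (simp add: orbit_elt_Ad[OF X cent_prod_GL_inf[OF GP]] Ghol)
    qed (auto intro: holomorphic_intros)
    have prod: "p (Ad (G s) X) * q (Ad (G s) X) = 0" for s
    proof -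
      have "Ad (G s) X \<in> C \<union> D" using GL[of s] LT CD by blast
      then show ?thesis using p(3) q(3) GL[of s] by auto
    qed
    have "q (Ad (G 1) X) = 0"
      by (rule entire_product_zero[OF hol[OF p(1)] hol[OF q(1)] prod, of 0]) (simp add: Gx p(2))
    then show False using Gx q(2) by simp
  qed
  ultimately show ?thesis unfolding irreducible_top_def top by blast
qed

section \<open>Immersion into the space of infinite matrices\<close>

lemma reg_at_corner:
  assumes "reg_at (gl n) ecoords (corner n z) f"
  shows "reg_at UNIV ecoords z (\<lambda>y. f (corner n y))"
proof (rule reg_at_comp[where \<phi>="corner n", OF assms])
  fix c assume "c \<in> ecoords"
  then obtain i j where c: "c = (\<lambda>Z. Z i j)" by (rule ecoordsE)
  show "reg_at UNIV ecoords z (\<lambda>y. c (corner n y))"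
    unfolding c by (cases "i < n \<and> j < n") (auto simp: corner_def)
qed simp_all

lemma zopen_corner:
  assumes "openin (sp_top (gl_space n)) W"
  shows "zopen UNIV ecoords (corner n -` W)"
proof -
  have "zopen UNIV ecoords {y \<in> UNIV. corner n y \<in> W}"
  proof (rule zopen_preimage[where \<phi>="corner n", OF zopen_whole])
    show "zopen (gl n) ecoords W" using assms is_zar_open[OF is_zar_gl] by blast
    show "reg_at UNIV ecoords y (\<lambda>y. c (corner n y))" if "c \<in> ecoords" for y c
      by (rule reg_at_corner[OF reg_at_coord[OF that]])
  qed simp
  then show ?thesis by (simp add: vimage_def)
qed

lemma M_inf_open: "openin (sp_top M_inf) U \<Longrightarrow> zopen UNIV ecoords U"
proof -
  assume "openin (sp_top M_inf) U"
  then have "generate_topology_on {corner n -` W | n W. openin (sp_top (gl_space n)) W} U"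
    by (simp add: M_inf_def openin_topology_generated_by_iff)
  then show ?thesis
  proof induction
    case Empty
    show ?case by (simp add: zopen_def)
  next
    case (Int a b)
    then show ?case by (simp add: zopen_Int)
  next
    case (UN K)
    then show ?case by (simp add: zopen_Union)
  next
    case (Basis s)
    then show ?case using zopen_corner by blast
  qed
qed

lemma M_inf_reg:
  assumes "f \<in> sp_reg M_inf U" "z \<in> U"
  shows "reg_at UNIV ecoords z f"
proof -
  obtain n W h where *: "openin (sp_top (gl_space n)) W" "h \<in> sp_reg (gl_space n) W" "z \<in> corner n -` W"
    "\<forall>Y\<in>corner n -` W. f Y = h (corner n Y)"
    using assms by (auto simp: M_inf_def)
  have W: "zopen (gl n) ecoords W" using *(1) is_zar_open[OF is_zar_gl] by blast
  have "reg_at (gl n) ecoords (corner n z) h" using is_zar_reg[OF is_zar_gl W] *(2,3) by blast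
  then have "reg_at UNIV ecoords z (\<lambda>y. h (corner n y))" by (rule reg_at_corner)
  then show ?thesis
    by (rule reg_at_open_cong[OF zopen_corner[OF *(1)] *(3), rotated]) (use *(4) in blast)
qed

lemma openin_gl: "openin (sp_top (gl_space n)) (gl n)"
  unfolding is_zar_open[OF is_zar_gl] by (rule zopen_whole)

lemma openin_M_inf: "openin (sp_top M_inf) UNIV"
proof -
  have "openin (sp_top M_inf) (corner 0 -` gl 0)"
    unfolding M_inf_def using openin_gl by (auto intro!: topology_generated_by_Basis)
  moreover have "corner 0 -` gl 0 = UNIV" by auto
  ultimately show ?thesis by simp
qed

lemma M_inf_carrier: "sp_carrier M_inf = UNIV"
  using openin_subset[OF openin_M_inf] by blast

lemma M_inf_entry: "regular_at M_inf Y (\<lambda>Z. Z i j)"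
proof -
  let ?n = "Suc (max i j)"
  have "(\<lambda>Z. Z i j) \<in> sp_reg (gl_space ?n) (gl ?n)"
    unfolding is_zar_reg[OF is_zar_gl zopen_whole] by simp
  moreover have "corner ?n Y i j = Y i j" for Y by (simp add: corner_def less_Suc_eq_le)
  ultimately have "(\<lambda>Z. Z i j) \<in> sp_reg M_inf UNIV"
    unfolding M_inf_def
    by (auto intro!: exI[of _ "?n"] exI[of _ "gl ?n"] exI[of _ "\<lambda>Z. Z i j"] openin_gl)
  then show ?thesis unfolding regular_at_def using openin_M_inf by blast
qed

lemma reg_at_A_stratum_entry:
  assumes "strong_reg X" "Y \<in> A_stratum X n"
  shows "reg_at (A_stratum X n) (orbit_coords X) Y (\<lambda>Y. Y i j)"
  by (rule reg_at_subset[OF reg_at_orbit_entry[OF assms(1)] A_stratum_orbit]) (use assms(2) A_stratum_orbit in blast)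

lemma strata_morphism:
  assumes X: "strong_reg X"
  shows "sp_morphism (strata X (A_orbit X) n) M_inf (\<lambda>Y. Y)"
proof (rule sp_morphismI[OF is_zar_strata[OF X] M_inf_carrier M_inf_open M_inf_reg])
  fix c z assume "c \<in> ecoords" "z \<in> A_stratum X n"
  then show "reg_at (A_stratum X n) (orbit_coords X) z (\<lambda>y. c y)" using reg_at_A_stratum_entry[OF X] by (auto elim!: ecoordsE)
qed simp_all

lemma ind_space_morphism:
  assumes "\<And>n. sp_morphism (Z n) W \<phi>"
  shows "sp_morphism (ind_space Z) W \<phi>"
  unfolding sp_morphism_def continuous_map_def ind_space_carrier
proof (intro conjI allI impI ballI)
  let ?T = "\<Union>n. sp_carrier (Z n)"
  have e: "{x \<in> ?T. \<phi> x \<in> U} \<inter> sp_carrier (Z n) = {x \<in> sp_carrier (Z n). \<phi> x \<in> U}" for U n by blast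
  show "\<phi> \<in> ?T \<rightarrow> sp_carrier W"
    using assms unfolding sp_morphism_def continuous_map_def by blast
  fix U assume U: "openin (sp_top W) U"
  show "openin (sp_top (ind_space Z)) {x \<in> ?T. \<phi> x \<in> U}"
    unfolding openin_ind_space e using assms U unfolding sp_morphism_def continuous_map_def by blast
  fix f assume f: "f \<in> sp_reg W U"
  have "f \<circ> \<phi> \<in> sp_reg (Z n) ({x \<in> ?T. \<phi> x \<in> U} \<inter> sp_carrier (Z n))" for n
    unfolding e using assms U f unfolding sp_morphism_def by blast
  then show "f \<circ> \<phi> \<in> sp_reg (ind_space Z) {x \<in> ?T. \<phi> x \<in> U}"
    by (simp add: ind_space_def)
qed

section \<open>Germs and point derivations on a Zariski space\<close>

lemma regular_at_zar:
  assumes "is_zar Z S \<Phi>" "x \<in> S"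
  shows "regular_at Z x f \<longleftrightarrow> reg_at S \<Phi> x f"
proof
  assume "regular_at Z x f"
  then obtain U where U: "openin (sp_top Z) U" "x \<in> U" "f \<in> sp_reg Z U" by (auto simp: regular_at_def)
  then have "zopen S \<Phi> U" using is_zar_open[OF assms(1)] by blast
  then show "reg_at S \<Phi> x f" using is_zar_reg[OF assms(1)] U by blast
next
  assume "reg_at S \<Phi> x f"
  then obtain U where U: "zopen S \<Phi> U" "x \<in> U" "\<forall>y\<in>U. reg_at S \<Phi> y f" using reg_at_nbhd[OF _ assms(2)] by blast
  then have "f \<in> sp_reg Z U" "openin (sp_top Z) U" using is_zar_reg[OF assms(1) U(1)] is_zar_open[OF assms(1)] by blast+
  then show "regular_at Z x f" using U(2) by (auto simp: regular_at_def)
qed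

context
  fixes Z :: "'a space_fun" and S \<Phi> x D
  assumes Z: "is_zar Z S \<Phi>" and x: "x \<in> S" and D: "point_derivation Z x D"
begin

lemma derivation_local:
  "reg_at S \<Phi> x f \<Longrightarrow> reg_at S \<Phi> x g \<Longrightarrow> zopen S \<Phi> U \<Longrightarrow> x \<in> U \<Longrightarrow> (\<And>y. y \<in> U \<Longrightarrow> f y = g y) \<Longrightarrow> D f = D g"
  using D unfolding point_derivation_def regular_at_zar[OF Z x] is_zar_open[OF Z] by blast

lemma derivation_add: "reg_at S \<Phi> x f \<Longrightarrow> reg_at S \<Phi> x g \<Longrightarrow> D (\<lambda>y. f y + g y) = D f + D g"
  using D unfolding point_derivation_def regular_at_zar[OF Z x] by blast

lemma derivation_mult: "reg_at S \<Phi> x f \<Longrightarrow> reg_at S \<Phi> x g \<Longrightarrow> D (\<lambda>y. f y * g y) = f x * D g + g x * D f"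
  using D unfolding point_derivation_def regular_at_zar[OF Z x] by blast

lemma derivation_const: "D (\<lambda>_. c) = 0"
proof -
  have "D (\<lambda>y. 1 * 1) = 1 * D (\<lambda>_. 1) + 1 * D (\<lambda>_. 1)"
    using derivation_mult[of "\<lambda>_. 1" "\<lambda>_. 1"] by simp
  then have 1: "D (\<lambda>_. 1) = 0" by simp
  have "D (\<lambda>y. c * 1) = c * D (\<lambda>_. 1) + 1 * D (\<lambda>_. c)"
    using derivation_mult[of "\<lambda>_. c" "\<lambda>_. 1"] by simp
  moreover have "D (\<lambda>y. c * 1) = c * D (\<lambda>_. 1)"
    using D reg_at_const[of S \<Phi> x 1] unfolding point_derivation_def regular_at_zar[OF Z x] by blast
  ultimately show ?thesis using 1 by simp
qed

lemma derivation_sum: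
  assumes "\<And>i. i \<in> I \<Longrightarrow> reg_at S \<Phi> x (f i)"
  shows "D (\<lambda>y. \<Sum>i\<in>I. f i y) = (\<Sum>i\<in>I. D (f i))"
  using assms
proof (induction I rule: infinite_finite_induct)
  case (insert i I)
  then show ?case using derivation_add[of "f i" "\<lambda>y. \<Sum>i\<in>I. f i y"] by (simp add: reg_at_sum)
qed (simp_all add: derivation_const)

lemma derivation_zero:
  assumes "\<And>c. c \<in> \<Phi> \<Longrightarrow> D c = 0" "reg_at S \<Phi> x f"
  shows "D f = 0"
proof -
  have poly: "D p = 0" if "p \<in> poly_funs \<Phi>" for p
    using that
  proof induction
    case (const c)
    show ?case by (rule derivation_const)
  next
    case (coord c)
    then show ?case by (rule assms(1))
  next
    case (add p q)
    then show ?case using derivation_add[OF reg_at_poly reg_at_poly] by simp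
  next
    case (mult p q)
    then show ?case using derivation_mult[OF reg_at_poly reg_at_poly] by simp
  qed
  obtain p q where 1: "p \<in> poly_funs \<Phi>" "q \<in> poly_funs \<Phi>" "q x \<noteq> 0" "\<And>y. y \<in> S \<Longrightarrow> q y \<noteq> 0 \<Longrightarrow> f y = p y / q y"
    using reg_atE[OF assms(2)] by metis
  have "D (\<lambda>y. f y * q y) = D p"
    by (rule derivation_local[OF reg_at_mult[OF assms(2) reg_at_poly[OF 1(2)]] reg_at_poly[OF 1(1)] zopen_basic[OF 1(2)]])
      (use 1 x in auto)
  moreover have "D (\<lambda>y. f y * q y) = f x * D q + q x * D f" by (rule derivation_mult[OF assms(2) reg_at_poly[OF 1(2)]])
  ultimately show ?thesis using poly[OF 1(1)] poly[OF 1(2)] 1(3) by simp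
qed

end

text \<open>Let D kill the entries of W, and let \<delta> collect its values on the entries of the
  group element g(W). Differentiating W g(W) = g(W) X at Y gives Y \<delta> = \<delta> X, so
  \<delta> g^(-1) lies in gl(n) and commutes with Y, hence is 0. So D vanishes on all coordinates of
  the stratum.\<close>

lemma strata_immersion:
  assumes X: "strong_reg X" and Y: "Y \<in> A_stratum X n"
  shows "inj_differential_at (strata X (A_orbit X) n) M_inf (\<lambda>Y. Y) Y"
  unfolding inj_differential_at_def
proof (rule allI, rule impI)
  let ?Z = "strata X (A_orbit X) n" and ?S = "A_stratum X n"
  note Z = is_zar_strata[OF X, of n]
  fix D
  assume D0: "point_derivation ?Z Y D \<and> (\<forall>h. regular_at M_inf Y h \<longrightarrow> D (h \<circ> (\<lambda>Y. Y)) = 0)"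
  then have D: "point_derivation ?Z Y D" by blast
  have DY: "D (\<lambda>Z. Z i j) = 0" for i j using D0 M_inf_entry[of Y i j] by (auto simp: comp_def)
  define \<delta> :: imat where "\<delta> = (\<lambda>i j. D (\<lambda>Y. orbit_elt X Y i j))"
  define g where "g = orbit_elt X Y"
  have gP: "g \<in> cent_prod X n" unfolding g_def by (rule A_stratum_orbit_elt(1)[OF X Y])
  have gi: "g \<in> GL_inf" by (rule cent_prod_GL_inf[OF gP])
  have gamM: "orbit_elt X W \<in> Mn n" if "W \<in> ?S" for W using cent_prod_GL[OF A_stratum_orbit_elt(1)[OF X that]] by simp
  have "\<delta> i j = 0" if "n \<le> i \<or> n \<le> j" for i j
  proof -
    have "orbit_elt X W i j = mone i j" if "W \<in> ?S" for W using gamM[OF that] \<open>n \<le> i \<or> n \<le> j\<close> unfolding Mn_def by blast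
    then have "\<delta> i j = D (\<lambda>_. mone i j)"
      unfolding \<delta>_def by (intro derivation_local[OF Z Y D _ _ zopen_whole Y]) simp_all
    then show ?thesis by (simp add: derivation_const[OF Z Y D])
  qed
  then have \<delta>: "\<delta> \<in> gl n" by (simp add: gl_def)
  note rY = reg_at_A_stratum_entry[OF X Y]
  have "(Y \<odot> \<delta>) i j = (\<delta> \<odot> X) i j" for i j
  proof -
    let ?K = "{..<max n (Suc (max i j))}"
    have eq: "(\<Sum>k\<in>?K. W i k * orbit_elt X W k j) = (\<Sum>k\<in>?K. orbit_elt X W i k * X k j)" if W: "W \<in> ?S" for W
    proof -
      have "orbit_elt X W \<odot> X = W \<odot> orbit_elt X W"
        using Ad_eq_iff[OF cent_prod_GL_inf[OF A_stratum_orbit_elt(1)[OF X W]]] A_stratum_orbit_elt(2)[OF X W] by blast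
      moreover have "(W \<odot> orbit_elt X W) i j = (\<Sum>k\<in>?K. W i k * orbit_elt X W k j)"
        using gamM[OF W] by (intro mmul_sum) (auto simp: Mn_def mone_def)
      moreover have "(orbit_elt X W \<odot> X) i j = (\<Sum>k\<in>?K. orbit_elt X W i k * X k j)"
        using gamM[OF W] by (intro mmul_sum) (auto simp: Mn_def mone_def)
      ultimately show ?thesis by simp
    qed
    have r1: "reg_at ?S (orbit_coords X) Y (\<lambda>W. W i k * orbit_elt X W k j)" for k by (intro reg_at_mult rY reg_at_orbit_elt)
    have r2: "reg_at ?S (orbit_coords X) Y (\<lambda>W. orbit_elt X W i k * X k j)" for k by (intro reg_at_mult reg_at_const reg_at_orbit_elt)
    have "D (\<lambda>W. \<Sum>k\<in>?K. W i k * orbit_elt X W k j) = D (\<lambda>W. \<Sum>k\<in>?K. orbit_elt X W i k * X k j)"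
      by (rule derivation_local[OF Z Y D _ _ zopen_whole Y eq]) (intro reg_at_sum r1 r2)+
    moreover have "D (\<lambda>W. \<Sum>k\<in>?K. W i k * orbit_elt X W k j) = (\<Sum>k\<in>?K. Y i k * \<delta> k j)"
    proof -
      have "D (\<lambda>W. W i k * orbit_elt X W k j) = Y i k * \<delta> k j" for k
        using derivation_mult[OF Z Y D rY reg_at_orbit_elt, of i k k j] by (simp add: DY \<delta>_def)
      then show ?thesis using derivation_sum[OF Z Y D, where I="?K" and f="\<lambda>k W. W i k * orbit_elt X W k j"] r1 by simp
    qed
    moreover have "D (\<lambda>W. \<Sum>k\<in>?K. orbit_elt X W i k * X k j) = (\<Sum>k\<in>?K. \<delta> i k * X k j)"
    proof -
      have "D (\<lambda>W. orbit_elt X W i k * X k j) = \<delta> i k * X k j" for k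
        using derivation_mult[OF Z Y D reg_at_orbit_elt reg_at_const, of i k "X k j"]
        by (simp add: derivation_const[OF Z Y D] \<delta>_def mult.commute)
      then show ?thesis using derivation_sum[OF Z Y D, where I="?K" and f="\<lambda>k W. orbit_elt X W i k * X k j"] r2 by simp
    qed
    moreover have "(Y \<odot> \<delta>) i j = (\<Sum>k\<in>?K. Y i k * \<delta> k j)"
      using \<delta> by (intro mmul_sum) (auto simp: gl_def)
    moreover have "(\<delta> \<odot> X) i j = (\<Sum>k\<in>?K. \<delta> i k * X k j)"
      using \<delta> by (intro mmul_sum) (auto simp: gl_def)
    ultimately show ?thesis by simp
  qed
  then have eq: "Y \<odot> \<delta> = \<delta> \<odot> X" by (intro ext)
  define A where "A = \<delta> \<odot> minv g"
  have bm: "blk n (minv g)" using blk_Mn[OF GL_Mn[OF minv_GL(1)[OF cent_prod_GL[OF gP]]]] by simp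
  have A: "A \<in> gl n" unfolding A_def by (rule gl_mmul_blk(1)[OF \<delta> bm])
  have gX: "minv g \<odot> Y = X \<odot> minv g"
  proof -
    have "Ad g X = Y" unfolding g_def by (rule A_stratum_orbit_elt(2)[OF X Y])
    then have "Ad (minv g) Y = X" using Ad_minv[OF gi] by blast
    then show ?thesis using Ad_eq_iff[OF minv_GL_inf(1)[OF gi]] by blast
  qed
  have "A \<odot> Y = \<delta> \<odot> (minv g \<odot> Y)" unfolding A_def using \<delta> gi by (simp add: mmul_assoc)
  also have "\<dots> = (\<delta> \<odot> X) \<odot> minv g" unfolding gX using \<delta> gi by (simp add: mmul_assoc)
  also have "\<dots> = Y \<odot> A" unfolding eq[symmetric] A_def using \<delta> gi by (simp add: mmul_assoc)
  finally have AY: "A \<odot> Y = Y \<odot> A" .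
  have "strong_reg Y"
    using strong_reg_Ad_cent_prod[OF X gP] A_stratum_orbit_elt(2)[OF X Y] by (simp add: g_def)
  then have "A = 0" by (rule strong_reg_commutant_zero[OF _ A AY])
  then have "A \<odot> g = 0" by simp
  then have "\<delta> = 0" using gi by (simp add: A_def)
  then have Dc: "D c = 0" if "c \<in> orbit_coords X" for c
    using that by (auto elim!: orbit_coordsE simp: \<delta>_def fun_eq_iff)
  show "\<forall>f. regular_at ?Z Y f \<longrightarrow> D f = 0"
  proof (rule allI, rule impI)
    fix f assume f: "regular_at ?Z Y f"
    have "reg_at (A_stratum X n) (orbit_coords X) Y f" using f unfolding regular_at_zar[OF Z Y] .
    with Dc show "D f = 0" by (rule derivation_zero[OF Z Y D])
  qed
qed

lemma A_orbit_immersed: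
  assumes X: "strong_reg X"
  shows "immersed_by (strata X (A_orbit X)) (\<lambda>Y. Y) (A_orbit X)"
proof -
  have m: "sp_morphism (ind_space (strata X (A_orbit X))) M_inf (\<lambda>Y. Y)"
    by (rule ind_space_morphism, rule strata_morphism[OF X])
  have c: "sp_carrier (ind_space (strata X (A_orbit X))) = A_orbit X"
    unfolding ind_space_carrier strata_carrier[OF X] by (rule A_orbit_A_stratum[OF X, symmetric])
  have d: "\<forall>n. \<forall>x\<in>sp_carrier (strata X (A_orbit X) n).
      inj_differential_at (strata X (A_orbit X) n) M_inf (\<lambda>Y. Y) x"
    by (intro allI ballI, rule strata_immersion[OF X], simp only: strata_carrier[OF X])
  show ?thesis
    unfolding immersed_by_def c using ind_variety_strata[OF X] m d by (simp only: inj_on_id2 image_ident simp_thms)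
qed

section \<open>Derivatives along curves\<close>

definition linear_form :: "(imat \<Rightarrow> complex) \<Rightarrow> bool" where
  "linear_form \<Lambda> \<longleftrightarrow> (\<forall>V W. \<Lambda> (V + W) = \<Lambda> V + \<Lambda> W) \<and> (\<forall>a V. \<Lambda> (msmult a V) = a * \<Lambda> V)"

text \<open>Entrywise complex derivative at 0, so that no topology on infinite matrices is
  needed.\<close>

definition velocity :: "(complex \<Rightarrow> imat) \<Rightarrow> imat \<Rightarrow> bool" where
  "velocity c V \<longleftrightarrow> (\<forall>i j. ((\<lambda>t. c t i j) has_field_derivative V i j) (at 0))"

lemma linear_form_add: "linear_form \<Lambda> \<Longrightarrow> \<Lambda> (V + W) = \<Lambda> V + \<Lambda> W" by (simp add: linear_form_def)

lemma linear_form_scale: "linear_form \<Lambda> \<Longrightarrow> \<Lambda> (msmult a V) = a * \<Lambda> V" by (simp add: linear_form_def)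

lemma linear_form_zero: "linear_form \<Lambda> \<Longrightarrow> \<Lambda> 0 = 0"
  using linear_form_scale[of \<Lambda> 0 0] by simp

lemma linear_form_sum:
  fixes F :: "'i \<Rightarrow> imat"
  assumes "linear_form \<Lambda>"
  shows "\<Lambda> (\<Sum>i\<in>I. F i) = (\<Sum>i\<in>I. \<Lambda> (F i))"
  using sum_comp_morphism[of \<Lambda> F I, OF linear_form_zero[OF assms] linear_form_add[OF assms]] by (simp add: comp_def)

lemma linear_form_uminus: "linear_form \<Lambda> \<Longrightarrow> \<Lambda> (- V) = - \<Lambda> V"
  using linear_form_scale[of \<Lambda> "- 1" V] by (simp add: msmult_minus1)

text \<open>The chain rule without partial derivatives: one linear form, independent of the curve,
  computes the derivative along every curve through z. Linearity of tangent vectors in their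
  direction is read off from it.\<close>

lemma poly_derivative:
  assumes "p \<in> poly_funs ecoords"
  shows "\<exists>\<Lambda>. linear_form \<Lambda> \<and> (\<forall>c V. velocity c V \<longrightarrow> c 0 = z \<longrightarrow> ((\<lambda>t. p (c t)) has_field_derivative \<Lambda> V) (at 0))"
  using assms
proof induction
  case (const k)
  show ?case by (rule exI[of _ "\<lambda>_. 0"]) (simp add: linear_form_def)
next
  case (coord x)
  obtain i j where x: "x = (\<lambda>Z. Z i j)" by (rule ecoordsE[OF coord])
  show ?case by (rule exI[of _ "\<lambda>V. V i j"]) (simp add: linear_form_def x velocity_def)
next
  case (add p q)
  obtain L where L: "linear_form L" "\<And>c V. velocity c V \<Longrightarrow> c 0 = z \<Longrightarrow> ((\<lambda>t. p (c t)) has_field_derivative L V) (at 0)"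
    using add.IH(1) by blast
  obtain M where M: "linear_form M" "\<And>c V. velocity c V \<Longrightarrow> c 0 = z \<Longrightarrow> ((\<lambda>t. q (c t)) has_field_derivative M V) (at 0)"
    using add.IH(2) by blast
  show ?case
    by (rule exI[of _ "\<lambda>V. L V + M V"])
      (use L(1) M(1) in \<open>auto simp: linear_form_def algebra_simps intro!: DERIV_add L(2) M(2)\<close>)
next
  case (mult p q)
  obtain L where L: "linear_form L" "\<And>c V. velocity c V \<Longrightarrow> c 0 = z \<Longrightarrow> ((\<lambda>t. p (c t)) has_field_derivative L V) (at 0)"
    using mult.IH(1) by blast
  obtain M where M: "linear_form M" "\<And>c V. velocity c V \<Longrightarrow> c 0 = z \<Longrightarrow> ((\<lambda>t. q (c t)) has_field_derivative M V) (at 0)"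
    using mult.IH(2) by blast
  show ?case
  proof (intro exI[of _ "\<lambda>V. L V * q z + M V * p z"] conjI allI impI)
    show "linear_form (\<lambda>V. L V * q z + M V * p z)" using L(1) M(1) by (auto simp: linear_form_def algebra_simps)
    fix c V assume "velocity c V" and c0: "c 0 = z"
    then have "((\<lambda>t. p (c t) * q (c t)) has_field_derivative L V * q (c 0) + M V * p (c 0)) (at 0)"
      by (intro DERIV_mult L(2) M(2))
    then show "((\<lambda>t. p (c t) * q (c t)) has_field_derivative L V * q z + M V * p z) (at 0)" by (simp only: c0)
  qed
qed

lemma reg_at_derivative:
  assumes "reg_at S ecoords z f"
  shows "\<exists>\<Lambda>. linear_form \<Lambda> \<and> (\<forall>c V. velocity c V \<longrightarrow> c 0 = z \<longrightarrow> (\<forall>t. c t \<in> S) \<longrightarrow>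
    ((\<lambda>t. f (c t)) has_field_derivative \<Lambda> V) (at 0))"
proof -
  obtain p q where pq: "p \<in> poly_funs ecoords" "q \<in> poly_funs ecoords" "q z \<noteq> 0"
    "\<And>y. y \<in> S \<Longrightarrow> q y \<noteq> 0 \<Longrightarrow> f y = p y / q y"
    using reg_atE[OF assms] by metis
  obtain L where L: "linear_form L" "\<And>c V. velocity c V \<Longrightarrow> c 0 = z \<Longrightarrow> ((\<lambda>t. p (c t)) has_field_derivative L V) (at 0)"
    using poly_derivative[OF pq(1)] by blast
  obtain M where M: "linear_form M" "\<And>c V. velocity c V \<Longrightarrow> c 0 = z \<Longrightarrow> ((\<lambda>t. q (c t)) has_field_derivative M V) (at 0)"
    using poly_derivative[OF pq(2)] by blast
  define a b where "a = 1 / q z" and "b = - p z / (q z * q z)"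
  show ?thesis
  proof (intro exI[of _ "\<lambda>V. a * L V + b * M V"] conjI allI impI)
    show "linear_form (\<lambda>V. a * L V + b * M V)"
      using L(1) M(1) by (simp add: linear_form_def algebra_simps)
    fix c V assume v: "velocity c V" and c0: "c 0 = z" and S: "\<forall>t. c t \<in> S"
    have "(L V * q z - p z * M V) / (q z * q z) = a * L V + b * M V"
      using pq(3) by (simp add: a_def b_def diff_divide_distrib)
    then have d: "((\<lambda>t. p (c t) / q (c t)) has_field_derivative a * L V + b * M V) (at 0)"
      using DERIV_divide[OF L(2)[OF v c0] M(2)[OF v c0]] pq(3) by (simp add: c0)
    \<comment> \<open>The fraction represents f only where q does not vanish; continuity of q along
      the curve secures this near t = 0.\<close>
    have "isCont (\<lambda>t. q (c t)) 0" by (rule DERIV_isCont[OF M(2)[OF v c0]])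
    then have "((\<lambda>t. q (c t)) \<longlongrightarrow> q z) (nhds 0)"
      by (simp add: continuous_at tendsto_at_iff_tendsto_nhds[symmetric] isCont_def c0 tendsto_nhds_iff)
    then have "eventually (\<lambda>t. q (c t) \<noteq> 0) (nhds 0)" by (rule tendsto_imp_eventually_ne[OF _ pq(3)])
    then have "eventually (\<lambda>t. f (c t) = p (c t) / q (c t)) (nhds 0)"
      by (rule eventually_mono) (use pq(4) S in blast)
    from DERIV_cong_ev[OF refl this refl] d
    show "((\<lambda>t. f (c t)) has_field_derivative a * L V + b * M V) (at 0)" by blast
  qed
qed

lemma velocity_mmul_left:
  assumes "\<And>t. G t \<in> Mn n" "velocity G G'" "G' \<in> gl n" "velocity B B'"
  shows "velocity (\<lambda>t. G t \<odot> B t) (G' \<odot> B 0 + G 0 \<odot> B')"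
  unfolding velocity_def
proof (intro allI)
  fix i j
  let ?K = "{..<max n (Suc i)}"
  have e: "(G t \<odot> C) i j = (\<Sum>k\<in>?K. G t i k * C k j)" for t C
    using assms(1) by (intro mmul_sum) (auto simp: Mn_def mone_def)
  have e': "(G' \<odot> C) i j = (\<Sum>k\<in>?K. G' i k * C k j)" for C
    using assms(3) by (intro mmul_sum) (auto simp: gl_def)
  have "((\<lambda>t. \<Sum>k\<in>?K. G t i k * B t k j) has_field_derivative (\<Sum>k\<in>?K. G' i k * B 0 k j + B' k j * G 0 i k)) (at 0)"
    by (intro DERIV_sum DERIV_mult) (use assms(2,4) in \<open>auto simp: velocity_def\<close>)
  then show "((\<lambda>t. (G t \<odot> B t) i j) has_field_derivative (G' \<odot> B 0 + G 0 \<odot> B') i j) (at 0)"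
    by (simp add: e e' sum.distrib mult.commute)
qed

lemma velocity_mmul_right:
  assumes "\<And>t. G t \<in> Mn n" "velocity G G'" "G' \<in> gl n" "velocity B B'"
  shows "velocity (\<lambda>t. B t \<odot> G t) (B' \<odot> G 0 + B 0 \<odot> G')"
  unfolding velocity_def
proof (intro allI)
  fix i j
  let ?K = "{..<max n (Suc j)}"
  have e: "(C \<odot> G t) i j = (\<Sum>k\<in>?K. C i k * G t k j)" for t C
    using assms(1) by (intro mmul_sum) (auto simp: Mn_def mone_def)
  have e': "(C \<odot> G') i j = (\<Sum>k\<in>?K. C i k * G' k j)" for C
    using assms(3) by (intro mmul_sum) (auto simp: gl_def)
  have "((\<lambda>t. \<Sum>k\<in>?K. B t i k * G t k j) has_field_derivative (\<Sum>k\<in>?K. B' i k * G 0 k j + G' k j * B 0 i k)) (at 0)"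
    by (intro DERIV_sum DERIV_mult) (use assms(2,4) in \<open>auto simp: velocity_def\<close>)
  then show "((\<lambda>t. (B t \<odot> G t) i j) has_field_derivative (B' \<odot> G 0 + B 0 \<odot> G') i j) (at 0)"
    by (simp add: e e' sum.distrib mult.commute)
qed

lemma velocity_const: "velocity (\<lambda>_. B) 0"
  by (simp add: velocity_def)

lemma velocity_mexp: "A \<in> gl n \<Longrightarrow> velocity (\<lambda>t. mexp (msmult t A)) A"
  unfolding velocity_def using mexp_line_has_derivative(2) by blast

lemma velocity_mexp_mmul:
  assumes "A \<in> gl n"
  shows "velocity (\<lambda>t. mexp (msmult t A) \<odot> g) (A \<odot> g)"
  using velocity_mmul_left[OF mexp_Mn[OF gl_msmult[OF assms]] velocity_mexp[OF assms] assms velocity_const[of g]]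
  by simp

lemma velocity_Ad:
  assumes "A \<in> gl n"
  shows "velocity (\<lambda>t. Ad (mexp (msmult t A)) Y) (comm A Y)"
proof -
  have m: "- A \<in> gl n" using assms by simp
  have "Ad (mexp (msmult t A)) Y = (mexp (msmult t A) \<odot> Y) \<odot> mexp (msmult t (- A))" for t
    unfolding Ad_def mexp_GL(2)[OF gl_msmult[OF assms]] by simp
  moreover have "velocity (\<lambda>t. (mexp (msmult t A) \<odot> Y) \<odot> mexp (msmult t (- A)))
      ((A \<odot> Y) \<odot> mexp (msmult 0 (- A)) + (mexp (msmult 0 A) \<odot> Y) \<odot> (- A))"
    by (rule velocity_mmul_right[OF mexp_Mn[OF gl_msmult[OF m]] velocity_mexp[OF m] m velocity_mexp_mmul[OF assms]])
  ultimately show ?thesis by (simp add: comm_def mmul_uminus_right)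
qed

lemma velocity_line: "velocity (\<lambda>t. Y + msmult t V) V"
  unfolding velocity_def by (auto intro!: derivative_eq_intros)

text \<open>Lifted to the group, the curve becomes exp(tA) g in GL(n) with velocity A g, which is
  linear in A.\<close>

lemma orbit_deriv_linear:
  assumes g: "g \<in> GL n" and Y: "Y = Ad g X" and f: "reg_at (GL n) ecoords g (\<lambda>g. f (Ad g X))"
  shows "\<exists>\<Lambda>. linear_form \<Lambda> \<and> (\<forall>A\<in>gl n. orbit_deriv Y A f = \<Lambda> A \<and>
    ((\<lambda>t. f (Ad (mexp (msmult t A)) Y)) has_field_derivative \<Lambda> A) (at 0))"
proof -
  obtain L where L: "linear_form L" "\<And>c V. velocity c V \<Longrightarrow> c 0 = g \<Longrightarrow> (\<And>t. c t \<in> GL n) \<Longrightarrow>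
      ((\<lambda>t. f (Ad (c t) X)) has_field_derivative L V) (at 0)"
    using reg_at_derivative[OF f] by blast
  have "((\<lambda>t. f (Ad (mexp (msmult t A)) Y)) has_field_derivative L (A \<odot> g)) (at 0)" if A: "A \<in> gl n" for A
  proof -
    have E: "mexp (msmult t A) \<in> GL n" for t by (rule mexp_GL(1)[OF gl_msmult[OF A]])
    have "((\<lambda>t. f (Ad (mexp (msmult t A) \<odot> g) X)) has_field_derivative L (A \<odot> g)) (at 0)"
      by (rule L(2)[OF velocity_mexp_mmul[OF A]]) (simp_all add: GL_mmul[OF E g])
    then show ?thesis by (simp add: Y Ad_mmul[OF GL_GL_inf[OF E] GL_GL_inf[OF g]])
  qed
  moreover have "linear_form (\<lambda>A. L (A \<odot> g))"
    using L(1) row_col_finite_GL[OF g] by (simp add: linear_form_def mmul_add_left mmul_msmult_left)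
  ultimately show ?thesis
    by (intro exI[of _ "\<lambda>A. L (A \<odot> g)"] conjI ballI) (simp_all add: orbit_deriv_def DERIV_imp_deriv)
qed

lemma diff_at_linear:
  assumes "reg_at UNIV ecoords Y F"
  shows "\<exists>\<Lambda>. linear_form \<Lambda> \<and> diff_at F Y = \<Lambda> \<and> (\<forall>c V. velocity c V \<longrightarrow> c 0 = Y \<longrightarrow>
    ((\<lambda>t. F (c t)) has_field_derivative \<Lambda> V) (at 0))"
proof -
  obtain L where L: "linear_form L" "\<And>c V. velocity c V \<Longrightarrow> c 0 = Y \<Longrightarrow> (\<And>t. c t \<in> UNIV) \<Longrightarrow>
      ((\<lambda>t. F (c t)) has_field_derivative L V) (at 0)"
    using reg_at_derivative[OF assms] by blast
  have "diff_at F Y V = L V" for V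
    unfolding diff_at_def by (rule DERIV_imp_deriv, rule L(2)[OF velocity_line]) simp_all
  then show ?thesis using L by (intro exI[of _ L]) (simp add: fun_eq_iff)
qed

lemma diff_at_linear_form: "reg_at UNIV ecoords Y F \<Longrightarrow> linear_form (diff_at F Y)"
  using diff_at_linear by blast

lemma orbit_deriv_diff_at:
  assumes "reg_at UNIV ecoords Y F" "A \<in> gl n"
  shows "orbit_deriv Y A F = diff_at F Y (comm A Y)"
proof -
  obtain L where L: "diff_at F Y = L" "\<And>c V. velocity c V \<Longrightarrow> c 0 = Y \<Longrightarrow> ((\<lambda>t. F (c t)) has_field_derivative L V) (at 0)"
    using diff_at_linear[OF assms(1)] by blast
  have "((\<lambda>t. F (Ad (mexp (msmult t A)) Y)) has_field_derivative L (comm A Y)) (at 0)"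
    by (rule L(2)[OF velocity_Ad[OF assms(2)]]) simp
  then show ?thesis using L(1) by (simp add: orbit_deriv_def DERIV_imp_deriv)
qed

lemma O_M_inf_reg_at:
  assumes "F \<in> O_M_inf"
  shows "reg_at UNIV ecoords Y F"
proof -
  obtain n f where f: "F = (\<lambda>X. f (corner n X))" "f \<in> sp_reg (gl_space n) (gl n)"
    using assms by (auto simp: O_M_inf_def)
  have "reg_at (gl n) ecoords (corner n Y) f" using f(2) is_zar_reg[OF is_zar_gl zopen_whole] by simp
  then show ?thesis unfolding f(1) by (rule reg_at_corner)
qed

lemma entry_O_M_inf: "(\<lambda>X. X i j) \<in> O_M_inf"
proof -
  let ?n = "Suc (max i j)"
  have "(\<lambda>Z. Z i j) \<in> sp_reg (gl_space ?n) (gl ?n)"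
    unfolding is_zar_reg[OF is_zar_gl zopen_whole] by simp
  moreover have "(\<lambda>X. X i j) = (\<lambda>X. (\<lambda>Z. Z i j) (corner ?n X))"
    by (simp add: corner_def less_Suc_eq_le)
  ultimately show ?thesis unfolding O_M_inf_def
    by (intro CollectI exI[of _ ?n] exI[of _ "\<lambda>Z. Z i j"] conjI)
qed

lemma diff_at_entry: "diff_at (\<lambda>X. X i j) Y V = V i j"
  unfolding diff_at_def by (rule DERIV_imp_deriv) (auto intro!: derivative_eq_intros)

text \<open>The entries are global functions whose derivatives are the entries of the vector. This
  gives the uniqueness in the definite descriptions of \<open>di\<close> and
  \<open>ham\<close>.\<close>

lemma tangent_vector_eqI:
  assumes "\<And>F. F \<in> O_M_inf \<Longrightarrow> diff_at F Y V = diff_at F Y W"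
  shows "V = W"
proof (intro ext)
  fix i j
  show "V i j = W i j" using assms[OF entry_O_M_inf, of i j] by (simp add: diff_at_entry)
qed

section \<open>Traces and the symplectic form\<close>

lemma comm_add_left: "row_col_finite A \<Longrightarrow> row_col_finite B \<Longrightarrow> comm (A + B) Y = comm A Y + comm B Y"
  by (simp add: comm_def mmul_add_left mmul_add_right)

lemma comm_msmult_left: "comm (msmult c A) Y = msmult c (comm A Y)"
  by (simp add: comm_def mmul_msmult_left mmul_msmult_right mat.scale_right_diff_distrib)

lemma comm_sum_left:
  fixes F :: "'a \<Rightarrow> imat"
  assumes "\<And>x. x \<in> I \<Longrightarrow> row_col_finite (F x)"
  shows "comm (\<Sum>x\<in>I. F x) Y = (\<Sum>x\<in>I. comm (F x) Y)"
  using assms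
proof (induction I rule: infinite_finite_induct)
  case (infinite I)
  then have "comm (\<Sum>x\<in>I. F x) Y = (\<Sum>x\<in>I. comm (F x) Y)" by (simp add: comm_def)
  then show ?case .
next
  case empty
  have "comm (\<Sum>x\<in>{}. F x) Y = (\<Sum>x\<in>{}. comm (F x) Y)" by (simp add: comm_def)
  then show ?case .
next
  case (insert x I)
  have "comm (F x + (\<Sum>x\<in>I. F x)) Y = comm (F x) Y + comm (\<Sum>x\<in>I. F x) Y"
    by (rule comm_add_left) (use insert.prems in \<open>auto intro: row_col_finite_sum\<close>)
  moreover have "comm (\<Sum>x\<in>I. F x) Y = (\<Sum>x\<in>I. comm (F x) Y)" using insert by blast
  ultimately have "comm (\<Sum>x\<in>insert x I. F x) Y = (\<Sum>x\<in>insert x I. comm (F x) Y)"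
    using insert.hyps by simp
  then show ?case .
qed

lemma comm_gl_eq_0: "comm A Y = 0 \<longleftrightarrow> A \<odot> Y = Y \<odot> A"
  by (simp add: comm_def)

lemma corner_comm: "A \<in> gl n \<Longrightarrow> corner n (comm A Y) = comm A (corner n Y)"
  using blk_gl[of A n n] by (simp add: comm_def corner_diff corner_mmul corner_id)

lemma tr_add: "tr n (A + B) = tr n A + tr n B" by (simp add: tr_def sum.distrib)

lemma tr_diff: "tr n (A - B) = tr n A - tr n B" by (simp add: tr_def sum_subtractf)

lemma tr_msmult: "tr n (msmult c A) = c * tr n A" by (simp add: tr_def sum_distrib_left)

lemma tr_zero [simp]: "tr n 0 = 0" by (simp add: tr_def)

lemma tr_sum:
  fixes F :: "'a \<Rightarrow> imat"
  shows "tr n (\<Sum>x\<in>I. F x) = (\<Sum>x\<in>I. tr n (F x))"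
  using sum_comp_morphism[of "tr n" F I, OF tr_zero tr_add] by (simp add: comp_def)

lemma tr_corner: "tr n (corner n A) = tr n A" by (simp add: tr_def corner_def)

lemma tr_commute:
  assumes "A \<in> gl n"
  shows "tr n (A \<odot> B) = tr n (B \<odot> A)"
proof -
  have "tr n (A \<odot> B) = (\<Sum>i<n. \<Sum>k<n. A i k * B k i)"
    unfolding tr_def by (intro sum.cong refl gl_mmul_apply) (simp add: assms)
  also have "\<dots> = (\<Sum>k<n. \<Sum>i<n. B k i * A i k)" by (subst sum.swap) (simp add: mult.commute)
  also have "\<dots> = tr n (B \<odot> A)"
    unfolding tr_def by (intro sum.cong refl gl_mmul_apply[symmetric]) (simp add: assms)
  finally show ?thesis .
qed

lemma tr_mono:
  assumes "A \<in> gl n" "n \<le> m"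
  shows "tr m (A \<odot> B) = tr n (A \<odot> B)"
  unfolding tr_def
proof (rule sum.mono_neutral_right)
  have "(A \<odot> B) i i = 0" if "n \<le> i" for i using assms(1) that by (intro mmul_zeroI) (auto simp: gl_def)
  then show "\<forall>i\<in>{..<m} - {..<n}. (A \<odot> B) i i = 0" by simp
qed (use assms in auto)

lemma tr_mmul_corner: "A \<in> gl n \<Longrightarrow> tr n (A \<odot> corner n B) = tr n (A \<odot> B)"
  using tr_corner[of n "A \<odot> B"] blk_gl[of A n n] by (simp add: corner_mmul corner_id)

lemma tr_Ad:
  assumes "u \<in> GL n" "A \<in> gl n"
  shows "tr n (Ad u A) = tr n A"
proof -
  have u: "u \<in> GL_inf" by (rule GL_GL_inf[OF assms(1)])
  have "u \<odot> A \<in> gl n" using gl_mmul_blk(2)[OF assms(2)] blk_Mn[OF GL_Mn[OF assms(1)]] by simp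
  then have "tr n ((u \<odot> A) \<odot> minv u) = tr n (minv u \<odot> (u \<odot> A))" by (rule tr_commute)
  then show ?thesis using u by (simp add: Ad_def)
qed

lemma tr_form:
  assumes "A \<in> gl n" "B \<in> gl n"
  shows "tr n (corner n Y \<odot> comm A B) = - tr n (B \<odot> comm A Y)"
    and "tr n (corner n Y \<odot> comm A B) = tr n (A \<odot> comm B Y)"
proof -
  let ?Y = "corner n Y"
  have Y: "?Y \<in> gl n" by simp
  have f: "row_col_finite A" "row_col_finite B" using assms by simp_all
  have 1: "tr n (?Y \<odot> (A \<odot> B)) = tr n (B \<odot> (?Y \<odot> A))"
    using tr_commute[OF assms(2), of "?Y \<odot> A"] f by (simp add: mmul_assoc)
  have 2: "tr n (?Y \<odot> (B \<odot> A)) = tr n (B \<odot> (A \<odot> ?Y))"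
    using tr_commute[OF Y, of "B \<odot> A"] f by (simp add: mmul_assoc)
  have 3: "tr n (?Y \<odot> (B \<odot> A)) = tr n (A \<odot> (?Y \<odot> B))"
    using tr_commute[OF assms(1), of "?Y \<odot> B"] f by (simp add: mmul_assoc)
  have 4: "tr n (?Y \<odot> (A \<odot> B)) = tr n (A \<odot> (B \<odot> ?Y))"
    using tr_commute[OF Y, of "A \<odot> B"] f by (simp add: mmul_assoc)
  have c: "tr n (D \<odot> comm C Y) = tr n (D \<odot> comm C ?Y)" if "C \<in> gl n" "D \<in> gl n" for C D
    using tr_mmul_corner[OF that(2), of "comm C Y"] corner_comm[OF that(1)] by simp
  show "tr n (?Y \<odot> comm A B) = - tr n (B \<odot> comm A Y)"
    unfolding c[OF assms] using f 1 2 by (simp add: comm_def mmul_diff_right tr_diff)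
  show "tr n (?Y \<odot> comm A B) = tr n (A \<odot> comm B Y)"
    unfolding c[OF assms(2,1)] using f 3 4 by (simp add: comm_def mmul_diff_right tr_diff)
qed

lemma tr_form_antisym:
  assumes "A \<in> gl n" "B \<in> gl n"
  shows "tr n (B \<odot> comm A Y) = - tr n (A \<odot> comm B Y)"
  using tr_form[OF assms, of Y] by simp

text \<open>The trace against b only sees the i-corner of [a, Y], which vanishes because a
  centralizes that corner.\<close>

lemma Cent_isotropic_aux:
  assumes "a \<in> Cent i Y" "b \<in> gl i" "i \<le> n"
  shows "tr n (b \<odot> comm a Y) = 0"
proof -
  have "corner i (comm a Y) = 0" using corner_comm[OF CentD(1)[OF assms(1)]] CentD(2)[OF assms(1)] by (simp add: comm_def)
  then have "tr i (b \<odot> comm a Y) = 0" using tr_mmul_corner[OF assms(2), of "comm a Y"] by simp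
  then show ?thesis using tr_mono[OF assms(2,3)] by simp
qed

text \<open>The element with the larger index centralizes a corner that contains the block of the
  other one; antisymmetry of the form handles both orders.\<close>

lemma Cent_isotropic:
  assumes "a \<in> Cent i Y" "b \<in> Cent j Y" "i \<le> n" "j \<le> n"
  shows "tr n (b \<odot> comm a Y) = 0"
proof (cases "j \<le> i")
  case True
  then show ?thesis using Cent_isotropic_aux[OF assms(1) gl_mono[OF True CentD(1)[OF assms(2)]] assms(3)] by simp
next
  case False
  then have "a \<in> gl j" using gl_mono[OF _ CentD(1)[OF assms(1)]] by simp
  then have "tr n (a \<odot> comm b Y) = 0" using Cent_isotropic_aux[OF assms(2) _ assms(4)] by simp
  then show ?thesis
    using tr_form_antisym[OF gl_mono[OF assms(3) CentD(1)[OF assms(1)]] gl_mono[OF assms(4) CentD(1)[OF assms(2)]], of Y]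
    by simp
qed

section \<open>The sum of the centralizers and its annihilator\<close>

lemma regD: "reg n Z \<Longrightarrow> (\<Sum>k<n. msmult (x k) (pw n Z k)) = 0 \<Longrightarrow> k < n \<Longrightarrow> x k = 0"
  unfolding reg_def by blast

definition cent_sum :: "nat \<Rightarrow> imat \<Rightarrow> imat set" where
  "cent_sum n Y = {A. \<exists>a. (\<forall>i. a i \<in> Cent i Y) \<and> A = (\<Sum>i\<le>n. a i)}"

definition unit_mat :: "nat \<Rightarrow> nat \<Rightarrow> imat" where
  "unit_mat i j = (\<lambda>k l. if k = i \<and> l = j then 1 else 0)"

lemma unit_mat_gl: "i < n \<Longrightarrow> j < n \<Longrightarrow> unit_mat i j \<in> gl n"
  by (auto simp: unit_mat_def gl_def)

lemma unit_mat_sum: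
  "(\<Sum>p\<in>{..<n} \<times> {..<n}. msmult (x p) (unit_mat (fst p) (snd p))) k l = (if k < n \<and> l < n then x (k, l) else 0)"
proof -
  have "(\<Sum>p\<in>{..<n} \<times> {..<n}. msmult (x p) (unit_mat (fst p) (snd p))) k l =
      (\<Sum>p\<in>{..<n} \<times> {..<n}. if p = (k, l) then x p else 0)"
    unfolding imat_sum_apply by (intro sum.cong refl) (auto simp: unit_mat_def)
  then show ?thesis by (simp add: sum.delta)
qed

text \<open>
  A dimension count: in \<open>gl(n+1)\<close> the \<open>n\<close> conditions given by the centralizer of \<open>Y\<^sub>n\<close> cut out
  exactly the subspace \<open>gl(n) + \<complex>[Y\<^sub>n\<^sub>+\<^sub>1]\<close> of dimension \<open>n\<^sup>2 + n + 1\<close>; the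
  conjugate transposes make the bilinear trace form definite.
\<close>
lemma perp_step:
  assumes Y: "strong_reg Y" and A: "A \<in> gl (Suc n)"
    and perp: "\<And>b. b \<in> Cent n Y \<Longrightarrow> tr (Suc n) (b \<odot> comm A Y) = 0"
  shows "\<exists>c\<in>Cent (Suc n) Y. A - c \<in> gl n"
proof -
  let ?N = "Suc n" and ?Y = "corner (Suc n) Y"
  define Wc where "Wc k = comm (pw n (corner n Y) k) ?Y" for k
  define Fc :: "nat \<Rightarrow> imat" where "Fc k = (\<lambda>i j. cnj (Wc k j i))" for k
  have pwN: "pw n (corner n Y) k \<in> gl ?N" for k using gl_mono[of n ?N] by simp
  have Wgl: "Wc k \<in> gl ?N" for k unfolding Wc_def comm_def using pwN by simp
  \<comment> \<open>A itself, a basis of gl(n), the powers of the (n+1)-corner, and the conjugate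
    transposes of its commutators with the powers of the n-corner: 1 + n^2 + (n + 1) + n = (n + 1)^2
    + 1 matrices in a space of dimension (n + 1)^2.\<close>
  define fam :: "unit + (nat \<times> nat) + nat + nat \<Rightarrow> imat" where
    "fam q = (case q of Inl _ \<Rightarrow> A | Inr (Inl p) \<Rightarrow> unit_mat (fst p) (snd p) | Inr (Inr (Inl k)) \<Rightarrow> pw ?N ?Y k
       | Inr (Inr (Inr k)) \<Rightarrow> Fc k)" for q
  let ?I = "{()} <+> (({..<n} \<times> {..<n}) <+> ({..<?N} <+> {..<n}))"
  let ?J = "{..<?N} \<times> {..<?N}"
  have "card ?J < card ?I" by (simp add: card_Plus algebra_simps)
  moreover have "finite ?J" "finite ?I" by simp_all
  ultimately obtain x where x0: "\<exists>q\<in>?I. x q \<noteq> 0"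
    and xs: "\<forall>j\<in>?J. (\<Sum>q\<in>?I. (\<lambda>j q. fam q (fst j) (snd j)) j q * x q) = 0"
    using underdetermined[of ?J ?I "\<lambda>j q. fam q (fst j) (snd j)"] by blast
  define \<alpha> where "\<alpha> = x (Inl ())"
  define E where "E = (\<Sum>p\<in>{..<n} \<times> {..<n}. msmult (x (Inr (Inl p))) (unit_mat (fst p) (snd p)))"
  define P where "P = (\<Sum>k<?N. msmult (x (Inr (Inr (Inl k)))) (pw ?N ?Y k))"
  define F where "F = (\<Sum>k<n. msmult (x (Inr (Inr (Inr k)))) (Fc k))"
  have E: "E \<in> gl n" unfolding E_def by (rule gl_sum) (auto intro!: gl_msmult unit_mat_gl)
  have P: "P \<in> Cent ?N Y" unfolding P_def by (intro Cent_sum Cent_msmult pw_Cent)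
  have Fgl: "F \<in> gl ?N" unfolding F_def
    by (rule gl_sum) (use Wgl in \<open>auto simp: Fc_def gl_def\<close>)
  have total: "msmult \<alpha> A + E + P + F = 0"
  proof -
    have "(msmult \<alpha> A + E + P + F) i j = 0" if "i < ?N" "j < ?N" for i j
      using bspec[OF xs, of "(i, j)"] that
      by (simp add: sum.Plus fam_def comp_def \<alpha>_def E_def P_def F_def imat_sum_apply mult.commute add.assoc
          del: sum.lessThan_Suc)
    moreover have "msmult \<alpha> A + E + P + F \<in> gl ?N"
      using A gl_mono[of n ?N, OF _ E] CentD(1)[OF P] Fgl by simp
    ultimately show ?thesis using gl_eq_0_iff by blast
  qed
  \<comment> \<open>Conjugated coefficients make F the conjugate transpose of W = [b, Y_(n+1)], so
    tr(F W) is the sum of all |W_ki|^2. As A, E and P are orthogonal to W, the relation forces W =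
    0, and b lies in two neighbouring centralizers.\<close>
  define b where "b = (\<Sum>k<n. msmult (cnj (x (Inr (Inr (Inr k))))) (pw n (corner n Y) k))"
  have b: "b \<in> Cent n Y" unfolding b_def by (intro Cent_sum Cent_msmult pw_Cent)
  have bN: "b \<in> gl ?N" using gl_mono[of n ?N, OF _ CentD(1)[OF b]] by simp
  define W where "W = comm b ?Y"
  have WF: "F i j = cnj (W j i)" for i j
  proof -
    have "W = (\<Sum>k<n. msmult (cnj (x (Inr (Inr (Inr k))))) (Wc k))"
      unfolding W_def b_def Wc_def by (subst comm_sum_left) (simp_all add: comm_msmult_left)
    then show ?thesis by (simp add: F_def Fc_def imat_sum_apply)
  qed
  have trW: "tr ?N (M \<odot> W) = tr ?N (M \<odot> comm b Y)" if "M \<in> gl ?N" for M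
    using tr_mmul_corner[OF that, of "comm b Y"] corner_comm[OF bN, of Y] by (simp add: W_def)
  have 1: "tr ?N (A \<odot> W) = 0"
    using perp[OF b] tr_form_antisym[OF A bN, of Y] by (simp add: trW[OF A])
  have 2: "tr ?N (E \<odot> W) = 0"
    using Cent_isotropic_aux[OF b E, of ?N] trW[OF gl_mono[of n ?N, OF _ E]] by simp
  have 3: "tr ?N (P \<odot> W) = 0"
    using Cent_isotropic[OF b P, of ?N] trW[OF CentD(1)[OF P]] by simp
  have "tr ?N ((msmult \<alpha> A + E + P + F) \<odot> W) = 0" by (simp add: total)
  moreover have "row_col_finite A" "row_col_finite E" "row_col_finite P" "row_col_finite F" "row_col_finite W"
    using A E CentD(1)[OF P] Fgl bN by (simp_all add: W_def comm_def)
  ultimately have "tr ?N (F \<odot> W) = 0"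
    using 1 2 3 by (simp add: mmul_add_left mmul_msmult_left tr_add tr_msmult)
  moreover have "tr ?N (F \<odot> W) = (\<Sum>i<?N. \<Sum>k<?N. F i k * W k i)"
    unfolding tr_def by (intro sum.cong refl gl_mmul_apply) (simp add: Fgl)
  moreover have "F i k * W k i = of_real ((norm (W k i))\<^sup>2)" for i k
    using complex_norm_square[of "W k i"] by (simp add: WF mult.commute)
  ultimately have "of_real (\<Sum>i<?N. \<Sum>k<?N. (norm (W k i))\<^sup>2) = (0::complex)"
    by (simp del: sum.lessThan_Suc)
  then have "(\<Sum>i<?N. \<Sum>k<?N. (norm (W k i))\<^sup>2) = 0" by (simp only: of_real_eq_0_iff)
  then have "\<forall>i<?N. \<forall>k<?N. W k i = 0"
    by (simp add: sum_nonneg_eq_0_iff sum_nonneg del: sum.lessThan_Suc)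
  moreover have "W \<in> gl ?N" unfolding W_def comm_def using bN by simp
  ultimately have W0: "W = 0" using gl_eq_0_iff by blast
  then have "b \<in> Cent ?N Y" using bN by (simp add: W_def Cent_def comm_def)
  then have "b = 0" by (rule strong_reg_zero[OF Y _ CentD(1)[OF b]])
  then have xF: "x (Inr (Inr (Inr k))) = 0" if "k < n" for k
  proof -
    have "(\<Sum>k<n. msmult (cnj (x (Inr (Inr (Inr k))))) (pw n (corner n Y) k)) = 0"
      using \<open>b = 0\<close> by (simp add: b_def)
    then have "cnj (x (Inr (Inr (Inr k)))) = 0"
      using regD[of n "corner n Y" "\<lambda>k. cnj (x (Inr (Inr (Inr k))))" k, OF strong_reg_reg[OF Y]] that by simp
    then show ?thesis by simp
  qed
  have "F = 0" using WF W0 by (simp add: fun_eq_iff)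
  then have tot: "msmult \<alpha> A + E + P = 0" using total by simp
  \<comment> \<open>If \<alpha> = 0, then P = - E lies in gl(n) and in the centralizer of the
    (n+1)-corner, so both vanish. Independence of the unit matrices and regularity then kill all
    remaining coefficients.\<close>
  have "\<alpha> \<noteq> 0"
  proof
    assume a0: "\<alpha> = 0"
    then have EP: "P = - E" using tot by (simp add: eq_neg_iff_add_eq_0 add.commute)
    then have "P \<in> gl n" using E by simp
    then have P0: "P = 0" by (rule strong_reg_zero[OF Y P])
    then have E0: "E = 0" using EP by simp
    have "x (Inr (Inl p)) = 0" if "p \<in> {..<n} \<times> {..<n}" for p
      using unit_mat_sum[where n=n and x="\<lambda>p. x (Inr (Inl p))" and k="fst p" and l="snd p"] E0 that by (auto simp: E_def)
    moreover have "x (Inr (Inr (Inl k))) = 0" if "k < ?N" for k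
      using P0[unfolded P_def] by (rule regD[where x="\<lambda>k. x (Inr (Inr (Inl k)))", OF strong_reg_reg[OF Y]]) (rule that)
    ultimately have "x q = 0" if "q \<in> ?I" for q
      using that a0 xF by (auto simp: \<alpha>_def)
    then show False using x0 by blast
  qed
  define c where "c = msmult (- 1 / \<alpha>) P"
  have "A = msmult (1 / \<alpha>) (msmult \<alpha> A)" using \<open>\<alpha> \<noteq> 0\<close> by simp
  also have "msmult \<alpha> A = - E - P" using tot by (simp add: eq_diff_eq eq_neg_iff_add_eq_0 add_ac)
  finally have "A - c = msmult (1 / \<alpha>) (- E)"
    by (simp add: c_def fun_eq_iff diff_divide_distrib)
  then have "A - c \<in> gl n" using E by simp
  moreover have "c \<in> Cent ?N Y" unfolding c_def by (rule Cent_msmult[OF P])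
  ultimately show ?thesis by blast
qed

text \<open>\<open>perp_step\<close> splits off a component in the largest centralizer. The
  difference lies in the smaller gl and is still orthogonal to the smaller centralizers, since the
  component removed is so by isotropy.\<close>

lemma perp_cent_sum:
  assumes Y: "strong_reg Y"
  shows "A \<in> gl n \<Longrightarrow> (\<And>i b. i \<le> n \<Longrightarrow> b \<in> Cent i Y \<Longrightarrow> tr n (b \<odot> comm A Y) = 0) \<Longrightarrow> A \<in> cent_sum n Y"
proof (induction n arbitrary: A)
  case 0
  then have "A = 0" using gl_eq_0_iff[OF 0(1)] by simp
  then have e: "A = (\<Sum>i\<le>0::nat. (0::imat))" by simp
  have z: "(0::imat) \<in> Cent i Y" for i by (simp add: Cent_def)
  have "\<exists>a. (\<forall>i. a i \<in> Cent i Y) \<and> A = (\<Sum>i\<le>0. a i)"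
    by (rule exI[where x="\<lambda>_. 0"], intro conjI allI, rule z, rule e)
  then show ?case unfolding cent_sum_def mem_Collect_eq .
next
  case (Suc n)
  have "tr (Suc n) (b \<odot> comm A Y) = 0" if "b \<in> Cent n Y" for b using Suc.prems(2)[OF _ that] by simp
  then obtain c where c: "c \<in> Cent (Suc n) Y" "A - c \<in> gl n" using perp_step[OF Y Suc.prems(1)] by blast
  have "A - c \<in> cent_sum n Y"
  proof (rule Suc.IH[OF c(2)])
    fix i b assume ib: "i \<le> n" "b \<in> Cent i Y"
    have bn: "b \<in> gl n" by (rule gl_mono[OF ib(1) CentD(1)[OF ib(2)]])
    have fA: "row_col_finite A" "row_col_finite c" "row_col_finite b" using Suc.prems(1) CentD(1)[OF c(1)] bn by simp_all
    have "comm (A - c) Y = comm A Y - comm c Y" using fA by (simp add: comm_def mmul_diff_left mmul_diff_right)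
    moreover have "tr (Suc n) (b \<odot> comm A Y) = 0" using Suc.prems(2)[OF _ ib(2)] ib(1) by simp
    moreover have "tr (Suc n) (b \<odot> comm c Y) = 0" by (rule Cent_isotropic[OF c(1) ib(2)]) (use ib(1) in simp_all)
    ultimately have "tr (Suc n) (b \<odot> comm (A - c) Y) = 0" using fA by (simp add: mmul_diff_right tr_diff)
    then show "tr n (b \<odot> comm (A - c) Y) = 0" using tr_mono[OF bn, of "Suc n" "comm (A - c) Y"] by simp
  qed
  then obtain a where a: "\<And>i. a i \<in> Cent i Y" "A - c = (\<Sum>i\<le>n. a i)" by (auto simp: cent_sum_def)
  have "A = (\<Sum>i\<le>Suc n. (a(Suc n := c)) i)"
  proof -
    have "(\<Sum>i\<le>Suc n. (a(Suc n := c)) i) = (\<Sum>i\<le>n. a i) + c" by simp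
    then show ?thesis using a(2) by (simp add: diff_eq_eq)
  qed
  moreover have "(a(Suc n := c)) i \<in> Cent i Y" for i using a(1) c(1) by simp
  ultimately show ?case unfolding cent_sum_def by blast
qed

section \<open>Tangent vectors of the orbit and trace powers\<close>

lemma velocity_unique:
  assumes "velocity c V" "velocity c W"
  shows "V = W"
proof (intro ext)
  fix i j
  show "V i j = W i j" by (rule DERIV_unique) (use assms in \<open>auto simp: velocity_def\<close>)
qed

text \<open>A constant curve has velocity 0, so A commutes with Y. As a consequence the cosets in
  all tangent spaces are singletons.\<close>

lemma strong_reg_stab_lie:
  assumes "strong_reg Y"
  shows "stab_lie n Y = {0}"
proof -
  have "A = 0" if A: "A \<in> gl n" and st: "\<And>t. Ad (mexp (msmult t A)) Y = Y" for A
  proof -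
    have "velocity (\<lambda>t. Ad (mexp (msmult t A)) Y) 0" unfolding st by (rule velocity_const)
    then have "comm A Y = 0" using velocity_unique[OF velocity_Ad[OF A]] by blast
    then show ?thesis by (intro strong_reg_commutant_zero[OF assms A]) (simp add: comm_gl_eq_0)
  qed
  moreover have "Ad (mexp (msmult t 0)) Y = Y" for t by (simp add: mexp_0)
  ultimately show ?thesis unfolding stab_lie_def by auto
qed

lemma strong_reg_stab_lie_inf: "strong_reg Y \<Longrightarrow> stab_lie_inf Y = {0}"
  by (simp add: stab_lie_inf_def strong_reg_stab_lie)

lemma coset_of_0: "coset_of {0} A = {A}"
  by (simp add: coset_of_def)

lemma orbit_tangent_strong_reg: "strong_reg Y \<Longrightarrow> orbit_tangent Y = {{A} | A. A \<in> gl_inf}"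
  by (auto simp: orbit_tangent_def strong_reg_stab_lie_inf coset_of_0)

lemma di_singleton:
  assumes "A \<in> gl n"
  shows "di Y {A} = comm A Y"
  unfolding di_def
proof (rule the_equality)
  have 1: "diff_at F Y (comm A Y) = orbit_deriv Y A F" if "F \<in> O_M_inf" for F
    using orbit_deriv_diff_at[OF O_M_inf_reg_at[OF that] assms] by simp
  then show "\<forall>A'\<in>{A}. \<forall>F\<in>O_M_inf. diff_at F Y (comm A Y) = orbit_deriv Y A' F" by simp
  fix V assume *: "\<forall>A'\<in>{A}. \<forall>F\<in>O_M_inf. diff_at F Y V = orbit_deriv Y A' F"
  show "V = comm A Y"
  proof (rule tangent_vector_eqI[of Y])
    fix F assume F: "F \<in> O_M_inf"
    show "diff_at F Y V = diff_at F Y (comm A Y)" using * F 1[OF F] by simp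
  qed
qed

lemma tr_gl_indep:
  assumes "B \<in> gl n" "B \<in> gl m"
  shows "tr m (B \<odot> C) = tr n (B \<odot> C)"
proof (cases "n \<le> m")
  case True
  show ?thesis by (rule tr_mono[OF assms(1) True])
next
  case False
  then show ?thesis using tr_mono[OF assms(2), of n C] by simp
qed

lemma omega_singleton:
  assumes "A \<in> gl n" "B \<in> gl n"
  shows "omega_inf Y {A} {B} = - tr n (B \<odot> comm A Y)"
  unfolding omega_inf_def
proof (rule the_equality)
  have "- tr n (B \<odot> comm A Y) = tr m (corner m Y \<odot> comm A B)" if "A \<in> gl m" "B \<in> gl m" for m
    using tr_form(1)[OF that] tr_gl_indep[OF assms(2) that(2)] by simp
  then show "\<forall>m A' B'. A' \<in> {A} \<inter> gl m \<and> B' \<in> {B} \<inter> gl m \<longrightarrow>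
      - tr n (B \<odot> comm A Y) = tr m (corner m Y \<odot> comm A' B')" by auto
  fix c assume "\<forall>m A' B'. A' \<in> {A} \<inter> gl m \<and> B' \<in> {B} \<inter> gl m \<longrightarrow> c = tr m (corner m Y \<odot> comm A' B')"
  then have "c = tr n (corner n Y \<odot> comm A B)" using assms by simp
  then show "c = - tr n (B \<odot> comm A Y)" using tr_form(1)[OF assms] by simp
qed

section \<open>Derivatives of trace powers\<close>

lemma velocity_mmul_gl:
  assumes "\<And>t. G t \<in> gl n" "velocity G G'" "G' \<in> gl n" "velocity B B'"
  shows "velocity (\<lambda>t. B t \<odot> G t) (B' \<odot> G 0 + B 0 \<odot> G')"
  unfolding velocity_def
proof (intro allI)
  fix i j
  have e: "(C \<odot> G t) i j = (\<Sum>k<n. C i k * G t k j)" for t C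
    using assms(1)[of t] by (intro mmul_sum) (auto simp: gl_def)
  have e': "(C \<odot> G') i j = (\<Sum>k<n. C i k * G' k j)" for C
    using assms(3) by (intro mmul_sum) (auto simp: gl_def)
  have "((\<lambda>t. \<Sum>k<n. B t i k * G t k j) has_field_derivative (\<Sum>k<n. B' i k * G 0 k j + G' k j * B 0 i k)) (at 0)"
    by (intro DERIV_sum DERIV_mult) (use assms(2,4) in \<open>auto simp: velocity_def\<close>)
  then show "((\<lambda>t. (B t \<odot> G t) i j) has_field_derivative (B' \<odot> G 0 + B 0 \<odot> G') i j) (at 0)"
    by (simp add: e e' sum.distrib mult.commute)
qed

lemma velocity_corner: "velocity c V \<Longrightarrow> velocity (\<lambda>t. corner n (c t)) (corner n V)"
  unfolding velocity_def corner_def by auto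

lemma mmul_mpow_pw:
  assumes "C \<in> gl n" "Z \<in> gl n"
  shows "C \<odot> mpow Z k = C \<odot> pw n Z k"
proof (cases k)
  case 0
  then show ?thesis using corner_mone_right[OF assms(1)] by (simp add: pw_0)
next
  case (Suc m)
  then show ?thesis by (simp only: pw_mpow_Suc[OF assms(2)])
qed

text \<open>The derivative of Z^k is the sum of the Z^a V Z^b with a + b = k - 1, and the terms
  agree only under a trace against a matrix C commuting with Z. A general C is carried along because
  the induction passes from C to Z C. For k = 0 the truncated \<open>k - 1\<close> is multiplied by
  0.\<close>

lemma velocity_mpow:
  fixes c :: "complex \<Rightarrow> imat" and n :: nat
  defines "Z \<equiv> corner n (c 0)"
  assumes v: "velocity c V"
  shows "\<exists>D. velocity (\<lambda>t. mpow (corner n (c t)) k) D \<and>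
    (\<forall>C\<in>Cent n (c 0). tr n (C \<odot> D) = of_nat k * tr n (C \<odot> pw n Z (k - 1) \<odot> corner n V))"
proof (induction k)
  case 0
  show ?case
    by (rule exI[where x="0::imat"], simp only: mpow.simps mmul_zero_right tr_zero of_nat_0 mult_zero_left)
      (simp add: velocity_def)
next
  case (Suc k)
  then obtain D where D: "velocity (\<lambda>t. mpow (corner n (c t)) k) D"
    "\<And>C. C \<in> Cent n (c 0) \<Longrightarrow> tr n (C \<odot> D) = of_nat k * tr n (C \<odot> pw n Z (k - 1) \<odot> corner n V)" by blast
  let ?V = "corner n V"
  have Z: "Z \<in> gl n" by (simp add: Z_def)
  have V: "?V \<in> gl n" by simp
  have "velocity (\<lambda>t. mpow (corner n (c t)) k \<odot> corner n (c t)) (D \<odot> Z + mpow Z k \<odot> ?V)"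
    unfolding Z_def by (rule velocity_mmul_gl[OF corner_gl velocity_corner[OF v] corner_gl D(1)])
  moreover have "tr n (C \<odot> (D \<odot> Z + mpow Z k \<odot> ?V)) = of_nat (Suc k) * tr n (C \<odot> pw n Z k \<odot> ?V)"
    if C: "C \<in> Cent n (c 0)" for C
  proof -
    have Cg: "C \<in> gl n" by (rule CentD(1)[OF C])
    have CZ: "C \<odot> Z = Z \<odot> C" using CentD(2)[OF C] by (simp add: Z_def)
    have ZC: "Z \<odot> C \<in> Cent n (c 0)" using Cg Z CZ unfolding Cent_def Z_def[symmetric] by (simp add: mmul_assoc)
    have f: "row_col_finite C" "row_col_finite Z" "row_col_finite ?V" "row_col_finite (pw n Z k)" using Cg Z by simp_all
    have d: "C \<odot> (D \<odot> Z + mpow Z k \<odot> ?V) = (C \<odot> D) \<odot> Z + (C \<odot> pw n Z k) \<odot> ?V"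
      using f mmul_mpow_pw[OF Cg Z, of k] by (simp add: mmul_add_right mmul_assoc[symmetric])
    have "tr n ((C \<odot> D) \<odot> Z) = tr n ((Z \<odot> C) \<odot> D)"
      using tr_commute[OF Z, of "C \<odot> D"] f by (simp add: mmul_assoc)
    also have "\<dots> = of_nat k * tr n ((Z \<odot> C) \<odot> pw n Z (k - 1) \<odot> ?V)" by (rule D(2)[OF ZC])
    also have "\<dots> = of_nat k * tr n (C \<odot> pw n Z k \<odot> ?V)"
    proof (cases k)
      case (Suc m)
      have "(Z \<odot> C) \<odot> pw n Z m = C \<odot> pw n Z (Suc m)"
        unfolding CZ[symmetric] pw_Suc'[OF Z] using f by (simp add: mmul_assoc)
      then show ?thesis using Suc by simp
    qed simp
    finally show ?thesis unfolding d tr_add by (simp add: algebra_simps)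
  qed
  ultimately show ?case unfolding mpow.simps diff_Suc_1 by blast
qed

lemma trace_power_derivative:
  assumes v: "velocity c V"
  shows "((\<lambda>t. tr n (mpow (corner n (c t)) j)) has_field_derivative
    of_nat j * tr n (pw n (corner n (c 0)) (j - 1) \<odot> V)) (at 0)"
proof -
  let ?Z = "corner n (c 0)"
  obtain D where D: "velocity (\<lambda>t. mpow (corner n (c t)) j) D"
    "\<And>C. C \<in> Cent n (c 0) \<Longrightarrow> tr n (C \<odot> D) = of_nat j * tr n (C \<odot> pw n ?Z (j - 1) \<odot> corner n V)"
    using velocity_mpow[OF v] by blast
  have one: "corner n mone \<in> Cent n (c 0)" using pw_Cent[of n "c 0" 0] by (simp add: pw_0)
  have "tr n (corner n mone \<odot> D) = tr n D"
    using tr_mmul_corner[OF corner_gl, of n mone D] corner_mone_left[OF corner_gl, of n D] by (simp add: tr_corner)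
  moreover have "tr n (corner n mone \<odot> pw n ?Z (j - 1) \<odot> corner n V) = tr n (pw n ?Z (j - 1) \<odot> V)"
    using corner_mone_left[OF pw_gl] tr_mmul_corner[OF pw_gl] by simp
  ultimately have "tr n D = of_nat j * tr n (pw n ?Z (j - 1) \<odot> V)" using D(2)[OF one] by simp
  moreover have "((\<lambda>t. tr n (mpow (corner n (c t)) j)) has_field_derivative tr n D) (at 0)"
    unfolding tr_def by (rule DERIV_sum) (use D(1) in \<open>simp add: velocity_def\<close>)
  ultimately show ?thesis by simp
qed

lemma diff_at_trace_power:
  "diff_at (\<lambda>X. tr n (mpow (corner n X) j)) Y V = of_nat j * tr n (pw n (corner n Y) (j - 1) \<odot> V)"
  unfolding diff_at_def
  by (rule DERIV_imp_deriv) (use trace_power_derivative[OF velocity_line[of Y V], of n j] in simp)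

lemma reg_at_mpow: "reg_at (gl n) ecoords z (\<lambda>Z. mpow Z k i j)"
proof (induction k arbitrary: i j)
  case (Suc k)
  have "mpow y (Suc k) i j = (\<Sum>l<n. mpow y k i l * y l j)" if "y \<in> gl n" for y
    unfolding mpow.simps using that by (intro mmul_sum) (auto simp: gl_def)
  then show ?case by (rule reg_at_cong) (assumption, intro reg_at_sum reg_at_mult Suc.IH reg_at_entry)
qed simp

lemma trace_power_O_M_inf: "(\<lambda>X. tr n (mpow (corner n X) j)) \<in> O_M_inf"
proof -
  have "(\<lambda>Z. tr n (mpow Z j)) \<in> sp_reg (gl_space n) (gl n)"
    unfolding is_zar_reg[OF is_zar_gl zopen_whole] tr_def by (intro ballI reg_at_sum reg_at_mpow)
  then show ?thesis unfolding O_M_inf_def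
    by (intro CollectI exI[of _ n] exI[of _ "\<lambda>Z. tr n (mpow Z j)"] conjI refl)
qed

lemma trace_power_A_orbit:
  assumes X: "strong_reg X" and Y: "Y \<in> A_orbit X"
  shows "tr i (mpow (corner i Y) (Suc j)) = tr i (mpow (corner i X) (Suc j))"
proof -
  obtain g n where g: "Y = Ad g X" "g \<in> cent_prod X n" using Y A_orbit_cent_prod[OF X] by blast
  obtain u where u: "u \<in> GL i" "corner i Y = Ad u (corner i X)"
    using corner_Ad_cent_prod[OF g(2), of i] g(1) by blast
  have "mpow (corner i Y) (Suc j) = Ad u (mpow (corner i X) (Suc j))"
    unfolding u(2) by (rule Ad_mpow[symmetric]) (use GL_GL_inf[OF u(1)] in simp_all)
  then show ?thesis using tr_Ad[OF u(1) mpow_Suc_gl[OF corner_gl]] by (simp only:)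
qed

section \<open>Tangent spaces of the orbit and the Lagrangian property\<close>

lemma mmul_sum_left_row_col_finite:
  fixes F :: "'a \<Rightarrow> imat"
  assumes "\<And>x. x \<in> I \<Longrightarrow> row_col_finite (F x)"
  shows "(\<Sum>x\<in>I. F x) \<odot> C = (\<Sum>x\<in>I. F x \<odot> C)"
  using assms
proof (induction I rule: infinite_finite_induct)
  case (insert x I)
  have "(F x + (\<Sum>x\<in>I. F x)) \<odot> C = F x \<odot> C + (\<Sum>x\<in>I. F x) \<odot> C"
    by (rule mmul_add_left) (use insert.prems in \<open>auto intro: row_col_finite_sum\<close>)
  moreover have "(\<Sum>x\<in>I. F x) \<odot> C = (\<Sum>x\<in>I. F x \<odot> C)" using insert by blast
  ultimately have "(\<Sum>x\<in>insert x I. F x) \<odot> C = (\<Sum>x\<in>insert x I. F x \<odot> C)"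
    using insert.hyps by simp
  then show ?case .
qed simp_all

lemma cent_sumE:
  assumes "A \<in> cent_sum n Y"
  obtains a where "\<And>i. a i \<in> Cent i Y" "A = (\<Sum>i\<le>n. a i)"
  using assms unfolding cent_sum_def by blast

lemma cent_sumI:
  assumes "\<And>i. a i \<in> Cent i Y"
  shows "(\<Sum>i\<le>n. a i) \<in> cent_sum n Y"
  using assms unfolding cent_sum_def by blast

lemma cent_sum_mono:
  assumes "A \<in> cent_sum n Y" "n \<le> m"
  shows "A \<in> cent_sum m Y"
proof -
  obtain a where a: "\<And>i. a i \<in> Cent i Y" "A = (\<Sum>i\<le>n. a i)" by (rule cent_sumE[OF assms(1)]) blast
  have "(\<Sum>i\<le>m. if i \<le> n then a i else 0) = (\<Sum>i\<le>n. a i)"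
    by (rule sum.mono_neutral_cong_right) (use assms(2) in auto)
  moreover have "(\<Sum>i\<le>m. if i \<le> n then a i else 0) \<in> cent_sum m Y"
    by (rule cent_sumI) (use a(1) Cent_zero in \<open>simp\<close>)
  ultimately show ?thesis using a(2) by simp
qed

lemma Cent_cent_sum:
  assumes "b \<in> Cent i Y" "i \<le> n"
  shows "b \<in> cent_sum n Y"
proof -
  have "(\<Sum>j\<le>n. if j = i then b else 0) \<in> cent_sum n Y"
    by (rule cent_sumI) (use assms(1) Cent_zero in \<open>simp\<close>)
  moreover have "(\<Sum>j\<le>n. if j = i then b else 0) = b" using assms(2) by (subst sum.delta) simp_all
  ultimately show ?thesis by (simp only:)
qed

lemma cent_sum_gl: "A \<in> cent_sum n Y \<Longrightarrow> A \<in> gl n"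
proof (erule cent_sumE)
  fix a assume a: "\<And>i. a i \<in> Cent i Y" "A = (\<Sum>i\<le>n. a i)"
  show "A \<in> gl n" unfolding a(2) by (rule gl_sum) (use gl_mono CentD(1)[OF a(1)] in blast)
qed

lemma cent_sum_isotropic:
  assumes "A \<in> cent_sum n Y" "B \<in> cent_sum n Y"
  shows "tr n (B \<odot> comm A Y) = 0"
proof -
  obtain a where a: "\<And>i. a i \<in> Cent i Y" "A = (\<Sum>i\<le>n. a i)" by (rule cent_sumE[OF assms(1)]) blast
  obtain b where b: "\<And>i. b i \<in> Cent i Y" "B = (\<Sum>i\<le>n. b i)" by (rule cent_sumE[OF assms(2)]) blast
  have f: "row_col_finite (a i)" "row_col_finite (b i)" for i using CentD(1)[OF a(1)] CentD(1)[OF b(1)] row_col_finite_gl by blast+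
  have "B \<odot> comm A Y = (\<Sum>j\<le>n. \<Sum>i\<le>n. b j \<odot> comm (a i) Y)"
    unfolding a(2) b(2) by (simp only: comm_sum_left[OF f(1)] mmul_sum_left_row_col_finite[OF f(2)] mmul_sum_right[OF f(2)])
  then show ?thesis by (simp add: tr_sum Cent_isotropic[OF a(1) b(1)])
qed

lemma mexp_A_orbit:
  assumes Y: "strong_reg Y" and a: "a \<in> Cent i Y"
  shows "Ad (mexp (msmult t a)) Y \<in> A_orbit Y"
proof -
  have z: "mexp (msmult t a) \<in> cent_grp i Y" by (rule mexp_cent_grp[OF Cent_msmult[OF a]])
  have "mexp (msmult t a) \<in> cent_prod Y i"
  proof (cases i)
    case 0
    then have "a = 0" using CentD(1)[OF a] gl_eq_0_iff[of a 0] by simp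
    then show ?thesis using 0 by (simp add: mexp_0)
  next
    case (Suc m)
    have "mone \<odot> mexp (msmult t a) \<in> cent_prod Y (Suc m)"
      using cent_prod_mone[of Y m] z unfolding cent_prod.simps Suc by blast
    then show ?thesis by (simp only: Suc mmul_mone_left)
  qed
  then show ?thesis unfolding A_orbit_cent_prod[OF Y] by blast
qed

lemma GL_orbit_mexp:
  assumes "Y \<in> GL_orbit n X" "A \<in> gl n"
  shows "Ad (mexp (msmult t A)) Y \<in> GL_orbit n X"
proof -
  obtain g where g: "g \<in> GL n" "Y = Ad g X" using assms(1) by (auto simp: GL_orbit_def)
  have E: "mexp (msmult t A) \<in> GL n" by (rule mexp_GL(1)[OF gl_msmult[OF assms(2)]])
  have "Ad (mexp (msmult t A)) Y = Ad (mexp (msmult t A) \<odot> g) X"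
    by (simp add: g(2) Ad_mmul[OF GL_GL_inf[OF E] GL_GL_inf[OF g(1)]])
  then show ?thesis unfolding GL_orbit_def using GL_mmul[OF E g(1)] by blast
qed

text \<open>For a in a single centralizer the curve exp(ta) acting on Y stays in the orbit of
  \<open>A(\<infinity>)\<close> and, for small t, in U, so f vanishes along it. Sums are reached
  only through linearity of the derivative in A.\<close>

lemma cent_sum_stratum_tangent:
  assumes X: "strong_reg X" and YA: "Y \<in> A_orbit X" and YG: "Y \<in> GL_orbit n X" and A: "A \<in> cent_sum n Y"
    and U: "openin (sp_top (orbit_space n X)) U" "Y \<in> U"
    and f: "f \<in> sp_reg (orbit_space n X) U" "\<forall>Z\<in>U \<inter> A_orbit X. f Z = 0"
  shows "orbit_deriv Y A f = 0"
proof -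
  have SY: "strong_reg Y" by (rule A_orbit_strong_reg[OF X YA])
  obtain g where g: "g \<in> GL n" "Y = Ad g X" using YG by (auto simp: GL_orbit_def)
  note Z = is_zar_orbit[OF X, of n]
  have zU: "zopen (GL_orbit n X) (orbit_coords X) U" using U(1) is_zar_open[OF Z] by blast
  have fY: "reg_at (GL_orbit n X) (orbit_coords X) (Ad g X) f"
    using f(1) is_zar_reg[OF Z zU] U(2) g(2) by blast
  obtain L where L: "linear_form L" "\<And>B. B \<in> gl n \<Longrightarrow> orbit_deriv Y B f = L B"
    using orbit_deriv_linear[OF g reg_at_orbit_GL[OF X g(1) fY]] by blast
  obtain q where q: "q \<in> poly_funs (orbit_coords X)" "q Y \<noteq> 0" "\<And>y. y \<in> GL_orbit n X \<Longrightarrow> q y \<noteq> 0 \<Longrightarrow> y \<in> U"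
    using zopenD[OF zU U(2)] by blast
  obtain M where M: "\<And>B. B \<in> gl n \<Longrightarrow> ((\<lambda>t. q (Ad (mexp (msmult t B)) Y)) has_field_derivative M B) (at 0)"
    using orbit_deriv_linear[OF g reg_at_orbit_GL[OF X g(1) reg_at_poly[OF q(1)]]] by blast
  obtain a where a: "\<And>i. a i \<in> Cent i Y" "A = (\<Sum>i\<le>n. a i)" by (rule cent_sumE[OF A]) blast
  have "L (a i) = 0" if i: "i \<le> n" for i
  proof -
    let ?c = "\<lambda>t. Ad (mexp (msmult t (a i))) Y"
    have ag: "a i \<in> gl n" by (rule gl_mono[OF i CentD(1)[OF a(1)]])
    have "((\<lambda>t. q (?c t)) \<longlongrightarrow> q (?c 0)) (at 0)"
      using DERIV_isCont[OF M[OF ag]] by (simp add: isCont_def)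
    then have "((\<lambda>t. q (?c t)) \<longlongrightarrow> q (?c 0)) (nhds 0)"
      by (simp add: tendsto_nhds_iff)
    moreover have "q (?c 0) \<noteq> 0" using q(2) by (simp add: mexp_0)
    ultimately have "eventually (\<lambda>t. q (?c t) \<noteq> 0) (nhds 0)" by (rule tendsto_imp_eventually_ne)
    then have "eventually (\<lambda>t. f (?c t) = 0) (nhds 0)"
    proof (rule eventually_mono)
      fix t assume "q (?c t) \<noteq> 0"
      then have "?c t \<in> U" by (rule q(3)[OF GL_orbit_mexp[OF YG ag]])
      moreover have "?c t \<in> A_orbit X" using mexp_A_orbit[OF SY a(1)] A_orbit_eq[OF X YA] by blast
      ultimately show "f (?c t) = 0" using f(2) by blast
    qed
    then have "((\<lambda>t. f (?c t)) has_field_derivative 0) (at 0)"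
      using DERIV_cong_ev[OF refl _ refl, of "\<lambda>t. f (?c t)" "\<lambda>_. 0" 0 0] by simp
    then have "orbit_deriv Y (a i) f = 0" unfolding orbit_deriv_def by (rule DERIV_imp_deriv)
    then show ?thesis using L(2)[OF ag] by simp
  qed
  then have "L A = 0" unfolding a(2) linear_form_sum[OF L(1)] by simp
  then show ?thesis using L(2)[OF cent_sum_gl[OF A]] by simp
qed

lemma reg_at_orbit_restrict:
  assumes "strong_reg X" "Y \<in> GL_orbit n X" "reg_at UNIV ecoords Y F"
  shows "reg_at (GL_orbit n X) (orbit_coords X) Y F"
proof (rule reg_at_comp[where \<phi>="\<lambda>y. y", OF assms(3) _ assms(2)])
  fix c assume "c \<in> ecoords"
  then obtain i j where c: "c = (\<lambda>Z. Z i j)" by (rule ecoordsE)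
  show "reg_at (GL_orbit n X) (orbit_coords X) Y (\<lambda>y. c y)" unfolding c by (rule reg_at_orbit_entry[OF assms(1,2)])
qed simp

lemma orbit_deriv_trace_power:
  assumes "A \<in> gl n"
  shows "orbit_deriv Y A (\<lambda>Z. tr i (mpow (corner i Z) (Suc j)) - r) =
    of_nat (Suc j) * tr i (pw i (corner i Y) j \<odot> comm A Y)"
proof -
  have "((\<lambda>t. tr i (mpow (corner i (Ad (mexp (msmult t A)) Y)) (Suc j)) - r) has_field_derivative
      of_nat (Suc j) * tr i (pw i (corner i (Ad (mexp (msmult 0 A)) Y)) (Suc j - 1) \<odot> comm A Y) - 0) (at 0)"
    by (intro DERIV_diff DERIV_const trace_power_derivative velocity_Ad[OF assms])
  then have "orbit_deriv Y A (\<lambda>Z. tr i (mpow (corner i Z) (Suc j)) - r) =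
      of_nat (Suc j) * tr i (pw i (corner i (Ad (mexp (msmult 0 A)) Y)) (Suc j - 1) \<odot> comm A Y) - 0"
    unfolding orbit_deriv_def by (rule DERIV_imp_deriv)
  then show ?thesis by (simp only: mat.scale_zero_left mexp_0 Ad_mone diff_Suc_1 diff_0_right)
qed

text \<open>Subtracting their constant values, trace powers become functions vanishing on the orbit.
  Their derivatives are traces of powers of Y_i times [A, Y], and these powers span the centralizer
  of Y_i; so A is orthogonal to every centralizer.\<close>

lemma stratum_tangent_cent_sum:
  assumes X: "strong_reg X" and YA: "Y \<in> A_orbit X" and YG: "Y \<in> GL_orbit n X" and A: "A \<in> gl n"
    and ann: "\<And>U f. openin (sp_top (orbit_space n X)) U \<Longrightarrow> Y \<in> U \<Longrightarrow> f \<in> sp_reg (orbit_space n X) U \<Longrightarrow>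
            \<forall>Z\<in>U \<inter> A_orbit X. f Z = 0 \<Longrightarrow> orbit_deriv Y A f = 0"
  shows "A \<in> cent_sum n Y"
proof (rule perp_cent_sum[OF A_orbit_strong_reg[OF X YA] A])
  fix i b assume i: "i \<le> n" and b: "b \<in> Cent i Y"
  note Z = is_zar_orbit[OF X, of n]
  have pw0: "tr i (pw i (corner i Y) j \<odot> comm A Y) = 0" for j
  proof -
    let ?f = "\<lambda>Z. tr i (mpow (corner i Z) (Suc j)) - tr i (mpow (corner i X) (Suc j))"
    have o: "openin (sp_top (orbit_space n X)) (GL_orbit n X)" using is_zar_open[OF Z] zopen_whole by blast
    have r: "?f \<in> sp_reg (orbit_space n X) (GL_orbit n X)"
      unfolding is_zar_reg[OF Z zopen_whole]
      by (intro ballI reg_at_diff reg_at_const reg_at_orbit_restrict[OF X] O_M_inf_reg_at trace_power_O_M_inf)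
    have v: "\<forall>Z\<in>GL_orbit n X \<inter> A_orbit X. ?f Z = 0"
    proof
      fix W assume "W \<in> GL_orbit n X \<inter> A_orbit X"
      then show "?f W = 0" using trace_power_A_orbit[OF X, of W i j] by (simp del: mpow.simps)
    qed
    have "of_nat (Suc j) * tr i (pw i (corner i Y) j \<odot> comm A Y) = 0"
      using ann[OF o YG r v] unfolding orbit_deriv_trace_power[OF A] .
    then show ?thesis by (simp del: of_nat_Suc)
  qed
  obtain x where x: "b = (\<Sum>k<i. msmult (x k) (pw i (corner i Y) k))"
    using Cent_expand[OF A_orbit_strong_reg[OF X YA] b] by blast
  have "b \<odot> comm A Y = (\<Sum>k<i. msmult (x k) (pw i (corner i Y) k \<odot> comm A Y))"
    unfolding x by (subst mmul_sum_left_row_col_finite) (simp_all add: mmul_msmult_left)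
  then have "tr i (b \<odot> comm A Y) = 0" by (simp add: tr_sum tr_msmult pw0)
  then show "tr n (b \<odot> comm A Y) = 0" using tr_mono[OF CentD(1)[OF b] i] by simp
qed

lemma stratum_tangent_A_orbit:
  assumes X: "strong_reg X" and YA: "Y \<in> A_orbit X" and YG: "Y \<in> GL_orbit n X"
  shows "stratum_tangent n X (A_orbit X) Y = {{A} | A. A \<in> cent_sum n Y}"
proof (intro equalityI subsetI)
  fix S assume "S \<in> stratum_tangent n X (A_orbit X) Y"
  then obtain A where A: "S = {A}" "A \<in> gl n"
    and ann: "\<And>U f. openin (sp_top (orbit_space n X)) U \<Longrightarrow> Y \<in> U \<Longrightarrow> f \<in> sp_reg (orbit_space n X) U \<Longrightarrow>
            \<forall>Z\<in>U \<inter> A_orbit X. f Z = 0 \<Longrightarrow> orbit_deriv Y A f = 0"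
    unfolding stratum_tangent_def strong_reg_stab_lie[OF A_orbit_strong_reg[OF X YA]] coset_of_0 by blast
  have "A \<in> cent_sum n Y" by (rule stratum_tangent_cent_sum[OF X YA YG A(2)]) (rule ann)
  then show "S \<in> {{A} | A. A \<in> cent_sum n Y}" using A(1) by blast
next
  fix S assume "S \<in> {{A} | A. A \<in> cent_sum n Y}"
  then obtain A where A: "S = {A}" "A \<in> cent_sum n Y" by blast
  have "\<forall>U f. openin (sp_top (orbit_space n X)) U \<and> Y \<in> U \<and> f \<in> sp_reg (orbit_space n X) U \<and>
            (\<forall>Z\<in>U \<inter> A_orbit X. f Z = 0) \<longrightarrow> orbit_deriv Y A f = 0"
    using cent_sum_stratum_tangent[OF X YA YG A(2)] by blast
  then show "S \<in> stratum_tangent n X (A_orbit X) Y"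
    unfolding stratum_tangent_def strong_reg_stab_lie[OF A_orbit_strong_reg[OF X YA]] coset_of_0
    using A(1) cent_sum_gl[OF A(2)] by blast
qed

lemma ind_tangent_A_orbit:
  assumes X: "strong_reg X" and Y: "Y \<in> A_orbit X"
  shows "ind_tangent X (A_orbit X) Y = {{A} | A n. A \<in> cent_sum n Y}"
proof (intro equalityI subsetI)
  note SY = A_orbit_strong_reg[OF X Y]
  fix S assume "S \<in> ind_tangent X (A_orbit X) Y"
  then obtain A n where A: "S = {A}" "Y \<in> GL_orbit n X" "{A} \<in> stratum_tangent n X (A_orbit X) Y"
    unfolding ind_tangent_def strong_reg_stab_lie[OF SY] strong_reg_stab_lie_inf[OF SY] coset_of_0 by blast
  have "A \<in> cent_sum n Y" using A(3) unfolding stratum_tangent_A_orbit[OF X Y A(2)] by blast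
  then show "S \<in> {{A} | A n. A \<in> cent_sum n Y}" using A(1) by blast
next
  note SY = A_orbit_strong_reg[OF X Y]
  fix S assume "S \<in> {{A} | A n. A \<in> cent_sum n Y}"
  then obtain A n where A: "S = {A}" "A \<in> cent_sum n Y" by blast
  obtain m where m: "Y \<in> A_stratum X m" using Y A_orbit_A_stratum[OF X] by blast
  let ?N = "max m n"
  have YG: "Y \<in> GL_orbit ?N X"
    using A_stratum_mono[of m ?N X] A_stratum_orbit[of X ?N] m by auto
  have AN: "A \<in> cent_sum ?N Y" by (rule cent_sum_mono[OF A(2)]) simp
  have "{A} \<in> stratum_tangent ?N X (A_orbit X) Y"
    unfolding stratum_tangent_A_orbit[OF X Y YG] using AN by blast
  then show "S \<in> ind_tangent X (A_orbit X) Y"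
    unfolding ind_tangent_def strong_reg_stab_lie[OF SY] strong_reg_stab_lie_inf[OF SY] coset_of_0
    using A(1) YG cent_sum_gl[OF AN] by blast
qed

lemma A_orbit_lagrangian:
  assumes X: "strong_reg X"
  shows "lagrangian X (A_orbit X)"
  unfolding lagrangian_def
proof
  fix Y assume Y: "Y \<in> A_orbit X"
  note SY = A_orbit_strong_reg[OF X Y]
  let ?W = "{{A} | A n. A \<in> cent_sum n Y}"
  have "?W = omega_perp Y ?W"
  proof (intro equalityI subsetI)
    fix S assume "S \<in> ?W"
    then obtain A n where A: "S = {A}" "A \<in> cent_sum n Y" by blast
    have "omega_inf Y {A} T = 0" if T: "T \<in> ?W" for T
    proof -
      obtain B m where B: "T = {B}" "B \<in> cent_sum m Y" using T by blast
      have AB: "A \<in> cent_sum (max n m) Y" "B \<in> cent_sum (max n m) Y" using cent_sum_mono[OF A(2)] cent_sum_mono[OF B(2)] by simp_all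
      show ?thesis unfolding B(1) omega_singleton[OF cent_sum_gl[OF AB(1)] cent_sum_gl[OF AB(2)]]
        using cent_sum_isotropic[OF AB] by simp
    qed
    moreover have "{A} \<in> orbit_tangent Y"
      unfolding orbit_tangent_strong_reg[OF SY] gl_inf_def using cent_sum_gl[OF A(2)] by blast
    ultimately show "S \<in> omega_perp Y ?W" unfolding omega_perp_def A(1) by blast
  next
    fix S assume "S \<in> omega_perp Y ?W"
    then have S: "S \<in> orbit_tangent Y" and ann: "\<And>B n. B \<in> cent_sum n Y \<Longrightarrow> omega_inf Y S {B} = 0"
      unfolding omega_perp_def by blast+
    obtain A n where A: "S = {A}" "A \<in> gl n" using S unfolding orbit_tangent_strong_reg[OF SY] gl_inf_def by blast
    have "A \<in> cent_sum n Y"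
    proof (rule perp_cent_sum[OF SY A(2)])
      fix i b assume i: "i \<le> n" and b: "b \<in> Cent i Y"
      have "omega_inf Y {A} {b} = 0" using ann[OF Cent_cent_sum[OF b i]] A(1) by simp
      then show "tr n (b \<odot> comm A Y) = 0"
        unfolding omega_singleton[OF A(2) gl_mono[OF i CentD(1)[OF b]]] by simp
    qed
    then show "S \<in> ?W" using A(1) by blast
  qed
  then show "ind_tangent X (A_orbit X) Y = omega_perp Y (ind_tangent X (A_orbit X) Y)"
    unfolding ind_tangent_A_orbit[OF X Y] .
qed

section \<open>Hamiltonian vector fields\<close>

lemma tr_unit_mat:
  assumes "B \<in> gl m" "i < m" "j < m"
  shows "tr m (B \<odot> unit_mat j i) = B i j"
proof -
  have "(B \<odot> unit_mat j i) l l = (if l = i then B i j else 0)" for l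
  proof -
    have "(B \<odot> unit_mat j i) l l = (\<Sum>k<m. B l k * unit_mat j i k l)"
      using assms(1) by (intro mmul_sum) (auto simp: gl_def)
    also have "\<dots> = (\<Sum>k<m. if k = j then (if l = i then B i j else 0) else 0)"
      by (intro sum.cong refl) (auto simp: unit_mat_def)
    finally show ?thesis using assms(3) by (simp add: sum.delta)
  qed
  then show ?thesis using assms(2) by (simp add: tr_def sum.delta)
qed

lemma gl_tr_eqI:
  assumes "B \<in> gl m" "C \<in> gl m" "\<And>V. V \<in> gl m \<Longrightarrow> tr m (B \<odot> V) = tr m (C \<odot> V)"
  shows "B = C"
proof (intro ext)
  fix i j
  show "B i j = C i j"
  proof (cases "i < m \<and> j < m")
    case True
    then have ij: "i < m" "j < m" by simp_all
    show ?thesis using assms(3)[OF unit_mat_gl[OF ij(2,1)]]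
      by (simp add: tr_unit_mat[OF assms(1) ij] tr_unit_mat[OF assms(2) ij])
  next
    case False
    then have "m \<le> i \<or> m \<le> j" by auto
    then show ?thesis using gl_outside[OF assms(1)] gl_outside[OF assms(2)] by simp
  qed
qed

text \<open>V ranges over all infinite matrices, not only over gl(m). Thus B does not depend on the
  block size m, which makes the bracket independent of the representatives of F and G.\<close>

definition is_grad :: "(imat \<Rightarrow> complex) \<Rightarrow> imat \<Rightarrow> nat \<Rightarrow> imat \<Rightarrow> bool" where
  "is_grad F Y m B \<longleftrightarrow> B \<in> gl m \<and> (\<forall>V. diff_at F Y V = tr m (B \<odot> V))"

lemma is_grad_mono:
  assumes "is_grad F Y m B" "m \<le> n"
  shows "is_grad F Y n B"
proof -
  have B: "B \<in> gl m" "\<And>V. diff_at F Y V = tr m (B \<odot> V)" using assms(1) by (auto simp: is_grad_def)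
  have "tr n (B \<odot> V) = tr m (B \<odot> V)" for V by (rule tr_mono[OF B(1) assms(2)])
  then show ?thesis unfolding is_grad_def using B gl_mono[OF assms(2) B(1)] by simp
qed

lemma is_grad_unique:
  assumes "is_grad F Y m B" "is_grad F Y n C"
  shows "B = C"
proof -
  have "is_grad F Y (max m n) B" "is_grad F Y (max m n) C"
    using is_grad_mono[OF assms(1)] is_grad_mono[OF assms(2)] by simp_all
  then have "B \<in> gl (max m n)" "C \<in> gl (max m n)" "\<And>V. tr (max m n) (B \<odot> V) = tr (max m n) (C \<odot> V)"
    unfolding is_grad_def by (blast, blast, metis)
  then show ?thesis by (rule gl_tr_eqI)
qed

lemma diff_at_corner:
  assumes "F = (\<lambda>Y. f (corner m Y))"
  shows "diff_at f (corner m Y) (corner m V) = diff_at F Y V"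
proof -
  have "corner m (Y + msmult t V) = corner m Y + msmult t (corner m V)" for t
    by (auto simp: corner_def fun_eq_iff)
  then show ?thesis unfolding diff_at_def assms by simp
qed

lemma gradient:
  assumes F: "F = (\<lambda>Y. f (corner m Y))" and f: "f \<in> sp_reg (gl_space m) (gl m)"
  shows "is_grad F Y m (grad m f (corner m Y))"
proof -
  have "F \<in> O_M_inf" unfolding O_M_inf_def F
    by (intro CollectI exI[of _ m] exI[of _ f] conjI refl f)
  then have lin: "linear_form (diff_at F Y)" by (intro diff_at_linear_form O_M_inf_reg_at)
  \<comment> \<open>The indices are exchanged because the trace form pairs entry (i, j) with entry
    (j, i).\<close>
  define B :: imat where "B = (\<lambda>i j. if i < m \<and> j < m then diff_at F Y (unit_mat j i) else 0)"
  have B: "B \<in> gl m" by (auto simp: B_def gl_def)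
  have corner: "diff_at F Y (corner m V) = diff_at F Y V" for V
    using diff_at_corner[OF F, of Y V] diff_at_corner[OF F, of Y "corner m V"] by simp
  have BV: "diff_at F Y V = tr m (B \<odot> V)" for V
  proof -
    have "corner m V = (\<Sum>p\<in>{..<m} \<times> {..<m}. msmult ((\<lambda>p. V (fst p) (snd p)) p) (unit_mat (fst p) (snd p)))"
    proof (intro ext)
      fix k l
      show "corner m V k l = (\<Sum>p\<in>{..<m} \<times> {..<m}. msmult ((\<lambda>p. V (fst p) (snd p)) p) (unit_mat (fst p) (snd p))) k l"
        unfolding unit_mat_sum by (simp add: corner_def)
    qed
    then have "diff_at F Y V = (\<Sum>p\<in>{..<m} \<times> {..<m}. V (fst p) (snd p) * diff_at F Y (unit_mat (fst p) (snd p)))"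
      unfolding corner[of V, symmetric] by (simp only: linear_form_sum[OF lin] linear_form_scale[OF lin])
    also have "\<dots> = (\<Sum>k<m. \<Sum>i<m. V k i * diff_at F Y (unit_mat k i))"
      by (simp add: sum.cartesian_product case_prod_unfold)
    also have "\<dots> = (\<Sum>i<m. \<Sum>k<m. B i k * V k i)"
      by (subst sum.swap) (intro sum.cong refl, simp add: B_def)
    also have "\<dots> = tr m (B \<odot> V)"
      unfolding tr_def by (intro sum.cong refl gl_mmul_apply[symmetric]) (simp add: B)
    finally show ?thesis .
  qed
  have "grad m f (corner m Y) = B"
    unfolding grad_def
  proof (rule the_equality)
    have d: "diff_at f (corner m Y) V = tr m (B \<odot> V)" if "V \<in> gl m" for V
      using diff_at_corner[OF F, of Y V] that BV[of V] by (simp add: corner_id)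
    then show "B \<in> gl m \<and> (\<forall>V\<in>gl m. diff_at f (corner m Y) V = tr m (B \<odot> V))" using B by blast
    fix C assume C: "C \<in> gl m \<and> (\<forall>V\<in>gl m. diff_at f (corner m Y) V = tr m (C \<odot> V))"
    show "C = B" by (rule gl_tr_eqI[of _ m]) (use C B d in simp_all)
  qed
  then show ?thesis unfolding is_grad_def using B BV by simp
qed

lemma O_M_inf_lift:
  assumes "f \<in> sp_reg (gl_space n) (gl n)" "n \<le> m"
  shows "(\<lambda>Z. f (corner n Z)) \<in> sp_reg (gl_space m) (gl m)"
proof -
  have "reg_at (gl n) ecoords (corner n z) f" for z using assms(1) is_zar_reg[OF is_zar_gl zopen_whole] by simp
  then show ?thesis unfolding is_zar_reg[OF is_zar_gl zopen_whole]
    by (intro ballI reg_at_subset[OF reg_at_corner subset_UNIV])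
qed

text \<open>With C the gradient of G, tr(Y [B, C]) = - tr(C [B, Y]), so the bracket is the
  derivative of G in the direction - [B, Y].\<close>

lemma poisson_grad:
  assumes F: "F \<in> O_M_inf" and G: "G \<in> O_M_inf" and B: "is_grad F Y m B"
  shows "poisson F G Y = diff_at G Y (- comm B Y)"
  unfolding poisson_def
proof (rule the_equality)
  have rep: "diff_at G Y (- comm B Y) = poisson_gl n f g (corner n Y)"
    if "f \<in> sp_reg (gl_space n) (gl n)" "g \<in> sp_reg (gl_space n) (gl n)"
      "F = (\<lambda>Y. f (corner n Y))" "G = (\<lambda>Y. g (corner n Y))" for n f g
  proof -
    have f: "is_grad F Y n (grad n f (corner n Y))" by (rule gradient[OF that(3,1)])
    have g: "is_grad G Y n (grad n g (corner n Y))" by (rule gradient[OF that(4,2)])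
    have Bf: "grad n f (corner n Y) = B" by (rule is_grad_unique[OF f B])
    have Bn: "B \<in> gl n" using f unfolding Bf is_grad_def by blast
    have gn: "grad n g (corner n Y) \<in> gl n" using g unfolding is_grad_def by blast
    have "diff_at G Y (- comm B Y) = - diff_at G Y (comm B Y)"
      by (rule linear_form_uminus[OF diff_at_linear_form[OF O_M_inf_reg_at[OF G]]])
    also have "\<dots> = - tr n (grad n g (corner n Y) \<odot> comm B Y)" using g by (simp add: is_grad_def)
    also have "\<dots> = poisson_gl n f g (corner n Y)"
      unfolding poisson_gl_def Bf using tr_form(1)[OF Bn gn] by simp
    finally show ?thesis .
  qed
  then show "\<forall>n f g. f \<in> sp_reg (gl_space n) (gl n) \<and> g \<in> sp_reg (gl_space n) (gl n) \<and>
     F = (\<lambda>Y. f (corner n Y)) \<and> G = (\<lambda>Y. g (corner n Y)) \<longrightarrow>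
     diff_at G Y (- comm B Y) = poisson_gl n f g (corner n Y)" by blast
  fix c
  assume c: "\<forall>n f g. f \<in> sp_reg (gl_space n) (gl n) \<and> g \<in> sp_reg (gl_space n) (gl n) \<and>
     F = (\<lambda>Y. f (corner n Y)) \<and> G = (\<lambda>Y. g (corner n Y)) \<longrightarrow> c = poisson_gl n f g (corner n Y)"
  obtain n1 f where f: "F = (\<lambda>X. f (corner n1 X))" "f \<in> sp_reg (gl_space n1) (gl n1)"
    using F unfolding O_M_inf_def by blast
  obtain n2 g where g: "G = (\<lambda>X. g (corner n2 X))" "g \<in> sp_reg (gl_space n2) (gl n2)"
    using G unfolding O_M_inf_def by blast
  \<comment> \<open>\<open>poisson\<close> asks for representatives on one common gl(n), so both are
    pulled back to the larger block; without such a pair the defining condition would be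
    vacuous.\<close>
  let ?N = "max n1 n2" and ?f = "\<lambda>Z. f (corner n1 Z)" and ?g = "\<lambda>Z. g (corner n2 Z)"
  have 1: "?f \<in> sp_reg (gl_space ?N) (gl ?N)" by (rule O_M_inf_lift[OF f(2)]) simp
  have 2: "?g \<in> sp_reg (gl_space ?N) (gl ?N)" by (rule O_M_inf_lift[OF g(2)]) simp
  have 3: "F = (\<lambda>Y. ?f (corner ?N Y))" unfolding f(1) by (simp add: min_absorb1)
  have 4: "G = (\<lambda>Y. ?g (corner ?N Y))" unfolding g(1) by (simp add: min_absorb1)
  have "c = poisson_gl ?N ?f ?g (corner ?N Y)"
    by (rule c[rule_format]) (intro conjI 1 2 3 4)
  then show "c = diff_at G Y (- comm B Y)" using rep[OF 1 2 3 4] by simp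
qed

lemma ham_grad:
  assumes F: "F \<in> O_M_inf" and B: "is_grad F Y m B"
  shows "ham F Y = - comm B Y"
  unfolding ham_def
proof (rule the_equality)
  show "\<forall>G\<in>O_M_inf. diff_at G Y (- comm B Y) = poisson F G Y"
    using poisson_grad[OF F _ B] by simp
  fix V assume V: "\<forall>G\<in>O_M_inf. diff_at G Y V = poisson F G Y"
  show "V = - comm B Y"
    by (rule tangent_vector_eqI[of Y]) (use V poisson_grad[OF F _ B] in simp)
qed

lemma ham_trace_power:
  "ham (\<lambda>X. tr n (mpow (corner n X) (Suc j))) Y = comm (msmult (- of_nat (Suc j)) (pw n (corner n Y) j)) Y"
proof -
  let ?B = "msmult (of_nat (Suc j)) (pw n (corner n Y) j)"
  have "is_grad (\<lambda>X. tr n (mpow (corner n X) (Suc j))) Y n ?B"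
    unfolding is_grad_def diff_at_trace_power by (simp add: mmul_msmult_left tr_msmult del: of_nat_Suc)
  then have "ham (\<lambda>X. tr n (mpow (corner n X) (Suc j))) Y = - comm ?B Y"
    by (rule ham_grad[OF trace_power_O_M_inf])
  also have "\<dots> = comm (msmult (- of_nat (Suc j)) (pw n (corner n Y) j)) Y"
    unfolding comm_msmult_left by (rule mat.scale_minus_left[symmetric])
  finally show ?thesis .
qed

lemma J_inf_Suc: "J_inf = {(\<lambda>X. tr n (mpow (corner n X) (Suc j))) | n j. j < n}"
proof (intro equalityI subsetI)
  fix f assume "f \<in> J_inf"
  then obtain n j where f: "f = (\<lambda>X. tr n (mpow (corner n X) j))" "1 \<le> j" "j \<le> n" unfolding J_inf_def by blast
  then have "f = (\<lambda>X. tr n (mpow (corner n X) (Suc (j - 1))))" "j - 1 < n" by simp_all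
  then show "f \<in> {(\<lambda>X. tr n (mpow (corner n X) (Suc j))) | n j. j < n}" by blast
next
  fix f :: "imat \<Rightarrow> complex" assume "f \<in> {(\<lambda>X. tr n (mpow (corner n X) (Suc j))) | n j. j < n}"
  then obtain n j where f: "f = (\<lambda>X. tr n (mpow (corner n X) (Suc j)))" "j < n" by blast
  have "1 \<le> Suc j" "Suc j \<le> n" using f(2) by simp_all
  then show "f \<in> J_inf" unfolding J_inf_def using f(1) by blast
qed

text \<open>The Hamiltonian vectors are nonzero multiples of the commutators [Y_i^k, Y] with k < i,
  and the Y_i^k with k < i span the centralizer of Y_i.\<close>

lemma a_inf_at_cent_sum:
  assumes Y: "strong_reg Y"
  shows "a_inf_at Y = {comm A Y | A n. A \<in> cent_sum n Y}"
proof (intro equalityI)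
  let ?R = "{comm A Y | A n. A \<in> cent_sum n Y}"
  show "a_inf_at Y \<subseteq> ?R"
    unfolding a_inf_at_def
  proof (rule mat.span_minimal)
    show "{ham f Y | f. f \<in> J_inf} \<subseteq> ?R"
    proof
      fix V assume "V \<in> {ham f Y | f. f \<in> J_inf}"
      then obtain n j where V: "V = ham (\<lambda>X. tr n (mpow (corner n X) (Suc j))) Y" unfolding J_inf_Suc by blast
      have "msmult (- of_nat (Suc j)) (pw n (corner n Y) j) \<in> cent_sum n Y"
        by (rule Cent_cent_sum[OF Cent_msmult[OF pw_Cent] order_refl])
      then show "V \<in> ?R" unfolding V ham_trace_power by blast
    qed
    show "mat.subspace ?R"
    proof (rule mat.subspaceI)
      have "comm 0 Y \<in> ?R" using Cent_cent_sum[OF Cent_zero order_refl] by blast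
      then show "0 \<in> ?R" by (simp add: comm_def)
    next
      fix V W assume "V \<in> ?R" "W \<in> ?R"
      then obtain A n B m where A: "V = comm A Y" "A \<in> cent_sum n Y" and B: "W = comm B Y" "B \<in> cent_sum m Y" by blast
      have AB: "A \<in> cent_sum (max n m) Y" "B \<in> cent_sum (max n m) Y" using cent_sum_mono[OF A(2)] cent_sum_mono[OF B(2)] by simp_all
      obtain a where a: "\<And>i. a i \<in> Cent i Y" "A = (\<Sum>i\<le>max n m. a i)" by (rule cent_sumE[OF AB(1)]) blast
      obtain b where b: "\<And>i. b i \<in> Cent i Y" "B = (\<Sum>i\<le>max n m. b i)" by (rule cent_sumE[OF AB(2)]) blast
      have "(\<Sum>i\<le>max n m. a i + b i) \<in> cent_sum (max n m) Y" by (rule cent_sumI) (rule Cent_add[OF a(1) b(1)])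
      then have "A + B \<in> cent_sum (max n m) Y" by (simp only: a(2) b(2) sum.distrib)
      moreover have "V + W = comm (A + B) Y"
        unfolding A(1) B(1) by (rule comm_add_left[OF row_col_finite_gl[OF cent_sum_gl[OF A(2)]] row_col_finite_gl[OF cent_sum_gl[OF B(2)]], symmetric])
      ultimately show "V + W \<in> ?R" by blast
    next
      fix c V assume "V \<in> ?R"
      then obtain A n where A: "V = comm A Y" "A \<in> cent_sum n Y" by blast
      obtain a where a: "\<And>i. a i \<in> Cent i Y" "A = (\<Sum>i\<le>n. a i)" by (rule cent_sumE[OF A(2)]) blast
      have "(\<Sum>i\<le>n. msmult c (a i)) \<in> cent_sum n Y" by (rule cent_sumI) (rule Cent_msmult[OF a(1)])
      then have "msmult c A \<in> cent_sum n Y" by (simp only: a(2) mat.scale_sum_right)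
      then have "comm (msmult c A) Y \<in> ?R" by blast
      then show "msmult c V \<in> ?R" unfolding A(1) comm_msmult_left .
    qed
  qed
  show "?R \<subseteq> a_inf_at Y"
  proof
    fix V assume "V \<in> ?R"
    then obtain A n where A: "V = comm A Y" "A \<in> cent_sum n Y" by blast
    obtain a where a: "\<And>i. a i \<in> Cent i Y" "A = (\<Sum>i\<le>n. a i)" by (rule cent_sumE[OF A(2)]) blast
    have p: "comm (pw i (corner i Y) k) Y \<in> a_inf_at Y" if "k < i" for i k
    proof -
      let ?c = "- of_nat (Suc k) :: complex"
      have "ham (\<lambda>X. tr i (mpow (corner i X) (Suc k))) Y \<in> a_inf_at Y"
        unfolding a_inf_at_def J_inf_Suc by (rule mat.span_base) (use that in blast)
      then have "msmult (inverse ?c) (comm (msmult ?c (pw i (corner i Y) k)) Y) \<in> a_inf_at Y"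
        unfolding ham_trace_power a_inf_at_def by (rule mat.span_scale)
      moreover have "?c \<noteq> 0" unfolding neg_equal_0_iff_equal by (rule of_nat_neq_0)
      ultimately show ?thesis
        by (simp only: comm_msmult_left mat.scale_scale left_inverse mat.scale_one simp_thms)
    qed
    have "comm (a i) Y \<in> a_inf_at Y" for i
    proof -
      obtain x where x: "a i = (\<Sum>k<i. msmult (x k) (pw i (corner i Y) k))" using Cent_expand[OF Y a(1)] by blast
      have "comm (a i) Y = (\<Sum>k<i. msmult (x k) (comm (pw i (corner i Y) k) Y))"
        unfolding x by (subst comm_sum_left) (simp_all add: comm_msmult_left)
      also have "\<dots> \<in> a_inf_at Y"
        unfolding a_inf_at_def
        by (intro mat.span_sum mat.span_scale) (use p[unfolded a_inf_at_def] in blast)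
      finally show ?thesis .
    qed
    moreover have "V = (\<Sum>i\<le>n. comm (a i) Y)"
      unfolding A(1) a(2) by (rule comm_sum_left) (rule row_col_finite_gl[OF CentD(1)[OF a(1)]])
    ultimately show "V \<in> a_inf_at Y" unfolding a_inf_at_def by (simp only: mat.span_sum)
  qed
qed

section \<open>Strong regularity\<close>

interpretation fm: module "\<lambda>c (\<eta> :: imat \<Rightarrow> complex) V. c * \<eta> V"
  by unfold_locales (auto simp: fun_eq_iff algebra_simps)

section \<open>From independent differentials to the algebraic condition\<close>

lemma mpow_scalar: "mpow (corner n (msmult c mone)) (Suc k) = corner n (msmult (c ^ Suc k) mone)"
proof (induction k)
  case (Suc k)
  have "mpow (corner n (msmult c mone)) (Suc (Suc k)) = mpow (corner n (msmult c mone)) (Suc k) \<odot> corner n (msmult c mone)"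
    by (rule mpow.simps(2))
  also have "\<dots> = corner n (msmult (c ^ Suc k) mone) \<odot> corner n (msmult c mone)" unfolding Suc.IH ..
  also have "\<dots> = msmult c (msmult (c ^ Suc k) (corner n mone \<odot> corner n mone))"
    by (simp only: corner_msmult mmul_msmult_left mmul_msmult_right)
  also have "corner n mone \<odot> corner n mone = corner n mone" by (rule corner_mone_left[OF corner_gl])
  finally show ?case by (simp only: corner_msmult mat.scale_scale power_Suc)
qed simp

lemma trace_power_scalar: "tr n (mpow (corner n (msmult c mone)) (Suc k)) = of_nat n * c ^ Suc k"
  unfolding mpow_scalar tr_corner tr_msmult by (simp add: tr_def mone_def)

text \<open>On the scalar matrix c the function takes the value n c^(j+1); c = 1 recovers n, and c =
  2 recovers j. So the functions in \<open>J_inf\<close> are faithfully indexed by pairs.\<close>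

lemma trace_power_inj:
  assumes "(\<lambda>X. tr n (mpow (corner n X) (Suc j))) = (\<lambda>X. tr m (mpow (corner m X) (Suc k)))" "j < n"
  shows "n = m \<and> j = k"
proof -
  have e: "of_nat n * c ^ Suc j = of_nat m * c ^ Suc k" for c :: complex
    using fun_cong[OF assms(1), of "msmult c mone"] unfolding trace_power_scalar .
  have nm: "n = m" using e[of 1] by simp
  then have "(2::complex) ^ Suc j = 2 ^ Suc k" using e[of 2] assms(2) by simp
  then have "(of_nat (2 ^ Suc j) :: complex) = of_nat (2 ^ Suc k)" by simp
  then have "(2::nat) ^ Suc j = 2 ^ Suc k" by (simp only: of_nat_eq_iff)
  then show ?thesis using nm by simp
qed

lemma sum_fun_apply:
  fixes G :: "'a \<Rightarrow> 'b \<Rightarrow> complex"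
  shows "(\<Sum>x\<in>S. G x) V = (\<Sum>x\<in>S. G x V)"
  by (induction S rule: infinite_finite_induct) simp_all

text \<open>Strong regularity speaks of a set of differentials; relations between matrices need a
  family indexed by pairs (n, k), with the matrices Y_n^k turned into functionals by the trace form.
  Injectivity of the indexing bridges the two.\<close>

lemma strongly_regular_independent:
  fixes u :: "nat \<times> nat \<Rightarrow> complex"
  assumes X: "strongly_regular X" and T: "finite T" "\<And>n k. (n, k) \<in> T \<Longrightarrow> k < n"
    and zero: "\<And>V. (\<Sum>p\<in>T. u p * tr (fst p) (pw (fst p) (corner (fst p) X) (snd p) \<odot> V)) = 0"
    and p: "p \<in> T"
  shows "u p = 0"
proof -
  define F where "F p = (\<lambda>Z. tr (fst p) (mpow (corner (fst p) Z) (Suc (snd p))))" for p :: "nat \<times> nat"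
  define \<delta> where "\<delta> p = diff_at (F p) X" for p
  have \<delta>: "\<delta> p V = of_nat (Suc (snd p)) * tr (fst p) (pw (fst p) (corner (fst p) X) (snd p) \<odot> V)" for p V
    unfolding \<delta>_def F_def diff_at_trace_power diff_Suc_1 ..
  have FJ: "F p \<in> J_inf" if "p \<in> T" for p
    unfolding J_inf_Suc F_def using T(2)[of "fst p" "snd p"] that by auto
  have inj: "inj_on \<delta> T"
  proof (rule inj_onI)
    fix p q assume pq: "p \<in> T" "q \<in> T" "\<delta> p = \<delta> q"
    have "F p = F q"
      using X FJ[OF pq(1)] FJ[OF pq(2)] pq(3) unfolding strongly_regular_def \<delta>_def inj_on_def by blast
    then have "fst p = fst q \<and> snd p = snd q"
      unfolding F_def by (rule trace_power_inj) (use T(2)[of "fst p" "snd p"] pq(1) in simp)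
    then show "p = q" by (simp add: prod_eq_iff)
  qed
  \<comment> \<open>The division compensates the factor k + 1 in the differential of
    tr(Z^(k+1)).\<close>
  define v where "v \<eta> = u (inv_into T \<delta> \<eta>) / of_nat (Suc (snd (inv_into T \<delta> \<eta>)))" for \<eta>
  have v: "v (\<delta> p) = u p / of_nat (Suc (snd p))" if "p \<in> T" for p
    unfolding v_def inv_into_f_f[OF inj that] ..
  have "fm.independent ((\<lambda>f. diff_at f X) ` J_inf)" using X unfolding strongly_regular_def by blast
  moreover have "finite (\<delta> ` T)" using T(1) by simp
  moreover have "\<delta> ` T \<subseteq> (\<lambda>f. diff_at f X) ` J_inf" unfolding \<delta>_def using FJ by blast
  moreover have "(\<Sum>\<eta>\<in>\<delta> ` T. (\<lambda>V. v \<eta> * \<eta> V)) = 0"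
  proof
    fix V
    have "(\<Sum>\<eta>\<in>\<delta> ` T. (\<lambda>V. v \<eta> * \<eta> V)) V = (\<Sum>p\<in>T. v (\<delta> p) * \<delta> p V)"
      unfolding sum_fun_apply by (simp add: sum.reindex[OF inj])
    also have "\<dots> = (\<Sum>p\<in>T. u p * tr (fst p) (pw (fst p) (corner (fst p) X) (snd p) \<odot> V))"
      by (intro sum.cong refl) (simp add: v \<delta> del: of_nat_Suc)
    finally show "(\<Sum>\<eta>\<in>\<delta> ` T. (\<lambda>V. v \<eta> * \<eta> V)) V = 0 V" using zero by simp
  qed
  moreover have "\<delta> p \<in> \<delta> ` T" using p by blast
  ultimately have "v (\<delta> p) = 0" by (rule fm.independentD)
  then show ?thesis using v[OF p] by (simp del: of_nat_Suc)
qed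

text \<open>A relation among the powers of X_n is a relation among differentials; this gives
  regularity. Then a common element of two neighbouring centralizers expands both in powers of X_n
  and in powers of X_(n+1), and equating the two is again such a relation.\<close>

lemma strongly_regular_strong_reg:
  assumes X: "strongly_regular X"
  shows "strong_reg X"
proof -
  have reg: "reg n (corner n X)" for n
    unfolding reg_def
  proof (intro allI impI)
    fix x k assume s: "(\<Sum>k<n. msmult (x k) (pw n (corner n X) k)) = 0" and k: "k < n"
    have "(\<lambda>p. x (snd p)) (n, k) = 0"
    proof (rule strongly_regular_independent[OF X, of "Pair n ` {..<n}"])
      fix V
      have "(\<Sum>k<n. x k * tr n (pw n (corner n X) k \<odot> V)) = tr n ((\<Sum>k<n. msmult (x k) (pw n (corner n X) k)) \<odot> V)"
        by (subst mmul_sum_left_row_col_finite) (simp_all add: tr_sum tr_msmult mmul_msmult_left)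
      also have "\<dots> = 0" unfolding s by simp
      finally show "(\<Sum>p\<in>Pair n ` {..<n}. x (snd p) * tr (fst p) (pw (fst p) (corner (fst p) X) (snd p) \<odot> V)) = 0"
        by (subst sum.reindex) (auto simp: inj_on_def)
    qed (use k in auto)
    then show "x k = 0" by simp
  qed
  moreover have "A = 0" if A: "A \<in> Cent n X" "A \<in> Cent (Suc n) X" for n A
  proof -
    obtain x where x: "A = (\<Sum>k<n. msmult (x k) (pw n (corner n X) k))"
      using centralizer_regular[OF corner_gl reg CentD[OF A(1)]] by blast
    obtain y where y: "A = (\<Sum>k<Suc n. msmult (y k) (pw (Suc n) (corner (Suc n) X) k))"
      using centralizer_regular[OF corner_gl reg CentD[OF A(2)]] by blast
    \<comment> \<open>Coefficients of the first expansion minus the second. The functionals cancel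
      although the traces have sizes n and n + 1, because A lies in gl(n).\<close>
    define u where "u p = (if fst p = n then x (snd p) else - y (snd p))" for p :: "nat \<times> nat"
    let ?T = "(SIGMA m:{n, Suc n}. {..<m})"
    have "x k = 0" if k: "k < n" for k
    proof -
      have "u (n, k) = 0"
      proof (rule strongly_regular_independent[OF X, of ?T])
        fix V
        have 1: "(\<Sum>k<n. x k * tr n (pw n (corner n X) k \<odot> V)) = tr n (A \<odot> V)"
          unfolding x by (subst mmul_sum_left_row_col_finite) (simp_all add: tr_sum tr_msmult mmul_msmult_left)
        have 2: "(\<Sum>k<Suc n. y k * tr (Suc n) (pw (Suc n) (corner (Suc n) X) k \<odot> V)) = tr (Suc n) (A \<odot> V)"
          unfolding y by (subst mmul_sum_left_row_col_finite)
            (simp_all add: tr_sum tr_msmult mmul_msmult_left del: sum.lessThan_Suc)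
        have "(\<Sum>p\<in>?T. u p * tr (fst p) (pw (fst p) (corner (fst p) X) (snd p) \<odot> V)) =
            (\<Sum>m\<in>{n, Suc n}. \<Sum>k<m. u (m, k) * tr m (pw m (corner m X) k \<odot> V))"
          by (subst sum.Sigma) (auto simp: case_prod_unfold)
        also have "\<dots> = (\<Sum>k<n. x k * tr n (pw n (corner n X) k \<odot> V)) -
            (\<Sum>k<Suc n. y k * tr (Suc n) (pw (Suc n) (corner (Suc n) X) k \<odot> V))"
          by (simp add: u_def sum_negf del: sum.lessThan_Suc)
        also have "\<dots> = 0" unfolding 1 2 using tr_mono[OF CentD(1)[OF A(1)], of "Suc n" V] by simp
        finally show "(\<Sum>p\<in>?T. u p * tr (fst p) (pw (fst p) (corner (fst p) X) (snd p) \<odot> V)) = 0" .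
      qed (use k in auto)
      then show ?thesis by (simp add: u_def)
    qed
    then show ?thesis unfolding x by simp
  qed
  ultimately show ?thesis unfolding strong_reg_def by blast
qed

theorem theorem5p18:
  fixes X :: imat
  assumes "strongly_regular X"
  shows "(ind_subvariety X (i_preimage X (A_orbit X)) \<and>
          irreducible_top (sp_top (ind_space (strata X (i_preimage X (A_orbit X))))) \<and>
          immersed_by (strata X (i_preimage X (A_orbit X))) (\<lambda>Y. Y) (A_orbit X)) \<and>
         lagrangian X (i_preimage X (A_orbit X)) \<and>
         (\<forall>Y\<in>A_orbit X. di Y ` ind_tangent X (i_preimage X (A_orbit Y)) Y = a_inf_at Y)"
proof -
  have X: "strong_reg X" by (rule strongly_regular_strong_reg[OF assms])
  have "di Y ` ind_tangent X (i_preimage X (A_orbit Y)) Y = a_inf_at Y" if Y: "Y \<in> A_orbit X" for Y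
  proof -
    \<comment> \<open>Tangent vectors are singletons here, and the differential of the inclusion
      sends {A} to [A, Y].\<close>
    have "di Y ` {{A} | A n. A \<in> cent_sum n Y} = {comm A Y | A n. A \<in> cent_sum n Y}"
    proof (intro equalityI subsetI)
      fix V assume "V \<in> di Y ` {{A} | A n. A \<in> cent_sum n Y}"
      then obtain A n where A: "V = di Y {A}" "A \<in> cent_sum n Y" by blast
      show "V \<in> {comm A Y | A n. A \<in> cent_sum n Y}"
        unfolding A(1) di_singleton[OF cent_sum_gl[OF A(2)]] using A(2) by blast
    next
      fix V assume "V \<in> {comm A Y | A n. A \<in> cent_sum n Y}"
      then obtain A n where A: "V = comm A Y" "A \<in> cent_sum n Y" by blast
      have "V = di Y {A}" unfolding A(1) di_singleton[OF cent_sum_gl[OF A(2)]] ..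
      then show "V \<in> di Y ` {{A} | A n. A \<in> cent_sum n Y}" using A(2) by blast
    qed
    then show ?thesis
      unfolding A_orbit_eq[OF X Y] i_preimage_A_orbit[OF X] ind_tangent_A_orbit[OF X Y]
        a_inf_at_cent_sum[OF A_orbit_strong_reg[OF X Y]] .
  qed
  then show ?thesis
    unfolding i_preimage_A_orbit[OF X]
    using A_orbit_ind_subvariety[OF X] A_orbit_irreducible[OF X] A_orbit_immersed[OF X] A_orbit_lagrangian[OF X]
    by blast
qed

end
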